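(* Let $N\ge1$ be an integer, $H\in(0,1)$, $\mathcal{B}=\{\mathbf{x}\in\mathbb{R}^N\colon\|\mathbf{x}\|\le1\}$, and let $\xi$ be the multiparameter fractional Brownian motion with parameter $H$ on $\mathcal{B}$, regarded as a centred Gaussian random variable in $C(\mathcal{B})$. Consider the series representation $$\xi(\mathbf{x})=\sum_{m=0}^{\infty}\sum_{n=1}^{\infty}\sum_{l=1}^{h(m,N)}u^l_{mn}(\mathbf{x})\,\xi^l_{mn},\qquad u^l_{mn}(\mathbf{x})=\tau_{mn}\left[g_m(j_{|m-1|-H,n}\|\mathbf{x}\|)-\delta^0_m\right]S^l_m\left(\frac{\mathbf{x}}{\|\mathbf{x}\|}\right),$$ with independent standard normal random variables $\xi^l_{mn}$ and $$\tau_{mn}=\frac{2^{H+1}\sqrt{\pi^{(N-2)/2}\,\Gamma(H+N/2)\,\Gamma(H+1)\sin(\pi H)}}{\Gamma(N/2)\,J_{|m-1|-H+1}(j_{|m-1|-H,n})\,j_{|m-1|-H,n}^{H+1}}.$$ This representation possesses the optimal approximation rate for $\xi$ on $\mathcal{B}$: its terms can be enumerated as $f_1\xi_1,f_2\xi_2,\dots$ (each $f_j\xi_j$ being one of the terms $u^l_{mn}\xi^l_{mn}$, each term occurring exactly once) in such a way that $$\left(\mathsf{E}\left\|\sum_{j=p}^{\infty}f_j\xi_j\right\|_{C(\mathcal{B})}^2\right)^{1/2}\approx l_p(\xi),\qquad p\ge1,$$ where $l_p(\xi)$ is the $p$th $l$-approximation number of $\xi$; equivalently, this quantity is $\approx p^{-H/N}(\log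 p)^{1/2}$ for $p\ge2$.
   Context: $\|\cdot\|$ is the Euclidean norm on $\mathbb{R}^N$. The multiparameter fractional Brownian motion with parameter $H\in(0,1)$ is the centred Gaussian random field with covariance $R(\mathbf{x},\mathbf{y})=\frac12(\|\mathbf{x}\|^{2H}+\|\mathbf{y}\|^{2H}-\|\mathbf{x}-\mathbf{y}\|^{2H})$ (with continuous sample paths). $C(\mathcal{B})$ is the Banach space of continuous functions on $\mathcal{B}$ with the uniform norm. For positive sequences, $a_p\preceq b_p$ means $a_p\le c\,b_p$ for some constant $c>0$ and all $p$, and $a_p\approx b_p$ means $a_p\preceq b_p$ and $b_p\preceq a_p$ (constants may depend on $N$ and $H$). The $p$th $l$-approximation number of $\xi$ is $$l_p(\xi)=\inf\left\{\left(\mathsf{E}\left\|\sum_{j=p}^{\infty}f_j\xi_j\right\|_{C(\mathcal{B})}^2\right)^{1/2}\colon\ \xi=\sum_{j=1}^{\infty}f_j\xi_j,\ f_j\in C(\mathcal{B})\right\},$$ where $\xi_j$ are independent standard normal random variables and the infimum is over all possible series representations of $\xi$. It is a known theorem of Ayache and Linde that $l_p(\xi)\approx p^{-H/N}(\log p)^{1/2}$ ($p\ge2$). The series above is a representation of $\xi$ on $\mathcal{B}$, converging in $C(\mathcal{B})$ with probability $1$. Its ingredients are the following. $J_\nu$ is the Bessel function of the first kind of order $\nu$, and $j_{\nu,1}<j_{\nu,2}<\dots$ are the positive zeros of $J_\nu$ ($\nu>-1$). For $m\ge0$, $g_m(u)=2^{(N-2)/2}\Gamma(N/2)J_{m+(N-2)/2}(u)/u^{(N-2)/2}$,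 extended by continuity to $u=0$; $\delta^0_m$ is the Kronecker delta. Each term of the series is interpreted as $0$ at $\mathbf{x}=\mathbf{0}$. $h(m,N)=\frac{(2m+N-2)(m+N-3)!}{(N-2)!\,m!}$ is the number of linearly independent spherical harmonics of degree $m$ on $S^{N-1}$; conventions: $h(0,2)=1$, and for $N=1$: $h(0,1)=h(1,1)=1$, $h(m,1)=0$ for $m\ge2$. The functions $S^l_m$, $1\le l\le h(m,N)$, are real-valued spherical harmonics of degree $m$, orthonormal in $L^2(S^{N-1})$ with respect to surface measure, defined as follows. For $N=1$: $S^0=\{-1,1\}$, $S^1_0(x)=1/\sqrt2$, $S^1_1(x)=x/\sqrt2$. For $N\ge 2$: let $C^\lambda_m$ be the Gegenbauer polynomials, $(1-2xt+t^2)^{-\lambda}=\sum_{m\ge0}C^\lambda_m(x)t^m$. For integers $m=m_0\ge m_1\ge\dots\ge m_{N-2}\ge0$ and $r_k=\sqrt{x_{k+1}^2+\dots+x_N^2}$ ($0\le k\le N-2$) put $$H(m_k,\pm,\mathbf{x})=\left(\frac{x_{N-1}+ix_N}{r_{N-2}}\right)^{\pm m_{N-2}}r_{N-2}^{m_{N-2}}\prod_{k=0}^{N-3}r_k^{m_k-m_{k+1}}C^{m_{k+1}+(N-k-2)/2}_{m_k-m_{k+1}}\left(\frac{x_{k+1}}{r_k}\right)$$ (extended by continuity), $Y(m_k,\pm,\mathbf{x})=r_0^{-m}H(m_k,\pm,\mathbf{x})$, and $$L(m_k)=2\pi\prod_{k=1}^{N-2}\frac{\pi\,2^{k-2m_k-N+2}\,\Gamma(m_{k-1}+m_k+N-1-k)}{(m_{k-1}+(N-1-k)/2)\,(m_{k-1}-m_k)!\,[\Gamma(m_k+(N-1-k)/2)]^2},$$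 which is the squared $L^2(S^{N-1})$-norm of $Y(m_k,\pm,\cdot)$. Let $l=l(m_k,\pm)$ be the number of the symbol $(m_0,\dots,m_{N-2},\pm)$ in the lexicographic ordering of the symbols with $m_0=m$ (when $m_{N-2}=0$ the two signs give the same function and are counted once). Then $S^l_m=Y(m_k,+,\cdot)/\sqrt{L(m_k)}$ if $m_{N-2}=0$; $S^l_m=\sqrt2\,\mathrm{Re}\,Y(m_k,+,\cdot)/\sqrt{L(m_k)}$ if $m_{N-2}>0$ and $l=l(m_k,+)$; $S^l_m=-\sqrt2\,\mathrm{Im}\,Y(m_k,-,\cdot)/\sqrt{L(m_k)}$ if $m_{N-2}>0$ and $l=l(m_k,-)$. *)

theory Defs
  imports
    "HOL-Probability.Probability"
    "HOL-Computational_Algebra.Formal_Power_Series"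
    "HOL-Library.List_Lexorder"
begin

section \<open>Bessel functions of the first kind\<close>

text \<open>Ascending power series for \<open>J\<^sub>\<nu>\<close>; as \<^const>\<open>powr\<close> is used, only arguments \<open>u > 0\<close> are meaningful.\<close>

definition bessel_J :: "real \<Rightarrow> real \<Rightarrow> real" where
  "bessel_J \<nu> u =
     (u / 2) powr \<nu> * (\<Sum>k. (-1) ^ k * rGamma (\<nu> + real k + 1) / fact k * (u / 2) ^ (2 * k))"

text \<open>
  For \<open>n \<ge> 1\<close>, \<open>bessel_zero \<nu> n\<close> is the \<open>n\<close>-th positive zero \<open>j\<^sub>\<nu>\<^sub>,\<^sub>n\<close> of \<open>J\<^sub>\<nu>\<close> (\<open>\<nu> > -1\<close>);
  the value \<open>0\<close> at \<open>n = 0\<close> only starts the recursion.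
\<close>

primrec bessel_zero :: "real \<Rightarrow> nat \<Rightarrow> real" where
  "bessel_zero \<nu> 0 = 0"
| "bessel_zero \<nu> (Suc n) = Inf {u. u > bessel_zero \<nu> n \<and> bessel_J \<nu> u = 0}"


section \<open>Real spherical harmonics\<close>

text \<open>
  In this section a point of \<open>N\<close>-dimensional space is given by its coordinates
  \<open>x 1, \<dots>, x N\<close>, where \<open>x :: nat \<Rightarrow> real\<close>.
\<close>

definition harm_dim :: "nat \<Rightarrow> nat \<Rightarrow> nat" where
  "harm_dim m N =
     (if N = 1 then (if m \<le> 1 then 1 else 0)
      else if N = 2 \<and> m = 0 then 1
      else ((2 * m + N - 2) * fact (m + N - 3)) div (fact (N - 2) * fact m))"

text \<open>
  Gegenbauer polynomials: the coefficient of \<open>t\<^sup>m\<close> in \<open>(1 - 2xt + t\<^sup>2)\<^bsup>-a\<^esup>\<close>, written as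
  the binomial series \<open>(1 + s)\<^bsup>-a\<^esup>\<close> composed with \<open>s = t\<^sup>2 - 2xt\<close>.
\<close>

definition gegenbauer :: "real \<Rightarrow> nat \<Rightarrow> real \<Rightarrow> real" where
  "gegenbauer a m x =
     fps_nth (fps_compose (fps_binomial (- a)) (fps_X ^ 2 - fps_const (2 * x) * fps_X)) m"

definition tail_radius :: "nat \<Rightarrow> nat \<Rightarrow> (nat \<Rightarrow> real) \<Rightarrow> real" where
  "tail_radius N k x = sqrt (\<Sum>i = k + 1..N. (x i)\<^sup>2)"

text \<open>
  For \<open>N \<ge> 2\<close> a symbol \<open>(m\<^sub>0, \<dots>, m\<^bsub>N-2\<^esub>, \<plusminus>)\<close> is encoded as the list \<open>[m\<^sub>0, \<dots>, m\<^bsub>N-2\<^esub>, s]\<close> of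
  length \<open>N\<close> with \<open>s = 0\<close> for \<open>+\<close> and \<open>s = 1\<close> for \<open>-\<close>. If \<open>m\<^bsub>N-2\<^esub> = 0\<close>, only the symbol with \<open>+\<close>
  is kept. Lists are ordered lexicographically by \<^theory>\<open>HOL-Library.List_Lexorder\<close>, so
  \<open>harm_symbol N m l\<close> is the symbol with number \<open>l\<close>.
\<close>

definition harm_symbols :: "nat \<Rightarrow> nat \<Rightarrow> nat list set" where
  "harm_symbols N m =
     {ms. length ms = N \<and> ms ! 0 = m \<and> (\<forall>k < N - 2. ms ! (k + 1) \<le> ms ! k) \<and>
          ms ! (N - 1) \<le> 1 \<and> (ms ! (N - 2) = 0 \<longrightarrow> ms ! (N - 1) = 0)}"

definition harm_symbol :: "nat \<Rightarrow> nat \<Rightarrow> nat \<Rightarrow> nat list" where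
  "harm_symbol N m l = sorted_list_of_set (harm_symbols N m) ! (l - 1)"

text \<open>
  The homogeneous polynomial \<open>H(m\<^sub>k, \<plusminus>, x)\<close>, with \<open>\<epsilon> = \<plusminus>1\<close>. Where some \<open>r\<^sub>k\<close> vanishes, the
  conventions \<open>a / 0 = 0\<close> and \<open>0\<^sup>0 = 1\<close> give exactly the continuous extension: a factor belonging
  to \<open>r\<^sub>k = 0\<close> is constantly \<open>1\<close> if its degree is \<open>0\<close>, and evaluates to its limit \<open>0\<close> otherwise.
\<close>

definition harm_poly :: "nat \<Rightarrow> nat list \<Rightarrow> int \<Rightarrow> (nat \<Rightarrow> real) \<Rightarrow> complex" where
  "harm_poly N ms \<epsilon> x =
     (Complex (x (N - 1)) (x N) / of_real (tail_radius N (N - 2) x)) powi (\<epsilon> * int (ms ! (N - 2)))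
     * of_real (tail_radius N (N - 2) x ^ (ms ! (N - 2)))
     * of_real (\<Prod>k \<in> {k. k + 3 \<le> N}.
         tail_radius N k x ^ (ms ! k - ms ! (k + 1))
         * gegenbauer (real (ms ! (k + 1)) + (real N - real k - 2) / 2) (ms ! k - ms ! (k + 1))
             (x (k + 1) / tail_radius N k x))"

definition harm_Y :: "nat \<Rightarrow> nat list \<Rightarrow> int \<Rightarrow> (nat \<Rightarrow> real) \<Rightarrow> complex" where
  "harm_Y N ms \<epsilon> x = harm_poly N ms \<epsilon> x / of_real (tail_radius N 0 x ^ (ms ! 0))"

definition harm_L :: "nat \<Rightarrow> nat list \<Rightarrow> real" where
  "harm_L N ms =
     2 * pi * (\<Prod>k = 1..N - 2.
        pi * 2 powi (int k - 2 * int (ms ! k) - int N + 2)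
          * Gamma (real (ms ! (k - 1)) + real (ms ! k) + real N - 1 - real k)
        / ((real (ms ! (k - 1)) + (real N - 1 - real k) / 2) * fact (ms ! (k - 1) - ms ! k)
           * (Gamma (real (ms ! k) + (real N - 1 - real k) / 2))\<^sup>2))"

definition sph_harm :: "nat \<Rightarrow> nat \<Rightarrow> nat \<Rightarrow> (nat \<Rightarrow> real) \<Rightarrow> real" where
  "sph_harm N m l x =
     (if N = 1 then (if m = 0 then 1 / sqrt 2 else x 1 / sqrt 2)
      else (let ms = harm_symbol N m l in
        if ms ! (N - 2) = 0 then Re (harm_Y N ms 1 x) / sqrt (harm_L N ms)
        else if ms ! (N - 1) = 0 then sqrt 2 * Re (harm_Y N ms 1 x) / sqrt (harm_L N ms)
        else - sqrt 2 * Im (harm_Y N ms (-1) x) / sqrt (harm_L N ms)))"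


section \<open>The terms of the series\<close>

definition radial_g :: "nat \<Rightarrow> nat \<Rightarrow> real \<Rightarrow> real" where
  "radial_g N m u =
     (let g = (\<lambda>v. 2 powr ((real N - 2) / 2) * Gamma (real N / 2)
                     * bessel_J (real m + (real N - 2) / 2) v / v powr ((real N - 2) / 2))
      in if u = 0 then Lim (at_right 0) g else g u)"

definition mfbm_tau :: "nat \<Rightarrow> real \<Rightarrow> nat \<Rightarrow> nat \<Rightarrow> real" where
  "mfbm_tau N H m n =
     (let \<nu> = \<bar>real m - 1\<bar> - H; j = bessel_zero \<nu> n in
      2 powr (H + 1) * sqrt (pi powr ((real N - 2) / 2) * Gamma (H + real N / 2) * Gamma (H + 1) * sin (pi * H))
      / (Gamma (real N / 2) * bessel_J (\<nu> + 1) j * j powr (H + 1)))"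

text \<open>
  The function \<open>u\<^sup>l\<^sub>m\<^sub>n\<close>. The map \<open>e\<close> labels the coordinates of \<^typ>\<open>real ^ 'n\<close> by
  \<open>1, \<dots>, N\<close>, where \<open>N = CARD('n)\<close>.
\<close>

definition mfbm_term :: "real \<Rightarrow> (nat \<Rightarrow> 'n::finite) \<Rightarrow> nat \<times> nat \<times> nat \<Rightarrow> real ^ 'n \<Rightarrow> real" where
  "mfbm_term H e = (\<lambda>(m, n, l) x.
     if x = 0 then 0
     else mfbm_tau CARD('n) H m n
          * (radial_g CARD('n) m (bessel_zero (\<bar>real m - 1\<bar> - H) n * norm x) - (if m = 0 then 1 else 0))
          * sph_harm CARD('n) m l (\<lambda>k. (x /\<^sub>R norm x) $ e k))"

definition term_index :: "nat \<Rightarrow> (nat \<times> nat \<times> nat) set" where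
  "term_index N = {(m, n, l). 1 \<le> n \<and> 1 \<le> l \<and> l \<le> harm_dim m N}"


section \<open>Multiparameter fractional Brownian motion\<close>

definition centred_gaussian :: "'a measure \<Rightarrow> ('a \<Rightarrow> real) \<Rightarrow> bool" where
  "centred_gaussian M X \<longleftrightarrow> X \<in> borel_measurable M \<and>
     ((AE \<omega> in M. X \<omega> = 0) \<or> (\<exists>\<sigma>>0. distributed M lborel X (normal_density 0 \<sigma>)))"

definition centred_gaussian_field :: "'a measure \<Rightarrow> 'b set \<Rightarrow> ('b \<Rightarrow> 'a \<Rightarrow> real) \<Rightarrow> bool" where
  "centred_gaussian_field M T \<xi> \<longleftrightarrow>
     (\<forall>F a. finite F \<and> F \<subseteq> T \<longrightarrow> centred_gaussian M (\<lambda>\<omega>. \<Sum>x\<in>F. a x * \<xi> x \<omega>))"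

definition is_mfbm :: "'a measure \<Rightarrow> real \<Rightarrow> (real ^ 'n::finite \<Rightarrow> 'a \<Rightarrow> real) \<Rightarrow> bool" where
  "is_mfbm M H \<xi> \<longleftrightarrow> prob_space M \<and> centred_gaussian_field M (cball 0 1) \<xi> \<and>
     (\<forall>x \<in> cball 0 1. \<forall>y \<in> cball 0 1. (\<integral>\<omega>. \<xi> x \<omega> * \<xi> y \<omega> \<partial>M) =
        (norm x powr (2 * H) + norm y powr (2 * H) - norm (x - y) powr (2 * H)) / 2) \<and>
     (\<forall>\<omega> \<in> space M. continuous_on (cball 0 1) (\<lambda>x. \<xi> x \<omega>))"


section \<open>Series representations and approximation numbers\<close>

definition iid_std_normal :: "'a measure \<Rightarrow> 'i set \<Rightarrow> ('i \<Rightarrow> 'a \<Rightarrow> real) \<Rightarrow> bool" where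
  "iid_std_normal M I Z \<longleftrightarrow> prob_space.indep_vars M (\<lambda>_. borel) Z I \<and>
     (\<forall>i\<in>I. distributed M lborel (Z i) std_normal_density)"

text \<open>
  The convergence in \<open>C(B)\<close> (\<open>B\<close> the closed unit ball) is uniform convergence on \<open>B\<close>.
  Sequences are indexed from \<open>1\<close>; their values at \<open>0\<close> are irrelevant.
\<close>

definition series_rep ::
  "'a measure \<Rightarrow> (real ^ 'n::finite \<Rightarrow> 'a \<Rightarrow> real) \<Rightarrow> (nat \<Rightarrow> real ^ 'n \<Rightarrow> real) \<Rightarrow> (nat \<Rightarrow> 'a \<Rightarrow> real) \<Rightarrow> bool" where
  "series_rep M \<xi> f Z \<longleftrightarrow>
     (\<forall>j\<ge>1. continuous_on (cball 0 1) (f j)) \<and> iid_std_normal M {1..} Z \<and>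
     (AE \<omega> in M. uniform_limit (cball 0 1) (\<lambda>n x. \<Sum>j = 1..n. f j x * Z j \<omega>) (\<lambda>x. \<xi> x \<omega>) sequentially)"

text \<open>
  The iterated series \<open>\<Sum>\<^sub>m \<Sum>\<^sub>n \<Sum>\<^sub>l u\<^sup>l\<^sub>m\<^sub>n(x) \<xi>\<^sup>l\<^sub>m\<^sub>n\<close> converges to \<open>\<xi>\<close> in \<open>C(B)\<close> almost surely;
  \<open>V m\<close> is the sum of its \<open>m\<close>-th inner series.
\<close>

definition mfbm_series_rep ::
  "'a measure \<Rightarrow> real \<Rightarrow> (nat \<Rightarrow> 'n::finite) \<Rightarrow> (real ^ 'n \<Rightarrow> 'a \<Rightarrow> real) \<Rightarrow> (nat \<times> nat \<times> nat \<Rightarrow> 'a \<Rightarrow> real) \<Rightarrow> bool" where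
  "mfbm_series_rep M H e \<xi> Z \<longleftrightarrow>
     iid_std_normal M (term_index CARD('n)) Z \<and>
     (AE \<omega> in M. \<exists>V.
        (\<forall>m. uniform_limit (cball 0 1)
           (\<lambda>k x. \<Sum>n = 1..k. \<Sum>l = 1..harm_dim m CARD('n). mfbm_term H e (m, n, l) x * Z (m, n, l) \<omega>)
           (V m) sequentially) \<and>
        uniform_limit (cball 0 1) (\<lambda>k x. \<Sum>m\<le>k. V m x) (\<lambda>x. \<xi> x \<omega>) sequentially)"

definition ennreal_sqrt :: "ennreal \<Rightarrow> ennreal" where
  "ennreal_sqrt a = (if a = \<infinity> then \<infinity> else ennreal (sqrt (enn2real a)))"

definition ball_norm :: "(real ^ 'n::finite \<Rightarrow> real) \<Rightarrow> ennreal" where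
  "ball_norm f = (SUP x \<in> cball 0 1. ennreal \<bar>f x\<bar>)"

text \<open>
  \<open>(E \<parallel>\<Sum>\<^bsub>j\<ge>p\<^esub> f\<^sub>j \<xi>\<^sub>j\<parallel>\<^sup>2)\<^bsup>1/2\<^esup>\<close> as an extended nonnegative number. The expectation is a nonnegative
  integral: unlike the Bochner integral it does not become \<open>0\<close> when the integrand fails to
  be integrable, and it ignores null sets on which the series might diverge.
\<close>

definition tail_error :: "'a measure \<Rightarrow> (nat \<Rightarrow> real ^ 'n::finite \<Rightarrow> real) \<Rightarrow> (nat \<Rightarrow> 'a \<Rightarrow> real) \<Rightarrow> nat \<Rightarrow> ennreal" where
  "tail_error M f Z p =
     ennreal_sqrt (\<integral>\<^sup>+\<omega>. (ball_norm (\<lambda>x. \<Sum>j. f (p + j) x * Z (p + j) \<omega>))\<^sup>2 \<partial>M)"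

definition l_approx :: "'a measure \<Rightarrow> (real ^ 'n::finite \<Rightarrow> 'a \<Rightarrow> real) \<Rightarrow> nat \<Rightarrow> ennreal" where
  "l_approx M \<xi> p = (INF (f, Z) \<in> {(f, Z). series_rep M \<xi> f Z}. tail_error M f Z p)"

end

theory Submission
  imports Defs
begin

text \<open>
  Upper bound. Comparing characteristic functions of \<open>\<xi>(x) - \<xi>(y)\<close> and of the terms of the series gives
  \<open>\<Sum>\<^sub>i (u\<^sub>i x - u\<^sub>i y)\<^sup>2 \<le> \<parallel>x - y\<parallel>\<^bsup>2H\<^esup>\<close> over any finite set of indices, so the explicit constants \<open>\<tau>\<^sub>m\<^sub>n\<close> are never
  evaluated. Up to an additive constant \<open>u\<^sup>l\<^sub>m\<^sub>n\<close> solves the Helmholtz equation \<open>\<Delta>v = - j\<^sup>2 v\<close> with \<open>j\<close> the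
  corresponding Bessel zero. If all \<open>j \<ge> T\<close>, a combination \<open>h = \<Sum> c\<^sub>i v\<^sub>i\<close> is minus the Laplacian of
  \<open>\<Sum> c\<^sub>i j\<^sub>i\<^bsup>-2\<^esup> v\<^sub>i\<close>, which oscillates by at most \<open>T\<^bsup>-2-H\<^esup>\<close> on balls of radius \<open>1/T\<close>, and the maximum principle yields
  \<open>\<Sum> u\<^sub>i\<^sup>2 \<le> C T\<^bsup>-2H\<^esup>\<close>. Sturm comparison gives \<open>j \<ge> c (m + n)\<close>, hence at most \<open>C T\<^sup>N\<close> indices have \<open>j < T\<close>.
  Order the terms by dyadic levels \<open>2\<^sup>k \<le> j < 2\<^bsup>k+1\<^esup>\<close>; on each level a net and Gaussian exponential moments bound
  all partial sums uniformly by \<open>2\<^bsup>-kH\<^esup> (k+1)\<^bsup>1/2\<^esup>\<close>, and the levels are summed.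

  Lower bound, for an arbitrary representation. The Gaussian kernel is positive definite and diagonally dominant
  on a lattice, so integrating it over its scale shows that increments of \<open>\<xi>\<close> along about \<open>8 p\<close> disjoint
  lattice edges of mesh \<open>\<epsilon> \<approx> p\<^bsup>-1/N\<^esup>\<close> have a Gram matrix bounded below by \<open>c \<epsilon>\<^bsup>2H\<^esup>\<close>.
  Dropping the first \<open>p - 1\<close> terms removes only a subspace of that dimension, and at least \<open>2 p\<close> of the truncated
  increments remain separated by \<open>c' \<epsilon>\<^sup>H\<close>. Translating the Gaussian measure to each of these
  produces disjoint events, whence their maximum is at least of order \<open>\<epsilon>\<^sup>H (log p)\<^bsup>1/2\<^esup>\<close> with probability \<open>1/2\<close>.
\<close>

subsection \<open>Zeros of Bessel functions\<close>

text \<open>The enumeration and both constants must be fixed before the probability space, the field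
  and the normal variables are quantified. The estimates on the functions
  \<open>mfbm_term H e i\<close> are deterministic, so a single representation on some space yields
  them for all others; if there is none, any enumeration does. Two obstacles shape the rest. The
  given representation is an iterated series, which carries no licence to rearrange: uniform
  convergence of the reordered series is proved from scratch, and its limit is identified with the
  field separately, by second moments on a countable dense set. And a tail may start in the middle
  of a dyadic level, so the bound for a level must control all its partial sums at once. The decay
  of \<Sum> u^2 cannot come from the Hoelder bound alone, which sees only differences; the Helmholtz
  equation converts small oscillation into small values. Finally p = 1 escapes the rate because ln 1
  = 0; there every representation has the same error, the norm of the field itself.\<close>

lemma second_derivative_nonpos_at_max:
  fixes f f' :: "real \<Rightarrow> real"
  assumes c: "a < c" "c < b"
    and f: "\<And>x. a < x \<Longrightarrow> x < b \<Longrightarrow> (f has_real_derivative f' x) (at x)"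
    and f': "(f' has_real_derivative D) (at c)"
    and max: "\<And>x. a < x \<Longrightarrow> x < b \<Longrightarrow> f x \<le> f c"
  shows "D \<le> 0"
proof (rule ccontr)
  assume "\<not> D \<le> 0"
  then have "D > 0" by simp
  have "f' c = 0"
  proof (rule DERIV_local_max[OF f[OF c]])
    show "0 < min (c - a) (b - c)" using c by simp
    show "\<forall>y. \<bar>c - y\<bar> < min (c - a) (b - c) \<longrightarrow> f y \<le> f c" by (auto intro!: max)
  qed
  from DERIV_pos_inc_right[OF f' \<open>D > 0\<close>] obtain d where d: "d > 0" "\<And>h. 0 < h \<Longrightarrow> h < d \<Longrightarrow> f' c < f' (c + h)"
    by blast
  define h where "h = min d (b - c) / 2"
  have h: "0 < h" "h < d" "c + h < b" using d(1) c by (auto simp: h_def min_def field_simps)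
  obtain z where z: "z > c" "z < c + h" "f (c + h) - f c = (c + h - c) * f' z"
    using MVT2[of c "c + h" f f'] f c h by (metis add.commute less_add_same_cancel2 less_trans order_le_less order_less_le_trans)
  have "f' z > 0" using d(2)[of "z - c"] z h \<open>f' c = 0\<close> by simp
  then have "f (c + h) > f c" using z h by (smt (verit) zero_less_mult_iff)
  moreover have "f (c + h) \<le> f c" using max[of "c + h"] c h by simp
  ultimately show False by simp
qed

text \<open>The entire factor of \<open>bessel_J\<close> in the variable t = u^2/4. Without the
  power of u it is smooth through 0, and differentiation merely shifts the order.\<close>

definition bessel_phi :: "real \<Rightarrow> real \<Rightarrow> real" where
  "bessel_phi \<nu> t = (\<Sum>k. (-1) ^ k * rGamma (\<nu> + real k + 1) / fact k * t ^ k)"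

lemma bessel_J_phi: "bessel_J \<nu> u = (u / 2) powr \<nu> * bessel_phi \<nu> (u\<^sup>2 / 4)"
  by (simp add: bessel_J_def bessel_phi_def power_mult power_divide)

lemma summable_bessel_phi:
  "summable (\<lambda>k. (-1) ^ k * rGamma (\<nu> + real k + 1) / fact k * t ^ k)" (is "summable ?f")
proof (rule summable_ratio_test)
  let ?N = "nat \<lceil>\<bar>\<nu>\<bar> + 2 * \<bar>t\<bar>\<rceil>"
  show "norm (?f (Suc n)) \<le> 1 / 2 * norm (?f n)" if "n \<ge> ?N" for n
  proof -
    have n: "real n \<ge> \<bar>\<nu>\<bar> + 2 * \<bar>t\<bar>" using that by linarith
    have r: "rGamma (\<nu> + real n + 1) = (\<nu> + real n + 1) * rGamma (\<nu> + real (Suc n) + 1)"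
      using rGamma_plus1[of "\<nu> + real n + 1"] by (simp add: add_ac)
    have "\<bar>t\<bar> \<le> 1 / 2 * (1 * (1 + real n))" using n by simp
    also have "\<dots> \<le> 1 / 2 * ((\<nu> + real n + 1) * (1 + real n))"
      using n by (intro mult_left_mono mult_right_mono) auto
    finally have "\<bar>t\<bar> / (1 + real n) \<le> 1 / 2 * \<bar>\<nu> + real n + 1\<bar>"
      using n by (simp add: field_simps)
    then have "(\<bar>t\<bar> / (1 + real n)) * (\<bar>rGamma (\<nu> + real (Suc n) + 1)\<bar> * \<bar>t\<bar> ^ n / fact n)
        \<le> (1 / 2 * \<bar>\<nu> + real n + 1\<bar>) * (\<bar>rGamma (\<nu> + real (Suc n) + 1)\<bar> * \<bar>t\<bar> ^ n / fact n)"
      by (intro mult_right_mono) auto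
    then show ?thesis
      by (simp add: r abs_mult power_abs[symmetric] mult_ac)
  qed
qed simp

lemma DERIV_bessel_phi: "(bessel_phi \<nu> has_real_derivative - bessel_phi (\<nu> + 1) t) (at t)"
proof -
  let ?c = "\<lambda>k. (-1) ^ k * rGamma (\<nu> + real k + 1) / fact k"
  have "((\<lambda>x. \<Sum>n. ?c n * x ^ n) has_real_derivative (\<Sum>n. diffs ?c n * t ^ n)) (at t)"
    by (rule termdiffs_strong_converges_everywhere) (rule summable_bessel_phi)
  moreover have "diffs ?c n * t ^ n = - ((-1) ^ n * rGamma (\<nu> + 1 + real n + 1) / fact n * t ^ n)" for n
    by (simp add: diffs_def add_ac divide_simps)
  ultimately show ?thesis
    using summable_bessel_phi[of "\<nu> + 1" t] by (simp add: bessel_phi_def[abs_def] suminf_minus)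
qed

text \<open>Bessel's equation t y'' + (\<nu> + 1) y' + y = 0 for y =
  \<open>bessel_phi \<nu>\<close>: by \<open>DERIV_bessel_phi\<close> the orders shifted by 1 and 2
  stand for - y' and y''. It holds coefficientwise by the functional equation of the reciprocal
  Gamma function.\<close>

lemma bessel_phi_ode:
  "t * bessel_phi (\<nu> + 2) t - (\<nu> + 1) * bessel_phi (\<nu> + 1) t + bessel_phi \<nu> t = 0"
proof -
  let ?c = "\<lambda>\<nu> k. (-1) ^ k * rGamma (\<nu> + real k + 1) / fact k * t ^ k"
  have s: "?c \<nu> sums bessel_phi \<nu> t" for \<nu>
    unfolding bessel_phi_def using summable_bessel_phi by (rule summable_sums)
  have "(\<lambda>k. t * ?c (\<nu> + 2) k) sums (t * bessel_phi (\<nu> + 2) t)" by (intro sums_mult s)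
  \<comment> \<open>Multiplication by t moves the coefficients up by one place, so that all three
    series are indexed by the same power of t.\<close>
  then have "(\<lambda>k. if k = 0 then 0 else t * ?c (\<nu> + 2) (k - 1)) sums (t * bessel_phi (\<nu> + 2) t)"
    using sums_Suc[of "\<lambda>k. if k = 0 then 0 else t * ?c (\<nu> + 2) (k - 1)" "t * bessel_phi (\<nu> + 2) t"] by (simp del: minus_mult_right)
  then have "(\<lambda>k. (if k = 0 then 0 else t * ?c (\<nu> + 2) (k - 1)) - (\<nu> + 1) * ?c (\<nu> + 1) k + ?c \<nu> k) sums
     (t * bessel_phi (\<nu> + 2) t - (\<nu> + 1) * bessel_phi (\<nu> + 1) t + bessel_phi \<nu> t)"
    by (intro sums_add sums_diff sums_mult s)
  moreover have "(if k = 0 then 0 else t * ?c (\<nu> + 2) (k - 1)) - (\<nu> + 1) * ?c (\<nu> + 1) k + ?c \<nu> k = 0" for k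
  proof (cases k)
    case 0
    then show ?thesis using rGamma_plus1[of "\<nu> + 1"] by (simp add: add_ac)
  next
    case (Suc n)
    have r: "rGamma (\<nu> + real k + 1) = (\<nu> + real k + 1) * rGamma (\<nu> + real k + 2)"
      using rGamma_plus1[of "\<nu> + real k + 1"] by (simp add: add_ac)
    have e: "\<nu> + 2 + real n + 1 = \<nu> + real k + 2" "\<nu> + 1 + real k + 1 = \<nu> + real k + 2"
      using Suc by simp_all
    have f: "(fact k :: real) = real k * fact n" "k > 0" "t ^ k = t * t ^ n" "(-1) ^ k = - ((-1::real) ^ n)"
      using Suc by simp_all
    have "k - 1 = n" using Suc by simp
    show ?thesis
      unfolding e r \<open>k - 1 = n\<close> f(1,3,4) using f(2) by (simp add: e field_simps)
  qed
  ultimately have "(\<lambda>k. 0) sums (t * bessel_phi (\<nu> + 2) t - (\<nu> + 1) * bessel_phi (\<nu> + 1) t + bessel_phi \<nu> t)"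
    by simp
  then show ?thesis by (rule sums_unique2[OF _ sums_zero])
qed

lemma bessel_phi_0: "bessel_phi \<nu> 0 = rGamma (\<nu> + 1)"
proof -
  have "(\<lambda>k. (-1) ^ k * rGamma (\<nu> + real k + 1) / fact k * 0 ^ k) sums ((-1) ^ 0 * rGamma (\<nu> + real 0 + 1) / fact 0)"
    by (rule powser_sums_zero)
  then show ?thesis by (simp add: bessel_phi_def sums_iff)
qed

text \<open>A family whose linear span is closed under differentiation; \<open>bessel_w\<close> and
  its first two derivatives lie in that span.\<close>

definition powr_bessel_phi :: "real \<Rightarrow> real \<Rightarrow> real \<Rightarrow> real" where
  "powr_bessel_phi a \<nu> u = u powr a * bessel_phi \<nu> (u\<^sup>2 / 4)"

lemma DERIV_powr_bessel_phi:
  assumes u: "u > 0"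
  shows "(powr_bessel_phi a \<nu> has_real_derivative
    a * powr_bessel_phi (a - 1) \<nu> u - powr_bessel_phi (a + 1) (\<nu> + 1) u / 2) (at u)"
proof -
  have "((\<lambda>u. u\<^sup>2 / 4) has_real_derivative u / 2) (at u)"
    by (auto intro!: derivative_eq_intros)
  then have "((\<lambda>u. bessel_phi \<nu> (u\<^sup>2 / 4)) has_real_derivative - bessel_phi (\<nu> + 1) (u\<^sup>2 / 4) * (u / 2)) (at u)"
    by (rule DERIV_chain2[OF DERIV_bessel_phi])
  from DERIV_mult[OF has_real_derivative_powr[OF u, of a] this] show ?thesis
    unfolding powr_bessel_phi_def[abs_def]
    by (rule DERIV_cong) (use u in \<open>simp add: powr_add\<close>)
qed

text \<open>Up to a constant factor this is \<open>u\<^bsup>1/2\<^esup> J\<^sub>\<nu>(u)\<close>, which satisfies \<open>w'' = - q w\<close> without a first-order term.\<close>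

definition bessel_w :: "real \<Rightarrow> real \<Rightarrow> real" where
  "bessel_w \<nu> = powr_bessel_phi (\<nu> + 1 / 2) \<nu>"

definition bessel_w' :: "real \<Rightarrow> real \<Rightarrow> real" where
  "bessel_w' \<nu> u = (\<nu> + 1 / 2) * powr_bessel_phi (\<nu> - 1 / 2) \<nu> u - powr_bessel_phi (\<nu> + 3 / 2) (\<nu> + 1) u / 2"

definition bessel_q :: "real \<Rightarrow> real \<Rightarrow> real" where
  "bessel_q \<nu> u = 1 + (1 / 4 - \<nu>\<^sup>2) / u\<^sup>2"

lemma bessel_J_zero_iff: "u > 0 \<Longrightarrow> bessel_J \<nu> u = 0 \<longleftrightarrow> bessel_w \<nu> u = 0"
  by (simp add: bessel_J_phi bessel_w_def powr_bessel_phi_def)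

lemma DERIV_bessel_w: "u > 0 \<Longrightarrow> (bessel_w \<nu> has_real_derivative bessel_w' \<nu> u) (at u)"
  using DERIV_powr_bessel_phi[of u "\<nu> + 1 / 2" \<nu>] by (simp add: bessel_w_def bessel_w'_def add.assoc)

lemma DERIV_bessel_w':
  assumes u: "u > 0"
  shows "(bessel_w' \<nu> has_real_derivative - bessel_q \<nu> u * bessel_w \<nu> u) (at u)"
proof -
  let ?F = powr_bessel_phi and ?t = "u\<^sup>2 / 4"
  have "(bessel_w' \<nu> has_real_derivative
      (\<nu> + 1 / 2) * ((\<nu> - 1 / 2) * ?F (\<nu> - 1 / 2 - 1) \<nu> u - ?F (\<nu> - 1 / 2 + 1) (\<nu> + 1) u / 2)
      - ((\<nu> + 3 / 2) * ?F (\<nu> + 3 / 2 - 1) (\<nu> + 1) u - ?F (\<nu> + 3 / 2 + 1) (\<nu> + 1 + 1) u / 2) / 2) (at u)"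
    unfolding bessel_w'_def[abs_def]
    by (intro DERIV_diff DERIV_cmult DERIV_cdivide DERIV_powr_bessel_phi u)
  also have "(\<nu> + 1 / 2) * ((\<nu> - 1 / 2) * ?F (\<nu> - 1 / 2 - 1) \<nu> u - ?F (\<nu> - 1 / 2 + 1) (\<nu> + 1) u / 2)
      - ((\<nu> + 3 / 2) * ?F (\<nu> + 3 / 2 - 1) (\<nu> + 1) u - ?F (\<nu> + 3 / 2 + 1) (\<nu> + 1 + 1) u / 2) / 2
     = - bessel_q \<nu> u * bessel_w \<nu> u"
  proof -
    define p where "p = u powr (\<nu> - 3 / 2)"
    have e: "\<nu> - 1 / 2 - 1 = \<nu> - 3 / 2" "\<nu> - 1 / 2 + 1 = 2 + (\<nu> - 3 / 2)" "\<nu> + 3 / 2 - 1 = 2 + (\<nu> - 3 / 2)"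
      "\<nu> + 3 / 2 + 1 = 4 + (\<nu> - 3 / 2)" "\<nu> + 1 / 2 = 2 + (\<nu> - 3 / 2)" "\<nu> + 1 + 1 = \<nu> + 2"
      by simp_all
    have q: "- bessel_q \<nu> u * u\<^sup>2 = (\<nu>\<^sup>2 - 1 / 4) - u\<^sup>2"
      using u by (simp add: bessel_q_def field_simps)
    have F: "?F (2 + (\<nu> - 3 / 2)) \<mu> u = u\<^sup>2 * p * bessel_phi \<mu> ?t" "?F (4 + (\<nu> - 3 / 2)) \<mu> u = u ^ 4 * p * bessel_phi \<mu> ?t"
      "?F (\<nu> - 3 / 2) \<mu> u = p * bessel_phi \<mu> ?t" for \<mu>
      unfolding powr_bessel_phi_def powr_add p_def using u by simp_all
    \<comment> \<open>With u^(\<nu> - 3/2) factored out, the claim is linear in three consecutive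
      \<open>bessel_phi\<close>, and the only relation needed between them is Bessel's
      equation.\<close>
    have alg: "(\<nu> + 1 / 2) * ((\<nu> - 1 / 2) * (p * C) - u\<^sup>2 * p * B / 2)
        - ((\<nu> + 3 / 2) * (u\<^sup>2 * p * B) - u ^ 4 * p * A / 2) / 2 = ((\<nu>\<^sup>2 - 1 / 4) - u\<^sup>2) * (p * C)"
      if "?t * A - (\<nu> + 1) * B + C = 0" for A B C
    proof -
      have C: "C = (\<nu> + 1) * B - ?t * A" using that by simp
      show ?thesis unfolding C by (simp add: field_simps power2_eq_square power4_eq_xxxx)
    qed
    have "bessel_w \<nu> u = u\<^sup>2 * (p * bessel_phi \<nu> ?t)"
      unfolding bessel_w_def e(5) F by (simp only: mult.assoc)
    then have "- bessel_q \<nu> u * bessel_w \<nu> u = ((\<nu>\<^sup>2 - 1 / 4) - u\<^sup>2) * (p * bessel_phi \<nu> ?t)"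
      unfolding q[symmetric] by (simp only: mult.assoc)
    then show ?thesis unfolding e(1-4,6) F using alg[OF bessel_phi_ode[of ?t \<nu>]] by simp
  qed
  finally show ?thesis .
qed

section \<open>Sturm comparison for y'' = - q y\<close>

text \<open>Comparison by touching: Q (b - a) < pi leaves room for a positive sine s of frequency Q
  on [a, b]. Where y / s is maximal with value k > 0, the function y - k s has a maximum with second
  derivative (Q^2 - q) k s > 0, which is absurd.\<close>

lemma sturm_separation:
  assumes y: "\<And>u. u > 0 \<Longrightarrow> (y has_real_derivative y' u) (at u)"
    and y': "\<And>u. u > 0 \<Longrightarrow> (y' has_real_derivative - q u * y u) (at u)"
    and ab: "0 < a" "a < b" "y a = 0" "y b = 0"
    and Q: "Q > 0" "Q * (b - a) < pi" "\<And>u. a \<le> u \<Longrightarrow> u \<le> b \<Longrightarrow> q u < Q\<^sup>2"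
    and c: "a \<le> c" "c \<le> b"
  shows "y c \<le> 0"
proof (rule ccontr)
  assume neg: "\<not> y c \<le> 0"
  \<comment> \<open>Half of the slack, so that the argument of the sine runs from e to pi -
    e.\<close>
  define e where "e = (pi - Q * (b - a)) / 2"
  define s where "s = (\<lambda>u. sin (Q * (u - a) + e))"
  have e: "e > 0" using Q by (simp add: e_def)
  have s_pos: "s u > 0" if "a \<le> u" "u \<le> b" for u
  proof -
    have "0 \<le> Q * (u - a)" "Q * (u - a) \<le> Q * (b - a)" using that Q(1) by auto
    then show ?thesis unfolding s_def e_def using Q(2) by (intro sin_gt_zero) (simp_all add: field_simps)
  qed
  have cont: "continuous_on {a..b} (\<lambda>u. y u / s u)"
  proof (rule continuous_on_divide)
    show "continuous_on {a..b} y"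
      using y ab(1) by (intro continuous_at_imp_continuous_on ballI DERIV_isCont[OF y]) auto
    show "continuous_on {a..b} s" unfolding s_def by (intro continuous_intros)
    show "\<forall>x\<in>{a..b}. s x \<noteq> 0" using s_pos by force
  qed
  obtain m where m: "m \<in> {a..b}" "\<And>u. u \<in> {a..b} \<Longrightarrow> y u / s u \<le> y m / s m"
    using continuous_attains_sup[OF compact_Icc _ cont] ab by auto
  define k where "k = y m / s m"
  have "y c / s c \<le> k" using m(2)[of c] c by (simp add: k_def)
  moreover have "y c / s c > 0" using neg s_pos[of c] c by simp
  ultimately have k: "k > 0" by linarith
  have "m \<noteq> a" "m \<noteq> b" using k ab by (auto simp: k_def)
  then have am: "a < m" "m < b" using m(1) by auto
  have km: "y m = k * s m" using s_pos[of m] am by (simp add: k_def)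
  have "- q m * y m - k * (- Q\<^sup>2 * s m) \<le> 0"
  proof (rule second_derivative_nonpos_at_max[OF am])
    show "((\<lambda>u. y u - k * s u) has_real_derivative y' x - k * (Q * cos (Q * (x - a) + e))) (at x)"
      if "a < x" "x < b" for x
      unfolding s_def by (rule derivative_eq_intros y refl | use that ab in simp)+
    show "((\<lambda>x. y' x - k * (Q * cos (Q * (x - a) + e))) has_real_derivative - q m * y m - k * (- Q\<^sup>2 * s m)) (at m)"
      unfolding s_def by (rule derivative_eq_intros y' refl | use am ab in \<open>simp add: power2_eq_square\<close>)+
    show "y x - k * s x \<le> y m - k * s m" if "a < x" "x < b" for x
    proof -
      have "y x / s x \<le> k" using m(2)[of x] that by (simp add: k_def)
      then have "y x \<le> k * s x" using s_pos[of x] that by (simp add: field_simps)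
      then show ?thesis using km by simp
    qed
  qed
  then have "(Q\<^sup>2 - q m) * (k * s m) \<le> 0" unfolding km by (simp add: algebra_simps)
  moreover have "(Q\<^sup>2 - q m) * (k * s m) > 0"
    using Q(3)[of m] s_pos[of m] am k by (intro mult_pos_pos) auto
  ultimately show False by simp
qed

text \<open>The same touching argument with the roles exchanged: sin ((u - a) / 2) vanishes at both
  ends of an interval of length 2 pi, so if y were positive there, s / y would have an interior
  maximum.\<close>

lemma sturm_existence:
  assumes y: "\<And>u. u > 0 \<Longrightarrow> (y has_real_derivative y' u) (at u)"
    and y': "\<And>u. u > 0 \<Longrightarrow> (y' has_real_derivative - q u * y u) (at u)"
    and a: "0 < a" and q: "\<And>u. a \<le> u \<Longrightarrow> q u > 1 / 4"
  shows "\<exists>u. a \<le> u \<and> u \<le> a + 2 * pi \<and> y u \<le> 0"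
proof (rule ccontr)
  define b where "b = a + 2 * pi"
  assume "\<not> ?thesis"
  then have pos: "y u > 0" if "a \<le> u" "u \<le> b" for u using that by (force simp: b_def)
  define s where "s = (\<lambda>u. sin ((u - a) / 2))"
  have s_pos: "s u > 0" if "a < u" "u < b" for u
    using that unfolding s_def b_def by (intro sin_gt_zero) (auto simp: field_simps)
  have ends: "s a = 0" "s b = 0" by (auto simp: s_def b_def)
  have cont: "continuous_on {a..b} (\<lambda>u. s u / y u)"
  proof (rule continuous_on_divide)
    show "continuous_on {a..b} y"
      using y a by (intro continuous_at_imp_continuous_on ballI DERIV_isCont[OF y]) auto
    show "continuous_on {a..b} s" unfolding s_def by (intro continuous_intros) auto
    show "\<forall>x\<in>{a..b}. y x \<noteq> 0" using pos by force
  qed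
  have ab: "a < b" by (simp add: b_def)
  obtain m where m: "m \<in> {a..b}" "\<And>u. u \<in> {a..b} \<Longrightarrow> s u / y u \<le> s m / y m"
    using continuous_attains_sup[OF compact_Icc _ cont] ab by auto
  define k where "k = s m / y m"
  have "s ((a + b) / 2) / y ((a + b) / 2) \<le> k" using m(2)[of "(a + b) / 2"] ab by (simp add: k_def)
  moreover have "s ((a + b) / 2) / y ((a + b) / 2) > 0"
    using ab by (intro divide_pos_pos s_pos pos) (auto simp: field_simps)
  ultimately have k: "k > 0" by linarith
  have "m \<noteq> a" "m \<noteq> b" using k ends by (auto simp: k_def)
  then have am: "a < m" "m < b" using m(1) by auto
  have km: "s m = k * y m" using pos[of m] am by (simp add: k_def)
  have "- (1 / 4) * s m - k * (- q m * y m) \<le> 0"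
  proof (rule second_derivative_nonpos_at_max[OF am])
    show "((\<lambda>u. s u - k * y u) has_real_derivative (1 / 2) * cos ((x - a) / 2) - k * y' x) (at x)"
      if "a < x" "x < b" for x
      unfolding s_def by (rule derivative_eq_intros y refl | use that a in simp)+
    show "((\<lambda>x. (1 / 2) * cos ((x - a) / 2) - k * y' x) has_real_derivative - (1 / 4) * s m - k * (- q m * y m)) (at m)"
      unfolding s_def by (rule derivative_eq_intros y' refl | use am a in simp)+
    show "s x - k * y x \<le> s m - k * y m" if "a < x" "x < b" for x
    proof -
      have "s x / y x \<le> k" using m(2)[of x] that by (simp add: k_def)
      then have "s x \<le> k * y x" using pos[of x] that by (simp add: field_simps)
      then show ?thesis using km by simp
    qed
  qed
  then have "(q m - 1 / 4) * s m \<le> 0" using km by (simp add: algebra_simps)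
  moreover have "(q m - 1 / 4) * s m > 0"
    using q[of m] s_pos[of m] am by (intro mult_pos_pos) auto
  ultimately show False by simp
qed

section \<open>Position and spacing of the zeros\<close>

lemma bessel_w_pos_near_0:
  assumes "\<nu> > -1"
  shows "\<exists>\<delta>>0. \<forall>u. 0 < u \<and> u \<le> \<delta> \<longrightarrow> bessel_w \<nu> u > 0"
proof -
  have "bessel_phi \<nu> 0 > 0" using assms Gamma_real_pos[of "\<nu> + 1"] by (simp add: bessel_phi_0 rGamma_inverse_Gamma)
  moreover have "((\<lambda>u. bessel_phi \<nu> (u\<^sup>2 / 4)) \<longlongrightarrow> bessel_phi \<nu> (0\<^sup>2 / 4)) (at 0)"
    by (intro isCont_tendsto_compose[OF DERIV_isCont[OF DERIV_bessel_phi]] tendsto_intros) auto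
  ultimately have "\<forall>\<^sub>F u in at 0. bessel_phi \<nu> (u\<^sup>2 / 4) > 0" using order_tendstoD(1) by force
  then obtain d where d: "d > 0" "\<And>u. u \<noteq> 0 \<Longrightarrow> dist u 0 < d \<Longrightarrow> bessel_phi \<nu> (u\<^sup>2 / 4) > 0"
    unfolding eventually_at by auto
  show ?thesis
    by (rule exI[of _ "d / 2"]) (use d in \<open>auto simp: bessel_w_def powr_bessel_phi_def\<close>)
qed

text \<open>A Gronwall argument: K bounds |1 - q| beyond \<delta>, so (w^2 + w'^2) exp (K u) is
  nondecreasing and cannot drop to 0 from its positive value at \<delta>. It serves to exclude that
  w vanishes on an interval.\<close>

lemma bessel_w_not_both_0:
  assumes \<nu>: "\<nu> > -1" and a: "a > 0" "bessel_w \<nu> a = 0"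
  shows "bessel_w' \<nu> a \<noteq> 0"
proof
  assume a': "bessel_w' \<nu> a = 0"
  obtain \<delta> where \<delta>: "\<delta> > 0" "\<And>u. 0 < u \<Longrightarrow> u \<le> \<delta> \<Longrightarrow> bessel_w \<nu> u > 0" using bessel_w_pos_near_0[OF \<nu>] by blast
  have "\<delta> < a" using \<delta> a by (smt (verit))
  define K where "K = \<bar>1 / 4 - \<nu>\<^sup>2\<bar> / \<delta>\<^sup>2"
  define E where "E = (\<lambda>u. ((bessel_w \<nu> u)\<^sup>2 + (bessel_w' \<nu> u)\<^sup>2) * exp (K * u))"
  have "E \<delta> \<le> E a"
  proof (rule DERIV_nonneg_imp_nondecreasing[where f = E])
    show "\<delta> \<le> a" using \<open>\<delta> < a\<close> by simp
  next
    fix u assume u: "\<delta> \<le> u" "u \<le> a"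
    let ?y = "bessel_w \<nu> u" and ?y' = "bessel_w' \<nu> u" and ?q = "bessel_q \<nu> u"
    have up: "u > 0" using u \<delta> by simp
    have D: "(E has_real_derivative (2 * ?y * ?y' + 2 * ?y' * (- ?q * ?y)) * exp (K * u) + (?y\<^sup>2 + ?y'\<^sup>2) * (K * exp (K * u))) (at u)"
      unfolding E_def
      by (rule derivative_eq_intros DERIV_bessel_w[OF up] DERIV_bessel_w'[OF up] refl | simp)+
    have "\<bar>1 - ?q\<bar> \<le> K"
    proof -
      have "\<bar>1 - ?q\<bar> = \<bar>1 / 4 - \<nu>\<^sup>2\<bar> / u\<^sup>2" by (simp add: bessel_q_def abs_divide abs_minus_commute)
      also have "\<dots> \<le> K" unfolding K_def using u \<delta>(1) by (intro divide_left_mono power_mono) auto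
      finally show ?thesis .
    qed
    then have "\<bar>(1 - ?q) * (2 * ?y * ?y')\<bar> \<le> K * (?y\<^sup>2 + ?y'\<^sup>2)"
      unfolding abs_mult[of "1 - ?q"]
    proof (rule mult_mono)
      show "\<bar>2 * ?y * ?y'\<bar> \<le> ?y\<^sup>2 + ?y'\<^sup>2"
        using sum_squares_bound[of ?y ?y'] sum_squares_bound[of ?y "- ?y'"] by (simp add: abs_le_iff)
    qed (auto simp: K_def)
    then have "0 \<le> ((1 - ?q) * (2 * ?y * ?y') + K * (?y\<^sup>2 + ?y'\<^sup>2)) * exp (K * u)"
      by (intro mult_nonneg_nonneg) (auto simp: abs_le_iff)
    then show "\<exists>z. (E has_real_derivative z) (at u) \<and> 0 \<le> z"
      by (intro exI[of _ "(2 * ?y * ?y' + 2 * ?y' * (- ?q * ?y)) * exp (K * u) + (?y\<^sup>2 + ?y'\<^sup>2) * (K * exp (K * u))"] conjI D)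
         (simp add: algebra_simps)
  qed
  then have "E \<delta> \<le> 0" using a a' by (simp add: E_def)
  moreover have "E \<delta> > 0" using \<delta>(2)[of \<delta>] \<delta>(1) unfolding E_def
    by (intro mult_pos_pos add_pos_nonneg) auto
  ultimately show False by simp
qed

text \<open>The spacing is uniform in \<nu>, since \<nu>^2 only lowers the potential. If two zeros
  were closer, \<open>sturm_separation\<close> for w and - w would force w = 0 between them, hence w
  = w' = 0 at the midpoint.\<close>

lemma bessel_w_spacing:
  assumes \<nu>: "\<nu> > -1" and ab: "0 < \<delta>" "\<delta> \<le> a" "a < b" "bessel_w \<nu> a = 0" "bessel_w \<nu> b = 0"
  shows "b - a \<ge> pi / sqrt (2 + 1 / \<delta>\<^sup>2)"
proof (rule ccontr)
  define Q where "Q = sqrt (2 + 1 / \<delta>\<^sup>2)"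
  assume neg: "\<not> ?thesis"
  have Q: "Q > 0" "Q\<^sup>2 = 2 + 1 / \<delta>\<^sup>2" using ab by (auto simp: Q_def intro!: add_pos_nonneg)
  then have Qb: "Q * (b - a) < pi" using neg unfolding Q_def[symmetric] by (simp add: field_simps)
  have q: "bessel_q \<nu> u < Q\<^sup>2" if "a \<le> u" for u
  proof -
    have "(1 / 4 - \<nu>\<^sup>2) / u\<^sup>2 \<le> 1 / u\<^sup>2" by (intro divide_right_mono) (auto intro: order_trans[of _ "1/4"])
    also have "\<dots> \<le> 1 / \<delta>\<^sup>2" using that ab by (intro divide_left_mono power_mono mult_pos_pos zero_less_power) auto
    finally show ?thesis unfolding Q(2) bessel_q_def by simp
  qed
  have a0: "a > 0" using ab by simp
  have z: "bessel_w \<nu> c = 0" if c: "a \<le> c" "c \<le> b" for c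
  proof -
    have "bessel_w \<nu> c \<le> 0"
      by (rule sturm_separation[where q = "bessel_q \<nu>", OF DERIV_bessel_w DERIV_bessel_w' a0 ab(3-5) Q(1) Qb q c]) auto
    moreover have "- bessel_w \<nu> c \<le> 0"
      by (rule sturm_separation[where q = "bessel_q \<nu>" and y = "\<lambda>u. - bessel_w \<nu> u" and y' = "\<lambda>u. - bessel_w' \<nu> u", OF _ _ a0 ab(3) _ _ Q(1) Qb q c])
         (use ab in \<open>auto intro!: DERIV_minus[OF DERIV_bessel_w] DERIV_minus[OF DERIV_bessel_w', simplified]\<close>)
    ultimately show ?thesis by simp
  qed
  define c where "c = (a + b) / 2"
  have c: "a < c" "c < b" using ab by (auto simp: c_def)
  have "(bessel_w \<nu> has_real_derivative 0) (at c)"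
    by (rule has_field_derivative_transform_within[OF DERIV_const[of 0], of "min (c - a) (b - c)"])
       (use c z in \<open>auto simp: dist_real_def\<close>)
  then have "bessel_w' \<nu> c = 0" using DERIV_bessel_w[of c \<nu>] a0 c DERIV_unique by force
  then show False using bessel_w_not_both_0[OF \<nu>, of c] z[of c] c a0 by simp
qed

text \<open>Beyond 2 |\<nu>| + 1 the potential exceeds 1/4, so neither w nor - w stays positive on
  an interval of length 2 pi; the intermediate value theorem then gives a zero.\<close>

lemma bessel_w_zeros_unbounded:
  "\<exists>u>a. bessel_w \<nu> u = 0"
proof -
  define b where "b = max (a + 1) (2 * \<bar>\<nu>\<bar> + 1)"
  have b: "b > a" "b > 0" "b \<ge> 2 * \<bar>\<nu>\<bar> + 1" by (auto simp: b_def max_def)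
  have q: "bessel_q \<nu> u > 1 / 4" if "b \<le> u" for u
  proof -
    have "(2 * \<bar>\<nu>\<bar>)\<^sup>2 \<le> u\<^sup>2" using b that by (intro power_mono) auto
    then have "\<nu>\<^sup>2 \<le> u\<^sup>2 / 4" by (simp add: power_mult_distrib)
    moreover have "u > 0" using b that by simp
    ultimately have "\<nu>\<^sup>2 / u\<^sup>2 \<le> 1 / 4" "1 / 4 / u\<^sup>2 > 0" by (simp_all add: field_simps)
    then show ?thesis unfolding bessel_q_def diff_divide_distrib by linarith
  qed
  have "\<exists>u\<ge>b. u \<le> b + 2 * pi \<and> bessel_w \<nu> u \<le> 0"
    by (rule sturm_existence[where q = "bessel_q \<nu>" and y' = "bessel_w' \<nu>"])
       (use b q in \<open>auto intro: DERIV_bessel_w DERIV_bessel_w'[simplified]\<close>)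
  then obtain u1 where u1: "b \<le> u1" "bessel_w \<nu> u1 \<le> 0" by auto
  have "\<exists>u\<ge>b. u \<le> b + 2 * pi \<and> - bessel_w \<nu> u \<le> 0"
    by (rule sturm_existence[where q = "bessel_q \<nu>" and y' = "\<lambda>u. - bessel_w' \<nu> u"])
       (use b q in \<open>auto intro!: DERIV_minus[OF DERIV_bessel_w] DERIV_minus[OF DERIV_bessel_w', simplified]\<close>)
  then obtain u2 where u2: "b \<le> u2" "bessel_w \<nu> u2 \<ge> 0" by auto
  have cont: "isCont (bessel_w \<nu>) x" if "x > 0" for x using DERIV_isCont[OF DERIV_bessel_w[OF that]] .
  have "\<exists>u\<ge>b. bessel_w \<nu> u = 0"
  proof (cases "u1 \<le> u2")
    case True
    have "\<exists>x\<ge>u1. x \<le> u2 \<and> bessel_w \<nu> x = 0" by (rule IVT) (use True u1 u2 b in \<open>auto intro!: cont\<close>)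
    then show ?thesis using u1 by (meson order_trans)
  next
    case False
    have "\<exists>x\<ge>u2. x \<le> u1 \<and> bessel_w \<nu> x = 0" by (rule IVT2) (use False u1 u2 b in \<open>auto intro!: cont\<close>)
    then show ?thesis using u2 by (meson order_trans)
  qed
  then show ?thesis using b by (meson order_less_le_trans)
qed

text \<open>As long as u^2 < \<nu>^2 - 1/4 the potential is negative and w is convex wherever it is
  positive. Starting from w(0) = 0 with positive values, it has no positive interior maximum and so
  cannot come back to 0.\<close>

lemma bessel_w_zero_gt_order:
  assumes \<nu>: "\<nu> > 1 / 2" and b: "b > 0" "bessel_w \<nu> b = 0"
  shows "b \<ge> \<nu> - 1 / 2"
proof (rule ccontr)
  assume "\<not> b \<ge> \<nu> - 1 / 2"
  then have "b\<^sup>2 < (\<nu> - 1 / 2)\<^sup>2" using b by (intro power_strict_mono) auto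
  also have "\<dots> \<le> \<nu>\<^sup>2 - 1 / 4" using \<nu> by (simp add: power2_eq_square algebra_simps)
  finally have b2: "b\<^sup>2 < \<nu>\<^sup>2 - 1 / 4" .
  have q: "bessel_q \<nu> u < 0" if "0 < u" "u < b" for u
  proof -
    have "u\<^sup>2 < b\<^sup>2" using that by (intro power_strict_mono) auto
    then show ?thesis using b2 that by (simp add: bessel_q_def field_simps)
  qed
  obtain \<delta> where \<delta>: "\<delta> > 0" "\<And>u. 0 < u \<Longrightarrow> u \<le> \<delta> \<Longrightarrow> bessel_w \<nu> u > 0" using bessel_w_pos_near_0[of \<nu>] \<nu> by auto
  have "\<delta> < b" using \<delta>(2)[of b] b by force
  have w0: "bessel_w \<nu> 0 = 0" by (simp add: bessel_w_def powr_bessel_phi_def)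
  have "continuous_on UNIV (bessel_phi \<nu>)"
    by (intro continuous_at_imp_continuous_on ballI DERIV_isCont[OF DERIV_bessel_phi])
  then have "continuous_on {0..b} (\<lambda>u. bessel_phi \<nu> (u\<^sup>2 / 4))"
    by (rule continuous_on_compose2) (auto intro!: continuous_intros)
  moreover have "continuous_on {0..b} (\<lambda>u. u powr (\<nu> + 1 / 2))"
    using \<nu> by (intro continuous_on_powr' continuous_intros) auto
  ultimately have cont: "continuous_on {0..b} (bessel_w \<nu>)"
    unfolding bessel_w_def powr_bessel_phi_def[abs_def] by (rule continuous_on_mult[rotated])
  obtain m where m: "m \<in> {0..b}" "\<And>u. u \<in> {0..b} \<Longrightarrow> bessel_w \<nu> u \<le> bessel_w \<nu> m"
    using continuous_attains_sup[OF compact_Icc _ cont] b by auto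
  have "bessel_w \<nu> \<delta> \<le> bessel_w \<nu> m" using m(2) \<delta>(1) \<open>\<delta> < b\<close> by simp
  then have pos: "bessel_w \<nu> m > 0" using \<delta>(2)[of \<delta>] \<delta>(1) by simp
  then have "m \<noteq> 0" "m \<noteq> b" using w0 b by auto
  then have am: "0 < m" "m < b" using m(1) by auto
  have "- bessel_q \<nu> m * bessel_w \<nu> m \<le> 0"
    by (rule second_derivative_nonpos_at_max[OF am, of "bessel_w \<nu>" "bessel_w' \<nu>"])
       (use am m(2) DERIV_bessel_w DERIV_bessel_w' in auto)
  moreover have "0 < - bessel_q \<nu> m * bessel_w \<nu> m"
    using q[OF am] pos by (intro mult_pos_pos) auto
  ultimately show False by linarith
qed

text \<open>The infimum in \<open>bessel_zero\<close> is a genuine zero because consecutive zeros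
  keep a fixed distance; the same distance gives the linear growth in n.\<close>

lemma bessel_zero_props:
  assumes \<nu>: "\<nu> > -1" and \<delta>: "\<delta> > 0" "\<And>u. 0 < u \<Longrightarrow> u \<le> \<delta> \<Longrightarrow> bessel_w \<nu> u > 0"
  shows "bessel_zero \<nu> (Suc n) > 0 \<and> bessel_w \<nu> (bessel_zero \<nu> (Suc n)) = 0
    \<and> bessel_zero \<nu> (Suc n) \<ge> \<delta> + real n * (pi / sqrt (2 + 1 / \<delta>\<^sup>2))"
proof (induction n)
  define d where "d = pi / sqrt (2 + 1 / \<delta>\<^sup>2)"
  have d: "d > 0" using \<delta> by (auto simp: d_def intro!: divide_pos_pos add_pos_nonneg)
  have cont: "continuous_on {\<delta>..} (bessel_w \<nu>)"
    using \<delta> by (intro continuous_at_imp_continuous_on ballI DERIV_isCont[OF DERIV_bessel_w]) auto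
  have zero_ge: "u \<ge> \<delta>" if "u > 0" "bessel_w \<nu> u = 0" for u using \<delta>(2)[of u] that by force
  have step: "bessel_w \<nu> (Inf S) = 0 \<and> Inf S \<ge> r"
    if S: "S = {u. u > r0 \<and> bessel_J \<nu> u = 0}" and r: "r0 \<ge> 0" "r \<ge> \<delta>" "r > r0" "\<And>u. u > r0 \<Longrightarrow> bessel_w \<nu> u = 0 \<Longrightarrow> u \<ge> r"
    for S r r0
  proof -
    \<comment> \<open>The gap replaces the open condition u > r0 by the closed one u \<ge> r, and a
      closed nonempty set bounded below contains its infimum.\<close>
    have S': "S = {u \<in> {r..}. bessel_w \<nu> u = 0}"
      unfolding S using r \<delta>(1) bessel_J_zero_iff[of _ \<nu>] by (auto intro: order_less_le_trans)
    have "closed S" unfolding S'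
      by (rule continuous_closed_preimage_constant[OF continuous_on_subset[OF cont]]) (use r in auto)
    moreover have "S \<noteq> {}" using bessel_w_zeros_unbounded[of r \<nu>] by (force simp: S')
    moreover have "bdd_below S" unfolding S' by (rule bdd_belowI[of _ r]) auto
    ultimately have "Inf S \<in> S" by (intro closed_contains_Inf)
    then show ?thesis by (simp add: S')
  qed
  {
    case 0
    have "bessel_w \<nu> (bessel_zero \<nu> (Suc 0)) = 0 \<and> bessel_zero \<nu> (Suc 0) \<ge> \<delta>"
      using step[of "{u. u > 0 \<and> bessel_J \<nu> u = 0}" 0 \<delta>] \<delta>(1) zero_ge by simp
    then show ?case using \<delta>(1) by simp
  next
    case (Suc n)
    let ?z = "bessel_zero \<nu> (Suc n)"
    have z: "?z > 0" "bessel_w \<nu> ?z = 0" "?z \<ge> \<delta> + real n * d" using Suc by (auto simp: d_def)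
    have zd: "?z \<ge> \<delta>" using zero_ge z by blast
    have "bessel_w \<nu> (bessel_zero \<nu> (Suc (Suc n))) = 0 \<and> bessel_zero \<nu> (Suc (Suc n)) \<ge> ?z + d"
    proof -
      have "u \<ge> ?z + d" if "u > ?z" "bessel_w \<nu> u = 0" for u
        using bessel_w_spacing[OF \<nu> \<delta>(1) zd that(1) z(2) that(2)] by (simp add: d_def)
      then show ?thesis
        using step[of "{u. u > ?z \<and> bessel_J \<nu> u = 0}" ?z "?z + d"] zd d z(1) by simp
    qed
    then show ?case using z d unfolding d_def[symmetric] by (simp add: algebra_simps)
  }
qed

text \<open>The order bound gives growth in m, the spacing gives growth in n; what needs care is a
  zero-free interval (0, \<delta>] common to all orders.\<close>

theorem bessel_zero_lower:
  fixes H :: real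
  assumes H: "0 < H" "H < 1"
  shows "\<exists>c>0. \<forall>m n. n \<ge> 1 \<longrightarrow> bessel_zero (\<bar>real m - 1\<bar> - H) n \<ge> c * (real m + real n)"
proof -
  obtain d1 where d1: "d1 > 0" "\<And>u. 0 < u \<Longrightarrow> u \<le> d1 \<Longrightarrow> bessel_w (- H) u > 0" using bessel_w_pos_near_0[of "- H"] H by auto
  obtain d2 where d2: "d2 > 0" "\<And>u. 0 < u \<Longrightarrow> u \<le> d2 \<Longrightarrow> bessel_w (1 - H) u > 0" using bessel_w_pos_near_0[of "1 - H"] H by auto
  \<comment> \<open>d1 serves the order - H (m = 1), d2 the order 1 - H (m = 0 and m = 2). For m
    \<ge> 3 the zeros start at \<nu> - 1/2 \<ge> 3/2 - H, which is beyond (1 - H) / 4.\<close>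
  define \<delta> where "\<delta> = min (1 / 4 * (1 - H)) (min d1 d2)"
  have \<delta>: "\<delta> > 0" using d1 d2 H by (simp add: \<delta>_def)
  define d where "d = pi / sqrt (2 + 1 / \<delta>\<^sup>2)"
  have d: "d > 0" using \<delta> by (auto simp: d_def intro!: divide_pos_pos add_pos_nonneg)
  have pos: "bessel_w \<nu> u > 0" if \<nu>: "\<nu> = \<bar>real m - 1\<bar> - H" and u: "0 < u" "u \<le> \<delta>" for \<nu> u m
  proof -
    consider "m = 1" | "m = 0 \<or> m = 2" | "m \<ge> 3" by linarith
    then show ?thesis
    proof cases
      case 1 then show ?thesis using d1(2)[of u] u \<nu> by (simp add: \<delta>_def)
    next
      case 2 then show ?thesis using d2(2)[of u] u \<nu> by (auto simp: \<delta>_def)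
    next
      case 3
      then have \<nu>2: "\<nu> \<ge> 2 - H" using \<nu> by simp
      have nz: "bessel_w \<nu> v \<noteq> 0" if "0 < v" "v \<le> \<delta>" for v
        using bessel_w_zero_gt_order[of \<nu> v] that \<nu>2 H by (auto simp: \<delta>_def)
      obtain e where e: "e > 0" "\<And>u. 0 < u \<Longrightarrow> u \<le> e \<Longrightarrow> bessel_w \<nu> u > 0" using bessel_w_pos_near_0[of \<nu>] \<nu>2 H by auto
      show ?thesis
      proof (rule ccontr)
        assume neg: "\<not> bessel_w \<nu> u > 0"
        then have eu: "e < u" using e(2)[of u] u by force
        have "\<exists>v\<ge>e. v \<le> u \<and> bessel_w \<nu> v = 0"
          by (rule IVT2) (use neg e eu in \<open>auto intro!: DERIV_isCont[OF DERIV_bessel_w] simp: less_imp_le\<close>)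
        then show False using nz u e by fastforce
      qed
    qed
  qed
  \<comment> \<open>Adds up m \<le> z + 3, n - 1 \<le> z / d and 1 \<le> z / \<delta>; the 4 is 3 +
    1, both constants being absorbed by z / \<delta>.\<close>
  define c where "c = 1 / (1 + 1 / d + 4 / \<delta>)"
  have c: "c > 0" using d \<delta> by (auto simp: c_def intro!: add_pos_pos)
  have "bessel_zero (\<bar>real m - 1\<bar> - H) n \<ge> c * (real m + real n)" if n: "n \<ge> 1" for m n
  proof -
    define \<nu> where "\<nu> = \<bar>real m - 1\<bar> - H"
    obtain n' where n': "n = Suc n'" using n by (cases n) auto
    let ?z = "bessel_zero \<nu> n"
    have z: "?z > 0" "bessel_w \<nu> ?z = 0" "?z \<ge> \<delta> + real n' * d"
      using bessel_zero_props[of \<nu> \<delta> n'] pos[OF \<nu>_def] \<delta> H by (auto simp: \<nu>_def n' d_def)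
    have "?z \<ge> \<nu> - 1 / 2"
      using bessel_w_zero_gt_order[of \<nu> ?z] z by (cases "\<nu> > 1 / 2") auto
    then have "real m \<le> ?z + 3" using H unfolding \<nu>_def by linarith
    moreover have "real n' \<le> ?z / d" using z(3) d \<delta> by (simp add: field_simps)
    moreover have "1 \<le> ?z / \<delta>" using z(3) d \<delta> by (simp add: field_simps) (smt (verit) mult_nonneg_nonneg of_nat_0_le_iff)
    ultimately have "real m + real n \<le> ?z + ?z / d + 4 * (?z / \<delta>)" unfolding n' of_nat_Suc by linarith
    also have "\<dots> = (1 + 1 / d + 4 / \<delta>) * ?z" by (simp add: algebra_simps)
    finally show ?thesis unfolding \<nu>_def c_def using d \<delta> by (simp add: field_simps add_pos_pos)
  qed
  then show ?thesis using c by blast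
qed

subsection \<open>Counting the terms\<close>

lemma fact_add_le: "fact (m + k) \<le> (m + k) ^ k * (fact m :: nat)"
proof (induction k)
  case (Suc k)
  have "fact (m + Suc k) = Suc (m + k) * (fact (m + k) :: nat)" by simp
  also have "\<dots> \<le> Suc (m + k) * ((m + k) ^ k * fact m)" using Suc by (rule mult_le_mono2)
  also have "\<dots> \<le> Suc (m + k) * (Suc (m + k) ^ k * fact m)"
    by (intro mult_le_mono power_mono) auto
  finally show ?case by (simp only: add_Suc_right power_Suc mult.assoc)
qed simp

text \<open>The exponent N - 2 is what matters: the ranges of m and n add two more powers, so that
  the terms with zero below T number O(T^N).\<close>

lemma harm_dim_le:
  assumes "N \<ge> 2"
  shows "harm_dim m N \<le> 2 * (m + N) ^ (N - 2)"
proof (cases "N = 2")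
  case True
  show ?thesis
  proof (cases m)
    case (Suc k)
    have "2 * m * fact (m - 1) = 2 * (fact m :: nat)" using Suc by (simp only: fact_Suc diff_Suc_1 mult.assoc) simp
    then have "2 * m * fact (m - 1) div fact m = 2 * fact m div (fact m :: nat)" by (rule arg_cong)
    also have "\<dots> = 2" by (rule nonzero_mult_div_cancel_right) simp
    finally have "2 * m * fact (m - 1) div fact m = (2 :: nat)" .
    then show ?thesis using True Suc by (simp add: harm_dim_def del: fact_Suc)
  qed (simp add: True harm_dim_def)
next
  case False
  then obtain k where N: "N = k + 3" using assms by (metis add.commute le_add_diff_inverse le_neq_implies_less less_iff_Suc_add numeral_3_eq_3 numeral_2_eq_2 add_Suc_right add_Suc Suc_le_eq)
  have "(2 * m + N - 2) * fact (m + N - 3) = (2 * m + k + 1) * fact (m + k)" by (simp add: N)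
  also have "\<dots> \<le> (2 * (m + N)) * ((m + N) ^ k * fact m)"
    by (intro mult_le_mono order_trans[OF fact_add_le] power_mono) (auto simp: N)
  also have "\<dots> = 2 * (m + N) ^ (N - 2) * fact m" by (simp add: N)
  also have "\<dots> \<le> 2 * (m + N) ^ (N - 2) * (fact (N - 2) * fact m)"
    by (intro mult_le_mono) (auto simp: fact_ge_1)
  finally have "(2 * m + N - 2) * fact (m + N - 3) div (fact (N - 2) * fact m)
      \<le> 2 * (m + N) ^ (N - 2) * (fact (N - 2) * fact m) div (fact (N - 2) * fact m)"
    by (rule div_le_mono)
  also have "\<dots> = 2 * (m + N) ^ (N - 2)" by (rule nonzero_mult_div_cancel_right) auto
  finally show ?thesis using False assms by (simp add: harm_dim_def)
qed

lemma harm_dim_0: "N \<ge> 1 \<Longrightarrow> harm_dim 0 N \<ge> 1"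
proof -
  assume "N \<ge> 1"
  consider "N = 1" | "N = 2" | k where "N = k + 3" using \<open>N \<ge> 1\<close> by (metis One_nat_def Suc_1 add.commute add_Suc_right less_Suc_eq_le less_iff_Suc_add numeral_3_eq_3 One_nat_def le_neq_implies_less not_less_eq_eq plus_1_eq_Suc)
  then show ?thesis
  proof cases
    case 3
    have "(2 * 0 + N - 2) * fact (0 + N - 3) = (fact (N - 2) * fact 0 :: nat)" using 3 by simp
    then show ?thesis using 3 unfolding harm_dim_def by (simp del: fact_Suc)
  qed (auto simp: harm_dim_def)
qed

lemma term_index_count:
  fixes j :: "nat \<Rightarrow> nat \<Rightarrow> real"
  assumes N: "N \<ge> 1" and c: "c > 0" and j: "\<And>m n. n \<ge> 1 \<Longrightarrow> j m n \<ge> c * (real m + real n)" and T: "T \<ge> 1"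
  shows "finite {(m, n, l) \<in> term_index N. j m n < T}"
    and "real (card {(m, n, l) \<in> term_index N. j m n < T}) \<le> 2 * (1 / c + real N) ^ N * T ^ N"
proof -
  let ?A = "{(m, n, l) \<in> term_index N. j m n < T}"
  define X where "X = nat \<lfloor>T / c\<rfloor>"
  have X: "real X \<le> T / c" using T c by (simp add: X_def)
  have mn: "m + n \<le> X" if "n \<ge> 1" "j m n < T" for m n
  proof -
    have "c * (real m + real n) < T" using j[of n m] that by linarith
    then have "real (m + n) \<le> T / c" using c by (simp add: field_simps)
    then show ?thesis unfolding X_def by linarith
  qed
  have "\<exists>B. ?A \<subseteq> B \<and> finite B \<and> card B \<le> 2 * (X + N) ^ N"
  \<comment> \<open>In dimension one only m = 0 and m = 1 occur, so just n is free and the count is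
    linear.\<close>
  proof (cases "N = 1")
    case True
    have "?A \<subseteq> {..1} \<times> {..X} \<times> {1..1}"
      using mn True by (force simp: term_index_def harm_dim_def split: if_splits)
    moreover have "card ({..1::nat} \<times> {..X} \<times> {1..1::nat}) \<le> 2 * (X + N) ^ N"
      using True by (simp add: card_cartesian_product)
    ultimately show ?thesis by (intro exI[of _ "{..1} \<times> {..X} \<times> {1..1}"]) auto
  next
    case False
    then have N2: "N \<ge> 2" using N by simp
    have "?A \<subseteq> {..X} \<times> {..X} \<times> {1..2 * (X + N) ^ (N - 2)}"
    proof
      fix i assume "i \<in> ?A"
      then obtain m n l where i: "i = (m, n, l)" "(m, n, l) \<in> term_index N" "j m n < T" by blast
      then have a: "n \<ge> 1" "1 \<le> l" "l \<le> harm_dim m N" "m + n \<le> X" using mn by (auto simp: term_index_def)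
      have "harm_dim m N \<le> 2 * (X + N) ^ (N - 2)"
        using a(4) by (intro order_trans[OF harm_dim_le[OF N2]] mult_le_mono power_mono) auto
      then show "i \<in> {..X} \<times> {..X} \<times> {1..2 * (X + N) ^ (N - 2)}" using a i(1) by auto
    qed
    moreover have "card ({..X} \<times> {..X} \<times> {1..2 * (X + N) ^ (N - 2)}) \<le> 2 * (X + N) ^ N"
    proof -
      have "card ({..X} \<times> {..X} \<times> {1..2 * (X + N) ^ (N - 2)}) = (X + 1) * ((X + 1) * (2 * (X + N) ^ (N - 2)))"
        by (simp add: card_cartesian_product)
      also have "\<dots> \<le> (X + N) * ((X + N) * (2 * (X + N) ^ (N - 2)))"
        using N by (intro mult_le_mono) auto
      also have "\<dots> = 2 * (X + N) ^ Suc (Suc (N - 2))" by simp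
      also have "Suc (Suc (N - 2)) = N" using N2 by simp
      finally show ?thesis .
    qed
    ultimately show ?thesis
      by (intro exI[of _ "{..X} \<times> {..X} \<times> {1..2 * (X + N) ^ (N - 2)}"]) auto
  qed
  then obtain B where B: "?A \<subseteq> B" "finite B" "card B \<le> 2 * (X + N) ^ N" by blast
  show "finite ?A" using B finite_subset by blast
  have "card ?A \<le> 2 * (X + N) ^ N" using card_mono[OF B(2,1)] B(3) by simp
  then have "real (card ?A) \<le> real (2 * (X + N) ^ N)" by (rule of_nat_mono)
  also have "\<dots> = 2 * (real X + real N) ^ N" by simp
  also have "\<dots> \<le> 2 * ((1 / c + real N) * T) ^ N"
  proof (intro mult_left_mono power_mono)
    have "real N * 1 \<le> real N * T" using T by (intro mult_left_mono) auto
    then show "real X + real N \<le> (1 / c + real N) * T" using X by (simp add: algebra_simps)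
  qed auto
  finally show "real (card ?A) \<le> 2 * (1 / c + real N) ^ N * T ^ N" by (simp add: power_mult_distrib)
qed

lemma infinite_term_index: "N \<ge> 1 \<Longrightarrow> infinite (term_index N)"
proof
  assume N: "N \<ge> 1" and fin: "finite (term_index N)"
  have "(\<lambda>n. (0::nat, Suc n, 1::nat)) ` UNIV \<subseteq> term_index N"
    using harm_dim_0[OF N] by (auto simp: term_index_def)
  then have "finite ((\<lambda>n. (0::nat, Suc n, 1::nat)) ` UNIV)" using fin finite_subset by blast
  then have "finite (UNIV :: nat set)" by (rule finite_imageD) (auto simp: inj_on_def)
  then show False by simp
qed

subsection \<open>Partial derivatives of radial products\<close>

definition sqsum :: "nat set \<Rightarrow> (nat \<Rightarrow> real) \<Rightarrow> real" where
  "sqsum K x = (\<Sum>i\<in>K. (x i)\<^sup>2)"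

text \<open>Only pure derivatives along coordinate lines are recorded, which is what the Laplacian
  and the Euler operator consist of. With points as functions on \<open>nat\<close>, the coordinate
  set K can grow one index at a time.\<close>

definition has_partials ::
  "nat set \<Rightarrow> ((nat \<Rightarrow> real) \<Rightarrow> real) \<Rightarrow> (nat \<Rightarrow> (nat \<Rightarrow> real) \<Rightarrow> real) \<Rightarrow> (nat \<Rightarrow> (nat \<Rightarrow> real) \<Rightarrow> real) \<Rightarrow> bool" where
  "has_partials K f D D2 \<longleftrightarrow> (\<forall>i\<in>K. \<forall>x.
     ((\<lambda>t. f (x(i := t))) has_real_derivative D i x) (at (x i)) \<and>
     ((\<lambda>t. D i (x(i := t))) has_real_derivative D2 i x) (at (x i)))"

text \<open>A solid harmonic of degree d in the variables of K. Euler's identity is a clause of its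
  own because pure partial derivatives give no chain rule along rays, so homogeneity alone would not
  yield it.\<close>

definition harmonic_hom :: "nat set \<Rightarrow> nat \<Rightarrow> ((nat \<Rightarrow> real) \<Rightarrow> real) \<Rightarrow> bool" where
  "harmonic_hom K d f \<longleftrightarrow>
     (\<forall>x y. (\<forall>i\<in>K. x i = y i) \<longrightarrow> f x = f y) \<and> (\<forall>c x. f (\<lambda>i. c * x i) = c ^ d * f x) \<and>
     (\<exists>D D2. has_partials K f D D2 \<and> (\<forall>x. (\<Sum>i\<in>K. D2 i x) = 0) \<and> (\<forall>x. (\<Sum>i\<in>K. x i * D i x) = real d * f x))"

lemma sqsum_upd:
  assumes "finite K" "i \<in> K"
  shows "sqsum K (x(i := t)) = sqsum (K - {i}) x + t\<^sup>2"
proof -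
  have "sqsum K (x(i := t)) = t\<^sup>2 + (\<Sum>j\<in>K - {i}. ((x(i := t)) j)\<^sup>2)"
    using assms by (simp add: sqsum_def sum.remove)
  also have "(\<Sum>j\<in>K - {i}. ((x(i := t)) j)\<^sup>2) = sqsum (K - {i}) x"
    unfolding sqsum_def by (intro sum.cong) auto
  finally show ?thesis by (simp only: add.commute)
qed

lemma sqsum_cong: "(\<And>i. i \<in> K \<Longrightarrow> x i = y i) \<Longrightarrow> sqsum K x = sqsum K y"
  by (simp add: sqsum_def)

lemma sqsum_scale: "sqsum K (\<lambda>i. c * x i) = c\<^sup>2 * sqsum K x"
  by (simp add: sqsum_def power_mult_distrib sum_distrib_left)

lemma DERIV_sqsum:
  assumes "finite K" "i \<in> K"
  shows "((\<lambda>t. sqsum K (x(i := t))) has_real_derivative 2 * x i) (at (x i))"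
  unfolding sqsum_upd[OF assms] by (auto intro!: derivative_eq_intros)

lemma DERIV_radial_mult:
  assumes K: "finite K" "i \<in> K"
    and g: "\<And>s. (g has_real_derivative g' s) (at s)"
    and f: "((\<lambda>t. f (x(i := t))) has_real_derivative D) (at (x i))"
  shows "((\<lambda>t. g (sqsum K (x(i := t))) * f (x(i := t))) has_real_derivative
     2 * x i * (g' (sqsum K x) * f x) + g (sqsum K x) * D) (at (x i))"
proof -
  have "((\<lambda>t. g (sqsum K (x(i := t)))) has_real_derivative g' (sqsum K x) * (2 * x i)) (at (x i))"
    by (rule DERIV_chain2[where g = "\<lambda>t. sqsum K (x(i := t))", OF _ DERIV_sqsum[OF K]]) (simp add: g)
  from DERIV_mult[OF this f] show ?thesis by (rule DERIV_cong) simp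
qed

lemma DERIV_radial_mult2:
  assumes K: "finite K" "i \<in> K"
    and g: "\<And>s. (g has_real_derivative g' s) (at s)" and g': "\<And>s. (g' has_real_derivative g'' s) (at s)"
    and f: "((\<lambda>t. f (x(i := t))) has_real_derivative D i x) (at (x i))"
    and D: "((\<lambda>t. D i (x(i := t))) has_real_derivative D2) (at (x i))"
  shows "((\<lambda>t. 2 * t * (g' (sqsum K (x(i := t))) * f (x(i := t))) + g (sqsum K (x(i := t))) * D i (x(i := t)))
     has_real_derivative
     (2 * g' (sqsum K x) + 4 * (x i)\<^sup>2 * g'' (sqsum K x)) * f x + 4 * g' (sqsum K x) * (x i * D i x) + g (sqsum K x) * D2) (at (x i))"
proof -
  have a: "((\<lambda>t. 2 * t) has_real_derivative 2) (at (x i))" by (auto intro!: derivative_eq_intros)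
  show ?thesis
    using DERIV_add[OF DERIV_mult[OF a DERIV_radial_mult[OF K, where g = g' and g' = g'', OF g' f]]
        DERIV_radial_mult[OF K, where g = g and g' = g' and f = "D i", OF g D]]
    by (rule DERIV_cong) (simp add: algebra_simps power2_eq_square)
qed

text \<open>The Laplacian of g(|x|^2) f for a harmonic f of degree d: the cross terms add up by
  Euler's identity, so the result is again a radial factor times f. Both the Gegenbauer recursion
  and the Helmholtz equation rest on this.\<close>

lemma sum_radial_mult2:
  assumes "(\<Sum>i\<in>K. D2 i) = 0" "(\<Sum>i\<in>K. x i * D i) = real d * f"
  shows "(\<Sum>i\<in>K. (2 * g' + 4 * (x i)\<^sup>2 * g'') * f + 4 * g' * (x i * D i) + g * D2 i)
    = (4 * sqsum K x * g'' + (2 * real (card K) + 4 * real d) * g') * f"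
proof -
  have "(\<Sum>i\<in>K. (2 * g' + 4 * (x i)\<^sup>2 * g'') * f + 4 * g' * (x i * D i) + g * D2 i)
     = (\<Sum>i\<in>K. 2 * g' * f) + (\<Sum>i\<in>K. (x i)\<^sup>2 * (4 * g'' * f)) + 4 * g' * (\<Sum>i\<in>K. x i * D i) + g * (\<Sum>i\<in>K. D2 i)"
    by (simp add: sum.distrib sum_distrib_left algebra_simps)
  moreover have "(\<Sum>i\<in>K. (x i)\<^sup>2 * (4 * g'' * f)) = sqsum K x * (4 * g'' * f)"
    by (simp add: sqsum_def sum_distrib_right)
  ultimately show ?thesis unfolding assms by (simp add: algebra_simps)
qed

subsection \<open>Gegenbauer polynomials\<close>

text \<open>The coefficient of x^(n - 2 k) in the shape in which the binomial series yields it: it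
  comes from the power n - k of t^2 - 2 x t.\<close>

definition geg_coeff :: "real \<Rightarrow> nat \<Rightarrow> nat \<Rightarrow> real" where
  "geg_coeff a n k = ((- a) gchoose (n - k)) * real ((n - k) choose k) * (- 2) ^ (n - 2 * k)"

text \<open>The Gegenbauer differential equation, read off coefficientwise.\<close>

lemma geg_coeff_rec:
  assumes "2 * k + 2 \<le> n"
  shows "geg_coeff a n (Suc k) * (4 * (real k + 1) * (real n - real k - 1 + a))
     = - geg_coeff a n k * (real n - 2 * real k) * (real n - 2 * real k - 1)"
proof -
  define i where "i = n - k - 1"
  have e: "n - k = Suc i" "n - Suc k = i" "n - 2 * k = Suc (Suc (n - 2 * Suc k))" "k < i" "real n = real i + real k + 1"
    using assms by (auto simp: i_def)
  define p where "p = (- 2 :: real) ^ (n - 2 * Suc k)"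
  define G where "G = ((- a) gchoose i)"
  have G: "((- a) gchoose Suc i) * (real i + 1) = G * (- a - real i)"
    unfolding G_def using gbinomial_absorption'[of "Suc i" "- a"] gbinomial_mult_1[of "- a" i]
    by (simp add: algebra_simps)
  have c1: "real (i choose Suc k) * (real k + 1) = real (i choose k) * (real i - real k)"
  proof -
    have "Suc k * (i choose Suc k) = (i - k) * (i choose k)"
      unfolding binomial_absorption binomial_absorb_comp ..
    then have "real (Suc k) * real (i choose Suc k) = real (i - k) * real (i choose k)"
      unfolding of_nat_mult[symmetric] by (rule arg_cong)
    moreover have "real (i - k) = real i - real k" using e(4) by (simp add: of_nat_diff)
    ultimately show ?thesis by (simp add: algebra_simps)
  qed
  have c2: "real (Suc i choose k) * (real i + 1 - real k) = (real i + 1) * real (i choose k)"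
  proof -
    have "(Suc i - k) * (Suc i choose k) = Suc i * (i choose k)"
      using binomial_absorb_comp[of "Suc i" k] by simp
    then have "real (Suc i - k) * real (Suc i choose k) = real (Suc i) * real (i choose k)"
      unfolding of_nat_mult[symmetric] by (rule arg_cong)
    moreover have "real (Suc i - k) = real i + 1 - real k" using e(4) by (simp add: of_nat_diff)
    ultimately show ?thesis by (simp add: algebra_simps)
  qed
  \<comment> \<open>The factor i + 1 clears the denominators in the ratios of the binomial
    coefficients; it is cancelled at the end.\<close>
  have "(real i + 1) * (geg_coeff a n (Suc k) * (4 * (real k + 1) * (real n - real k - 1 + a)))
      = 4 * p * G * (real i + a) * (real (i choose Suc k) * (real k + 1)) * (real i + 1)"
    unfolding geg_coeff_def e(1,2) e(5) p_def[symmetric] G_def[symmetric] by (simp add: algebra_simps)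
  also have "\<dots> = 4 * p * G * (real i + a) * (real i - real k) * ((real i + 1) * real (i choose k))"
    unfolding c1 by (simp add: algebra_simps)
  also have "\<dots> = - (4 * p * (G * (- a - real i)) * (real i - real k) * (real (Suc i choose k) * (real i + 1 - real k)))"
    unfolding c2 by (simp add: algebra_simps)
  also have "\<dots> = (real i + 1) * (- geg_coeff a n k * (real n - 2 * real k) * (real n - 2 * real k - 1))"
    unfolding G[symmetric] geg_coeff_def e(1,3) e(5) power_Suc p_def[symmetric] by (simp add: algebra_simps)
  finally have "(real i + 1) * (geg_coeff a n (Suc k) * (4 * (real k + 1) * (real n - real k - 1 + a)))
    = (real i + 1) * (- geg_coeff a n k * (real n - 2 * real k) * (real n - 2 * real k - 1))" .
  moreover have "real i + 1 \<noteq> 0" by linarith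
  ultimately show ?thesis using mult_left_cancel[THEN iffD1] by blast
qed

text \<open>The homogenisation r^n C(y / r) with r^2 = y^2 + s, where s stands for the squared
  length of the remaining coordinates. Being a polynomial in y and s, it passes smoothly through r =
  0.\<close>

definition geg_hom :: "real \<Rightarrow> nat \<Rightarrow> real \<Rightarrow> real \<Rightarrow> real" where
  "geg_hom a n y s = (\<Sum>k\<le>n div 2. geg_coeff a n k * (y ^ (n - 2 * k) * (y\<^sup>2 + s) ^ k))"

lemma gegenbauer_sum:
  "gegenbauer a n x = (\<Sum>k\<le>n div 2. geg_coeff a n k * x ^ (n - 2 * k))"
proof -
  have nth: "fps_nth ((fps_X ^ 2 - fps_const (2 * x) * fps_X) ^ i) n
      = (if i \<le> n then real (i choose (n - i)) * (- 2 * x) ^ (2 * i - n) else 0)" for i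
  proof -
    \<comment> \<open>As t^2 - 2 x t = t (t - 2 x), the i-th power reaches t^n exactly through the
      coefficient of t^(n - i) in (t - 2 x)^i.\<close>
    have "(fps_X ^ 2 - fps_const (2 * x) * fps_X :: real fps) = fps_X * (fps_X + fps_const (- 2 * x))"
      by (simp add: algebra_simps power2_eq_square flip: fps_const_neg)
    then have "(fps_X ^ 2 - fps_const (2 * x) * fps_X :: real fps) ^ i = fps_X ^ i * (fps_X + fps_const (- 2 * x)) ^ i"
      by (simp only: power_mult_distrib)
    then have "fps_nth ((fps_X ^ 2 - fps_const (2 * x) * fps_X) ^ i) n
        = fps_nth (fps_X ^ i * (fps_X + fps_const (- 2 * x)) ^ i) n" by (rule arg_cong)
    also have "\<dots> = (if n < i then 0 else fps_nth ((fps_X + fps_const (- 2 * x)) ^ i) (n - i))"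
      by (rule fps_X_power_mult_nth)
    finally have 1: "fps_nth ((fps_X ^ 2 - fps_const (2 * x) * fps_X) ^ i) n
        = (if n < i then 0 else fps_nth ((fps_X + fps_const (- 2 * x)) ^ i) (n - i))" .
    have "fps_nth ((fps_X + fps_const (- 2 * x)) ^ i) (n - i) = real (i choose (n - i)) * (- 2 * x) ^ (2 * i - n)" if "i \<le> n"
    proof -
      have "(fps_X + fps_const (- 2 * x)) ^ i = (\<Sum>k\<le>i. of_nat (i choose k) * fps_X ^ k * fps_const (- 2 * x) ^ (i - k))"
        by (rule binomial_ring)
      then have "fps_nth ((fps_X + fps_const (- 2 * x)) ^ i) (n - i)
          = (\<Sum>k\<le>i. fps_nth (fps_const (real (i choose k) * (- 2 * x) ^ (i - k)) * fps_X ^ k) (n - i))"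
        by (simp add: fps_sum_nth fps_of_nat[symmetric] fps_const_power mult_ac flip: fps_const_mult)
      also have "\<dots> = (\<Sum>k\<le>i. if k = n - i then real (i choose k) * (- 2 * x) ^ (i - k) else 0)"
        by (intro sum.cong) (auto simp: fps_X_power_nth)
      also have "\<dots> = (if n - i \<le> i then real (i choose (n - i)) * (- 2 * x) ^ (i - (n - i)) else 0)"
        by simp
      also have "\<dots> = real (i choose (n - i)) * (- 2 * x) ^ (2 * i - n)"
      proof (cases "n - i \<le> i")
        case True
        then have "i - (n - i) = 2 * i - n" using that by linarith
        then show ?thesis using True by (simp only: if_True)
      next
        case False
        then have "i choose (n - i) = 0" by (intro binomial_eq_0) linarith
        then show ?thesis using False by (simp only: if_False of_nat_0 mult_zero_left)
      qed
      finally show ?thesis .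
    qed
    with 1 show ?thesis by (simp only: not_le if_not_P split: if_splits) auto
  qed
  have "gegenbauer a n x = (\<Sum>i=0..n. ((- a) gchoose i) * (real (i choose (n - i)) * (- 2 * x) ^ (2 * i - n)))"
    unfolding gegenbauer_def fps_compose_nth nth by (intro sum.cong) auto
  also have "\<dots> = (\<Sum>k=0..n. ((- a) gchoose (n - k)) * (real ((n - k) choose k) * (- 2 * x) ^ (n - 2 * k)))"
  proof (rule sum.reindex_bij_witness[of _ "\<lambda>k. n - k" "\<lambda>k. n - k"], goal_cases)
    case (5 i)
    then have "2 * i - n = n - 2 * (n - i)" by auto
    then show ?case using 5 by simp
  qed auto
  also have "\<dots> = (\<Sum>k\<le>n div 2. ((- a) gchoose (n - k)) * (real ((n - k) choose k) * (- 2 * x) ^ (n - 2 * k)))"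
    by (rule sum.mono_neutral_right) (auto simp: binomial_eq_0)
  also have "\<dots> = (\<Sum>k\<le>n div 2. geg_coeff a n k * x ^ (n - 2 * k))"
    unfolding geg_coeff_def power_mult_distrib by (intro sum.cong refl) (simp only: mult.assoc)
  finally show ?thesis .
qed

lemma gegenbauer_geg_hom:
  assumes s: "s \<ge> 0"
  shows "sqrt (y\<^sup>2 + s) ^ n * gegenbauer a n (y / sqrt (y\<^sup>2 + s)) = geg_hom a n y s"
proof -
  let ?r = "sqrt (y\<^sup>2 + s)"
  \<comment> \<open>At r = 0 also y = 0, and the conventions y / 0 = 0 and 0^0 = 1 reproduce the
    value of the polynomial.\<close>
  have "?r ^ n * (y / ?r) ^ (n - 2 * k) = y ^ (n - 2 * k) * (y\<^sup>2 + s) ^ k" if "k \<le> n div 2" for k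
  proof (cases "?r = 0")
    case True
    then have "y\<^sup>2 + s = 0" "y = 0" using s by (auto simp: add_nonneg_eq_0_iff)
    then show ?thesis using that s by (cases "n = 0"; cases "k = 0") (auto simp: power_0_left)
  next
    case False
    have n: "(n - 2 * k) + 2 * k = n" using that by simp
    have "?r ^ ((n - 2 * k) + 2 * k) = ?r ^ (n - 2 * k) * (?r\<^sup>2) ^ k" by (simp only: power_add power_mult)
    then have "?r ^ n = ?r ^ (n - 2 * k) * (?r\<^sup>2) ^ k" unfolding n .
    then show ?thesis using False s by (simp add: power_divide)
  qed
  then have t: "geg_coeff a n k * (y ^ (n - 2 * k) * (y\<^sup>2 + s) ^ k) = ?r ^ n * (geg_coeff a n k * (y / ?r) ^ (n - 2 * k))"
    if "k \<le> n div 2" for k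
    using that by (simp only: mult.left_commute[of _ "geg_coeff a n k"])
  show ?thesis unfolding geg_hom_def gegenbauer_sum sum_distrib_left
    by (intro sum.cong refl, rule t[symmetric]) simp
qed

text \<open>This and the following derivatives keep the literal shape that the product rule
  produces. Truncated exponents are harmless, since each comes with a numerical factor that vanishes
  in that case.\<close>

definition geg_hom_y :: "real \<Rightarrow> nat \<Rightarrow> real \<Rightarrow> real \<Rightarrow> real" where
  "geg_hom_y a n y s = (\<Sum>k\<le>n div 2. geg_coeff a n k *
     (real (n - 2 * k) * (y ^ (n - 2 * k - 1) * (y\<^sup>2 + s) ^ k) + 2 * real k * (y ^ (n - 2 * k + 1) * (y\<^sup>2 + s) ^ (k - 1))))"

definition geg_hom_yy :: "real \<Rightarrow> nat \<Rightarrow> real \<Rightarrow> real \<Rightarrow> real" where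
  "geg_hom_yy a n y s = (\<Sum>k\<le>n div 2. geg_coeff a n k *
     (real (n - 2 * k) * (real (n - 2 * k - 1) * (y ^ (n - 2 * k - 1 - 1) * (y\<^sup>2 + s) ^ k)
         + 2 * real k * (y ^ (n - 2 * k - 1 + 1) * (y\<^sup>2 + s) ^ (k - 1)))
      + 2 * real k * (real (n - 2 * k + 1) * (y ^ (n - 2 * k + 1 - 1) * (y\<^sup>2 + s) ^ (k - 1))
         + 2 * real (k - 1) * (y ^ (n - 2 * k + 1 + 1) * (y\<^sup>2 + s) ^ (k - 1 - 1)))))"

definition geg_hom_s :: "real \<Rightarrow> nat \<Rightarrow> real \<Rightarrow> real \<Rightarrow> real" where
  "geg_hom_s a n y s = (\<Sum>k\<le>n div 2. geg_coeff a n k * (real k * y ^ (n - 2 * k) * (y\<^sup>2 + s) ^ (k - 1)))"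

definition geg_hom_ss :: "real \<Rightarrow> nat \<Rightarrow> real \<Rightarrow> real \<Rightarrow> real" where
  "geg_hom_ss a n y s = (\<Sum>k\<le>n div 2. geg_coeff a n k * (real k * real (k - 1) * y ^ (n - 2 * k) * (y\<^sup>2 + s) ^ (k - 2)))"

lemma DERIV_geg_term: "((\<lambda>y. y ^ p * (y\<^sup>2 + s) ^ k) has_real_derivative
    real p * (y ^ (p - 1) * (y\<^sup>2 + s) ^ k) + 2 * real k * (y ^ (p + 1) * (y\<^sup>2 + s) ^ (k - 1))) (at y)"
proof -
  have q: "((\<lambda>y. y\<^sup>2 + s) has_real_derivative 2 * y) (at y)" by (auto intro!: derivative_eq_intros)
  have b: "((\<lambda>y. (y\<^sup>2 + s) ^ k) has_real_derivative real k * (y\<^sup>2 + s) ^ (k - 1) * (2 * y)) (at y)"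
    using DERIV_chain2[OF DERIV_pow q, of k] by simp
  have a: "((\<lambda>y. y ^ p) has_real_derivative real p * y ^ (p - 1)) (at y)" using DERIV_pow[of p y] by simp
  show ?thesis by (rule DERIV_cong[OF DERIV_mult[OF a b]]) simp
qed

lemma DERIV_geg_hom_y: "((\<lambda>y. geg_hom a n y s) has_real_derivative geg_hom_y a n y s) (at y)"
  unfolding geg_hom_def geg_hom_y_def by (intro DERIV_sum DERIV_cmult DERIV_geg_term)

lemma DERIV_geg_hom_yy: "((\<lambda>y. geg_hom_y a n y s) has_real_derivative geg_hom_yy a n y s) (at y)"
  unfolding geg_hom_y_def geg_hom_yy_def by (intro DERIV_sum DERIV_cmult DERIV_add DERIV_geg_term)

lemma DERIV_shift_pow: "((\<lambda>s. (b + s) ^ k) has_real_derivative real k * (b + s) ^ (k - 1)) (at s)" for b :: real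
  by (auto intro!: derivative_eq_intros)

lemma DERIV_geg_hom_s: "(geg_hom a n y has_real_derivative geg_hom_s a n y s) (at s)"
  unfolding geg_hom_def[abs_def] geg_hom_s_def
proof (intro DERIV_sum DERIV_cmult)
  fix k
  show "((\<lambda>s. y ^ (n - 2 * k) * (y\<^sup>2 + s) ^ k) has_real_derivative real k * y ^ (n - 2 * k) * (y\<^sup>2 + s) ^ (k - 1)) (at s)"
    by (rule DERIV_cong[OF DERIV_cmult[OF DERIV_shift_pow]]) simp
qed

lemma DERIV_geg_hom_ss: "(geg_hom_s a n y has_real_derivative geg_hom_ss a n y s) (at s)"
  unfolding geg_hom_s_def[abs_def] geg_hom_ss_def
proof (intro DERIV_sum DERIV_cmult)
  fix k
  show "((\<lambda>s. real k * y ^ (n - 2 * k) * (y\<^sup>2 + s) ^ (k - 1)) has_real_derivative real k * real (k - 1) * y ^ (n - 2 * k) * (y\<^sup>2 + s) ^ (k - 2)) (at s)"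
    by (rule DERIV_cong[OF DERIV_cmult[OF DERIV_shift_pow]]) (simp add: numeral_2_eq_2)
qed

lemma geg_hom_euler: "y * geg_hom_y a n y s + 2 * s * geg_hom_s a n y s = real n * geg_hom a n y s"
proof -
  have main: "y * (c * (real p * (y ^ (p - 1) * (y\<^sup>2 + s) ^ k) + 2 * real k * (y ^ (p + 1) * (y\<^sup>2 + s) ^ (k - 1))))
      + 2 * s * (c * (real k * y ^ p * (y\<^sup>2 + s) ^ (k - 1))) = (real p + 2 * real k) * (c * (y ^ p * (y\<^sup>2 + s) ^ k))" for c p k
  proof -
    have 1: "y * (real p * y ^ (p - 1)) = real p * y ^ p" by (cases p) auto
    have 2: "real k * (y\<^sup>2 + s) ^ k = real k * ((y\<^sup>2 + s) * (y\<^sup>2 + s) ^ (k - 1))" by (cases k) auto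
    have "y * (c * (real p * (y ^ (p - 1) * (y\<^sup>2 + s) ^ k) + 2 * real k * (y ^ (p + 1) * (y\<^sup>2 + s) ^ (k - 1))))
      + 2 * s * (c * (real k * y ^ p * (y\<^sup>2 + s) ^ (k - 1)))
      = c * (y * (real p * y ^ (p - 1))) * (y\<^sup>2 + s) ^ k + 2 * c * y ^ p * (real k * ((y\<^sup>2 + s) * (y\<^sup>2 + s) ^ (k - 1)))"
      by (simp add: algebra_simps power2_eq_square)
    then show ?thesis unfolding 1 2[symmetric] by (simp add: algebra_simps)
  qed
  have "real (n - 2 * k) + 2 * real k = real n" if "k \<in> {..n div 2}" for k
  proof -
    have "2 * k \<le> n" using that by auto
    then show ?thesis by linarith
  qed
  then show ?thesis
    unfolding geg_hom_def geg_hom_y_def geg_hom_s_def sum_distrib_left sum.distrib[symmetric] main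
    by (intro sum.cong refl) (simp only:)
qed

text \<open>This is Laplace's equation for F(y, |x'|^2) Q(x') when Q is a solid harmonic of degree d
  in c variables and 4 a + 2 = 2 c + 4 d. The second y-derivative of the k-th term cancels against
  the s-terms of index k + 1, by \<open>geg_coeff_rec\<close>.\<close>

lemma geg_hom_pde: "geg_hom_yy a n y s + 4 * s * geg_hom_ss a n y s + (4 * a + 2) * geg_hom_s a n y s = 0"
proof -
  define z where "z = y\<^sup>2 + s"
  define A where "A k = geg_coeff a n k * (real (n - 2 * k) * real (n - 2 * k - 1)) * (y ^ (n - 2 * k - 1 - 1) * z ^ k)" for k
  define B where "B k = geg_coeff a n k * (4 * real k * (real (n - 2 * k) + real k + a)) * (y ^ (n - 2 * k) * z ^ (k - 1))" for k
  have s: "s = z - y\<^sup>2" by (simp add: z_def)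
  have main: "c * (real p * (real (p - 1) * (y ^ (p - 1 - 1) * z ^ k) + 2 * real k * (y ^ (p - 1 + 1) * z ^ (k - 1)))
      + 2 * real k * (real (p + 1) * (y ^ (p + 1 - 1) * z ^ (k - 1)) + 2 * real (k - 1) * (y ^ (p + 1 + 1) * z ^ (k - 1 - 1))))
      + 4 * s * (c * (real k * real (k - 1) * y ^ p * z ^ (k - 2))) + (4 * a + 2) * (c * (real k * y ^ p * z ^ (k - 1)))
      = c * (real p * real (p - 1)) * (y ^ (p - 1 - 1) * z ^ k) + c * (4 * real k * (real p + real k + a)) * (y ^ p * z ^ (k - 1))" for c p k
  proof -
    have 1: "real p * y ^ (p - 1 + 1) = real p * y ^ p" by (cases p) auto
    have 2: "real k * real (k - 1) * (z * z ^ (k - 2)) = real k * (real k - 1) * z ^ (k - 1)"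
    proof (cases k)
      case (Suc j) then show ?thesis by (cases j) auto
    qed simp
    have 3: "k - 1 - 1 = k - 2" "p + 1 - 1 = p" "y ^ (p + 1 + 1) = y\<^sup>2 * y ^ p" by (simp_all add: power2_eq_square)
    have "c * (real p * (real (p - 1) * (y ^ (p - 1 - 1) * z ^ k) + 2 * real k * (y ^ (p - 1 + 1) * z ^ (k - 1)))
      + 2 * real k * (real (p + 1) * (y ^ p * z ^ (k - 1)) + 2 * real (k - 1) * (y\<^sup>2 * y ^ p * z ^ (k - 2))))
      + 4 * (z - y\<^sup>2) * (c * (real k * real (k - 1) * y ^ p * z ^ (k - 2))) + (4 * a + 2) * (c * (real k * y ^ p * z ^ (k - 1)))
      = c * (real p * real (p - 1)) * (y ^ (p - 1 - 1) * z ^ k) + 2 * c * (real p * y ^ (p - 1 + 1)) * real k * z ^ (k - 1)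
        + 2 * c * (real p + 2 * a + 2) * real k * (y ^ p * z ^ (k - 1))
        + 4 * c * y ^ p * (real k * real (k - 1) * (z * z ^ (k - 2)))"
      by (simp add: algebra_simps del: power_Suc)
    then show ?thesis unfolding 1 2 3 s by (simp add: algebra_simps del: power_Suc)
  qed
  have "geg_hom_yy a n y s + 4 * s * geg_hom_ss a n y s + (4 * a + 2) * geg_hom_s a n y s = (\<Sum>k\<le>n div 2. A k + B k)"
    unfolding geg_hom_yy_def geg_hom_ss_def geg_hom_s_def sum_distrib_left sum.distrib[symmetric] z_def[symmetric] A_def B_def main
    by (rule refl)
  also have "\<dots> = 0"
  proof -
    have AB: "A k + B (Suc k) = 0" if "k < n div 2" for k
    proof -
      have k: "2 * k + 2 \<le> n" using that by linarith
      have e: "n - 2 * k - 1 - 1 = n - 2 * Suc k" "real (n - 2 * Suc k) + real (Suc k) + a = real n - real k - 1 + a" "real (n - 2 * k) = real n - 2 * real k" "real (n - 2 * k - 1) = real n - 2 * real k - 1"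
        using k by (auto simp: of_nat_diff)
      have "B (Suc k) = geg_coeff a n (Suc k) * (4 * (real k + 1) * (real n - real k - 1 + a)) * (y ^ (n - 2 * Suc k) * z ^ k)"
        unfolding B_def e by simp
      moreover have "A k = geg_coeff a n k * (real n - 2 * real k) * (real n - 2 * real k - 1) * (y ^ (n - 2 * Suc k) * z ^ k)"
        unfolding A_def e by (simp only: mult.assoc)
      ultimately have "A k + B (Suc k) = (geg_coeff a n k * (real n - 2 * real k) * (real n - 2 * real k - 1)
         + geg_coeff a n (Suc k) * (4 * (real k + 1) * (real n - real k - 1 + a))) * (y ^ (n - 2 * Suc k) * z ^ k)"
        by (simp only: distrib_right)
      then show ?thesis unfolding geg_coeff_rec[OF k] by simp
    qed
    have "(\<Sum>k\<le>n div 2. A k) = (\<Sum>k<n div 2. A k) + A (n div 2)" by (simp add: lessThan_Suc_atMost[symmetric])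
    \<comment> \<open>The last exponent n - 2 k is 0 or 1, so this term has no partner and vanishes
      by itself.\<close>
    also have "A (n div 2) = 0"
    proof -
      have "n - 2 * (n div 2) = 0 \<or> n - 2 * (n div 2) = 1" by linarith
      then show ?thesis by (auto simp: A_def)
    qed
    finally have 1: "(\<Sum>k\<le>n div 2. A k) = (\<Sum>k<n div 2. A k)" by simp
    have "(\<Sum>k\<le>n div 2. B k) = B 0 + (\<Sum>k<n div 2. B (Suc k))"
      by (rule sum.atMost_shift)
    also have "B 0 = 0" by (simp add: B_def)
    finally have "(\<Sum>k\<le>n div 2. A k + B k) = (\<Sum>k<n div 2. A k + B (Suc k))"
      unfolding sum.distrib 1 by simp
    then show ?thesis using AB by simp
  qed
  finally show ?thesis .
qed

lemma geg_hom_scale: "geg_hom a n (c * y) (c\<^sup>2 * s) = c ^ n * geg_hom a n y s"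
proof -
  have "(c * y) ^ (n - 2 * k) * ((c * y)\<^sup>2 + c\<^sup>2 * s) ^ k = c ^ n * (y ^ (n - 2 * k) * (y\<^sup>2 + s) ^ k)" if "k \<le> n div 2" for k
  proof -
    have e: "(c * y)\<^sup>2 + c\<^sup>2 * s = c\<^sup>2 * (y\<^sup>2 + s)" by (simp add: algebra_simps power_mult_distrib)
    have n: "(n - 2 * k) + 2 * k = n" using that by simp
    have "c ^ ((n - 2 * k) + 2 * k) = c ^ (n - 2 * k) * (c\<^sup>2) ^ k" by (simp only: power_add power_mult)
    then have "c ^ n = c ^ (n - 2 * k) * (c\<^sup>2) ^ k" unfolding n .
    then show ?thesis unfolding e by (simp add: power_mult_distrib del: power_Suc)
  qed
  then have t: "geg_coeff a n k * ((c * y) ^ (n - 2 * k) * ((c * y)\<^sup>2 + c\<^sup>2 * s) ^ k) = c ^ n * (geg_coeff a n k * (y ^ (n - 2 * k) * (y\<^sup>2 + s) ^ k))" if "k \<le> n div 2" for k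
    using that by (simp only: mult.left_commute[of _ "geg_coeff a n k"])
  show ?thesis unfolding geg_hom_def sum_distrib_left by (intro sum.cong refl, rule t) simp
qed

subsection \<open>Harmonic homogeneous functions\<close>

lemma harmonic_hom_cmult:
  assumes "harmonic_hom K d f"
  shows "harmonic_hom K d (\<lambda>x. c * f x)"
proof -
  obtain D D2 where D: "has_partials K f D D2" "\<And>x. (\<Sum>i\<in>K. D2 i x) = 0" "\<And>x. (\<Sum>i\<in>K. x i * D i x) = real d * f x"
    using assms by (auto simp: harmonic_hom_def)
  have "has_partials K (\<lambda>x. c * f x) (\<lambda>i x. c * D i x) (\<lambda>i x. c * D2 i x)"
    using D(1) by (auto simp: has_partials_def intro!: DERIV_cmult)
  moreover have "(\<Sum>i\<in>K. c * D2 i x) = 0" "(\<Sum>i\<in>K. x i * (c * D i x)) = real d * (c * f x)" for x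
    using D(2)[of x] D(3)[of x] by (simp_all add: sum_distrib_left[symmetric] mult.left_commute)
  moreover have "(\<forall>x y. (\<forall>i\<in>K. x i = y i) \<longrightarrow> c * f x = c * f y) \<and> (\<forall>b x. c * f (\<lambda>i. b * x i) = b ^ d * (c * f x))"
    using assms by (auto simp: harmonic_hom_def)
  ultimately show ?thesis unfolding harmonic_hom_def by blast
qed

lemma harmonic_hom_const: "harmonic_hom K 0 (\<lambda>x. c)"
  unfolding harmonic_hom_def has_partials_def
  by (intro conjI allI impI exI[of _ "\<lambda>i x. 0"]) auto

lemma harmonic_hom_coord:
  assumes "finite K" "k \<in> K"
  shows "harmonic_hom K 1 (\<lambda>x. x k)"
proof -
  have "has_partials K (\<lambda>x. x k) (\<lambda>i x. if i = k then 1 else 0) (\<lambda>i x. 0)"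
    unfolding has_partials_def
  proof (intro ballI allI conjI)
    fix i and x :: "nat \<Rightarrow> real"
    show "((\<lambda>t. (x(i := t)) k) has_real_derivative (if i = k then 1 else 0)) (at (x i))" by (cases "i = k") auto
  qed auto
  moreover have "(\<Sum>i\<in>K. x i * (if i = k then 1 else 0)) = x k" for x :: "nat \<Rightarrow> real"
  proof -
    have "(\<Sum>i\<in>K. x i * (if i = k then 1 else 0)) = (\<Sum>i\<in>K. if i = k then x i else 0)" by (intro sum.cong) auto
    then show ?thesis using assms by simp
  qed
  ultimately show ?thesis using assms unfolding harmonic_hom_def
    by (intro conjI exI[of _ "\<lambda>i x. if i = k then 1 else 0"] exI[of _ "\<lambda>i x. 0"]) auto
qed

lemma DERIV_Re_power:
  fixes w c d :: complex
  shows "((\<lambda>t. Re (w * (c + d * of_real t) ^ m)) has_real_derivative Re (w * d * of_nat m * (c + d * of_real t) ^ (m - 1))) (at t)"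
proof -
  have "((\<lambda>z. w * (c + d * z) ^ m) has_field_derivative w * d * of_nat m * (c + d * of_real t) ^ (m - 1)) (at (of_real t))"
    by (auto intro!: derivative_eq_intros)
  then have "((\<lambda>t. w * (c + d * of_real t) ^ m) has_vector_derivative w * d * of_nat m * (c + d * of_real t) ^ (m - 1)) (at t)"
    by (rule has_vector_derivative_real_field)
  then show ?thesis
    unfolding has_real_derivative_iff_has_vector_derivative
    by (rule bounded_linear.has_vector_derivative[OF bounded_linear_Re])
qed

text \<open>On every coordinate line this is the real part of a complex power; differentiation in
  the q-direction brings a factor i, and i^2 = -1 makes the Laplacian vanish. The weight w selects
  the real part (w = 1) or the imaginary part (w = - i).\<close>

lemma harmonic_hom_Re_power:
  assumes pq: "p \<noteq> q"
  shows "harmonic_hom {p, q} m (\<lambda>x. Re (w * Complex (x p) (x q) ^ m))"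
proof -
  let ?z = "\<lambda>x::nat \<Rightarrow> real. Complex (x p) (x q)"
  define u where "u i = (if i = p then 1 else \<i>)" for i :: nat
  define D where "D i x = Re (w * u i * of_nat m * ?z x ^ (m - 1))" for i x
  define D2 where "D2 i x = Re (w * u i * of_nat m * u i * of_nat (m - 1) * ?z x ^ (m - 1 - 1))" for i x
  have line: "\<exists>c. \<forall>t. ?z (x(i := t)) = c + u i * of_real t" if "i \<in> {p, q}" for i x
    using that pq by (intro exI[of _ "if i = p then Complex 0 (x q) else Complex (x p) 0"])
      (auto simp: u_def complex_eq_iff)
  have "has_partials {p, q} (\<lambda>x. Re (w * ?z x ^ m)) D D2"
    unfolding has_partials_def
  proof (intro ballI allI)
    fix i x assume i: "i \<in> {p, q}"
    obtain c where c: "\<And>t. ?z (x(i := t)) = c + u i * of_real t" using line[OF i] by blast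
    have zx: "?z x = c + u i * of_real (x i)" using c[of "x i"] by simp
    show "((\<lambda>t. Re (w * ?z (x(i := t)) ^ m)) has_real_derivative D i x) (at (x i)) \<and>
       ((\<lambda>t. D i (x(i := t))) has_real_derivative D2 i x) (at (x i))"
      unfolding D_def D2_def c zx by (intro conjI DERIV_Re_power)
  qed
  moreover have "(\<Sum>i\<in>{p, q}. D2 i x) = 0" for x
    using pq by (simp add: D2_def u_def)
  moreover have "(\<Sum>i\<in>{p, q}. x i * D i x) = real m * Re (w * ?z x ^ m)" for x
  proof -
    have "(\<Sum>i\<in>{p, q}. x i * D i x) = Re (w * of_nat m * ?z x ^ (m - 1) * (of_real (x p) + \<i> * of_real (x q)))"
      using pq by (simp add: D_def u_def algebra_simps)
    also have "of_real (x p) + \<i> * of_real (x q) = ?z x" by (simp add: complex_eq_iff)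
    also have "w * of_nat m * ?z x ^ (m - 1) * ?z x = of_real (real m) * (w * ?z x ^ m)"
      by (cases m) auto
    finally show ?thesis by simp
  qed
  moreover have "Re (w * ?z (\<lambda>i. c * x i) ^ m) = c ^ m * Re (w * ?z x ^ m)" for c x
  proof -
    have "?z (\<lambda>i. c * x i) = of_real c * ?z x" by (simp add: complex_eq_iff)
    then have e: "w * ?z (\<lambda>i. c * x i) ^ m = of_real (c ^ m) * (w * ?z x ^ m)"
      by (simp only: power_mult_distrib of_real_power mult.left_commute)
    have "Re (of_real a * v) = a * Re v" for a v by simp
    then show ?thesis unfolding e .
  qed
  ultimately show ?thesis unfolding harmonic_hom_def by auto
qed

text \<open>Adds one coordinate to a solid harmonic. The choice of a is the one for which
  \<open>geg_hom_pde\<close> becomes Laplace's equation of the product; \<open>geg_hom_euler\<close>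
  gives its Euler identity.\<close>

lemma harmonic_hom_extend:
  assumes K: "finite K" "k \<notin> K" and Q: "harmonic_hom K d Q"
    and a: "a = real d + (real (card K) - 1) / 2"
  shows "harmonic_hom (insert k K) (n + d) (\<lambda>x. geg_hom a n (x k) (sqsum K x) * Q x)"
proof -
  obtain E E2 where E: "has_partials K Q E E2" "\<And>x. (\<Sum>i\<in>K. E2 i x) = 0" "\<And>x. (\<Sum>i\<in>K. x i * E i x) = real d * Q x"
    and Qc: "\<And>x y. (\<forall>i\<in>K. x i = y i) \<Longrightarrow> Q x = Q y" and Qh: "\<And>c x. Q (\<lambda>i. c * x i) = c ^ d * Q x"
    using Q by (auto simp: harmonic_hom_def)
  let ?F = "geg_hom a n"
  define D where "D i x = (if i = k then geg_hom_y a n (x k) (sqsum K x) * Q x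
    else 2 * x i * (geg_hom_s a n (x k) (sqsum K x) * Q x) + ?F (x k) (sqsum K x) * E i x)" for i x
  define D2 where "D2 i x = (if i = k then geg_hom_yy a n (x k) (sqsum K x) * Q x
    else (2 * geg_hom_s a n (x k) (sqsum K x) + 4 * (x i)\<^sup>2 * geg_hom_ss a n (x k) (sqsum K x)) * Q x
       + 4 * geg_hom_s a n (x k) (sqsum K x) * (x i * E i x) + ?F (x k) (sqsum K x) * E2 i x)" for i x
  have upd_k: "sqsum K (x(k := t)) = sqsum K x" "Q (x(k := t)) = Q x" for x t
    using K(2) by (auto intro!: sqsum_cong Qc)
  have "has_partials (insert k K) (\<lambda>x. ?F (x k) (sqsum K x) * Q x) D D2"
    unfolding has_partials_def
  proof (intro ballI allI conjI)
    fix i x assume i: "i \<in> insert k K"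
    show "((\<lambda>t. ?F ((x(i := t)) k) (sqsum K (x(i := t))) * Q (x(i := t))) has_real_derivative D i x) (at (x i))"
    proof (cases "i = k")
      case True
      show ?thesis unfolding True upd_k D_def by (auto intro!: DERIV_cmult_right DERIV_geg_hom_y)
    next
      case False
      then have iK: "i \<in> K" using i by simp
      have "((\<lambda>t. Q (x(i := t))) has_real_derivative E i x) (at (x i))" using E(1) iK by (auto simp: has_partials_def)
      from DERIV_radial_mult[where g = "?F (x k)" and g' = "geg_hom_s a n (x k)" and f = Q and x = x, OF K(1) iK DERIV_geg_hom_s this] show ?thesis
        using False by (simp only: D_def fun_upd_other if_False not_sym[OF False] simp_thms)
    qed
    show "((\<lambda>t. D i (x(i := t))) has_real_derivative D2 i x) (at (x i))"
    proof (cases "i = k")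
      case True
      show ?thesis unfolding True upd_k D_def D2_def by (auto intro!: DERIV_cmult_right DERIV_geg_hom_yy)
    next
      case False
      then have iK: "i \<in> K" using i by simp
      have "((\<lambda>t. Q (x(i := t))) has_real_derivative E i x) (at (x i))" "((\<lambda>t. E i (x(i := t))) has_real_derivative E2 i x) (at (x i))"
        using E(1) iK by (auto simp: has_partials_def)
      from DERIV_radial_mult2[where g = "?F (x k)" and g' = "geg_hom_s a n (x k)" and g'' = "geg_hom_ss a n (x k)" and f = Q and x = x and D = E, OF K(1) iK DERIV_geg_hom_s DERIV_geg_hom_ss this]
      show ?thesis using False by (simp add: D_def D2_def)
    qed
  qed
  moreover have "(\<Sum>i\<in>insert k K. D2 i x) = 0" for x
  proof -
    let ?s = "sqsum K x"
    have "(\<Sum>i\<in>K. D2 i x) = (\<Sum>i\<in>K. (2 * geg_hom_s a n (x k) ?s + 4 * (x i)\<^sup>2 * geg_hom_ss a n (x k) ?s) * Q x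
       + 4 * geg_hom_s a n (x k) ?s * (x i * E i x) + ?F (x k) ?s * E2 i x)"
      using K(2) by (intro sum.cong) (auto simp: D2_def)
    also have "\<dots> = (4 * ?s * geg_hom_ss a n (x k) ?s + (2 * real (card K) + 4 * real d) * geg_hom_s a n (x k) ?s) * Q x"
      by (rule sum_radial_mult2[OF E(2,3)])
    also have "2 * real (card K) + 4 * real d = 4 * a + 2" unfolding a by (simp add: field_simps)
    finally have "(\<Sum>i\<in>insert k K. D2 i x) = (geg_hom_yy a n (x k) ?s + 4 * ?s * geg_hom_ss a n (x k) ?s + (4 * a + 2) * geg_hom_s a n (x k) ?s) * Q x"
      using K by (simp add: D2_def distrib_right)
    then show ?thesis unfolding geg_hom_pde by simp
  qed
  moreover have "(\<Sum>i\<in>insert k K. x i * D i x) = real (n + d) * (?F (x k) (sqsum K x) * Q x)" for x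
  proof -
    let ?s = "sqsum K x"
    have "(\<Sum>i\<in>K. x i * D i x) = (\<Sum>i\<in>K. (x i)\<^sup>2 * (2 * geg_hom_s a n (x k) ?s * Q x) + ?F (x k) ?s * (x i * E i x))"
      using K(2) by (intro sum.cong) (auto simp: D_def algebra_simps power2_eq_square)
    also have "\<dots> = ?s * (2 * geg_hom_s a n (x k) ?s * Q x) + ?F (x k) ?s * (real d * Q x)"
      unfolding sum.distrib E(3)[symmetric] by (simp add: sqsum_def sum_distrib_right sum_distrib_left)
    finally have "(\<Sum>i\<in>insert k K. x i * D i x) = (x k * geg_hom_y a n (x k) ?s + 2 * ?s * geg_hom_s a n (x k) ?s) * Q x + ?F (x k) ?s * (real d * Q x)"
      using K by (simp add: D_def algebra_simps)
    then show ?thesis unfolding geg_hom_euler by (simp add: algebra_simps)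
  qed
  moreover have "?F (x k) (sqsum K x) * Q x = ?F (y k) (sqsum K y) * Q y" if "\<forall>i\<in>insert k K. x i = y i" for x y
    using that Qc[of x y] sqsum_cong[of K x y] by simp
  moreover have "?F (c * x k) (sqsum K (\<lambda>i. c * x i)) * Q (\<lambda>i. c * x i) = c ^ (n + d) * (?F (x k) (sqsum K x) * Q x)" for c x
    by (simp add: sqsum_scale geg_hom_scale Qh power_add)
  ultimately show ?thesis unfolding harmonic_hom_def by blast
qed

definition valid_symbol :: "nat \<Rightarrow> nat list \<Rightarrow> bool" where
  "valid_symbol N ms \<longleftrightarrow> (\<forall>k < N - 2. ms ! (k + 1) \<le> ms ! k)"

definition geg_prod :: "nat \<Rightarrow> nat list \<Rightarrow> nat \<Rightarrow> (nat \<Rightarrow> real) \<Rightarrow> real" where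
  "geg_prod N ms k x = (\<Prod>i\<in>{k..<N - 2}.
     geg_hom (real (ms ! (i + 1)) + (real N - real i - 2) / 2) (ms ! i - ms ! (i + 1)) (x (i + 1)) (sqsum {i + 2..N} x))"

text \<open>Downward induction on k: the plane of the last two coordinates carries the complex
  power, and each step puts coordinate k + 1 in front.\<close>

lemma harmonic_hom_geg_prod:
  assumes N: "N \<ge> 2" and ms: "valid_symbol N ms" and k: "k \<le> N - 2"
  shows "harmonic_hom {k + 1..N} (ms ! k) (\<lambda>x. geg_prod N ms k x * Re (w * Complex (x (N - 1)) (x N) ^ (ms ! (N - 2))))"
  using k
proof (induction rule: inc_induct)
  case base
  have "{N - 2 + 1..N} = {N - 1, N}" using N by auto
  then show ?case using harmonic_hom_Re_power[of "N - 1" N "ms ! (N - 2)" w] N by (simp add: geg_prod_def)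
next
  case (step k)
  have k: "k < N - 2" using step.hyps by simp
  let ?a = "real (ms ! (k + 1)) + (real N - real k - 2) / 2"
  have ins: "{k + 1..N} = insert (k + 1) {k + 2..N}" using k by auto
  have c: "real (card {k + 2..N}) = real N - real k - 1" using k by (simp add: of_nat_diff)
  have "harmonic_hom (insert (k + 1) {k + 2..N}) (ms ! k - ms ! (k + 1) + ms ! (k + 1))
    (\<lambda>x. geg_hom ?a (ms ! k - ms ! (k + 1)) (x (k + 1)) (sqsum {k + 2..N} x) *
       (geg_prod N ms (Suc k) x * Re (w * Complex (x (N - 1)) (x N) ^ (ms ! (N - 2)))))"
  proof (rule harmonic_hom_extend)
    show "harmonic_hom {k + 2..N} (ms ! (k + 1)) (\<lambda>x. geg_prod N ms (Suc k) x * Re (w * Complex (x (N - 1)) (x N) ^ (ms ! (N - 2))))"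
      using step.IH by simp
    show "?a = real (ms ! (k + 1)) + (real (card {k + 2..N}) - 1) / 2" unfolding c by simp
  qed auto
  moreover have "ms ! k - ms ! (k + 1) + ms ! (k + 1) = ms ! k" using ms k by (simp add: valid_symbol_def)
  moreover have "geg_prod N ms k x = geg_hom ?a (ms ! k - ms ! (k + 1)) (x (k + 1)) (sqsum {k + 2..N} x) * geg_prod N ms (Suc k) x" for x
    unfolding geg_prod_def using k by (subst prod.atLeast_Suc_lessThan) auto
  ultimately show ?case unfolding ins by (simp only: mult.assoc)
qed

lemma harm_poly_eq:
  assumes N: "N \<ge> 2"
  shows "harm_poly N ms 1 x = Complex (x (N - 1)) (x N) ^ (ms ! (N - 2)) * of_real (geg_prod N ms 0 x)"
    and "harm_poly N ms (-1) x = cnj (Complex (x (N - 1)) (x N)) ^ (ms ! (N - 2)) * of_real (geg_prod N ms 0 x)"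
proof -
  let ?z = "Complex (x (N - 1)) (x N)" and ?m = "ms ! (N - 2)"
  have r: "tail_radius N k x = sqrt ((x (k + 1))\<^sup>2 + sqsum {k + 2..N} x)" if "k < N" for k
  proof -
    have "{k + 1..N} = insert (k + 1) {k + 2..N}" using that by auto
    then show ?thesis by (simp add: tail_radius_def sqsum_def)
  qed
  have prod: "(\<Prod>k \<in> {k. k + 3 \<le> N}.
         tail_radius N k x ^ (ms ! k - ms ! (k + 1))
         * gegenbauer (real (ms ! (k + 1)) + (real N - real k - 2) / 2) (ms ! k - ms ! (k + 1))
             (x (k + 1) / tail_radius N k x)) = geg_prod N ms 0 x"
    unfolding geg_prod_def
  proof (rule prod.cong)
    show "{k. k + 3 \<le> N} = {0..<N - 2}" by auto
    fix k assume "k \<in> {0..<N - 2}"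
    then have k: "k < N" by auto
    show "tail_radius N k x ^ (ms ! k - ms ! (k + 1))
         * gegenbauer (real (ms ! (k + 1)) + (real N - real k - 2) / 2) (ms ! k - ms ! (k + 1)) (x (k + 1) / tail_radius N k x)
       = geg_hom (real (ms ! (k + 1)) + (real N - real k - 2) / 2) (ms ! k - ms ! (k + 1)) (x (k + 1)) (sqsum {k + 2..N} x)"
      unfolding r[OF k] by (rule gegenbauer_geg_hom) (simp add: sqsum_def sum_nonneg)
  qed
  have "{N - 2 + 2..N} = {N}" "N - 2 + 1 = N - 1" using N by auto
  then have R: "tail_radius N (N - 2) x = cmod ?z" using r[of "N - 2"] N by (simp add: sqsum_def cmod_def)
  have 1: "(?z / of_real (cmod ?z)) powi (1 * int ?m) * of_real (cmod ?z ^ ?m) = ?z ^ ?m"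
  proof (cases "?z = 0")
    case True
    show ?thesis unfolding True by (cases ?m) auto
  next
    case False
    then have "complex_of_real (cmod ?z) \<noteq> 0" by simp
    then show ?thesis by (simp add: power_divide del: Complex_eq)
  qed
  have 2: "(?z / of_real (cmod ?z)) powi (- 1 * int ?m) * of_real (cmod ?z ^ ?m) = cnj ?z ^ ?m"
  proof (cases "?z = 0")
    case True
    show ?thesis unfolding True by (cases ?m) (auto simp: power_int_minus)
  next
    case False
    define r where "r = complex_of_real (cmod ?z)"
    have r0: "r \<noteq> 0" using False by (simp add: r_def)
    \<comment> \<open>The minus sign inverts z / r; since r^2 is z times its conjugate, (r / z)^m
      r^m is the m-th power of the conjugate.\<close>
    have rz: "r * r = ?z * cnj ?z" unfolding r_def using complex_norm_square[of ?z] by (simp only: power2_eq_square of_real_mult)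
    have "(?z / r) powi (- 1 * int ?m) * r ^ ?m = (r * r / ?z) ^ ?m"
      using False r0 by (simp add: power_int_minus power_divide power_mult_distrib field_simps del: Complex_eq)
    also have "r * r / ?z = cnj ?z" unfolding rz using False by simp
    finally show ?thesis by (simp add: r_def)
  qed
  show "harm_poly N ms 1 x = ?z ^ ?m * of_real (geg_prod N ms 0 x)"
    unfolding harm_poly_def prod R 1 ..
  show "harm_poly N ms (-1) x = cnj ?z ^ ?m * of_real (geg_prod N ms 0 x)"
    unfolding harm_poly_def prod R 2 ..
qed

subsection \<open>The number of symbols\<close>

text \<open>Dropping the first entry of a symbol leaves a symbol of one dimension less, so symbols
  can be counted by summing over the second entry.\<close>

lemma harm_symbols_Suc:
  assumes N: "N \<ge> 2"
  shows "harm_symbols (Suc N) m = (\<Union>k\<in>{..m}. (#) m ` harm_symbols N k)"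
proof (intro set_eqI iffI)
  fix ms assume ms: "ms \<in> harm_symbols (Suc N) m"
  then obtain a ns where a: "ms = a # ns" by (cases ms) (auto simp: harm_symbols_def)
  have am: "a = m" using ms a by (simp add: harm_symbols_def)
  have le: "ms ! (k + 1) \<le> ms ! k" if "k < Suc N - 2" for k using ms that by (simp add: harm_symbols_def)
  have "ns ! 0 \<le> m" using le[of 0] N a am by simp
  moreover have "ns ! (k + 1) \<le> ns ! k" if "k < N - 2" for k using le[of "Suc k"] that a by simp
  moreover have "length ns = N" "ns ! (N - 1) \<le> 1" "ns ! (N - 2) = 0 \<longrightarrow> ns ! (N - 1) = 0"
    using ms a N by (auto simp: harm_symbols_def nth_Cons' numeral_2_eq_2)
  ultimately have "ns \<in> harm_symbols N (ns ! 0)" "ns ! 0 \<in> {..m}" by (auto simp: harm_symbols_def)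
  then show "ms \<in> (\<Union>k\<in>{..m}. (#) m ` harm_symbols N k)" using a am by blast
next
  fix ms assume "ms \<in> (\<Union>k\<in>{..m}. (#) m ` harm_symbols N k)"
  then obtain k ns where k: "k \<le> m" "ns \<in> harm_symbols N k" "ms = m # ns" by auto
  have "ms ! (i + 1) \<le> ms ! i" if "i < Suc N - 2" for i
    using k that by (cases i) (auto simp: harm_symbols_def)
  moreover have "length ms = Suc N" "ms ! 0 = m" using k by (auto simp: harm_symbols_def)
  moreover have "ms ! (Suc N - 1) = ns ! (N - 1)" "ms ! (Suc N - 2) = ns ! (N - 2)"
    using k(3) N by (auto simp: nth_Cons' numeral_2_eq_2)
  ultimately show "ms \<in> harm_symbols (Suc N) m"
    using k(2) by (auto simp: harm_symbols_def)
qed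

lemma harm_symbols_2: "harm_symbols 2 m = (if m = 0 then {[0, 0]} else {[m, 0], [m, 1]})"
proof -
  have "ms \<in> harm_symbols 2 m \<longleftrightarrow> (\<exists>s. ms = [m, s] \<and> s \<le> 1 \<and> (m = 0 \<longrightarrow> s = 0))" for ms
    by (auto simp: harm_symbols_def length_Suc_conv numeral_2_eq_2)
  then show ?thesis by (auto simp: le_Suc_eq)
qed

lemma finite_harm_symbols: "N \<ge> 2 \<Longrightarrow> finite (harm_symbols N m)"
proof (induction N arbitrary: m rule: dec_induct)
  case base
  then show ?case by (simp add: harm_symbols_2)
next
  case (step N)
  then show ?case by (simp add: harm_symbols_Suc)
qed

lemma card_harm_symbols_Suc:
  assumes N: "N \<ge> 2"
  shows "card (harm_symbols (Suc N) m) = (\<Sum>k\<le>m. card (harm_symbols N k))"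
proof -
  have "card (harm_symbols (Suc N) m) = (\<Sum>k\<le>m. card ((#) m ` harm_symbols N k))"
    unfolding harm_symbols_Suc[OF N]
    by (rule card_UN_disjoint) (auto simp: finite_harm_symbols[OF N], auto simp: harm_symbols_def)
  also have "\<dots> = (\<Sum>k\<le>m. card (harm_symbols N k))"
    by (intro sum.cong refl card_image) (auto simp: inj_on_def)
  finally show ?thesis .
qed

text \<open>The hockey-stick identity, applied to both binomials.\<close>

lemma card_harm_symbols: "card (harm_symbols (r + 3) m) = (m + r + 1 choose (r + 1)) + (m + r choose (r + 1))"
proof (induction r arbitrary: m)
  case 0
  have "(\<Sum>k\<le>m. card (harm_symbols 2 k)) = 2 * m + 1" by (induction m) (auto simp: harm_symbols_2)
  then show ?case using card_harm_symbols_Suc[of 2 m] by (simp add: numeral_3_eq_3 numeral_2_eq_2)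
next
  case (Suc r)
  have "card (harm_symbols (Suc r + 3) m) = (\<Sum>k\<le>m. (k + r + 1 choose (r + 1)) + (k + r choose (r + 1)))"
    using card_harm_symbols_Suc[of "r + 3" m] Suc by simp
  also have "\<dots> = (m + Suc r + 1 choose (Suc r + 1)) + (m + Suc r choose (Suc r + 1))"
    by (induction m) (auto simp: binomial_eq_0)
  finally show ?case .
qed

text \<open>Guarantees that l - 1 is a valid position of the sorted list in
  \<open>harm_symbol\<close>; beyond its end the symbol would be unspecified.\<close>

lemma card_harm_symbols_ge:
  assumes N: "N \<ge> 2"
  shows "harm_dim m N \<le> card (harm_symbols N m)"
proof (cases "N = 2")
  case True
  show ?thesis
  proof (cases m)
    case (Suc k)
    have "2 * m * fact (m - 1) = 2 * (fact m :: nat)" using Suc by (simp only: fact_Suc diff_Suc_1 mult.assoc) simp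
    then have "2 * m * fact (m - 1) div fact m = 2 * fact m div (fact m :: nat)" by (rule arg_cong)
    also have "\<dots> = 2" by (rule nonzero_mult_div_cancel_right) simp
    finally have "2 * m * fact (m - 1) div fact m = (2 :: nat)" .
    then show ?thesis using True Suc by (simp add: harm_dim_def harm_symbols_2 del: fact_Suc)
  qed (simp add: True harm_dim_def harm_symbols_2)
next
  case False
  define r where "r = N - 3"
  have r: "N = r + 3" using N False by (simp add: r_def)
  have a: "(m + r + 1 choose (r + 1)) * (fact (r + 1) * fact m) = (m + r + 1) * fact (m + r)"
    using binomial_fact_lemma[of "r + 1" "m + r + 1"] by (simp add: mult_ac del: binomial_Suc_Suc)
  have b: "(m + r choose (r + 1)) * (fact (r + 1) * fact m) = m * fact (m + r)"
  proof (cases m)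
    case (Suc k)
    have "fact (r + 1) * fact k * (m + r choose (r + 1)) = (fact (m + r) :: nat)"
      using binomial_fact_lemma[of "r + 1" "m + r"] Suc by (simp del: binomial_Suc_Suc fact_Suc)
    moreover have "(fact m :: nat) = m * fact k" using Suc by simp
    ultimately show ?thesis by (simp only: ac_simps)
  qed simp
  have "(2 * m + N - 2) * fact (m + N - 3) = (m + r + 1) * fact (m + r) + m * (fact (m + r) :: nat)"
    by (simp add: r algebra_simps)
  also have "\<dots> = ((m + r + 1 choose (r + 1)) + (m + r choose (r + 1))) * (fact (r + 1) * fact m)"
    unfolding a[symmetric] b[symmetric] by (simp only: distrib_right)
  finally have "(2 * m + N - 2) * fact (m + N - 3) div (fact (N - 2) * fact m) = (m + r + 1 choose (r + 1)) + (m + r choose (r + 1))"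
    using r by (simp del: fact_Suc binomial_Suc_Suc)
  then show ?thesis using r card_harm_symbols[of r m] by (simp add: harm_dim_def)
qed

lemma harm_symbol_mem:
  assumes "N \<ge> 2" "1 \<le> l" "l \<le> harm_dim m N"
  shows "harm_symbol N m l \<in> harm_symbols N m"
proof -
  have fin: "finite (harm_symbols N m)" using assms(1) by (rule finite_harm_symbols)
  have "l - 1 < length (sorted_list_of_set (harm_symbols N m))"
    using card_harm_symbols_ge[OF assms(1), of m] assms by simp
  from nth_mem[OF this] show ?thesis unfolding harm_symbol_def using fin by (simp only: set_sorted_list_of_set)
qed

subsection \<open>The Helmholtz equation\<close>

text \<open>Recognises the explicit functions as restrictions of solid harmonics to the sphere, the
  form in which the Helmholtz equation can be checked.\<close>

theorem sph_harm_harmonic: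
  assumes N: "N \<ge> 1" and l: "1 \<le> l" "l \<le> harm_dim m N"
  shows "\<exists>P. harmonic_hom {1..N} m P \<and> (\<forall>x. tail_radius N 0 x = 1 \<longrightarrow> sph_harm N m l x = P x)"
proof (cases "N = 1")
  case True
  have "m = 0 \<or> m = 1" using l True by (auto simp: harm_dim_def split: if_splits)
  then show ?thesis
  proof
    assume "m = 0"
    then show ?thesis using harmonic_hom_const[of "{1..N}" "1 / sqrt 2"] True by (auto simp: sph_harm_def)
  next
    assume "m = 1"
    then show ?thesis using harmonic_hom_cmult[OF harmonic_hom_coord[of "{1..N}" 1], of "1 / sqrt 2"] True
      by (auto simp: sph_harm_def intro!: exI[of _ "\<lambda>x. x 1 / sqrt 2"])
  qed
next
  case False
  then have N2: "N \<ge> 2" using N by simp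
  define ms where "ms = harm_symbol N m l"
  have ms: "ms \<in> harm_symbols N m" unfolding ms_def using N2 l by (rule harm_symbol_mem)
  have v: "valid_symbol N ms" and m0: "ms ! 0 = m" using ms by (auto simp: harm_symbols_def valid_symbol_def)
  define P where "P w = (\<lambda>x. geg_prod N ms 0 x * Re (w * Complex (x (N - 1)) (x N) ^ (ms ! (N - 2))))" for w
  have P: "harmonic_hom {1..N} m (P w)" for w
    using harmonic_hom_geg_prod[OF N2 v, of 0 w] unfolding P_def m0 by simp
  have Y: "Re (harm_Y N ms 1 x) = P 1 x" "- Im (harm_Y N ms (-1) x) = P (- \<i>) x" if "tail_radius N 0 x = 1" for x
  proof -
    have "Im (cnj z ^ k) = - Im (z ^ k)" for z k
      by (metis complex_cnj_power cnj.simps(2))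
    then show "Re (harm_Y N ms 1 x) = P 1 x" "- Im (harm_Y N ms (-1) x) = P (- \<i>) x"
      using that unfolding harm_Y_def harm_poly_eq[OF N2] P_def by (simp_all add: mult.commute)
  qed
  define c where "c = (if ms ! (N - 2) = 0 then 1 else sqrt 2) / sqrt (harm_L N ms)"
  \<comment> \<open>Re (- i z) = Im z, so the weight - i yields the harmonics of sine type; the sign
    in front of Im Y fits because the symbol with - carries the conjugate power.\<close>
  define w where "w = (if ms ! (N - 2) = 0 \<or> ms ! (N - 1) = 0 then 1 else - \<i>)"
  have "sph_harm N m l x = c * P w x" if "tail_radius N 0 x = 1" for x
  proof -
    have "Im (harm_Y N ms (-1) x) = - P (- \<i>) x" using Y(2)[OF that] by simp
    then show ?thesis using Y(1)[OF that] False unfolding sph_harm_def Let_def ms_def[symmetric] c_def w_def by auto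
  qed
  then show ?thesis using harmonic_hom_cmult[OF P[of w], of c] by blast
qed

lemma radial_g_eq:
  assumes u: "u > 0"
  shows "radial_g N m u = Gamma (real N / 2) * (u / 2) ^ m * bessel_phi (real m + (real N - 2) / 2) (u\<^sup>2 / 4)"
proof -
  define b where "b = (real N - 2) / 2"
  have "(u / 2) powr (real m + b) = (u / 2) ^ m * (u powr b / 2 powr b)"
    using u by (simp add: powr_add powr_realpow powr_divide power_divide)
  then have "2 powr b * Gamma (real N / 2) * bessel_J (real m + b) u / u powr b
     = Gamma (real N / 2) * (u / 2) ^ m * bessel_phi (real m + b) (u\<^sup>2 / 4)"
    using u by (simp add: bessel_J_phi field_simps)
  then show ?thesis using u by (simp add: radial_g_def Let_def b_def)
qed

text \<open>Padding by 0 outside 1..N makes a move along an axis a single function update.\<close>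

definition coords :: "(nat \<Rightarrow> 'n::finite) \<Rightarrow> real ^ 'n \<Rightarrow> nat \<Rightarrow> real" where
  "coords e x = (\<lambda>k. if k \<in> {1..CARD('n)} then x $ e k else 0)"

lemma sqsum_coords:
  fixes e :: "nat \<Rightarrow> 'n::finite"
  assumes e: "bij_betw e {1..CARD('n)} UNIV"
  shows "sqsum {1..CARD('n)} (coords e x) = (norm x)\<^sup>2"
proof -
  have "(norm x)\<^sup>2 = (\<Sum>i\<in>UNIV. (x $ i)\<^sup>2)"
    by (simp add: norm_vec_def L2_set_def sum_nonneg)
  also have "\<dots> = (\<Sum>k\<in>{1..CARD('n)}. (x $ e k)\<^sup>2)" by (rule sum.reindex_bij_betw[OF e, symmetric])
  finally show ?thesis by (simp add: sqsum_def coords_def)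
qed

text \<open>v is a radial function times a solid harmonic, and Bessel's equation for the radial
  factor gives the eigenvalue - j^2. The Kronecker delta subtracts exactly the value of v at the
  origin, which is 0 unless m = 0.\<close>

theorem mfbm_term_helmholtz:
  fixes e :: "nat \<Rightarrow> 'n::finite" and H :: real
  assumes e: "bij_betw e {1..CARD('n)} UNIV" and i: "(m, n, l) \<in> term_index CARD('n)"
    and j: "j = bessel_zero (\<bar>real m - 1\<bar> - H) n" "j > 0"
  shows "\<exists>v D D2. has_partials {1..CARD('n)} v D D2 \<and> (\<forall>X. (\<Sum>i\<in>{1..CARD('n)}. D2 i X) = - (j\<^sup>2 * v X))
    \<and> (\<forall>x :: real ^ 'n. mfbm_term H e (m, n, l) x = v (coords e x) - v (coords e 0))"
proof -
  let ?N = "CARD('n)" and ?K = "{1..CARD('n)}"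
  define \<nu> where "\<nu> = real m + (real ?N - 2) / 2"
  have l: "1 \<le> l" "l \<le> harm_dim m ?N" using i by (auto simp: term_index_def)
  obtain P where P: "harmonic_hom ?K m P" and S: "\<And>x. tail_radius ?N 0 x = 1 \<Longrightarrow> sph_harm ?N m l x = P x"
    using sph_harm_harmonic[OF _ l] by auto
  obtain E E2 where E: "has_partials ?K P E E2" "\<And>x. (\<Sum>i\<in>?K. E2 i x) = 0" "\<And>x. (\<Sum>i\<in>?K. x i * E i x) = real m * P x"
    and Pc: "\<And>x y. (\<forall>i\<in>?K. x i = y i) \<Longrightarrow> P x = P y" and Ph: "\<And>c x. P (\<lambda>i. c * x i) = c ^ m * P x"
    using P by (auto simp: harmonic_hom_def)
  \<comment> \<open>Collects \<tau> and the constants of g_m. The power (j |x| / 2)^m is split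
    between (j / 2)^m here and the homogeneity of P.\<close>
  define \<kappa> where "\<kappa> = mfbm_tau ?N H m n * Gamma (real ?N / 2) * (j / 2) ^ m"
  define g where "g s = \<kappa> * bessel_phi \<nu> (j\<^sup>2 / 4 * s)" for s
  define g' where "g' s = - \<kappa> * (j\<^sup>2 / 4) * bessel_phi (\<nu> + 1) (j\<^sup>2 / 4 * s)" for s
  define g'' where "g'' s = \<kappa> * (j\<^sup>2 / 4)\<^sup>2 * bessel_phi (\<nu> + 2) (j\<^sup>2 / 4 * s)" for s
  have phi: "((\<lambda>s. bessel_phi \<mu> (j\<^sup>2 / 4 * s)) has_real_derivative - bessel_phi (\<mu> + 1) (j\<^sup>2 / 4 * s) * (j\<^sup>2 / 4)) (at s)" for \<mu> s
    by (rule DERIV_chain2[OF DERIV_bessel_phi]) (rule DERIV_cmult_Id)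
  have g: "(g has_real_derivative g' s) (at s)" for s
    unfolding g_def[abs_def] g'_def by (rule DERIV_cong[OF DERIV_cmult[OF phi]]) simp
  have g': "(g' has_real_derivative g'' s) (at s)" for s
    unfolding g'_def[abs_def] g''_def
    by (rule DERIV_cong[OF DERIV_cmult[OF phi]]) (simp add: power2_eq_square add.assoc)
  define v where "v X = g (sqsum ?K X) * P X" for X
  define D where "D i X = 2 * X i * (g' (sqsum ?K X) * P X) + g (sqsum ?K X) * E i X" for i X
  define D2 where "D2 i X = (2 * g' (sqsum ?K X) + 4 * (X i)\<^sup>2 * g'' (sqsum ?K X)) * P X
     + 4 * g' (sqsum ?K X) * (X i * E i X) + g (sqsum ?K X) * E2 i X" for i X
  have "has_partials ?K v D D2"
    unfolding has_partials_def
  proof (intro ballI allI conjI)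
    fix i X assume i: "i \<in> ?K"
    have Ei: "((\<lambda>t. P (X(i := t))) has_real_derivative E i X) (at (X i))"
      "((\<lambda>t. E i (X(i := t))) has_real_derivative E2 i X) (at (X i))"
      using E(1) i by (auto simp: has_partials_def)
    show "((\<lambda>t. v (X(i := t))) has_real_derivative D i X) (at (X i))"
      unfolding v_def D_def by (rule DERIV_radial_mult[OF _ i g Ei(1)]) simp
    have "((\<lambda>t. 2 * t * (g' (sqsum ?K (X(i := t))) * P (X(i := t))) + g (sqsum ?K (X(i := t))) * E i (X(i := t)))
      has_real_derivative D2 i X) (at (X i))"
      unfolding D2_def by (rule DERIV_radial_mult2[where f = P and D = E and g = g and g' = g' and g'' = g'', OF _ i g g' Ei]) simp
    then show "((\<lambda>t. D i (X(i := t))) has_real_derivative D2 i X) (at (X i))" by (simp add: D_def)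
  qed
  moreover have "(\<Sum>i\<in>?K. D2 i X) = - (j\<^sup>2 * v X)" for X
  proof -
    let ?s = "sqsum ?K X"
    have "(\<Sum>i\<in>?K. D2 i X) = (4 * ?s * g'' ?s + (2 * real (card ?K) + 4 * real m) * g' ?s) * P X"
      unfolding D2_def by (rule sum_radial_mult2[OF E(2,3)])
    also have "2 * real (card ?K) + 4 * real m = 4 * (\<nu> + 1)" by (simp add: \<nu>_def field_simps)
    also have "4 * ?s * g'' ?s + 4 * (\<nu> + 1) * g' ?s = - (j\<^sup>2 * g ?s)"
    proof -
      \<comment> \<open>Bessel's equation at t = q s with q = j^2/4, multiplied by 4 q
        \<kappa>.\<close>
      have "4 * s * (\<kappa> * q\<^sup>2 * A) + 4 * (\<nu> + 1) * (- \<kappa> * q * B) = - (4 * q * (\<kappa> * C))"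
        if "q * s * A - (\<nu> + 1) * B + C = 0" for s q A B C
      proof -
        have C: "C = (\<nu> + 1) * B - q * s * A" using that by simp
        show ?thesis unfolding C by (simp add: algebra_simps power2_eq_square)
      qed
      from this[OF bessel_phi_ode[of "j\<^sup>2 / 4 * ?s" \<nu>]] show ?thesis by (simp add: g_def g'_def g''_def)
    qed
    finally show ?thesis by (simp add: v_def)
  qed
  moreover have "mfbm_term H e (m, n, l) x = v (coords e x) - v (coords e 0)" for x :: "real ^ 'n"
  proof -
    have c0: "coords e 0 = (\<lambda>k. 0)" by (simp add: coords_def fun_eq_iff)
    have P0: "P X = P (\<lambda>k. 0)" if "m = 0" for X using Ph[of 0 X] that by simp
    have P0': "P (\<lambda>k. 0) = 0" if "m \<noteq> 0" using Ph[of 0 "\<lambda>k. 0"] that by (simp add: power_0_left)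
    \<comment> \<open>For m = 0 the factor Gamma (N/2) cancels the value \<open>rGamma (N/2)\<close>
      of the Bessel factor at 0; hence g_0(0) = 1, the constant that is subtracted in the
      term.\<close>
    have g0: "g 0 = mfbm_tau ?N H m n" if "m = 0"
    proof -
      have "\<nu> + 1 = real ?N / 2" using that by (simp add: \<nu>_def field_simps)
      then have "bessel_phi \<nu> 0 = rGamma (real ?N / 2)" by (simp only: bessel_phi_0)
      moreover have "Gamma (real ?N / 2) > 0" by (intro Gamma_real_pos) simp
      then have "Gamma (real ?N / 2) * rGamma (real ?N / 2) = 1"
        unfolding rGamma_inverse_Gamma by (intro right_inverse) linarith
      ultimately show ?thesis using that by (simp add: g_def \<kappa>_def)
    qed
    have v0: "v (coords e 0) = (if m = 0 then mfbm_tau ?N H m n * P (\<lambda>k. 0) else 0)"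
      using P0' g0 by (simp add: v_def c0 sqsum_def)
    show ?thesis
    proof (cases "x = 0")
      case True
      then show ?thesis by (simp add: mfbm_term_def)
    next
      case False
      define y where "y = (\<lambda>k. (x /\<^sub>R norm x) $ e k)"
      have nx: "norm x > 0" using False by simp
      have "(\<Sum>k = 1..?N. (y k)\<^sup>2) = sqsum ?K (coords e (x /\<^sub>R norm x))"
        unfolding sqsum_def coords_def y_def by (intro sum.cong) auto
      also have "\<dots> = 1" unfolding sqsum_coords[OF e] using False by simp
      finally have "tail_radius ?N 0 y = 1" by (simp add: tail_radius_def)
      then have Sy: "sph_harm ?N m l y = P y" by (rule S)
      have "P (coords e x) = P (\<lambda>k. norm x * y k)"
        by (rule Pc) (use nx in \<open>auto simp: coords_def y_def\<close>)
      then have Px: "P (coords e x) = norm x ^ m * P y" by (simp add: Ph)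
      have "radial_g ?N m (j * norm x) = Gamma (real ?N / 2) * (j * norm x / 2) ^ m * bessel_phi \<nu> ((j * norm x)\<^sup>2 / 4)"
        unfolding \<nu>_def using j nx by (intro radial_g_eq) simp
      then have "mfbm_tau ?N H m n * radial_g ?N m (j * norm x) * P y = v (coords e x)"
        unfolding v_def g_def \<kappa>_def sqsum_coords[OF e] Px
        by (simp add: power_mult_distrib power_divide)
      moreover have "P y = P (\<lambda>k. 0)" if "m = 0" using P0[OF that] .
      moreover have "mfbm_term H e (m, n, l) x = mfbm_tau ?N H m n * (radial_g ?N m (j * norm x) - (if m = 0 then 1 else 0)) * P y"
        using False Sy by (simp add: mfbm_term_def y_def j)
      ultimately show ?thesis unfolding v0 by (auto simp: algebra_simps)
    qed
  qed
  ultimately show ?thesis by blast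
qed

subsection \<open>Gaussian sums\<close>

lemma iid_std_normal_subset: "prob_space M \<Longrightarrow> iid_std_normal M I Z \<Longrightarrow> J \<subseteq> I \<Longrightarrow> iid_std_normal M J Z"
  by (auto simp: iid_std_normal_def intro: prob_space.indep_vars_subset)

lemma iid_std_normal_measurable:
  assumes "iid_std_normal M I Z" "i \<in> I"
  shows "Z i \<in> borel_measurable M"
  using assms distributed_measurable[of M lborel "Z i" std_normal_density] by (auto simp: iid_std_normal_def)

lemma iid_std_normal_distr:
  assumes "iid_std_normal M I Z" "i \<in> I"
  shows "distr M borel (Z i) = std_normal_distribution"
proof -
  have "distributed M lborel (Z i) std_normal_density" using assms by (auto simp: iid_std_normal_def)
  then have "distr M lborel (Z i) = density lborel std_normal_density" by (rule distributed_distr_eq_density)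
  then show ?thesis by (simp cong: distr_cong)
qed

definition char_fun :: "'a measure \<Rightarrow> ('a \<Rightarrow> real) \<Rightarrow> real \<Rightarrow> complex" where
  "char_fun M X t = (CLINT \<omega>|M. iexp (t * X \<omega>))"

lemma char_fun_eq: "X \<in> borel_measurable M \<Longrightarrow> char_fun M X t = char (distr M borel X) t"
  unfolding char_fun_def char_def by (subst integral_distr) auto

lemma char_fun_gauss_sum:
  assumes M: "prob_space M" and Z: "iid_std_normal M I Z" and F: "F \<subseteq> I"
  shows "char_fun M (\<lambda>\<omega>. \<Sum>i\<in>F. a i * Z i \<omega>) t = of_real (exp (- (t\<^sup>2 * (\<Sum>i\<in>F. (a i)\<^sup>2)) / 2))"
proof -
  interpret prob_space M by fact
  have meas: "Z i \<in> borel_measurable M" if "i \<in> F" for i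
    using iid_std_normal_measurable[OF Z] that F by auto
  have indep: "indep_vars (\<lambda>_. borel) (\<lambda>i \<omega>. a i * Z i \<omega>) F"
    using indep_vars_subset[of "\<lambda>_. borel" Z I F] Z F
    by (intro indep_vars_compose2[where X = Z and M' = "\<lambda>_. borel" and Y = "\<lambda>i z. a i * z"]) (auto simp: iid_std_normal_def)
  have single: "char (distr M borel (\<lambda>\<omega>. a i * Z i \<omega>)) t = of_real (exp (- (t\<^sup>2 * (a i)\<^sup>2) / 2))" if "i \<in> F" for i
  proof -
    have "char (distr M borel (\<lambda>\<omega>. a i * Z i \<omega>)) t = char_fun M (\<lambda>\<omega>. a i * Z i \<omega>) t"
      using meas[OF that] by (intro char_fun_eq[symmetric]) simp
    also have "\<dots> = char_fun M (Z i) (t * a i)" by (simp add: char_fun_def mult.assoc)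
    also have "\<dots> = char (distr M borel (Z i)) (t * a i)" using meas[OF that] by (rule char_fun_eq)
    also have "distr M borel (Z i) = std_normal_distribution" using iid_std_normal_distr[OF Z] that F by auto
    finally show ?thesis by (simp add: char_std_normal_distribution power_mult_distrib)
  qed
  have "char_fun M (\<lambda>\<omega>. \<Sum>i\<in>F. a i * Z i \<omega>) t = char (distr M borel (\<lambda>\<omega>. \<Sum>i\<in>F. a i * Z i \<omega>)) t"
    using meas by (intro char_fun_eq) auto
  also have "\<dots> = (\<Prod>i\<in>F. of_real (exp (- (t\<^sup>2 * (a i)\<^sup>2) / 2)))"
    unfolding char_distr_sum[OF indep] using single by (intro prod.cong) auto
  also have "\<dots> = of_real (\<Prod>i\<in>F. exp (- (t\<^sup>2 * (a i)\<^sup>2) / 2))" by simp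
  also have "(\<Prod>i\<in>F. exp (- (t\<^sup>2 * (a i)\<^sup>2) / 2)) = exp (\<Sum>i\<in>F. - (t\<^sup>2 * (a i)\<^sup>2) / 2)"
    by (cases "finite F") (simp_all add: exp_sum)
  also have "(\<Sum>i\<in>F. - (t\<^sup>2 * (a i)\<^sup>2) / 2) = - (t\<^sup>2 * (\<Sum>i\<in>F. (a i)\<^sup>2)) / 2"
    by (simp add: sum_distrib_left sum_divide_distrib sum_negf)
  finally show ?thesis .
qed

lemma char_fun_centred_gaussian:
  assumes M: "prob_space M" and X: "centred_gaussian M X"
  shows "char_fun M X t = of_real (exp (- (t\<^sup>2 * (\<integral>\<omega>. (X \<omega>)\<^sup>2 \<partial>M)) / 2))"
proof -
  interpret prob_space M by fact
  have meas: "X \<in> borel_measurable M" using X by (simp add: centred_gaussian_def)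
  consider "AE \<omega> in M. X \<omega> = 0" | \<sigma> where "\<sigma> > 0" "distributed M lborel X (normal_density 0 \<sigma>)"
    using X by (auto simp: centred_gaussian_def)
  then show ?thesis
  proof cases
    case 1
    have "(\<integral>\<omega>. (X \<omega>)\<^sup>2 \<partial>M) = (\<integral>\<omega>. 0 \<partial>M)" using 1 meas by (intro integral_cong_AE) auto
    moreover have "char_fun M X t = (CLINT \<omega>|M. 1)" unfolding char_fun_def using 1 meas by (intro integral_cong_AE) auto
    ultimately show ?thesis by (simp add: prob_space)
  next
    case 2
    have D: "distributed M lborel (\<lambda>x. X x / \<sigma>) std_normal_density"
      using normal_standard_normal_convert[OF 2(1), of X 0] 2(2) by simp
    have v: "(\<integral>\<omega>. (X \<omega>)\<^sup>2 \<partial>M) = \<sigma>\<^sup>2"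
      using normal_distributed_variance[OF 2] normal_distributed_expectation[OF 2] by simp
    have "distr M lborel (\<lambda>x. X x / \<sigma>) = density lborel std_normal_density"
      using D distributed_distr_eq_density by blast
    then have d: "distr M borel (\<lambda>x. X x / \<sigma>) = std_normal_distribution" by (simp cong: distr_cong)
    have "char_fun M X t = char_fun M (\<lambda>x. X x / \<sigma>) (t * \<sigma>)" using 2(1) by (simp add: char_fun_def)
    also have "\<dots> = char (distr M borel (\<lambda>x. X x / \<sigma>)) (t * \<sigma>)" using meas by (intro char_fun_eq) auto
    finally show ?thesis unfolding d v by (simp add: char_std_normal_distribution power_mult_distrib)
  qed
qed

lemma char_fun_tendsto:
  assumes M: "prob_space M" and S: "\<And>k::nat. S k \<in> borel_measurable M" and X: "X \<in> borel_measurable M"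
    and lim: "AE \<omega> in M. (\<lambda>k. S k \<omega>) \<longlonglongrightarrow> X \<omega>"
  shows "(\<lambda>k. char_fun M (S k) t) \<longlonglongrightarrow> char_fun M X t"
proof -
  interpret prob_space M by fact
  note [measurable] = S X
  show ?thesis unfolding char_fun_def
  proof (rule integral_dominated_convergence[where w = "\<lambda>_. 1"])
    show "AE \<omega> in M. (\<lambda>k. iexp (t * S k \<omega>)) \<longlonglongrightarrow> iexp (t * X \<omega>)"
      using lim by eventually_elim (intro tendsto_intros)
    show "AE \<omega> in M. norm (iexp (t * S k \<omega>)) \<le> 1" for k by (simp only: norm_exp_i_times order_refl AE_I2)
  qed auto
qed

text \<open>After division by s the sum is recognised as standard normal by its characteristic
  function. In the exponential moment, 4 v stays clear of the critical 2 v: multiplying the standard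
  density by exp (x^2/4) gives sqrt 2 times the normal density of variance 2.\<close>

lemma nn_integral_gauss_sum:
  assumes M: "prob_space M" and Z: "iid_std_normal M I Z" and F: "F \<subseteq> I" "finite F"
  shows "(\<integral>\<^sup>+\<omega>. ennreal ((\<Sum>i\<in>F. a i * Z i \<omega>)\<^sup>2) \<partial>M) = ennreal (\<Sum>i\<in>F. (a i)\<^sup>2)"
    and "v > 0 \<Longrightarrow> (\<Sum>i\<in>F. (a i)\<^sup>2) \<le> v \<Longrightarrow>
      (\<integral>\<^sup>+\<omega>. ennreal (exp ((\<Sum>i\<in>F. a i * Z i \<omega>)\<^sup>2 / (4 * v))) \<partial>M) \<le> ennreal (sqrt 2)"
proof -
  interpret prob_space M by fact
  let ?S = "\<lambda>\<omega>. \<Sum>i\<in>F. a i * Z i \<omega>"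
  define s where "s = sqrt (\<Sum>i\<in>F. (a i)\<^sup>2)"
  have s2: "s\<^sup>2 = (\<Sum>i\<in>F. (a i)\<^sup>2)" by (simp add: s_def sum_nonneg)
  have meas[measurable]: "?S \<in> borel_measurable M"
    using iid_std_normal_measurable[OF Z] F by (intro borel_measurable_sum borel_measurable_times) auto
  have distr: "distr M borel (\<lambda>\<omega>. ?S \<omega> / s) = std_normal_distribution" if "s \<noteq> 0"
  proof (rule Levy_uniqueness)
    show "real_distribution (distr M borel (\<lambda>\<omega>. ?S \<omega> / s))" by (intro real_distribution_distr) simp
    show "real_distribution std_normal_distribution" by (rule real_dist_normal_dist)
    show "char (distr M borel (\<lambda>\<omega>. ?S \<omega> / s)) = char std_normal_distribution"
    proof
      fix t
      have "char (distr M borel (\<lambda>\<omega>. ?S \<omega> / s)) t = char_fun M ?S (t / s)"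
        by (subst char_fun_eq[symmetric]) (auto simp: char_fun_def)
      also have "\<dots> = of_real (exp (- ((t / s)\<^sup>2 * s\<^sup>2) / 2))" unfolding char_fun_gauss_sum[OF M Z F(1)] s2 ..
      also have "(t / s)\<^sup>2 * s\<^sup>2 = t\<^sup>2" using that by (simp add: power_divide)
      finally show "char (distr M borel (\<lambda>\<omega>. ?S \<omega> / s)) t = char std_normal_distribution t"
        by (simp add: char_std_normal_distribution)
    qed
  qed
  have zero: "a i = 0" if "s = 0" "i \<in> F" for i
    using that F(2) by (simp add: s_def sum_nonneg_eq_0_iff)
  have nn: "(\<integral>\<^sup>+\<omega>. f (?S \<omega> / s) \<partial>M) = (\<integral>\<^sup>+x. ennreal (std_normal_density x) * f x \<partial>lborel)"
    if "s \<noteq> 0" "f \<in> borel_measurable borel" for f :: "real \<Rightarrow> ennreal"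
  proof -
    have "(\<integral>\<^sup>+\<omega>. f (?S \<omega> / s) \<partial>M) = (\<integral>\<^sup>+x. f x \<partial>(distr M borel (\<lambda>\<omega>. ?S \<omega> / s)))"
      using that by (subst nn_integral_distr) auto
    also have "\<dots> = (\<integral>\<^sup>+x. ennreal (std_normal_density x) * f x \<partial>lborel)"
      unfolding distr[OF that(1)] using that by (subst nn_integral_density) auto
    finally show ?thesis .
  qed
  show "(\<integral>\<^sup>+\<omega>. ennreal ((?S \<omega>)\<^sup>2) \<partial>M) = ennreal (\<Sum>i\<in>F. (a i)\<^sup>2)"
  proof (cases "s = 0")
    case True
    then show ?thesis using zero s2 by simp
  next
    case False
    have "(\<integral>\<^sup>+\<omega>. ennreal ((?S \<omega>)\<^sup>2) \<partial>M) = (\<integral>\<^sup>+\<omega>. ennreal (s\<^sup>2) * ennreal ((?S \<omega> / s)\<^sup>2) \<partial>M)"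
      using False by (intro nn_integral_cong) (simp add: ennreal_mult''[symmetric] power_divide)
    also have "\<dots> = ennreal (s\<^sup>2) * (\<integral>\<^sup>+x. ennreal (std_normal_density x) * ennreal (x\<^sup>2) \<partial>lborel)"
      unfolding nn[OF False, of "\<lambda>x. ennreal (x\<^sup>2)", simplified, symmetric] by (rule nn_integral_cmult) measurable
    also have "(\<integral>\<^sup>+x. ennreal (std_normal_density x) * ennreal (x\<^sup>2) \<partial>lborel) = (\<integral>\<^sup>+x. ennreal (std_normal_density x * x\<^sup>2) \<partial>lborel)"
      by (simp add: ennreal_mult)
    also have "\<dots> = ennreal 1"
    proof (rule nn_integral_eq_integral[THEN trans])
      have "has_bochner_integral lborel (\<lambda>x. std_normal_density x * x ^ (2 * 1)) (fact (2 * 1) / (2 ^ 1 * fact 1))"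
        by (rule std_normal_moment_even)
      then have h: "has_bochner_integral lborel (\<lambda>x. std_normal_density x * x\<^sup>2) 1" by simp
      then show "integrable lborel (\<lambda>x. std_normal_density x * x\<^sup>2)" by (rule integrable.intros)
      show "ennreal (\<integral>x. std_normal_density x * x\<^sup>2 \<partial>lborel) = ennreal 1"
        using h by (simp add: has_bochner_integral_integral_eq)
    qed auto
    finally show ?thesis by (simp add: s2)
  qed
  show "(\<integral>\<^sup>+\<omega>. ennreal (exp ((?S \<omega>)\<^sup>2 / (4 * v))) \<partial>M) \<le> ennreal (sqrt 2)"
    if v: "v > 0" "(\<Sum>i\<in>F. (a i)\<^sup>2) \<le> v"
  proof (cases "s = 0")
    case True
    then show ?thesis using zero by (simp add: emeasure_space_1)
  next
    case False
    have "(\<integral>\<^sup>+\<omega>. ennreal (exp ((?S \<omega>)\<^sup>2 / (4 * v))) \<partial>M) \<le> (\<integral>\<^sup>+\<omega>. ennreal (exp ((?S \<omega> / s)\<^sup>2 / 4)) \<partial>M)"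
    proof (intro nn_integral_mono ennreal_leI, simp only: exp_le_cancel_iff)
      fix \<omega>
      have "s\<^sup>2 > 0" using False by simp
      have "(?S \<omega>)\<^sup>2 / (4 * v) \<le> (?S \<omega>)\<^sup>2 / (4 * s\<^sup>2)"
        using v \<open>s\<^sup>2 > 0\<close> s2 by (intro divide_left_mono) (auto intro: mult_pos_pos)
      then show "(?S \<omega>)\<^sup>2 / (4 * v) \<le> (?S \<omega> / s)\<^sup>2 / 4" by (simp add: power_divide mult.commute)
    qed
    also have "\<dots> = (\<integral>\<^sup>+x. ennreal (std_normal_density x) * ennreal (exp (x\<^sup>2 / 4)) \<partial>lborel)"
      using nn[OF False, of "\<lambda>x. ennreal (exp (x\<^sup>2 / 4))"] by simp
    also have "\<dots> = (\<integral>\<^sup>+x. ennreal (sqrt 2) * ennreal (normal_density 0 (sqrt 2) x) \<partial>lborel)"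
    proof (rule nn_integral_cong)
      fix x :: real
      have "exp (- x\<^sup>2 / 2) * exp (x\<^sup>2 / 4) = exp (- x\<^sup>2 / 4)" by (simp add: exp_add[symmetric])
      then have "std_normal_density x * exp (x\<^sup>2 / 4) = sqrt 2 * normal_density 0 (sqrt 2) x"
        by (simp add: normal_density_def real_sqrt_mult divide_simps)
      then show "ennreal (std_normal_density x) * ennreal (exp (x\<^sup>2 / 4)) = ennreal (sqrt 2) * ennreal (normal_density 0 (sqrt 2) x)"
        by (simp add: ennreal_mult[symmetric])
    qed
    also have "\<dots> = ennreal (sqrt 2) * (\<integral>\<^sup>+x. ennreal (normal_density 0 (sqrt 2) x) \<partial>lborel)"
      by (rule nn_integral_cmult) simp
    also have "(\<integral>\<^sup>+x. ennreal (normal_density 0 (sqrt 2) x) \<partial>lborel) = 1"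
      using prob_space.emeasure_space_1[OF prob_space_normal_density[of "sqrt 2" 0]] by (simp add: emeasure_density)
    finally show ?thesis by simp
  qed
qed

subsection \<open>Iterated series\<close>

lemma norm_char_fun_le_lim:
  assumes M: "prob_space M" and S: "\<And>k::nat. S k \<in> borel_measurable M" and X: "X \<in> borel_measurable M"
    and lim: "AE \<omega> in M. (\<lambda>k. S k \<omega>) \<longlonglongrightarrow> X \<omega>"
    and le: "\<forall>\<^sub>F k in sequentially. norm (char_fun M (S k) t) \<le> c"
  shows "norm (char_fun M X t) \<le> c"
  using tendsto_upperbound[OF tendsto_norm[OF char_fun_tendsto[OF M S X lim]] le] by simp

lemma nn_integral_le_lim:
  assumes S: "\<And>k::nat. S k \<in> borel_measurable M" and X: "X \<in> borel_measurable M"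
    and lim: "AE \<omega> in M. (\<lambda>k. S k \<omega>) \<longlonglongrightarrow> X \<omega>"
    and le: "\<forall>\<^sub>F k in sequentially. (\<integral>\<^sup>+\<omega>. ennreal ((S k \<omega>)\<^sup>2) \<partial>M) \<le> c"
  shows "(\<integral>\<^sup>+\<omega>. ennreal ((X \<omega>)\<^sup>2) \<partial>M) \<le> c"
proof -
  note [measurable] = S X
  have "AE \<omega> in M. ennreal ((X \<omega>)\<^sup>2) = liminf (\<lambda>k. ennreal ((S k \<omega>)\<^sup>2))"
    using lim
  proof eventually_elim
    case (elim \<omega>)
    have "(\<lambda>k. ennreal ((S k \<omega>)\<^sup>2)) \<longlonglongrightarrow> ennreal ((X \<omega>)\<^sup>2)"
      using elim by (intro tendsto_ennrealI tendsto_intros)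
    then show ?case by (rule lim_imp_Liminf[OF sequentially_bot, symmetric])
  qed
  then have "(\<integral>\<^sup>+\<omega>. ennreal ((X \<omega>)\<^sup>2) \<partial>M) = (\<integral>\<^sup>+\<omega>. liminf (\<lambda>k. ennreal ((S k \<omega>)\<^sup>2)) \<partial>M)"
    by (rule nn_integral_cong_AE)
  also have "\<dots> \<le> liminf (\<lambda>k. \<integral>\<^sup>+\<omega>. ennreal ((S k \<omega>)\<^sup>2) \<partial>M)" by (rule nn_integral_liminf) simp
  also have "\<dots> \<le> c" using le by (intro Liminf_le) auto
  finally show ?thesis .
qed

text \<open>The index set of a partial sum of the iterated series: k tends to infinity at fixed K,
  then K.\<close>

definition term_box :: "nat \<Rightarrow> nat \<Rightarrow> nat \<Rightarrow> (nat \<times> nat \<times> nat) set" where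
  "term_box N K k = (SIGMA m:{..K}. SIGMA n:{1..k}. {1..harm_dim m N})"

lemma term_box: "finite (term_box N K k)" "term_box N K k \<subseteq> term_index N"
  by (auto simp: term_box_def term_index_def)

lemma sum_term_box:
  "(\<Sum>m\<le>K. \<Sum>n=1..k. \<Sum>l=1..harm_dim m N. f (m, n, l)) = (\<Sum>i\<in>term_box N K k. f i)"
  unfolding term_box_def by (simp add: sum.Sigma)

lemma finite_subset_term_box:
  assumes "finite F" "F \<subseteq> term_index N"
  shows "\<exists>k0. \<forall>K\<ge>k0. \<forall>k\<ge>k0. F \<subseteq> term_box N K k"
proof -
  obtain k0 where k0: "\<And>i. i \<in> F \<Longrightarrow> fst i \<le> k0 \<and> fst (snd i) \<le> k0"
  proof -
    have "finite ((\<lambda>i. max (fst i) (fst (snd i))) ` F)" using assms by simp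
    then obtain k0 where "\<forall>x\<in>(\<lambda>i. max (fst i) (fst (snd i))) ` F. x \<le> k0" using finite_nat_set_iff_bounded_le by blast
    then show ?thesis using that[of k0] by auto
  qed
  show ?thesis
  proof (intro exI allI impI subsetI)
    fix K k i assume K: "k0 \<le> K" "k0 \<le> k" and i: "i \<in> F"
    obtain m n l where "i = (m, n, l)" by (cases i) auto
    then show "i \<in> term_box N K k" using k0[OF i] K i assms(2) by (force simp: term_box_def term_index_def)
  qed
qed

text \<open>An iterated limit need not be the limit along any enumeration, so both estimates are
  passed through the two limits one after the other. They hold for all boxes containing F, where
  independence makes everything explicit; dominated convergence and Fatou's lemma keep them in the
  limit.\<close>

lemma iterated_series:
  assumes M: "prob_space M" and Z: "iid_std_normal M (term_index N) Z" and X: "X \<in> borel_measurable M"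
    and lim: "AE \<omega> in M. \<exists>V. (\<forall>m. (\<lambda>k. \<Sum>n=1..k. \<Sum>l=1..harm_dim m N. a (m, n, l) * Z (m, n, l) \<omega>) \<longlonglongrightarrow> V m)
       \<and> (\<lambda>K. \<Sum>m\<le>K. V m) \<longlonglongrightarrow> X \<omega>"
    and F: "finite F" "F \<subseteq> term_index N"
  shows "norm (char_fun M X t) \<le> exp (- (t\<^sup>2 * (\<Sum>i\<in>F. (a i)\<^sup>2)) / 2)"
    and "(\<And>G. finite G \<Longrightarrow> G \<subseteq> term_index N - F \<Longrightarrow> (\<Sum>i\<in>G. (a i)\<^sup>2) \<le> b) \<Longrightarrow>
      (\<integral>\<^sup>+\<omega>. ennreal ((X \<omega> - (\<Sum>i\<in>F. a i * Z i \<omega>))\<^sup>2) \<partial>M) \<le> ennreal b"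
proof -
  interpret prob_space M by fact
  define S where "S m k \<omega> = (\<Sum>n=1..k. \<Sum>l=1..harm_dim m N. a (m, n, l) * Z (m, n, l) \<omega>)" for m k \<omega>
  \<comment> \<open>The inner sums supplied by the assumption are chosen for each \<omega> without
    measurability; \<open>lim\<close> gives a measurable version that agrees with them almost
    surely.\<close>
  define V where "V m \<omega> = lim (\<lambda>k. S m k \<omega>)" for m \<omega>
  have Zm: "Z (m, n, l) \<in> borel_measurable M" if "n \<ge> 1" "1 \<le> l" "l \<le> harm_dim m N" for m n l
    using iid_std_normal_measurable[OF Z] that by (auto simp: term_index_def)
  have S[measurable]: "S m k \<in> borel_measurable M" for m k
    unfolding S_def[abs_def] by (intro borel_measurable_sum borel_measurable_times Zm) auto
  have V[measurable]: "V m \<in> borel_measurable M" for m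
    unfolding V_def[abs_def] by measurable
  note [measurable] = X
  have AE: "AE \<omega> in M. (\<forall>m. (\<lambda>k. S m k \<omega>) \<longlonglongrightarrow> V m \<omega>) \<and> (\<lambda>K. \<Sum>m\<le>K. V m \<omega>) \<longlonglongrightarrow> X \<omega>"
    using lim
  proof eventually_elim
    case (elim \<omega>)
    then obtain V' where V': "\<And>m. (\<lambda>k. S m k \<omega>) \<longlonglongrightarrow> V' m" "(\<lambda>K. \<Sum>m\<le>K. V' m) \<longlonglongrightarrow> X \<omega>"
      unfolding S_def by blast
    have "V m \<omega> = V' m" for m unfolding V_def by (rule limI[OF V'(1)])
    then show ?case using V' by simp
  qed
  have box: "(\<Sum>m\<le>K. S m k \<omega>) = (\<Sum>i\<in>term_box N K k. a i * Z i \<omega>)" for K k \<omega>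
    unfolding S_def sum_term_box[symmetric, of "\<lambda>i. a i * Z i \<omega>"] ..
  have inner: "AE \<omega> in M. (\<lambda>k. \<Sum>m\<le>K. S m k \<omega>) \<longlonglongrightarrow> (\<Sum>m\<le>K. V m \<omega>)" for K
    using AE
  proof eventually_elim
    case (elim \<omega>)
    then show ?case by (intro tendsto_sum) blast
  qed
  have outer: "AE \<omega> in M. (\<lambda>K. \<Sum>m\<le>K. V m \<omega>) \<longlonglongrightarrow> X \<omega>" using AE by eventually_elim blast
  obtain k0 where k0: "\<And>K k. K \<ge> k0 \<Longrightarrow> k \<ge> k0 \<Longrightarrow> F \<subseteq> term_box N K k"
    using finite_subset_term_box[OF F] by blast
  show "norm (char_fun M X t) \<le> exp (- (t\<^sup>2 * (\<Sum>i\<in>F. (a i)\<^sup>2)) / 2)"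
  proof (rule norm_char_fun_le_lim[OF M _ X outer])
    show "\<forall>\<^sub>F K in sequentially. norm (char_fun M (\<lambda>\<omega>. \<Sum>m\<le>K. V m \<omega>) t) \<le> exp (- (t\<^sup>2 * (\<Sum>i\<in>F. (a i)\<^sup>2)) / 2)"
      using eventually_ge_at_top[of k0]
    proof eventually_elim
      case (elim K)
      show ?case
      proof (rule norm_char_fun_le_lim[OF M _ _ inner])
        show "\<forall>\<^sub>F k in sequentially. norm (char_fun M (\<lambda>\<omega>. \<Sum>m\<le>K. S m k \<omega>) t) \<le> exp (- (t\<^sup>2 * (\<Sum>i\<in>F. (a i)\<^sup>2)) / 2)"
          using eventually_ge_at_top[of k0]
        proof eventually_elim
          case (elim k)
          have "(\<Sum>i\<in>F. (a i)\<^sup>2) \<le> (\<Sum>i\<in>term_box N K k. (a i)\<^sup>2)"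
            using k0[OF \<open>k0 \<le> K\<close> elim] term_box(1) by (intro sum_mono2) auto
          then have "t\<^sup>2 * (\<Sum>i\<in>F. (a i)\<^sup>2) \<le> t\<^sup>2 * (\<Sum>i\<in>term_box N K k. (a i)\<^sup>2)" by (intro mult_left_mono) auto
          then show ?case unfolding box char_fun_gauss_sum[OF M Z term_box(2)] by simp
        qed
      qed measurable
    qed
  qed measurable
  show "(\<integral>\<^sup>+\<omega>. ennreal ((X \<omega> - (\<Sum>i\<in>F. a i * Z i \<omega>))\<^sup>2) \<partial>M) \<le> ennreal b"
    if b: "\<And>G. finite G \<Longrightarrow> G \<subseteq> term_index N - F \<Longrightarrow> (\<Sum>i\<in>G. (a i)\<^sup>2) \<le> b"
  proof -
    define SF where "SF \<omega> = (\<Sum>i\<in>F. a i * Z i \<omega>)" for \<omega>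
    have SF[measurable]: "SF \<in> borel_measurable M"
      unfolding SF_def[abs_def] using F iid_std_normal_measurable[OF Z] by (intro borel_measurable_sum borel_measurable_times) auto
    show ?thesis unfolding SF_def[symmetric]
    proof (rule nn_integral_le_lim)
      show "AE \<omega> in M. (\<lambda>K. (\<Sum>m\<le>K. V m \<omega>) - SF \<omega>) \<longlonglongrightarrow> X \<omega> - SF \<omega>"
        using outer by eventually_elim (intro tendsto_intros)
      show "\<forall>\<^sub>F K in sequentially. (\<integral>\<^sup>+\<omega>. ennreal (((\<Sum>m\<le>K. V m \<omega>) - SF \<omega>)\<^sup>2) \<partial>M) \<le> ennreal b"
        using eventually_ge_at_top[of k0]
      proof eventually_elim
        case (elim K)
        show ?case
        proof (rule nn_integral_le_lim)
          show "AE \<omega> in M. (\<lambda>k. (\<Sum>m\<le>K. S m k \<omega>) - SF \<omega>) \<longlonglongrightarrow> (\<Sum>m\<le>K. V m \<omega>) - SF \<omega>"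
            using inner[of K] by eventually_elim (intro tendsto_diff tendsto_const)
          show "\<forall>\<^sub>F k in sequentially. (\<integral>\<^sup>+\<omega>. ennreal (((\<Sum>m\<le>K. S m k \<omega>) - SF \<omega>)\<^sup>2) \<partial>M) \<le> ennreal b"
            using eventually_ge_at_top[of k0]
          proof eventually_elim
            case (elim k)
            let ?G = "term_box N K k - F"
            have G: "finite ?G" "?G \<subseteq> term_index N - F" using term_box[of N K k] by auto
            have "(\<Sum>m\<le>K. S m k \<omega>) - SF \<omega> = (\<Sum>i\<in>?G. a i * Z i \<omega>)" for \<omega>
              unfolding box SF_def using k0[OF \<open>k0 \<le> K\<close> elim] term_box(1) F by (simp add: sum_diff)
            then have "(\<integral>\<^sup>+\<omega>. ennreal (((\<Sum>m\<le>K. S m k \<omega>) - SF \<omega>)\<^sup>2) \<partial>M) = ennreal (\<Sum>i\<in>?G. (a i)\<^sup>2)"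
              using nn_integral_gauss_sum(1)[OF M Z _ G(1)] G(2) by auto
            then show ?case using b[OF G] by (simp add: ennreal_leI)
          qed
        qed measurable
      qed
    qed measurable
  qed
qed

subsection \<open>Consequences of the representation\<close>

lemma is_mfbm_gaussian:
  assumes "is_mfbm M H \<xi>" "finite P" "P \<subseteq> cball 0 1"
  shows "centred_gaussian M (\<lambda>\<omega>. \<Sum>x\<in>P. b x * \<xi> x \<omega>)"
  using assms by (auto simp: is_mfbm_def centred_gaussian_field_def)

lemma is_mfbm_measurable:
  assumes "is_mfbm M H \<xi>" "x \<in> cball 0 1"
  shows "\<xi> x \<in> borel_measurable M" "centred_gaussian M (\<xi> x)"
  using is_mfbm_gaussian[OF assms(1), of "{x}" "\<lambda>_. 1"] assms(2) by (auto simp: centred_gaussian_def)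

lemma centred_gaussian_square_integrable:
  assumes M: "prob_space M" and X: "centred_gaussian M X"
  shows "integrable M (\<lambda>\<omega>. (X \<omega>)\<^sup>2)"
proof -
  interpret prob_space M by fact
  have [measurable]: "X \<in> borel_measurable M" using X by (simp add: centred_gaussian_def)
  consider "AE \<omega> in M. X \<omega> = 0" | \<sigma> where "\<sigma> > 0" "distributed M lborel X (normal_density 0 \<sigma>)"
    using X by (auto simp: centred_gaussian_def)
  then show ?thesis
  proof cases
    case 1
    have "integrable M (\<lambda>\<omega>. (X \<omega>)\<^sup>2) = integrable M (\<lambda>\<omega>. 0 :: real)" using 1 by (intro integrable_cong_AE) auto
    then show ?thesis by simp
  next
    case 2
    then show ?thesis
      using distributed_integrable[OF 2(2), of "\<lambda>x. x\<^sup>2"] integrable_normal_moment[OF 2(1), of 0 2] by simp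
  qed
qed

lemma is_mfbm_variance:
  assumes mf: "is_mfbm M H \<xi>" and P: "finite P" "P \<subseteq> cball 0 1"
  shows "(\<integral>\<omega>. (\<Sum>x\<in>P. b x * \<xi> x \<omega>)\<^sup>2 \<partial>M) =
    (\<Sum>x\<in>P. \<Sum>y\<in>P. b x * b y * ((norm x powr (2 * H) + norm y powr (2 * H) - norm (x - y) powr (2 * H)) / 2))"
proof -
  interpret prob_space M using mf by (simp add: is_mfbm_def)
  have M: "prob_space M" by (rule prob_space_axioms)
  \<comment> \<open>The covariances are Bochner integrals, so expanding the square under the
    integral needs integrability of every product; it follows from the Gaussian second
    moments.\<close>
  have int: "integrable M (\<lambda>\<omega>. \<xi> x \<omega> * \<xi> y \<omega>)" if "x \<in> P" "y \<in> P" for x y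
  proof (rule Bochner_Integration.integrable_bound)
    have c: "centred_gaussian M (\<xi> x)" "centred_gaussian M (\<xi> y)" and [measurable]: "\<xi> x \<in> borel_measurable M" "\<xi> y \<in> borel_measurable M"
      using that P is_mfbm_measurable[OF mf] by auto
    show "integrable M (\<lambda>\<omega>. (\<xi> x \<omega>)\<^sup>2 + (\<xi> y \<omega>)\<^sup>2)" using centred_gaussian_square_integrable[OF M] c by auto
    show "(\<lambda>\<omega>. \<xi> x \<omega> * \<xi> y \<omega>) \<in> borel_measurable M" by measurable
    show "AE \<omega> in M. norm (\<xi> x \<omega> * \<xi> y \<omega>) \<le> norm ((\<xi> x \<omega>)\<^sup>2 + (\<xi> y \<omega>)\<^sup>2)"
    proof (rule AE_I2)
      fix \<omega>
      have "2 * (\<bar>\<xi> x \<omega>\<bar> * \<bar>\<xi> y \<omega>\<bar>) \<le> (\<xi> x \<omega>)\<^sup>2 + (\<xi> y \<omega>)\<^sup>2"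
        using sum_squares_bound[of "\<bar>\<xi> x \<omega>\<bar>" "\<bar>\<xi> y \<omega>\<bar>"] by simp
      moreover have "0 \<le> \<bar>\<xi> x \<omega>\<bar> * \<bar>\<xi> y \<omega>\<bar>" by simp
      ultimately have "\<bar>\<xi> x \<omega>\<bar> * \<bar>\<xi> y \<omega>\<bar> \<le> (\<xi> x \<omega>)\<^sup>2 + (\<xi> y \<omega>)\<^sup>2" by linarith
      then show "norm (\<xi> x \<omega> * \<xi> y \<omega>) \<le> norm ((\<xi> x \<omega>)\<^sup>2 + (\<xi> y \<omega>)\<^sup>2)" by (simp add: abs_mult)
    qed
  qed
  have "(\<integral>\<omega>. (\<Sum>x\<in>P. b x * \<xi> x \<omega>)\<^sup>2 \<partial>M) = (\<integral>\<omega>. (\<Sum>x\<in>P. \<Sum>y\<in>P. b x * b y * (\<xi> x \<omega> * \<xi> y \<omega>)) \<partial>M)"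
    by (simp add: power2_eq_square sum_product mult_ac)
  also have "\<dots> = (\<Sum>x\<in>P. \<Sum>y\<in>P. b x * b y * (\<integral>\<omega>. \<xi> x \<omega> * \<xi> y \<omega> \<partial>M))"
    using int by (simp add: Bochner_Integration.integral_sum)
  also have "\<dots> = (\<Sum>x\<in>P. \<Sum>y\<in>P. b x * b y * ((norm x powr (2 * H) + norm y powr (2 * H) - norm (x - y) powr (2 * H)) / 2))"
    using mf P by (intro sum.cong refl) (auto simp: is_mfbm_def subset_iff)
  finally show ?thesis .
qed

lemma is_mfbm_increment:
  assumes mf: "is_mfbm M H \<xi>" and xy: "x \<in> cball 0 1" "y \<in> cball 0 1"
  shows "(\<integral>\<omega>. (\<xi> x \<omega> - \<xi> y \<omega>)\<^sup>2 \<partial>M) = norm (x - y) powr (2 * H)" "centred_gaussian M (\<lambda>\<omega>. \<xi> x \<omega> - \<xi> y \<omega>)"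
proof -
  interpret prob_space M using mf by (simp add: is_mfbm_def)
  \<comment> \<open>Written as a difference of indicators so that x = y is covered: the coefficient
    is then 0.\<close>
  define b where "b z = (if z = x then 1 else 0) - (if z = y then 1 else (0::real))" for z
  have e: "(\<Sum>z\<in>{x, y}. b z * f z) = f x - f y" for f
    by (cases "x = y") (auto simp: b_def)
  have fin: "finite {x, y}" "{x, y} \<subseteq> cball 0 1" using xy by auto
  from is_mfbm_gaussian[OF mf fin, of b] show "centred_gaussian M (\<lambda>\<omega>. \<xi> x \<omega> - \<xi> y \<omega>)" unfolding e .
  let ?R = "\<lambda>u v. (norm u powr (2 * H) + norm v powr (2 * H) - norm (u - v) powr (2 * H)) / 2"
  have "(\<integral>\<omega>. (\<xi> x \<omega> - \<xi> y \<omega>)\<^sup>2 \<partial>M) = (\<Sum>u\<in>{x, y}. b u * (\<Sum>v\<in>{x, y}. b v * ?R u v))"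
    by (simp only: is_mfbm_variance[OF mf fin, of b, unfolded e] sum_distrib_left mult.assoc)
  also have "\<dots> = (?R x x - ?R x y) - (?R y x - ?R y y)" unfolding e ..
  also have "\<dots> = norm (x - y) powr (2 * H)" by (simp add: norm_minus_commute[of y x] field_simps)
  finally show "(\<integral>\<omega>. (\<xi> x \<omega> - \<xi> y \<omega>)\<^sup>2 \<partial>M) = norm (x - y) powr (2 * H)" .
qed

text \<open>The modulus of the characteristic function at 1 suffices: for the Gaussian increment it
  is exp (- |x - y|^(2H) / 2), and by the series it is at most exp (- s / 2) with s the finite sum
  in question.\<close>

theorem mfbm_series_increments:
  fixes e :: "nat \<Rightarrow> 'n::finite"
  assumes mf: "is_mfbm M H \<xi>" and rep: "mfbm_series_rep M H e \<xi> Z"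
    and F: "finite F" "F \<subseteq> term_index CARD('n)" and xy: "x \<in> cball 0 1" "y \<in> cball 0 1"
  shows "(\<Sum>i\<in>F. (mfbm_term H e i x - mfbm_term H e i y)\<^sup>2) \<le> norm (x - y) powr (2 * H)"
proof -
  have M: "prob_space M" using mf by (simp add: is_mfbm_def)
  have Z: "iid_std_normal M (term_index CARD('n)) Z" using rep by (simp add: mfbm_series_rep_def)
  let ?X = "\<lambda>\<omega>. \<xi> x \<omega> - \<xi> y \<omega>" and ?a = "\<lambda>i. mfbm_term H e i x - mfbm_term H e i y"
  have X: "?X \<in> borel_measurable M" using is_mfbm_measurable(1)[OF mf] xy by auto
  have "AE \<omega> in M. \<exists>V. (\<forall>m. (\<lambda>k. \<Sum>n=1..k. \<Sum>l=1..harm_dim m CARD('n). ?a (m, n, l) * Z (m, n, l) \<omega>) \<longlonglongrightarrow> V m)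
       \<and> (\<lambda>K. \<Sum>m\<le>K. V m) \<longlonglongrightarrow> ?X \<omega>"
    using conjunct2[OF rep[unfolded mfbm_series_rep_def]]
  proof eventually_elim
    case (elim \<omega>)
    then obtain V where V: "\<And>m. uniform_limit (cball 0 1)
           (\<lambda>k x. \<Sum>n = 1..k. \<Sum>l = 1..harm_dim m CARD('n). mfbm_term H e (m, n, l) x * Z (m, n, l) \<omega>) (V m) sequentially"
      "uniform_limit (cball 0 1) (\<lambda>k x. \<Sum>m\<le>k. V m x) (\<lambda>x. \<xi> x \<omega>) sequentially" by blast
    have "(\<lambda>k. \<Sum>n=1..k. \<Sum>l=1..harm_dim m CARD('n). ?a (m, n, l) * Z (m, n, l) \<omega>) \<longlonglongrightarrow> V m x - V m y" for m
      using tendsto_diff[OF tendsto_uniform_limitI[OF V(1) xy(1)] tendsto_uniform_limitI[OF V(1) xy(2)], of m m]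
      by (simp add: sum_subtractf[symmetric] left_diff_distrib)
    moreover have "(\<lambda>K. \<Sum>m\<le>K. V m x - V m y) \<longlonglongrightarrow> ?X \<omega>"
      using tendsto_diff[OF tendsto_uniform_limitI[OF V(2) xy(1)] tendsto_uniform_limitI[OF V(2) xy(2)]]
      by (simp add: sum_subtractf)
    ultimately show ?case by (intro exI[of _ "\<lambda>m. V m x - V m y"]) blast
  qed
  from iterated_series(1)[OF M Z X this F, of 1]
  have "exp (- ((norm (x - y) powr (2 * H)) / 2)) \<le> exp (- (\<Sum>i\<in>F. (?a i)\<^sup>2) / 2)"
    unfolding char_fun_centred_gaussian[OF M is_mfbm_increment(2)[OF mf xy]] is_mfbm_increment(1)[OF mf xy] by simp
  then show ?thesis by simp
qed

subsection \<open>The maximum principle\<close>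

lemma continuous_on_of_holder:
  fixes f :: "'b::real_normed_vector \<Rightarrow> real"
  assumes H: "H > 0" and h: "\<And>x y. x \<in> S \<Longrightarrow> y \<in> S \<Longrightarrow> \<bar>f x - f y\<bar> \<le> K * norm (x - y) powr H"
  shows "continuous_on S f"
  unfolding continuous_on_def
proof
  fix x assume x: "x \<in> S"
  have "((\<lambda>y. K * norm (y - x) powr H) \<longlongrightarrow> K * norm (x - x) powr H) (at x within S)"
    using H by (intro tendsto_intros tendsto_powr2) auto
  then have "((\<lambda>y. K * norm (y - x) powr H) \<longlongrightarrow> 0) (at x within S)" by simp
  moreover have "\<forall>\<^sub>F y in at x within S. norm (f y - f x) \<le> K * norm (y - x) powr H"
    using h x by (auto simp: eventually_at_filter)
  ultimately have "((\<lambda>y. f y - f x) \<longlongrightarrow> 0) (at x within S)" by (rule Lim_null_comparison[rotated])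
  then show "(f \<longlongrightarrow> f x) (at x within S)" by (rule LIM_zero_cancel)
qed

lemma coords_add_axis:
  fixes e :: "nat \<Rightarrow> 'n::finite"
  assumes e: "bij_betw e {1..CARD('n)} UNIV" and i: "i \<in> {1..CARD('n)}"
  shows "coords e (y + (t - y $ e i) *\<^sub>R axis (e i) 1) = (coords e y)(i := t)"
proof
  fix k
  have "e k = e i \<longleftrightarrow> k = i" if "k \<in> {1..CARD('n)}"
    using that i by (rule inj_on_eq_iff[OF bij_betw_imp_inj_on[OF e]])
  then show "coords e (y + (t - y $ e i) *\<^sub>R axis (e i) 1) k = ((coords e y)(i := t)) k"
    using i by (auto simp: coords_def axis_def)
qed

text \<open>If the claim fails there is an a strictly between b and A. Adding a |y - x|^2 / (2 N) to
  G raises the boundary values above the value at the centre, so the minimum is interior and all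
  second derivatives there are nonnegative; but they sum to at most a - A < 0.\<close>

lemma maximum_principle:
  fixes e :: "nat \<Rightarrow> 'n::finite" and x :: "real ^ 'n"
  assumes e: "bij_betw e {1..CARD('n)} UNIV"
    and D: "has_partials {1..CARD('n)} G D D2"
    and lap: "\<And>y. y \<in> ball x \<rho> \<Longrightarrow> (\<Sum>i\<in>{1..CARD('n)}. D2 i (coords e y)) \<le> - A"
    and cont: "continuous_on (cball x \<rho>) (\<lambda>y. G (coords e y))"
    and osc: "\<And>y. y \<in> cball x \<rho> \<Longrightarrow> \<bar>G (coords e y) - G (coords e x)\<bar> \<le> B"
    and \<rho>: "\<rho> > 0"
  shows "A * \<rho>\<^sup>2 \<le> 2 * real CARD('n) * B"
proof (rule ccontr)
  let ?N = "real CARD('n)" and ?K = "{1..CARD('n)}"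
  assume neg: "\<not> ?thesis"
  define b where "b = 2 * ?N * B / \<rho>\<^sup>2"
  define a where "a = (A + b) / 2"
  have "b < A" using neg \<rho> by (simp add: b_def field_simps)
  then have a: "b < a" "a < A" by (auto simp: a_def)
  define \<Phi> where "\<Phi> y = G (coords e y) + a / (2 * ?N) * (norm (y - x))\<^sup>2" for y
  have "continuous_on (cball x \<rho>) \<Phi>" unfolding \<Phi>_def by (intro continuous_intros cont)
  then obtain y0 where y0: "y0 \<in> cball x \<rho>" "\<And>y. y \<in> cball x \<rho> \<Longrightarrow> \<Phi> y0 \<le> \<Phi> y"
    using continuous_attains_inf[OF compact_cball, of x \<rho> \<Phi>] \<rho> by auto
  have "norm (y0 - x) < \<rho>"
  proof (rule ccontr)
    assume "\<not> norm (y0 - x) < \<rho>"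
    then have r: "norm (y0 - x) = \<rho>" using y0(1) by (simp add: dist_norm norm_minus_commute)
    have "\<Phi> y0 \<le> \<Phi> x" using y0(2)[of x] \<rho> by simp
    then have "a / (2 * ?N) * \<rho>\<^sup>2 \<le> G (coords e x) - G (coords e y0)" by (simp add: \<Phi>_def r)
    also have "\<dots> \<le> B" using osc[OF y0(1)] by linarith
    finally have "a \<le> b" using \<rho> by (simp add: b_def field_simps)
    then show False using a by simp
  qed
  then have y0b: "y0 \<in> ball x \<rho>" by (simp add: dist_norm norm_minus_commute)
  have second: "D2 i (coords e y0) + a / ?N \<ge> 0" if i: "i \<in> ?K" for i
  proof -
    define c where "c = y0 $ e i"
    define d where "d = (y0 - x) $ e i"
    define r where "r = \<rho> - norm (y0 - x)"
    have r: "r > 0" using \<open>norm (y0 - x) < \<rho>\<close> by (simp add: r_def)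
    \<comment> \<open>The squared distance to x after moving y0 along the i-th axis until its
      coordinate is t.\<close>
    define q where "q t = (norm (y0 - x))\<^sup>2 + 2 * (t - c) * d + (t - c)\<^sup>2" for t
    define \<phi> where "\<phi> t = - (G ((coords e y0)(i := t)) + a / (2 * ?N) * q t)" for t
    define \<phi>' where "\<phi>' t = - (D i ((coords e y0)(i := t)) + a / (2 * ?N) * (2 * d + 2 * (t - c)))" for t
    have ci: "coords e y0 i = c" using i by (simp add: coords_def c_def)
    have line: "\<Phi> (y0 + (t - c) *\<^sub>R axis (e i) 1) = - \<phi> t" for t
    proof -
      have "norm (y0 + (t - c) *\<^sub>R axis (e i) 1 - x) ^ 2 = q t"
      proof -
        define a where "a = y0 - x"
        define b where "b = (axis (e i) 1 :: real ^ 'n)"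
        have ab: "a \<bullet> b = d" "b \<bullet> a = d" "b \<bullet> b = 1"
          unfolding a_def b_def d_def by (simp_all only: inner_axis inner_axis' inner_axis_axis inner_real_def) simp_all
        have "y0 + (t - c) *\<^sub>R b - x = a + (t - c) *\<^sub>R b" by (simp add: a_def)
        then show ?thesis unfolding b_def[symmetric] q_def a_def[symmetric] power2_norm_eq_inner
          by (simp only: inner_add_left inner_add_right inner_scaleR_left inner_scaleR_right ab)
             (simp add: algebra_simps power2_eq_square)
      qed
      then show ?thesis unfolding \<Phi>_def \<phi>_def using coords_add_axis[OF e i, of y0 t] by (simp add: c_def)
    qed
    have Gd: "((\<lambda>t. G ((coords e y0)(i := t))) has_real_derivative D i ((coords e y0)(i := t))) (at t)"
      "((\<lambda>t. D i ((coords e y0)(i := t))) has_real_derivative D2 i ((coords e y0)(i := t))) (at t)" for t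
      using D[unfolded has_partials_def, rule_format, OF i, of "(coords e y0)(i := t)"]
      by (simp_all only: fun_upd_same fun_upd_upd)
    have "- (D2 i ((coords e y0)(i := c)) + a / (2 * ?N) * 2) \<le> 0"
    proof (rule second_derivative_nonpos_at_max[of "c - r" c "c + r" \<phi> \<phi>'])
      show "(\<phi> has_real_derivative \<phi>' t) (at t)" for t
        unfolding \<phi>_def[abs_def] \<phi>'_def q_def
        by (intro DERIV_minus DERIV_add DERIV_cmult Gd) (auto intro!: derivative_eq_intros)
      show "(\<phi>' has_real_derivative - (D2 i ((coords e y0)(i := c)) + a / (2 * ?N) * 2)) (at c)"
        unfolding \<phi>'_def[abs_def]
        by (intro DERIV_minus DERIV_add DERIV_cmult Gd) (auto intro!: derivative_eq_intros)
      show "\<phi> t \<le> \<phi> c" if t: "c - r < t" "t < c + r" for t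
      proof -
        have "norm (y0 + (t - c) *\<^sub>R axis (e i) 1 - x) \<le> norm (y0 - x) + norm ((t - c) *\<^sub>R axis (e i) (1::real))"
          by (metis add_diff_eq add.commute diff_add_eq norm_triangle_ineq)
        also have "norm ((t - c) *\<^sub>R axis (e i) (1::real)) = \<bar>t - c\<bar>" by simp
        also have "norm (y0 - x) + \<bar>t - c\<bar> \<le> \<rho>" using t by (auto simp: r_def)
        finally have "y0 + (t - c) *\<^sub>R axis (e i) 1 \<in> cball x \<rho>" by (simp add: dist_norm norm_minus_commute)
        then have "\<Phi> y0 \<le> - \<phi> t" using y0(2) line by metis
        moreover have "\<Phi> y0 = - \<phi> c" using line[of c] by simp
        ultimately show ?thesis by simp
      qed
    qed (use r in auto)
    moreover have "(coords e y0)(i := c) = coords e y0" using ci by auto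
    ultimately show ?thesis by simp
  qed
  have "0 \<le> (\<Sum>i\<in>?K. D2 i (coords e y0) + a / ?N)" using second by (intro sum_nonneg) auto
  also have "\<dots> = (\<Sum>i\<in>?K. D2 i (coords e y0)) + a" by (simp add: sum.distrib)
  also have "\<dots> \<le> - A + a" using lap[OF y0b] by simp
  finally show False using a by simp
qed

lemma has_partials_sum:
  assumes "\<And>j. j \<in> F \<Longrightarrow> has_partials K (v j) (D j) (D2 j)"
  shows "has_partials K (\<lambda>X. \<Sum>j\<in>F. c j * v j X) (\<lambda>i X. \<Sum>j\<in>F. c j * D j i X) (\<lambda>i X. \<Sum>j\<in>F. c j * D2 j i X)"
  using assms unfolding has_partials_def by (auto intro!: DERIV_sum DERIV_cmult)

text \<open>Bounds the norm of the whole vector of values at x by testing it against its own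
  direction, which reduces the family to one scalar function and its potential.\<close>

lemma helmholtz_interior_bound:
  fixes e :: "nat \<Rightarrow> 'n::finite" and x :: "real ^ 'n"
  assumes e: "bij_betw e {1..CARD('n)} UNIV" and H: "H > 0" and F: "finite F"
    and v: "\<And>i. i \<in> F \<Longrightarrow> has_partials {1..CARD('n)} (v i) (D i) (D2 i)"
    and lap: "\<And>i X. i \<in> F \<Longrightarrow> (\<Sum>k\<in>{1..CARD('n)}. D2 i k X) = - ((j i)\<^sup>2 * v i X)"
    and j: "\<And>i. i \<in> F \<Longrightarrow> j i \<ge> T" and T: "T > 0"
    and holder: "\<And>x y :: real ^ 'n. x \<in> S \<Longrightarrow> y \<in> S \<Longrightarrow> (\<Sum>i\<in>F. (v i (coords e x) - v i (coords e y))\<^sup>2) \<le> norm (x - y) powr (2 * H)"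
    and S: "cball x (1 / T) \<subseteq> S"
  shows "L2_set (\<lambda>i. v i (coords e x)) F \<le> (1 + 2 * real CARD('n)) * T powr (- H)"
proof (cases "L2_set (\<lambda>i. v i (coords e x)) F = 0")
  case True
  then show ?thesis by simp
next
  case False
  define s where "s = L2_set (\<lambda>i. v i (coords e x)) F"
  have s: "s > 0" using False by (simp add: s_def order_less_le)
  \<comment> \<open>The unit vector in the direction of the values at x: the combination with these
    coefficients takes the value s there.\<close>
  define c where "c i = v i (coords e x) / s" for i
  have c1: "(\<Sum>i\<in>F. (c i)\<^sup>2) = 1"
  proof -
    have "(\<Sum>i\<in>F. (c i)\<^sup>2) = (\<Sum>i\<in>F. (v i (coords e x))\<^sup>2) / s\<^sup>2" by (simp add: c_def power_divide sum_divide_distrib)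
    also have "(\<Sum>i\<in>F. (v i (coords e x))\<^sup>2) = s\<^sup>2" by (simp add: s_def L2_set_def sum_nonneg)
    finally show ?thesis using s by simp
  qed
  \<comment> \<open>Cauchy-Schwarz turns the Hoelder bound for the family into one for combinations
    with bounded multipliers b: the multiplier is 1 for the function itself and 1 / j^2 for its
    potential.\<close>
  have cs: "\<bar>\<Sum>i\<in>F. c i * (b i * (v i (coords e y) - v i (coords e z)))\<bar> \<le> K * norm (y - z) powr H"
    if "y \<in> S" "z \<in> S" "\<And>i. i \<in> F \<Longrightarrow> \<bar>b i\<bar> \<le> K" "K \<ge> 0" for b y z K
  proof -
    have "(\<Sum>i\<in>F. c i * (b i * (v i (coords e y) - v i (coords e z))))\<^sup>2
        \<le> (\<Sum>i\<in>F. (c i)\<^sup>2) * (\<Sum>i\<in>F. (b i * (v i (coords e y) - v i (coords e z)))\<^sup>2)" by (rule Cauchy_Schwarz_ineq_sum)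
    also have "\<dots> \<le> (\<Sum>i\<in>F. K\<^sup>2 * (v i (coords e y) - v i (coords e z))\<^sup>2)"
      unfolding c1 mult_1 power_mult_distrib
    proof (intro sum_mono mult_right_mono)
      fix i assume "i \<in> F"
      then show "(b i)\<^sup>2 \<le> K\<^sup>2" using that(3)[of i] that(4) abs_le_square_iff[of "b i" K] by simp
    qed simp
    also have "\<dots> \<le> K\<^sup>2 * norm (y - z) powr (2 * H)"
      unfolding sum_distrib_left[symmetric] by (intro mult_left_mono holder that) simp
    also have "\<dots> = (K * norm (y - z) powr H)\<^sup>2"
      by (simp add: power_mult_distrib power2_eq_square powr_add[symmetric])
    finally show ?thesis using that(4) by (simp add: abs_le_square_iff[symmetric] abs_mult)
  qed
  define \<rho> where "\<rho> = 1 / T"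
  have \<rho>: "\<rho> > 0" using T by (simp add: \<rho>_def)
  have xS: "x \<in> S" using S \<rho> by (auto simp: \<rho>_def)
  define b where "b i = 1 / (j i)\<^sup>2" for i
  define G where "G X = (\<Sum>i\<in>F. (c i * b i) * v i X)" for X
  have jp: "j i > 0" if "i \<in> F" for i using j[OF that] T by simp
  have b: "\<bar>b i\<bar> \<le> \<rho>\<^sup>2" if "i \<in> F" for i
  proof -
    have "1 / (j i)\<^sup>2 \<le> 1 / T\<^sup>2" using j[OF that] T by (intro divide_left_mono power_mono mult_pos_pos) (auto intro!: zero_less_power jp that)
    then show ?thesis by (simp add: b_def \<rho>_def power_divide)
  qed
  \<comment> \<open>On the ball the combination stays above s - \<rho>^H, while the potential
    oscillates by at most \<rho>^(2 + H); the factor \<rho>^2 cancels afterwards.\<close>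
  have "(s - \<rho> powr H) * \<rho>\<^sup>2 \<le> 2 * real CARD('n) * (\<rho>\<^sup>2 * \<rho> powr H)"
  proof (rule maximum_principle[OF e, where G = G])
    show "has_partials {1..CARD('n)} G (\<lambda>k X. \<Sum>i\<in>F. (c i * b i) * D i k X) (\<lambda>k X. \<Sum>i\<in>F. (c i * b i) * D2 i k X)"
      unfolding G_def[abs_def] by (rule has_partials_sum[OF v])
    have Gdiff: "G (coords e y) - G (coords e z) = (\<Sum>i\<in>F. c i * (b i * (v i (coords e y) - v i (coords e z))))" for y z
      unfolding G_def by (simp add: sum_subtractf[symmetric] algebra_simps)
    show "continuous_on (cball x \<rho>) (\<lambda>y. G (coords e y))"
    proof (rule continuous_on_of_holder[OF H])
      show "\<bar>G (coords e y) - G (coords e z)\<bar> \<le> \<rho>\<^sup>2 * norm (y - z) powr H" if "y \<in> cball x \<rho>" "z \<in> cball x \<rho>" for y z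
        unfolding Gdiff using that S by (intro cs b) (auto simp: \<rho>_def)
    qed
    show "\<bar>G (coords e y) - G (coords e x)\<bar> \<le> \<rho>\<^sup>2 * \<rho> powr H" if y: "y \<in> cball x \<rho>" for y
    proof -
      have "\<bar>G (coords e y) - G (coords e x)\<bar> \<le> \<rho>\<^sup>2 * norm (y - x) powr H"
        unfolding Gdiff using y S xS by (intro cs b) (auto simp: \<rho>_def)
      also have "\<dots> \<le> \<rho>\<^sup>2 * \<rho> powr H"
        using y H by (intro mult_left_mono powr_mono2) (auto simp: dist_norm norm_minus_commute)
      finally show ?thesis .
    qed
    show "(\<Sum>k\<in>{1..CARD('n)}. \<Sum>i\<in>F. (c i * b i) * D2 i k (coords e y)) \<le> - (s - \<rho> powr H)" if y: "y \<in> ball x \<rho>" for y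
    proof -
      have "(\<Sum>k\<in>{1..CARD('n)}. \<Sum>i\<in>F. (c i * b i) * D2 i k (coords e y)) = (\<Sum>i\<in>F. (c i * b i) * (\<Sum>k\<in>{1..CARD('n)}. D2 i k (coords e y)))"
        by (subst sum.swap) (simp add: sum_distrib_left)
      also have "\<dots> = (\<Sum>i\<in>F. - (c i * v i (coords e y)))"
      proof (intro sum.cong refl)
        fix i assume "i \<in> F"
        then show "c i * b i * (\<Sum>k\<in>{1..CARD('n)}. D2 i k (coords e y)) = - (c i * v i (coords e y))"
          unfolding lap[OF \<open>i \<in> F\<close>] b_def using jp[of i] by simp
      qed
      also have "\<dots> = - (\<Sum>i\<in>F. c i * v i (coords e x)) - (\<Sum>i\<in>F. c i * (1 * (v i (coords e y) - v i (coords e x))))"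
        by (simp add: sum_negf sum_subtractf algebra_simps)
      also have "(\<Sum>i\<in>F. c i * v i (coords e x)) = s"
      proof -
        have "(\<Sum>i\<in>F. c i * v i (coords e x)) = (\<Sum>i\<in>F. s * (c i)\<^sup>2)"
          using s by (intro sum.cong) (auto simp: c_def power2_eq_square)
        then show ?thesis using c1 by (simp add: sum_distrib_left[symmetric])
      qed
      also have "- s - (\<Sum>i\<in>F. c i * (1 * (v i (coords e y) - v i (coords e x)))) \<le> - (s - \<rho> powr H)"
      proof -
        have "\<bar>\<Sum>i\<in>F. c i * (1 * (v i (coords e y) - v i (coords e x)))\<bar> \<le> 1 * norm (y - x) powr H"
          using y S xS by (intro cs[where b = "\<lambda>_. 1"]) (auto simp: \<rho>_def)
        also have "\<dots> \<le> \<rho> powr H"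
          using y H by (simp add: powr_mono2 dist_norm norm_minus_commute)
        finally show ?thesis by linarith
      qed
      finally show ?thesis .
    qed
  qed (use \<rho> in auto)
  then have "(s - \<rho> powr H) * \<rho>\<^sup>2 \<le> (2 * real CARD('n) * \<rho> powr H) * \<rho>\<^sup>2" by (simp only: ac_simps)
  then have "s - \<rho> powr H \<le> 2 * real CARD('n) * \<rho> powr H"
    by (rule mult_right_le_imp_le) (use \<rho> in simp)
  moreover have "\<rho> powr H = T powr (- H)" unfolding \<rho>_def powr_minus_divide using T by (subst powr_divide) auto
  ultimately show ?thesis unfolding s_def by (simp add: algebra_simps)
qed

text \<open>The interior bound needs a ball of radius 1/T inside the unit ball, so x is first pulled
  back to (1 - 1/T) x at the Hoelder price T^(-H). As u = v - v(0), the interior bound enters twice: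
  1 + 2 (1 + 2 N) = 3 + 4 N.\<close>

theorem helmholtz_tail_bound:
  fixes e :: "nat \<Rightarrow> 'n::finite" and u :: "'i \<Rightarrow> real ^ 'n \<Rightarrow> real"
  assumes e: "bij_betw e {1..CARD('n)} UNIV" and H: "H > 0" and F: "finite F"
    and u: "\<And>i. i \<in> F \<Longrightarrow> \<exists>v D D2. has_partials {1..CARD('n)} v D D2 \<and>
      (\<forall>X. (\<Sum>k\<in>{1..CARD('n)}. D2 k X) = - ((j i)\<^sup>2 * v X)) \<and> (\<forall>x. u i x = v (coords e x) - v (coords e 0))"
    and j: "\<And>i. i \<in> F \<Longrightarrow> j i \<ge> T" and T: "T \<ge> 2"
    and holder: "\<And>x y. x \<in> cball 0 1 \<Longrightarrow> y \<in> cball 0 1 \<Longrightarrow> (\<Sum>i\<in>F. (u i x - u i y)\<^sup>2) \<le> norm (x - y) powr (2 * H)"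
    and x: "x \<in> cball 0 1"
  shows "(\<Sum>i\<in>F. (u i x)\<^sup>2) \<le> (3 + 4 * real CARD('n))\<^sup>2 * T powr (- 2 * H)"
proof -
  have "\<exists>v D D2. \<forall>i\<in>F. has_partials {1..CARD('n)} (v i) (D i) (D2 i) \<and>
      (\<forall>X. (\<Sum>k\<in>{1..CARD('n)}. D2 i k X) = - ((j i)\<^sup>2 * v i X)) \<and> (\<forall>x. u i x = v i (coords e x) - v i (coords e 0))"
    using u by metis
  then obtain v D D2 where v: "\<And>i. i \<in> F \<Longrightarrow> has_partials {1..CARD('n)} (v i) (D i) (D2 i)"
    and lap: "\<And>i X. i \<in> F \<Longrightarrow> (\<Sum>k\<in>{1..CARD('n)}. D2 i k X) = - ((j i)\<^sup>2 * v i X)"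
    and uv: "\<And>i x. i \<in> F \<Longrightarrow> u i x = v i (coords e x) - v i (coords e 0)" by blast
  have holder': "(\<Sum>i\<in>F. (v i (coords e x) - v i (coords e y))\<^sup>2) \<le> norm (x - y) powr (2 * H)"
    if "x \<in> cball 0 1" "y \<in> cball 0 1" for x y
    using holder[OF that] uv by (simp cong: sum.cong)
  define A where "A = (1 + 2 * real CARD('n)) * T powr (- H)"
  have int: "L2_set (\<lambda>i. v i (coords e y)) F \<le> A" if "norm y \<le> 1 - 1 / T" for y
    unfolding A_def
  proof (rule helmholtz_interior_bound[OF e H F v lap j _ holder'])
    show "cball y (1 / T) \<subseteq> cball 0 1"
    proof
      fix z assume "z \<in> cball y (1 / T)"
      then have "norm (z - y) \<le> 1 / T" by (simp add: dist_norm norm_minus_commute)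
      moreover have "norm z \<le> norm y + norm (z - y)" using norm_triangle_ineq[of y "z - y"] by simp
      ultimately show "z \<in> cball 0 1" using that by simp
    qed
  qed (use T in auto)
  define y where "y = (1 - 1 / T) *\<^sub>R x"
  have T1: "0 \<le> 1 - 1 / T" using T by simp
  have nx: "norm x \<le> 1" using x by simp
  have ny: "norm y \<le> 1 - 1 / T" unfolding y_def using T1 nx by (simp add: mult_left_le)
  have yB: "y \<in> cball 0 1" using order_trans[OF ny, of 1] T by simp
  have "x - y = (1 / T) *\<^sub>R x" by (simp add: y_def algebra_simps)
  then have "norm (x - y) \<le> 1 / T" using nx T by (simp add: divide_right_mono)
  then have "norm (x - y) powr (2 * H) \<le> (1 / T) powr (2 * H)" using H by (intro powr_mono2) auto
  also have "\<dots> = (T powr (- H))\<^sup>2"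
    using T by (simp add: powr_minus_divide powr_divide power_divide power2_eq_square powr_add[symmetric])
  finally have "(\<Sum>i\<in>F. (u i x - u i y)\<^sup>2) \<le> (T powr (- H))\<^sup>2" using holder[OF x yB] by simp
  then have d: "L2_set (\<lambda>i. u i x - u i y) F \<le> T powr (- H)"
    unfolding L2_set_def by (metis powr_ge_zero real_le_lsqrt real_sqrt_le_iff real_sqrt_abs abs_of_nonneg real_sqrt_power)
  have "L2_set (\<lambda>i. u i x) F = L2_set (\<lambda>i. (u i x - u i y) + (v i (coords e y) + - v i (coords e 0))) F"
    by (intro L2_set_cong) (auto simp: uv)
  also have "\<dots> \<le> L2_set (\<lambda>i. u i x - u i y) F + L2_set (\<lambda>i. v i (coords e y) + - v i (coords e 0)) F"
    by (rule L2_set_triangle_ineq)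
  also have "\<dots> \<le> L2_set (\<lambda>i. u i x - u i y) F + (L2_set (\<lambda>i. v i (coords e y)) F + L2_set (\<lambda>i. - v i (coords e 0)) F)"
    by (intro add_left_mono L2_set_triangle_ineq)
  also have "L2_set (\<lambda>i. - v i (coords e 0)) F = L2_set (\<lambda>i. v i (coords e 0)) F" by (simp add: L2_set_def)
  also have "L2_set (\<lambda>i. u i x - u i y) F + (L2_set (\<lambda>i. v i (coords e y)) F + L2_set (\<lambda>i. v i (coords e 0)) F)
      \<le> T powr (- H) + (A + A)"
    using T1 by (intro add_mono d int ny) auto
  also have "\<dots> = (3 + 4 * real CARD('n)) * T powr (- H)" by (simp add: A_def algebra_simps)
  finally have "(L2_set (\<lambda>i. u i x) F)\<^sup>2 \<le> ((3 + 4 * real CARD('n)) * T powr (- H))\<^sup>2"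
    by (intro power_mono L2_set_nonneg)
  also have "\<dots> = (3 + 4 * real CARD('n))\<^sup>2 * T powr (- 2 * H)"
    by (simp add: power_mult_distrib power2_eq_square[of "T powr _"] powr_add[symmetric])
  finally show ?thesis by (simp add: L2_set_def sum_nonneg)
qed

subsection \<open>Chaining over dyadic levels\<close>

text \<open>Each index is numbered by the count of indices of lower level plus its position within
  its own level; listing these numbers in increasing order respects the levels.\<close>

lemma enumerate_by_level:
  fixes L :: "'i \<Rightarrow> nat"
  assumes fin: "\<And>k. finite {i \<in> I. L i \<le> k}" and inf: "infinite I"
  shows "\<exists>\<sigma> :: nat \<Rightarrow> 'i. bij_betw \<sigma> {1..} I \<and> (\<forall>p q. 1 \<le> p \<and> p \<le> q \<longrightarrow> L (\<sigma> p) \<le> L (\<sigma> q))"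
proof -
  have fin': "finite {i \<in> I. L i = k}" "finite {i \<in> I. L i < k}" for k
    by (rule finite_subset[OF _ fin[of k]], auto)+
  have "\<exists>h. \<forall>k. bij_betw (h k) {i \<in> I. L i = k} {0..<card {i \<in> I. L i = k}}"
    using ex_bij_betw_finite_nat[OF fin'(1)] by metis
  then obtain h where h: "\<And>k. bij_betw (h k) {i \<in> I. L i = k} {0..<card {i \<in> I. L i = k}}" by blast
  define b where "b k = card {i \<in> I. L i < k}" for k
  have b_Suc: "b (Suc k) = b k + card {i \<in> I. L i = k}" for k
  proof -
    have "{i \<in> I. L i < Suc k} = {i \<in> I. L i < k} \<union> {i \<in> I. L i = k}" by auto
    then show ?thesis unfolding b_def using fin' by (simp add: card_Un_disjoint disjoint_iff)
  qed
  have b_mono: "b k \<le> b l" if "k \<le> l" for k l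
    unfolding b_def using that by (intro card_mono fin') auto
  define g where "g i = b (L i) + h (L i) i" for i
  have h_less: "h (L i) i < card {i' \<in> I. L i' = L i}" if "i \<in> I" for i
    using bij_betwE[OF h[of "L i"]] that by auto
  have g_less: "g i < g i'" if "i \<in> I" "L i < L i'" for i i'
  proof -
    have "g i < b (Suc (L i))" using h_less[OF that(1)] by (simp add: g_def b_Suc)
    also have "\<dots> \<le> g i'" using b_mono[of "Suc (L i)" "L i'"] that by (simp add: g_def)
    finally show ?thesis .
  qed
  have inj: "inj_on g I"
  proof (rule inj_onI)
    fix i i' assume i: "i \<in> I" "i' \<in> I" "g i = g i'"
    then have L: "L i = L i'" using g_less[of i i'] g_less[of i' i] by (metis less_irrefl linorder_neqE_nat)
    then have "h (L i) i = h (L i) i'" using i(3) by (simp add: g_def)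
    then show "i = i'" using h[of "L i"] i L by (auto simp: bij_betw_def inj_on_def)
  qed
  define S where "S = g ` I"
  have S: "infinite S" unfolding S_def using inf inj by (simp add: finite_image_iff)
  define \<tau> where "\<tau> n = inv_into I g (enumerate S n)" for n
  have "bij_betw \<tau> UNIV I"
    unfolding \<tau>_def
    using bij_betw_trans[OF bij_enumerate[OF S] bij_betw_inv_into[OF inj_on_imp_bij_betw[OF inj], folded S_def]]
    by (simp add: comp_def)
  moreover have "bij_betw (\<lambda>p. p - 1) {1..} (UNIV :: nat set)"
    by (rule bij_betw_byWitness[where f' = Suc]) auto
  ultimately have "bij_betw (\<lambda>p. \<tau> (p - 1)) {1..} I"
    using bij_betw_trans by (fastforce simp: comp_def)
  moreover have "L (\<tau> (p - 1)) \<le> L (\<tau> (q - 1))" if "1 \<le> p" "p \<le> q" for p q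
  proof (rule ccontr)
    assume "\<not> ?thesis"
    moreover have \<tau>: "\<tau> n \<in> I" "g (\<tau> n) = enumerate S n" for n
      using enumerate_in_set[OF S, of n] unfolding \<tau>_def S_def by (auto intro: inv_into_into f_inv_into_f)
    ultimately have "enumerate S (q - 1) < enumerate S (p - 1)"
      using g_less[OF \<tau>(1), of "q - 1" "\<tau> (p - 1)"] by simp
    moreover have "enumerate S (p - 1) \<le> enumerate S (q - 1)"
      using that enumerate_mono_le_iff[OF S] by simp
    ultimately show False by simp
  qed
  ultimately show ?thesis by (intro exI[of _ "\<lambda>p. \<tau> (p - 1)"] conjI allI impI) blast+
qed

section \<open>Nets and the maximum over one block\<close>

text \<open>One point of the ball is chosen from every occupied cell of a grid, rather than the cell
  centre, so that the net lies in the ball. Cells of side \<eta> / N keep even the l1 distance below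
  \<eta>.\<close>

lemma finite_net:
  assumes \<eta>: "0 < \<eta>" "\<eta> \<le> 1"
  shows "\<exists>A :: (real ^ 'n::finite) set. finite A \<and> A \<subseteq> cball 0 1 \<and> (\<forall>x\<in>cball 0 1. \<exists>y\<in>A. norm (x - y) \<le> \<eta>)
    \<and> real (card A) \<le> ((2 * real CARD('n) + 3) / \<eta>) ^ CARD('n)"
proof -
  let ?N = "real CARD('n)" and ?B = "cball 0 1 :: (real ^ 'n) set"
  define s where "s = ?N / \<eta>"
  have s: "s > 0" using \<eta> by (simp add: s_def)
  define m where "m = \<lceil>s\<rceil>"
  define q :: "real ^ 'n \<Rightarrow> 'n \<Rightarrow> int" where "q x i = \<lfloor>x $ i * s\<rfloor>" for x i
  let ?P = "PiE (UNIV :: 'n set) (\<lambda>_. {-m..m})"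
  have qP: "q ` ?B \<subseteq> ?P"
  proof
    fix f assume "f \<in> q ` ?B"
    then obtain x where x: "x \<in> ?B" "f = q x" by auto
    have "q x i \<in> {-m..m}" for i
    proof -
      have "\<bar>x $ i\<bar> \<le> 1" using component_le_norm_cart[of x i] x(1) by simp
      then have "\<bar>x $ i * s\<bar> \<le> s" using s by (simp add: abs_mult mult_left_le_one_le)
      then have "- s \<le> x $ i * s" "x $ i * s \<le> s" by auto
      then show ?thesis unfolding q_def m_def by (auto simp: le_floor_iff) linarith+
    qed
    then show "f \<in> ?P" using x(2) by (auto simp: PiE_def extensional_def)
  qed
  have finP: "finite ?P" by (intro finite_PiE) auto
  define A where "A = inv_into ?B q ` (q ` ?B)"
  have "finite A" unfolding A_def using finite_subset[OF qP finP] by simp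
  moreover have "A \<subseteq> ?B" unfolding A_def by (auto intro: inv_into_into)
  moreover have "\<exists>y\<in>A. norm (x - y) \<le> \<eta>" if x: "x \<in> ?B" for x
  proof
    let ?y = "inv_into ?B q (q x)"
    show "?y \<in> A" using x by (auto simp: A_def)
    have "q ?y = q x" using x by (intro f_inv_into_f) auto
    then have "\<bar>(x - ?y) $ i\<bar> \<le> 1 / s" for i
    proof -
      have "\<lfloor>?y $ i * s\<rfloor> = \<lfloor>x $ i * s\<rfloor>" using \<open>q ?y = q x\<close> by (metis q_def)
      then have "\<bar>x $ i * s - ?y $ i * s\<bar> \<le> 1" by linarith
      then have "\<bar>(x $ i - ?y $ i) * s\<bar> \<le> 1" by (simp add: left_diff_distrib)
      then show ?thesis using s unfolding abs_mult by (simp add: le_divide_eq)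
    qed
    then have "(\<Sum>i\<in>UNIV. \<bar>(x - ?y) $ i\<bar>) \<le> (\<Sum>i\<in>(UNIV::'n set). 1 / s)" by (intro sum_mono)
    also have "\<dots> = \<eta>" using \<eta> by (simp add: s_def)
    finally show "norm (x - ?y) \<le> \<eta>" using norm_le_l1_cart[of "x - ?y"] by linarith
  qed
  moreover have "real (card A) \<le> ((2 * ?N + 3) / \<eta>) ^ CARD('n)"
  proof -
    have "card A \<le> card (q ` ?B)" unfolding A_def using finite_subset[OF qP finP] by (rule card_image_le)
    also have "\<dots> \<le> card ?P" by (rule card_mono[OF finP qP])
    also have "\<dots> = nat (2 * m + 1) ^ CARD('n)" by (simp add: card_PiE)
    finally have "real (card A) \<le> real (nat (2 * m + 1)) ^ CARD('n)" by (metis of_nat_le_iff of_nat_power)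
    also have "\<dots> \<le> ((2 * ?N + 3) / \<eta>) ^ CARD('n)"
    proof (rule power_mono)
      have "m \<ge> 0" using s by (simp add: m_def)
      then have "real (nat (2 * m + 1)) = 2 * real_of_int m + 1" by simp
      also have "\<dots> \<le> 2 * (s + 1) + 1"
      proof -
        have "real_of_int m \<le> s + 1" unfolding m_def by (rule of_int_ceiling_le_add_one)
        then show ?thesis by (intro add_right_mono mult_left_mono) auto
      qed
      also have "\<dots> \<le> (2 * ?N + 3) / \<eta>" using \<eta> by (simp add: s_def field_simps)
      finally show "real (nat (2 * m + 1)) \<le> (2 * ?N + 3) / \<eta>" .
    qed simp
    finally show ?thesis .
  qed
  ultimately show ?thesis by blast
qed

text \<open>The bound covers all partial sums of the block by brute force: they are treated like
  further net points, which costs only the factor b - a inside exp \<theta>.\<close>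

lemma block_dominating:
  fixes u :: "nat \<Rightarrow> real ^ 'n::finite \<Rightarrow> real" and A :: "(real ^ 'n) set"
  assumes M: "prob_space M" and Z: "iid_std_normal M {a<..b} Z" and v: "v > 0" and \<eta>: "\<eta> > 0" and H: "H > 0"
    and A: "finite A" "A \<subseteq> cball 0 1" "\<And>x. x \<in> cball 0 1 \<Longrightarrow> \<exists>y\<in>A. norm (x - y) \<le> \<eta>"
    and var: "\<And>x. x \<in> cball 0 1 \<Longrightarrow> (\<Sum>j\<in>{a<..b}. (u j x)\<^sup>2) \<le> v"
    and hol: "\<And>x y. x \<in> cball 0 1 \<Longrightarrow> y \<in> cball 0 1 \<Longrightarrow> (\<Sum>j\<in>{a<..b}. (u j x - u j y)\<^sup>2) \<le> norm (x - y) powr (2 * H)"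
    and \<theta>: "\<theta> \<ge> 0" "real (b - a) * real (card A) \<le> exp \<theta>"
  shows "\<exists>W. W \<in> borel_measurable M \<and> (\<forall>\<omega>. 0 \<le> W \<omega>)
    \<and> (\<forall>\<omega>. \<forall>s\<in>{a..b}. \<forall>x\<in>cball 0 1. (\<Sum>j\<in>{a<..s}. u j x * Z j \<omega>)\<^sup>2 \<le> W \<omega>)
    \<and> (\<integral>\<^sup>+\<omega>. ennreal (W \<omega>) \<partial>M) \<le> ennreal (8 * v * (\<theta> + 2) + 2 * \<eta> powr (2 * H) * real (b - a))"
proof -
  define X where "X s y \<omega> = (\<Sum>j\<in>{a<..s}. u j y * Z j \<omega>)" for s y \<omega>
  define E where "E \<omega> = (\<Sum>s\<in>{a<..b}. \<Sum>y\<in>A. exp ((X s y \<omega>)\<^sup>2 / (4 * v)))" for \<omega>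
  define Q where "Q \<omega> = (\<Sum>j\<in>{a<..b}. (Z j \<omega>)\<^sup>2)" for \<omega>
  \<comment> \<open>From X^2 \<le> 2 (value at a net point)^2 + 2 (difference)^2: the first two
    summands control the net points, the last one the passage to a general x by
    Cauchy-Schwarz.\<close>
  define W where "W \<omega> = 8 * v * \<theta> + 8 * v * exp (- \<theta>) * E \<omega> + 2 * \<eta> powr (2 * H) * Q \<omega>" for \<omega>
  have E0: "E \<omega> \<ge> 0" and Q0: "Q \<omega> \<ge> 0" for \<omega> by (auto simp: E_def Q_def intro!: sum_nonneg)
  have Zm: "Z j \<in> borel_measurable M" if "j \<in> {a<..b}" for j
    using iid_std_normal_measurable[OF Z that] .
  have Xm: "X s y \<in> borel_measurable M" if "s \<in> {a<..b}" for s y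
    unfolding X_def[abs_def] using that by (intro borel_measurable_sum borel_measurable_times Zm) auto
  have Qm: "(\<lambda>\<omega>. (Z j \<omega>)\<^sup>2) \<in> borel_measurable M" if "j \<in> {a<..b}" for j
    using Zm[OF that] by simp
  have Em: "(\<lambda>\<omega>. exp ((X s y \<omega>)\<^sup>2 / (4 * v))) \<in> borel_measurable M" if "s \<in> {a<..b}" for s y
    using Xm[OF that, of y] by simp
  have [measurable]: "E \<in> borel_measurable M" "Q \<in> borel_measurable M"
    unfolding E_def[abs_def] Q_def[abs_def] by (intro borel_measurable_sum Em Qm; assumption)+
  have "W \<in> borel_measurable M" unfolding W_def[abs_def] by measurable
  moreover have W0: "0 \<le> W \<omega>" for \<omega>
    unfolding W_def using v \<theta> E0 Q0 by (intro add_nonneg_nonneg mult_nonneg_nonneg) auto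
  moreover have "(X s x \<omega>)\<^sup>2 \<le> W \<omega>" if s: "s \<in> {a..b}" and x: "x \<in> cball 0 1" for \<omega> s x
  proof (cases "s = a")
    case True
    then show ?thesis using W0 by (simp add: X_def)
  next
    case False
    then have s': "s \<in> {a<..b}" using s by auto
    obtain y where y: "y \<in> A" "norm (x - y) \<le> \<eta>" using A(3)[OF x] by blast
    have yB: "y \<in> cball 0 1" using y A by auto
    have sub: "{a<..s} \<subseteq> {a<..b}" using s by auto
    have 1: "(X s y \<omega>)\<^sup>2 \<le> 4 * v * (\<theta> + exp (- \<theta>) * E \<omega>)"
    proof -
      let ?w = "(X s y \<omega>)\<^sup>2 / (4 * v)"
      have "exp ?w \<le> (\<Sum>y\<in>A. exp ((X s y \<omega>)\<^sup>2 / (4 * v)))"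
        using y A by (intro member_le_sum) auto
      also have "\<dots> \<le> E \<omega>" unfolding E_def using s' by (intro member_le_sum sum_nonneg) auto
      finally have "exp (- \<theta>) * exp ?w \<le> exp (- \<theta>) * E \<omega>" by (intro mult_left_mono) auto
      \<comment> \<open>Bounding the excess over \<theta> by an exponential replaces the maximum
        over net points and partial sums by a sum; damped by exp (- \<theta>), it has expectation at
        most 2.\<close>
      moreover have "?w - \<theta> \<le> exp (?w - \<theta>)" using exp_ge_add_one_self[of "?w - \<theta>"] by linarith
      moreover have "exp (?w - \<theta>) = exp (- \<theta>) * exp ?w" by (simp add: exp_add[symmetric])
      ultimately have "?w \<le> \<theta> + exp (- \<theta>) * E \<omega>" by linarith
      then show ?thesis using v by (simp add: divide_le_eq mult.commute)
    qed
    have 2: "(X s x \<omega> - X s y \<omega>)\<^sup>2 \<le> \<eta> powr (2 * H) * Q \<omega>"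
    proof -
      have "X s x \<omega> - X s y \<omega> = (\<Sum>j\<in>{a<..s}. (u j x - u j y) * Z j \<omega>)"
        by (simp add: X_def sum_subtractf left_diff_distrib)
      then have "(X s x \<omega> - X s y \<omega>)\<^sup>2 \<le> (\<Sum>j\<in>{a<..s}. (u j x - u j y)\<^sup>2) * (\<Sum>j\<in>{a<..s}. (Z j \<omega>)\<^sup>2)"
        using Cauchy_Schwarz_ineq_sum by simp
      also have "\<dots> \<le> \<eta> powr (2 * H) * Q \<omega>"
      proof (intro mult_mono)
        have "(\<Sum>j\<in>{a<..s}. (u j x - u j y)\<^sup>2) \<le> (\<Sum>j\<in>{a<..b}. (u j x - u j y)\<^sup>2)"
          using sub by (intro sum_mono2) auto
        also have "\<dots> \<le> norm (x - y) powr (2 * H)" by (rule hol[OF x yB])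
        also have "\<dots> \<le> \<eta> powr (2 * H)" using y H by (intro powr_mono2) auto
        finally show "(\<Sum>j\<in>{a<..s}. (u j x - u j y)\<^sup>2) \<le> \<eta> powr (2 * H)" .
        show "(\<Sum>j\<in>{a<..s}. (Z j \<omega>)\<^sup>2) \<le> Q \<omega>" unfolding Q_def using sub by (intro sum_mono2) auto
      qed (auto intro!: sum_nonneg)
      finally show ?thesis .
    qed
    have "(X s x \<omega>)\<^sup>2 \<le> 2 * (X s y \<omega>)\<^sup>2 + 2 * (X s x \<omega> - X s y \<omega>)\<^sup>2"
    proof -
      have "0 \<le> (X s y \<omega> - (X s x \<omega> - X s y \<omega>))\<^sup>2" by simp
      then show ?thesis by (simp add: power2_eq_square algebra_simps)
    qed
    also have "\<dots> \<le> 2 * (4 * v * (\<theta> + exp (- \<theta>) * E \<omega>)) + 2 * (\<eta> powr (2 * H) * Q \<omega>)"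
      using 1 2 by linarith
    also have "\<dots> = W \<omega>" by (simp add: W_def algebra_simps)
    finally show ?thesis .
  qed
  moreover have "(\<integral>\<^sup>+\<omega>. ennreal (W \<omega>) \<partial>M) \<le> ennreal (8 * v * (\<theta> + 2) + 2 * \<eta> powr (2 * H) * real (b - a))"
  proof -
    have c: "0 \<le> 8 * v * \<theta>" "0 \<le> 8 * v * exp (- \<theta>)" "0 \<le> 2 * \<eta> powr (2 * H)" using v \<theta> by auto
    have "(\<integral>\<^sup>+\<omega>. ennreal (W \<omega>) \<partial>M)
      = (\<integral>\<^sup>+\<omega>. ennreal (8 * v * \<theta>) + ennreal (8 * v * exp (- \<theta>)) * ennreal (E \<omega>) + ennreal (2 * \<eta> powr (2 * H)) * ennreal (Q \<omega>) \<partial>M)"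
    proof (rule nn_integral_cong)
      fix \<omega>
      show "ennreal (W \<omega>) = ennreal (8 * v * \<theta>) + ennreal (8 * v * exp (- \<theta>)) * ennreal (E \<omega>) + ennreal (2 * \<eta> powr (2 * H)) * ennreal (Q \<omega>)"
        unfolding W_def
        by (subst ennreal_plus, insert c E0[of \<omega>] Q0[of \<omega>], (auto intro!: add_nonneg_nonneg mult_nonneg_nonneg)[2])
           (subst ennreal_plus, auto intro!: mult_nonneg_nonneg simp: ennreal_mult)
    qed
    also have "\<dots> = ennreal (8 * v * \<theta>) + ennreal (8 * v * exp (- \<theta>)) * (\<integral>\<^sup>+\<omega>. ennreal (E \<omega>) \<partial>M)
        + ennreal (2 * \<eta> powr (2 * H)) * (\<integral>\<^sup>+\<omega>. ennreal (Q \<omega>) \<partial>M)"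
      using prob_space.emeasure_space_1[OF M] by (simp add: nn_integral_add nn_integral_cmult)
    also have "\<dots> \<le> ennreal (8 * v * \<theta>) + ennreal (8 * v * exp (- \<theta>)) * ennreal (exp \<theta> * 2)
        + ennreal (2 * \<eta> powr (2 * H)) * ennreal (real (b - a))"
    proof (intro add_mono mult_left_mono order_refl)
      have Em': "(\<lambda>\<omega>. ennreal (exp ((X s y \<omega>)\<^sup>2 / (4 * v)))) \<in> borel_measurable M" if "s \<in> {a<..b}" for s y
        using Em[OF that, of y] by measurable
      have "(\<integral>\<^sup>+\<omega>. ennreal (E \<omega>) \<partial>M) = (\<integral>\<^sup>+\<omega>. (\<Sum>s\<in>{a<..b}. \<Sum>y\<in>A. ennreal (exp ((X s y \<omega>)\<^sup>2 / (4 * v)))) \<partial>M)"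
        by (simp add: E_def sum_nonneg)
      also have "\<dots> = (\<Sum>s\<in>{a<..b}. \<integral>\<^sup>+\<omega>. (\<Sum>y\<in>A. ennreal (exp ((X s y \<omega>)\<^sup>2 / (4 * v)))) \<partial>M)"
        by (intro nn_integral_sum borel_measurable_sum Em')
      also have "\<dots> = (\<Sum>s\<in>{a<..b}. \<Sum>y\<in>A. \<integral>\<^sup>+\<omega>. ennreal (exp ((X s y \<omega>)\<^sup>2 / (4 * v))) \<partial>M)"
        by (intro sum.cong refl nn_integral_sum Em')
      also have "\<dots> \<le> (\<Sum>s\<in>{a<..b}. \<Sum>y\<in>A. ennreal 2)"
      proof (intro sum_mono)
        fix s y assume s: "s \<in> {a<..b}" and y: "y \<in> A"
        have sub: "{a<..s} \<subseteq> {a<..b}" using s by auto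
        have "(\<Sum>j\<in>{a<..s}. (u j y)\<^sup>2) \<le> v"
          using sum_mono2[of "{a<..b}" "{a<..s}" "\<lambda>j. (u j y)\<^sup>2"] sub var[of y] y A by auto
        from nn_integral_gauss_sum(2)[OF M Z sub _ v this]
        have "(\<integral>\<^sup>+\<omega>. ennreal (exp ((X s y \<omega>)\<^sup>2 / (4 * v))) \<partial>M) \<le> ennreal (sqrt 2)" by (simp add: X_def)
        also have "\<dots> \<le> ennreal 2" using real_sqrt_le_mono[of 2 "2\<^sup>2"] by (intro ennreal_leI) simp
        finally show "(\<integral>\<^sup>+\<omega>. ennreal (exp ((X s y \<omega>)\<^sup>2 / (4 * v))) \<partial>M) \<le> ennreal 2" .
      qed
      also have "\<dots> = ennreal (real (b - a) * real (card A) * 2)"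
        by (simp add: ennreal_of_nat_eq_real_of_nat ennreal_mult[symmetric] mult.assoc del: ennreal_numeral)
      also have "\<dots> \<le> ennreal (exp \<theta> * 2)" using \<theta> by (intro ennreal_leI mult_right_mono) auto
      finally show "(\<integral>\<^sup>+\<omega>. ennreal (E \<omega>) \<partial>M) \<le> ennreal (exp \<theta> * 2)" .
      have "(\<integral>\<^sup>+\<omega>. ennreal (Q \<omega>) \<partial>M) = (\<integral>\<^sup>+\<omega>. (\<Sum>j\<in>{a<..b}. ennreal ((Z j \<omega>)\<^sup>2)) \<partial>M)"
        by (simp add: Q_def)
      also have "\<dots> = (\<Sum>j\<in>{a<..b}. \<integral>\<^sup>+\<omega>. ennreal ((Z j \<omega>)\<^sup>2) \<partial>M)"
      proof (rule nn_integral_sum)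
        show "(\<lambda>\<omega>. ennreal ((Z j \<omega>)\<^sup>2)) \<in> borel_measurable M" if "j \<in> {a<..b}" for j
          using Qm[OF that] by measurable
      qed
      also have "\<dots> = (\<Sum>j\<in>{a<..b}. 1)"
      proof (intro sum.cong refl)
        fix j assume "j \<in> {a<..b}"
        then show "(\<integral>\<^sup>+\<omega>. ennreal ((Z j \<omega>)\<^sup>2) \<partial>M) = 1"
          using nn_integral_gauss_sum(1)[OF M Z, of "{j}" "\<lambda>_. 1"] by simp
      qed
      finally show "(\<integral>\<^sup>+\<omega>. ennreal (Q \<omega>) \<partial>M) \<le> ennreal (real (b - a))"
        by (simp add: ennreal_of_nat_eq_real_of_nat)
    qed auto
    also have "\<dots> = ennreal (8 * v * (\<theta> + 2) + 2 * \<eta> powr (2 * H) * real (b - a))"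
    proof -
      have e: "8 * v * exp (- \<theta>) * (exp \<theta> * 2) = 16 * v" by (simp add: exp_minus)
      have "ennreal (8 * v * exp (- \<theta>)) * ennreal (exp \<theta> * 2) = ennreal (16 * v)"
        using c by (simp add: ennreal_mult[symmetric] e[symmetric])
      moreover have "ennreal (2 * \<eta> powr (2 * H)) * ennreal (real (b - a)) = ennreal (2 * \<eta> powr (2 * H) * real (b - a))"
        by (rule ennreal_mult[symmetric]) auto
      ultimately show ?thesis using c v by (simp add: ennreal_plus[symmetric] algebra_simps del: ennreal_plus)
    qed
    finally show ?thesis .
  qed
  ultimately show ?thesis unfolding X_def by blast
qed

lemma initial_segment:
  fixes S :: "nat set"
  assumes "finite S" "S \<subseteq> {1..}" "\<And>i j. j \<in> S \<Longrightarrow> 1 \<le> i \<Longrightarrow> i \<le> j \<Longrightarrow> i \<in> S"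
  shows "S = {1..card S}"
proof (cases "S = {}")
  case False
  have m: "Max S \<in> S" by (rule Max_in[OF assms(1) False])
  have e: "S = {1..Max S}"
  proof (rule set_eqI)
    fix i
    show "i \<in> S \<longleftrightarrow> i \<in> {1..Max S}"
      using assms(2) Max_ge[OF assms(1), of i] assms(3)[OF m, of i] by auto
  qed
  have "card S = card {1..Max S}" using e by (rule arg_cong)
  then have "card S = Max S" by simp
  then show ?thesis using e by simp
qed simp

section \<open>Summation over the levels\<close>

text \<open>p may be much smaller than y = c 2^(K N), and y^(- \<alpha>) ln y need not be decreasing
  for small y; the factor 1 + 1 / (\<alpha> ln 2) in C pays for that.\<close>

lemma rate_conversion:
  assumes H: "H > 0" and N: "N \<ge> 1" and c: "c \<ge> 1"
  shows "\<exists>C>0. \<forall>p K. 2 \<le> p \<and> real p \<le> c * 2 ^ (K * N) \<longrightarrow>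
     real (K + 1) * ((2 powr (- H)) ^ K)\<^sup>2 \<le> C * (real p powr (- H / real N) * sqrt (ln (real p)))\<^sup>2"
proof -
  define \<alpha> where "\<alpha> = 2 * H / real N"
  have \<alpha>: "\<alpha> > 0" using H N by (simp add: \<alpha>_def)
  define C where "C = c powr \<alpha> * (2 / ln 2) * (1 + 1 / (\<alpha> * ln 2))"
  have "C > 0" unfolding C_def using c \<alpha> by (intro mult_pos_pos add_pos_pos divide_pos_pos) auto
  moreover have "real (K + 1) * ((2 powr (- H)) ^ K)\<^sup>2 \<le> C * (real p powr (- H / real N) * sqrt (ln (real p)))\<^sup>2"
    if p: "2 \<le> p" "real p \<le> c * 2 ^ (K * N)" for p K
  proof -
    define y where "y = c * 2 ^ (K * N)"
    have y: "y \<ge> real p" "y \<ge> 2" using p by (auto simp: y_def)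
    have lnp: "ln 2 \<le> ln (real p)" using p by simp
    have e1: "((2 powr (- H)) ^ K)\<^sup>2 = c powr \<alpha> * y powr (- \<alpha>)"
    proof -
      have "((2 powr (- H)) ^ K)\<^sup>2 = 2 powr (- (2 * H * real K))"
        by (simp add: powr_realpow[symmetric] powr_powr power_mult[symmetric] mult_ac)
      moreover have "y powr (- \<alpha>) = c powr (- \<alpha>) * 2 powr (- (2 * H * real K))"
      proof -
        have "(2 ^ (K * N)) powr (- \<alpha>) = (2 powr real (K * N)) powr (- \<alpha>)" by (simp only: powr_realpow)
        also have "\<dots> = 2 powr (- (2 * H * real K))" unfolding powr_powr using N by (simp add: \<alpha>_def mult_ac)
        finally show ?thesis unfolding y_def using c by (simp add: powr_mult)
      qed
      ultimately show ?thesis using c by (simp add: powr_minus)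
    qed
    have "real K * ln 2 \<le> ln y"
    proof -
      have "K \<le> K * N" using N by simp
      then have "real K \<le> real (K * N)" by (rule of_nat_mono)
      then have "real K * ln 2 \<le> real (K * N) * ln 2" by (intro mult_right_mono) auto
      also have "\<dots> = ln (2 ^ (K * N))" by (simp add: ln_realpow)
      also have "\<dots> \<le> ln y" unfolding y_def using c by (intro ln_mono) auto
      finally show ?thesis .
    qed
    moreover have "ln 2 \<le> ln y" using y by simp
    ultimately have e2: "real (K + 1) \<le> (2 / ln 2) * ln y" by (simp add: field_simps)
    \<comment> \<open>With y = p z the logarithm splits; ln z \<le> z^\<alpha> / \<alpha> removes
      the part in z, and ln p \<ge> ln 2 absorbs the resulting constant.\<close>
    have e3: "y powr (- \<alpha>) * ln y \<le> real p powr (- \<alpha>) * ln (real p) * (1 + 1 / (\<alpha> * ln 2))"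
    proof -
      define z where "z = y / real p"
      have z: "z \<ge> 1" "y = real p * z" using y p by (auto simp: z_def)
      have zz: "z powr (- \<alpha>) * z powr \<alpha> = 1" using z by (simp add: powr_add[symmetric])
      have z1: "z powr (- \<alpha>) \<le> 1" using powr_mono[of "- \<alpha>" 0 z] z \<alpha> by simp
      have "\<alpha> * ln z \<le> z powr \<alpha>" using ln_le_minus_one[of "z powr \<alpha>"] z by (simp add: ln_powr)
      then have "ln z \<le> z powr \<alpha> / \<alpha>" using \<alpha> by (simp add: field_simps)
      then have "z powr (- \<alpha>) * ln z \<le> z powr (- \<alpha>) * (z powr \<alpha> / \<alpha>)" by (intro mult_left_mono) auto
      also have "\<dots> = 1 / \<alpha>" using zz by (simp add: field_simps)
      also have "\<dots> \<le> ln (real p) * (1 / (\<alpha> * ln 2))" using lnp \<alpha> by (simp add: field_simps)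
      finally have a: "z powr (- \<alpha>) * ln z \<le> ln (real p) * (1 / (\<alpha> * ln 2))" .
      have b: "z powr (- \<alpha>) * ln (real p) \<le> ln (real p)" using z1 p by (simp add: mult_left_le_one_le)
      have "y powr (- \<alpha>) * ln y = real p powr (- \<alpha>) * (z powr (- \<alpha>) * ln (real p) + z powr (- \<alpha>) * ln z)"
        unfolding z(2) using z p by (simp add: powr_mult ln_mult algebra_simps)
      also have "\<dots> \<le> real p powr (- \<alpha>) * (ln (real p) + ln (real p) * (1 / (\<alpha> * ln 2)))"
        using a b by (intro mult_left_mono add_mono) auto
      finally show ?thesis by (simp add: algebra_simps)
    qed
    have "real (K + 1) * ((2 powr (- H)) ^ K)\<^sup>2 \<le> (2 / ln 2) * ln y * (c powr \<alpha> * y powr (- \<alpha>))"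
      unfolding e1 using e2 by (intro mult_right_mono) auto
    also have "\<dots> = c powr \<alpha> * (2 / ln 2) * (y powr (- \<alpha>) * ln y)" by simp
    also have "\<dots> \<le> c powr \<alpha> * (2 / ln 2) * (real p powr (- \<alpha>) * ln (real p) * (1 + 1 / (\<alpha> * ln 2)))"
      using e3 by (intro mult_left_mono) auto
    also have "\<dots> = C * (real p powr (- \<alpha>) * ln (real p))" by (simp add: C_def)
    also have "real p powr (- \<alpha>) * ln (real p) = (real p powr (- H / real N) * sqrt (ln (real p)))\<^sup>2"
      using p by (simp add: power_mult_distrib power2_eq_square[of "_ powr _"] powr_add[symmetric] \<alpha>_def)
    finally show ?thesis .
  qed
  ultimately show ?thesis by blast
qed

lemma ennreal_sqrt_le:
  assumes "a \<le> ennreal (b\<^sup>2)" "b \<ge> 0"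
  shows "ennreal_sqrt a \<le> ennreal b"
proof -
  have "a \<noteq> \<infinity>" using assms(1) ennreal_less_top[of "b\<^sup>2"] by (metis infinity_ennreal_def not_le)
  moreover have "sqrt (enn2real a) \<le> b"
    using assms by (intro real_le_lsqrt) (auto simp: enn2real_leI)
  ultimately show ?thesis by (simp add: ennreal_sqrt_def ennreal_leI)
qed

lemma ennreal_sqrt_ge:
  assumes "ennreal (b\<^sup>2) \<le> a" "b \<ge> 0"
  shows "ennreal b \<le> ennreal_sqrt a"
proof (cases "a = \<infinity>")
  case False
  then obtain r where r: "a = ennreal r" "r \<ge> 0" by (metis ennreal_cases infinity_ennreal_def)
  then have "b\<^sup>2 \<le> r" using assms by (simp add: ennreal_le_iff)
  then show ?thesis using r assms by (auto simp: ennreal_sqrt_def intro!: ennreal_leI real_le_rsqrt)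
qed (simp add: ennreal_sqrt_def)

text \<open>Both partial sums are compared with the start of the block that contains p, whence the
  factor 2; from there the bounds of the blocks telescope.\<close>

lemma partial_sums_bound:
  fixes P :: "nat \<Rightarrow> real" and a L :: "nat \<Rightarrow> nat"
  assumes Y: "\<And>k n. a k \<le> n \<Longrightarrow> n \<le> a (Suc k) \<Longrightarrow> \<bar>P n - P (a k)\<bar> \<le> Y k"
    and a: "\<And>k. a k \<le> a (Suc k)"
    and L: "\<And>n. a (L n) \<le> n" "\<And>n. n \<le> a (Suc (L n))" and mono: "mono L"
    and pn: "p \<le> n"
  shows "\<bar>P n - P p\<bar> \<le> 2 * (\<Sum>k\<in>{L p..L n}. Y k)"
proof -
  have Y0: "Y k \<ge> 0" for k using Y[of k "a k"] a[of k] by simp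
  have LL: "L p \<le> L n" using mono pn by (rule monoD)
  have "\<bar>P i - P (a (L p))\<bar> \<le> (\<Sum>k\<in>{L p..K}. Y k)" if "L p \<le> K" "a K \<le> i" "i \<le> a (Suc K)" for K i
    using that
  proof (induction K arbitrary: i rule: dec_induct)
    case base
    then show ?case using Y by simp
  next
    case (step K)
    have "\<bar>P (a (Suc K)) - P (a (L p))\<bar> \<le> (\<Sum>k\<in>{L p..K}. Y k)" using step.IH[of "a (Suc K)"] a by simp
    moreover have "\<bar>P i - P (a (Suc K))\<bar> \<le> Y (Suc K)" using Y step.prems by simp
    ultimately have "\<bar>P i - P (a (L p))\<bar> \<le> (\<Sum>k\<in>{L p..K}. Y k) + Y (Suc K)" by linarith
    then show ?case using step.hyps by simp
  qed
  from this[OF LL L(1,2)] have 1: "\<bar>P n - P (a (L p))\<bar> \<le> (\<Sum>k\<in>{L p..L n}. Y k)" .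
  have "\<bar>P p - P (a (L p))\<bar> \<le> Y (L p)" by (rule Y[OF L(1,2)])
  also have "\<dots> \<le> (\<Sum>k\<in>{L p..L n}. Y k)" using LL Y0 by (intro member_le_sum) auto
  finally show ?thesis using 1 by linarith
qed

text \<open>Cauchy-Schwarz with weights r^k. It trades the sum of square roots for one series that
  is linear in W; with expectations of W k of order (k + 1) r^(2 k) that series converges in
  mean.\<close>

lemma weighted_tail_bound:
  fixes W :: "nat \<Rightarrow> real"
  assumes r: "0 < r" "r < 1" and W: "\<And>k. W k \<ge> 0" and s: "summable (\<lambda>k. W k / r ^ k)"
  shows "(\<Sum>k\<in>{K..K'}. sqrt (W k))\<^sup>2 \<le> r ^ K / (1 - r) * (\<Sum>k. W (K + k) / r ^ (K + k))"
proof -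
  have rp: "r ^ k > 0" for k using r by simp
  have s': "summable (\<lambda>k. W (K + k) / r ^ (K + k))" using summable_ignore_initial_segment[OF s, of K] by (simp add: add.commute)
  have img: "{K..K'} = (\<lambda>k. K + k) ` {..<Suc K' - K}"
  proof -
    have "{K..K'} = {K..<Suc K'}" by auto
    also have "\<dots> = (\<lambda>k. K + k) ` {..<Suc K' - K}"
    proof (intro set_eqI iffI)
      fix x assume "x \<in> {K..<Suc K'}"
      then show "x \<in> (\<lambda>k. K + k) ` {..<Suc K' - K}" by (intro image_eqI[of _ _ "x - K"]) auto
    qed auto
    finally show ?thesis .
  qed
  have sum_shift: "(\<Sum>k\<in>{K..K'}. f k) = (\<Sum>k<Suc K' - K. f (K + k))" for f :: "nat \<Rightarrow> real"
    unfolding img by (subst sum.reindex) auto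
  have "(\<Sum>k\<in>{K..K'}. sqrt (W k))\<^sup>2 = (\<Sum>k\<in>{K..K'}. sqrt (r ^ k) * sqrt (W k / r ^ k))\<^sup>2"
    using rp by (intro arg_cong[where f = "\<lambda>x. x\<^sup>2"] sum.cong refl) (use r in \<open>simp add: real_sqrt_mult[symmetric]\<close>)
  also have "\<dots> \<le> (\<Sum>k\<in>{K..K'}. (sqrt (r ^ k))\<^sup>2) * (\<Sum>k\<in>{K..K'}. (sqrt (W k / r ^ k))\<^sup>2)"
    by (rule Cauchy_Schwarz_ineq_sum)
  also have "\<dots> = (\<Sum>k\<in>{K..K'}. r ^ k) * (\<Sum>k\<in>{K..K'}. W k / r ^ k)"
    using r W rp by (intro arg_cong2[where f = "(*)"] sum.cong refl real_sqrt_pow2 divide_nonneg_nonneg) (auto simp: less_imp_le)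
  also have "\<dots> \<le> r ^ K / (1 - r) * (\<Sum>k. W (K + k) / r ^ (K + k))"
  proof (intro mult_mono)
    have "(\<Sum>k\<in>{K..K'}. r ^ k) = r ^ K * (\<Sum>k<Suc K' - K. r ^ k)"
      unfolding sum_shift power_add sum_distrib_left ..
    also have "\<dots> \<le> r ^ K * (1 / (1 - r))"
    proof (intro mult_left_mono)
      have "(\<Sum>k<Suc K' - K. r ^ k) \<le> (\<Sum>k. r ^ k)" using r by (intro sum_le_suminf summable_geometric) auto
      also have "\<dots> = 1 / (1 - r)" using r by (intro suminf_geometric) auto
      finally show "(\<Sum>k<Suc K' - K. r ^ k) \<le> 1 / (1 - r)" .
    qed (use rp in \<open>auto simp: less_imp_le\<close>)
    finally show "(\<Sum>k\<in>{K..K'}. r ^ k) \<le> r ^ K / (1 - r)" by simp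
    show "(\<Sum>k\<in>{K..K'}. W k / r ^ k) \<le> (\<Sum>k. W (K + k) / r ^ (K + k))"
      unfolding sum_shift using W rp by (intro sum_le_suminf s') (auto simp: less_imp_le)
  qed (use r W rp in \<open>auto intro!: sum_nonneg divide_nonneg_nonneg simp: less_imp_le\<close>)
  finally show ?thesis .
qed

lemma block_variances:
  fixes u :: "nat \<Rightarrow> real ^ 'n::finite \<Rightarrow> real" and a :: "nat \<Rightarrow> nat"
  assumes H: "H > 0" and c2: "c2 > 0" and c3: "c3 \<ge> 1"
    and card: "\<And>k. real (a (Suc k) - a k) \<le> c3 * 2 ^ (k * CARD('n))"
    and var: "\<And>k x. x \<in> cball 0 1 \<Longrightarrow> (\<Sum>j\<in>{a k<..a (Suc k)}. (u j x)\<^sup>2) \<le> c2 * ((2 powr (- H)) ^ k)\<^sup>2"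
    and hol: "\<And>k x y. x \<in> cball 0 1 \<Longrightarrow> y \<in> cball 0 1 \<Longrightarrow> (\<Sum>j\<in>{a k<..a (Suc k)}. (u j x - u j y)\<^sup>2) \<le> norm (x - y) powr (2 * H)"
  shows "\<exists>c5>0. \<forall>M Z k. prob_space (M :: 'a measure) \<longrightarrow> iid_std_normal M {a k<..a (Suc k)} Z \<longrightarrow>
    (\<exists>W. W \<in> borel_measurable M \<and> (\<forall>\<omega>. 0 \<le> W \<omega>)
    \<and> (\<forall>\<omega>. \<forall>s\<in>{a k..a (Suc k)}. \<forall>x\<in>cball 0 1. (\<Sum>j\<in>{a k<..s}. u j x * Z j \<omega>)\<^sup>2 \<le> W \<omega>)
    \<and> (\<integral>\<^sup>+\<omega>. ennreal (W \<omega>) \<partial>M) \<le> ennreal (c5 * real (k + 1) * ((2 powr (- H)) ^ k)\<^sup>2))"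
proof -
  let ?N = "real CARD('n)"
  \<comment> \<open>The mesh is \<eta> = 2^(- k \<beta>). This \<beta> makes \<eta>^(2H) times the
    number 2^(k N) of terms in the block equal to 2^(- 2 k H), so the error off the net is no larger
    than the variance.\<close>
  define \<beta> where "\<beta> = 1 + ?N / (2 * H)"
  have \<beta>: "\<beta> > 0" unfolding \<beta>_def using H by (intro add_pos_nonneg) auto
  define D where "D = c3 * (2 * ?N + 3) ^ CARD('n)"
  have D: "D \<ge> 1" unfolding D_def using c3 one_le_power[of "2 * ?N + 3" "CARD('n)"] by (metis mult_1 mult_mono' zero_le_one le_add_same_cancel2 of_nat_0_le_iff mult_nonneg_nonneg zero_le_numeral add_increasing one_le_numeral)
  \<comment> \<open>\<theta> = c4 (k + 1) dominates the logarithm of the number of terms times the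
    number of net points, both exponential in k. This is the source of the logarithmic factor in the
    rate.\<close>
  define c4 where "c4 = ln D + (1 + \<beta>) * ?N"
  have c4: "c4 \<ge> 0" unfolding c4_def using D \<beta> by (intro add_nonneg_nonneg) auto
  define c5 where "c5 = 8 * c2 * (c4 + 2) + 2 * c3"
  have "8 * c2 * (c4 + 2) > 0" using c2 c4 by simp
  then have "c5 > 0" unfolding c5_def using c3 by linarith
  moreover have "\<exists>W. W \<in> borel_measurable M \<and> (\<forall>\<omega>. 0 \<le> W \<omega>)
    \<and> (\<forall>\<omega>. \<forall>s\<in>{a k..a (Suc k)}. \<forall>x\<in>cball 0 1. (\<Sum>j\<in>{a k<..s}. u j x * Z j \<omega>)\<^sup>2 \<le> W \<omega>)
    \<and> (\<integral>\<^sup>+\<omega>. ennreal (W \<omega>) \<partial>M) \<le> ennreal (c5 * real (k + 1) * ((2 powr (- H)) ^ k)\<^sup>2)"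
    if M: "prob_space M" and Z: "iid_std_normal M {a k<..a (Suc k)} Z" for M :: "'a measure" and Z k
  proof -
    define \<eta> where "\<eta> = 2 powr (- (real k * \<beta>))"
    have \<eta>: "0 < \<eta>" "\<eta> \<le> 1" unfolding \<eta>_def using \<beta> powr_mono[of "- (real k * \<beta>)" 0 2] by auto
    obtain A :: "(real ^ 'n) set" where A: "finite A" "A \<subseteq> cball 0 1" "\<And>x. x \<in> cball 0 1 \<Longrightarrow> \<exists>y\<in>A. norm (x - y) \<le> \<eta>"
      "real (card A) \<le> ((2 * ?N + 3) / \<eta>) ^ CARD('n)"
      using finite_net[OF \<eta>] by blast
    define v where "v = c2 * ((2 powr (- H)) ^ k)\<^sup>2"
    have v: "v > 0" using c2 by (simp add: v_def)
    define \<theta> where "\<theta> = c4 * real (k + 1)"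
    have \<theta>: "\<theta> \<ge> 0" using c4 by (simp add: \<theta>_def)
    have "real (a (Suc k) - a k) * real (card A) \<le> (c3 * 2 ^ (k * CARD('n))) * ((2 * ?N + 3) / \<eta>) ^ CARD('n)"
      using c3 by (intro mult_mono card A(4)) auto
    also have "\<dots> = D * (2 powr (real k * ?N) * 2 powr (real k * \<beta> * ?N))"
    proof -
      have "1 / \<eta> = 2 powr (real k * \<beta>)" by (simp only: \<eta>_def powr_minus_divide divide_divide_eq_right mult_1 div_by_1)
      then have 1: "(1 / \<eta>) ^ CARD('n) = 2 powr (real k * \<beta> * ?N)" by (simp only: powr_power mult_ac)
      have 2: "(2::real) ^ (k * CARD('n)) = 2 powr (real k * ?N)" by (simp add: powr_realpow[symmetric])
      have 3: "((2 * ?N + 3) / \<eta>) ^ CARD('n) = (2 * ?N + 3) ^ CARD('n) * (1 / \<eta>) ^ CARD('n)"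
        unfolding power_mult_distrib[symmetric] by simp
      show ?thesis unfolding 3 unfolding 1 2 D_def by (simp only: ac_simps)
    qed
    also have "\<dots> = exp (ln D + (real k * ?N + real k * \<beta> * ?N) * ln 2)"
      using D by (simp add: exp_add powr_def distrib_right)
    also have "\<dots> \<le> exp \<theta>"
    proof -
      have "(real k * ?N + real k * \<beta> * ?N) * ln 2 \<le> (real k * ?N + real k * \<beta> * ?N) * 1"
        using \<beta> ln_2_less_1 by (intro mult_left_mono) auto
      also have "\<dots> \<le> (1 + \<beta>) * ?N * real (k + 1)" using \<beta> by (simp add: algebra_simps)
      moreover have "ln D * 1 \<le> ln D * real (k + 1)" using D by (intro mult_left_mono) auto
      ultimately have "ln D + (real k * ?N + real k * \<beta> * ?N) * ln 2 \<le> \<theta>"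
        unfolding \<theta>_def c4_def distrib_right by linarith
      then show ?thesis by simp
    qed
    finally have card': "real (a (Suc k) - a k) * real (card A) \<le> exp \<theta>" .
    have e\<eta>: "\<eta> powr (2 * H) * 2 ^ (k * CARD('n)) = ((2 powr (- H)) ^ k)\<^sup>2"
    proof -
      have "\<eta> powr (2 * H) = 2 powr (- (real k * \<beta>) * (2 * H))" unfolding \<eta>_def by (rule powr_powr)
      also have "- (real k * \<beta>) * (2 * H) = - (2 * H * real k) + - real (k * CARD('n))" using H by (simp add: \<beta>_def field_simps)
      finally have "\<eta> powr (2 * H) = 2 powr (- (2 * H * real k)) / 2 ^ (k * CARD('n))"
        by (simp only: powr_add powr_minus divide_inverse powr_realpow zero_less_numeral)
      moreover have "((2 powr (- H)) ^ k)\<^sup>2 = 2 powr (- (2 * H * real k))"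
        by (simp add: powr_realpow[symmetric] powr_powr power_mult[symmetric] mult_ac)
      ultimately show ?thesis by simp
    qed
    have var': "(\<Sum>j\<in>{a k<..a (Suc k)}. (u j x)\<^sup>2) \<le> v" if "x \<in> cball 0 1" for x
      unfolding v_def by (rule var[OF that])
    have hol': "(\<Sum>j\<in>{a k<..a (Suc k)}. (u j x - u j y)\<^sup>2) \<le> norm (x - y) powr (2 * H)" if "x \<in> cball 0 1" "y \<in> cball 0 1" for x y
      by (rule hol[OF that])
    obtain W where W: "W \<in> borel_measurable M" "\<And>\<omega>. 0 \<le> W \<omega>"
      "\<And>\<omega> s x. s \<in> {a k..a (Suc k)} \<Longrightarrow> x \<in> cball 0 1 \<Longrightarrow> (\<Sum>j\<in>{a k<..s}. u j x * Z j \<omega>)\<^sup>2 \<le> W \<omega>"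
      "(\<integral>\<^sup>+\<omega>. ennreal (W \<omega>) \<partial>M) \<le> ennreal (8 * v * (\<theta> + 2) + 2 * \<eta> powr (2 * H) * real (a (Suc k) - a k))"
      using block_dominating[OF M Z v \<eta>(1) H A(1-3) var' hol' \<theta> card'] by blast
    have "8 * v * (\<theta> + 2) + 2 * \<eta> powr (2 * H) * real (a (Suc k) - a k) \<le> c5 * real (k + 1) * ((2 powr (- H)) ^ k)\<^sup>2"
    proof -
      let ?q = "((2 powr (- H)) ^ k)\<^sup>2"
      have q: "?q \<ge> 0" by simp
      have "8 * v * (\<theta> + 2) \<le> 8 * v * ((c4 + 2) * real (k + 1))"
        using v c4 by (intro mult_left_mono) (auto simp: \<theta>_def algebra_simps)
      also have "\<dots> = 8 * c2 * (c4 + 2) * real (k + 1) * ?q" by (simp add: v_def)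
      finally have 1: "8 * v * (\<theta> + 2) \<le> 8 * c2 * (c4 + 2) * real (k + 1) * ?q" .
      have "2 * \<eta> powr (2 * H) * real (a (Suc k) - a k) \<le> 2 * \<eta> powr (2 * H) * (c3 * 2 ^ (k * CARD('n)))"
        using card by (intro mult_left_mono) auto
      also have "\<dots> = 2 * c3 * ?q" unfolding e\<eta>[symmetric] by simp
      also have "\<dots> \<le> 2 * c3 * real (k + 1) * ?q" using c3 q by (intro mult_right_mono) auto
      finally have 2: "2 * \<eta> powr (2 * H) * real (a (Suc k) - a k) \<le> 2 * c3 * real (k + 1) * ?q" .
      show ?thesis using add_mono[OF 1 2] unfolding c5_def distrib_right .
    qed
    then have "(\<integral>\<^sup>+\<omega>. ennreal (W \<omega>) \<partial>M) \<le> ennreal (c5 * real (k + 1) * ((2 powr (- H)) ^ k)\<^sup>2)"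
      using W(4) by (meson ennreal_leI order_trans)
    then show ?thesis using W(1-3) by blast
  qed
  ultimately show ?thesis by blast
qed

text \<open>One random series Q, weighted by r^(-k), controls everything: its finiteness gives
  uniform convergence, its expectation from level K on gives the tail error.\<close>

theorem ordered_series_bound:
  fixes u :: "nat \<Rightarrow> real ^ 'n::finite \<Rightarrow> real" and a L :: "nat \<Rightarrow> nat"
  assumes H: "H > 0" and c2: "c2 > 0" and c3: "c3 \<ge> 1"
    and a0: "a 0 = 0" and amono: "\<And>k. a k \<le> a (Suc k)"
    and acard: "\<And>k. real (a (Suc k)) \<le> c3 * 2 ^ (k * CARD('n))"
    and L: "\<And>n. a (L n) \<le> n" "\<And>n. n < a (Suc (L n))" and Lmono: "mono L"
    and var: "\<And>k x. x \<in> cball 0 1 \<Longrightarrow> (\<Sum>j\<in>{a k<..a (Suc k)}. (u j x)\<^sup>2) \<le> c2 * ((2 powr (- H)) ^ k)\<^sup>2"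
    and hol: "\<And>k x y. x \<in> cball 0 1 \<Longrightarrow> y \<in> cball 0 1 \<Longrightarrow> (\<Sum>j\<in>{a k<..a (Suc k)}. (u j x - u j y)\<^sup>2) \<le> norm (x - y) powr (2 * H)"
  shows "\<exists>C>0. \<forall>M Z. prob_space (M :: 'a measure) \<longrightarrow> iid_std_normal M {1..} Z \<longrightarrow>
    (AE \<omega> in M. uniformly_convergent_on (cball 0 1) (\<lambda>n x. \<Sum>j = 1..n. u j x * Z j \<omega>)) \<and>
    (\<forall>p\<ge>2. tail_error M u Z p \<le> ennreal (C * (real p powr (- H / real CARD('n)) * sqrt (ln (real p)))))"
proof -
  let ?N = "CARD('n)" and ?B = "cball 0 1 :: (real ^ 'n) set"
  define r where "r = (2::real) powr (- H)"
  have r: "0 < r" "r < 1" using H powr_less_mono[of "- H" 0 2] by (auto simp: r_def)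
  have rp: "r ^ k > 0" for k using r by simp
  have card: "real (a (Suc k) - a k) \<le> c3 * 2 ^ (k * CARD('n))" for k
    using acard[of k] by (rule order_trans[rotated]) simp
  obtain c5 where c5: "c5 > 0" and block: "\<forall>M Z k. prob_space (M :: 'a measure) \<longrightarrow> iid_std_normal M {a k<..a (Suc k)} Z \<longrightarrow>
    (\<exists>W. W \<in> borel_measurable M \<and> (\<forall>\<omega>. 0 \<le> W \<omega>)
    \<and> (\<forall>\<omega>. \<forall>s\<in>{a k..a (Suc k)}. \<forall>x\<in>cball 0 1. (\<Sum>j\<in>{a k<..s}. u j x * Z j \<omega>)\<^sup>2 \<le> W \<omega>)
    \<and> (\<integral>\<^sup>+\<omega>. ennreal (W \<omega>) \<partial>M) \<le> ennreal (c5 * real (k + 1) * (r ^ k)\<^sup>2))"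
    using block_variances[OF H c2 c3 card var hol, where 'a = 'a] unfolding r_def by blast
  obtain C0 where C0: "C0 > 0" "\<And>p K. 2 \<le> p \<Longrightarrow> real p \<le> c3 * 2 ^ (K * ?N) \<Longrightarrow>
     real (K + 1) * (r ^ K)\<^sup>2 \<le> C0 * (real p powr (- H / real ?N) * sqrt (ln (real p)))\<^sup>2"
    using rate_conversion[OF H _ c3, of ?N] unfolding r_def by (metis One_nat_def Suc_leI zero_less_card_finite)
  \<comment> \<open>4 / (1 - r) comes from \<open>partial_sums_bound\<close> and
    \<open>weighted_tail_bound\<close>, c5 / (1 - r)^2 from the expectation of the weighted
    series.\<close>
  define c6 where "c6 = 4 / (1 - r) * (c5 / (1 - r)\<^sup>2)"
  have c6: "c6 > 0" using r c5 by (simp add: c6_def)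
  define C where "C = sqrt (c6 * C0)"
  have "C > 0" using c6 C0 by (simp add: C_def)
  moreover have "(AE \<omega> in M. uniformly_convergent_on ?B (\<lambda>n x. \<Sum>j = 1..n. u j x * Z j \<omega>)) \<and>
    (\<forall>p\<ge>2. tail_error M u Z p \<le> ennreal (C * (real p powr (- H / real ?N) * sqrt (ln (real p)))))"
    if M: "prob_space M" and Z: "iid_std_normal M {1..} Z" for M :: "'a measure" and Z
  proof -
    have "\<forall>k. \<exists>W. W \<in> borel_measurable M \<and> (\<forall>\<omega>. 0 \<le> W \<omega>)
      \<and> (\<forall>\<omega>. \<forall>s\<in>{a k..a (Suc k)}. \<forall>x\<in>?B. (\<Sum>j\<in>{a k<..s}. u j x * Z j \<omega>)\<^sup>2 \<le> W \<omega>)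
      \<and> (\<integral>\<^sup>+\<omega>. ennreal (W \<omega>) \<partial>M) \<le> ennreal (c5 * real (k + 1) * (r ^ k)\<^sup>2)"
      by (intro allI block[rule_format, OF M] iid_std_normal_subset[OF M Z]) auto
    from choice[OF this] obtain W where Wall: "\<forall>k. W k \<in> borel_measurable M \<and> (\<forall>\<omega>. 0 \<le> W k \<omega>)
      \<and> (\<forall>\<omega>. \<forall>s\<in>{a k..a (Suc k)}. \<forall>x\<in>?B. (\<Sum>j\<in>{a k<..s}. u j x * Z j \<omega>)\<^sup>2 \<le> W k \<omega>)
      \<and> (\<integral>\<^sup>+\<omega>. ennreal (W k \<omega>) \<partial>M) \<le> ennreal (c5 * real (k + 1) * (r ^ k)\<^sup>2)" ..
    then have Wm[measurable]: "\<And>k. W k \<in> borel_measurable M" and W0: "\<And>k \<omega>. 0 \<le> W k \<omega>"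
      and Wb: "\<And>k \<omega> s x. s \<in> {a k..a (Suc k)} \<Longrightarrow> x \<in> ?B \<Longrightarrow> (\<Sum>j\<in>{a k<..s}. u j x * Z j \<omega>)\<^sup>2 \<le> W k \<omega>"
      and WE: "\<And>k. (\<integral>\<^sup>+\<omega>. ennreal (W k \<omega>) \<partial>M) \<le> ennreal (c5 * real (k + 1) * (r ^ k)\<^sup>2)"
      by blast+
    \<comment> \<open>Extended values allow the expectation to be computed first. Finiteness almost
      everywhere follows from it, and there Q agrees with the real series q.\<close>
    define Q where "Q K \<omega> = (\<Sum>k. ennreal (W (K + k) \<omega> / r ^ (K + k)))" for K \<omega>
    have Qm[measurable]: "Q K \<in> borel_measurable M" for K unfolding Q_def[abs_def] by measurable
    have QE: "(\<integral>\<^sup>+\<omega>. Q K \<omega> \<partial>M) \<le> ennreal (c5 * real (K + 1) * r ^ K / (1 - r)\<^sup>2)" for K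
    proof -
      have "(\<integral>\<^sup>+\<omega>. Q K \<omega> \<partial>M) = (\<Sum>k. \<integral>\<^sup>+\<omega>. ennreal (W (K + k) \<omega> / r ^ (K + k)) \<partial>M)"
        unfolding Q_def by (rule nn_integral_suminf) measurable
      also have "\<dots> \<le> (\<Sum>k. ennreal (c5 * real (K + 1) * r ^ K * (real (Suc k) * r ^ k)))"
      proof (rule suminf_le)
        fix k
        have "(\<integral>\<^sup>+\<omega>. ennreal (W (K + k) \<omega> / r ^ (K + k)) \<partial>M) = (\<integral>\<^sup>+\<omega>. ennreal (1 / r ^ (K + k)) * ennreal (W (K + k) \<omega>) \<partial>M)"
          using W0 rp[of "K + k"] by (intro nn_integral_cong) (simp add: ennreal_mult[symmetric])
        also have "\<dots> = ennreal (1 / r ^ (K + k)) * (\<integral>\<^sup>+\<omega>. ennreal (W (K + k) \<omega>) \<partial>M)"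
          by (rule nn_integral_cmult) measurable
        also have "\<dots> \<le> ennreal (1 / r ^ (K + k)) * ennreal (c5 * real (K + k + 1) * (r ^ (K + k))\<^sup>2)"
          by (intro mult_left_mono WE) simp
        also have "\<dots> = ennreal (c5 * real (K + k + 1) * r ^ (K + k))"
          using rp[of "K + k"] c5 by (simp add: ennreal_mult[symmetric] power2_eq_square)
        also have "\<dots> \<le> ennreal (c5 * real (K + 1) * r ^ K * (real (Suc k) * r ^ k))"
        proof (rule ennreal_leI)
          \<comment> \<open>Submultiplicativity of k + 1 splits off the dependence on the starting
            level K.\<close>
          have "real (K + k + 1) \<le> real (K + 1) * real (Suc k)" by (simp add: algebra_simps)
          then have "real (K + k + 1) * (c5 * r ^ (K + k)) \<le> real (K + 1) * real (Suc k) * (c5 * r ^ (K + k))"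
            using c5 rp[of "K + k"] by (intro mult_right_mono) auto
          then show "c5 * real (K + k + 1) * r ^ (K + k) \<le> c5 * real (K + 1) * r ^ K * (real (Suc k) * r ^ k)"
            unfolding power_add by (simp only: ac_simps)
        qed
        finally show "(\<integral>\<^sup>+\<omega>. ennreal (W (K + k) \<omega> / r ^ (K + k)) \<partial>M) \<le> ennreal (c5 * real (K + 1) * r ^ K * (real (Suc k) * r ^ k))" .
      qed auto
      also have "\<dots> = ennreal (c5 * real (K + 1) * r ^ K * (1 / (1 - r)\<^sup>2))"
      proof (rule suminf_ennreal_eq)
        show "0 \<le> c5 * real (K + 1) * r ^ K * (real (Suc k) * r ^ k)" for k using c5 r by simp
        show "(\<lambda>k. c5 * real (K + 1) * r ^ K * (real (Suc k) * r ^ k)) sums (c5 * real (K + 1) * r ^ K * (1 / (1 - r)\<^sup>2))"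
          using r by (intro sums_mult geometric_deriv_sums) auto
      qed
      finally show ?thesis by simp
    qed
    have fin: "AE \<omega> in M. Q 0 \<omega> \<noteq> \<infinity>"
      using QE[of 0] by (intro nn_integral_PInf_AE) (auto simp: top_unique)
    define P where "P x \<omega> n = (\<Sum>j = 1..n. u j x * Z j \<omega>)" for x \<omega> n
    define q where "q K \<omega> = (\<Sum>k. W (K + k) \<omega> / r ^ (K + k))" for K \<omega>
    have summ: "summable (\<lambda>k. W k \<omega> / r ^ k)" if "Q 0 \<omega> \<noteq> \<infinity>" for \<omega>
      using that W0 rp unfolding Q_def by (intro summable_suminf_not_top) (auto simp: less_imp_le infinity_ennreal_def)
    have Qq: "Q K \<omega> = ennreal (q K \<omega>)" and q0: "0 \<le> q K \<omega>" if "Q 0 \<omega> \<noteq> \<infinity>" for K \<omega>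
    proof -
      have s: "summable (\<lambda>k. W (K + k) \<omega> / r ^ (K + k))"
        using summable_ignore_initial_segment[OF summ[OF that], of K] by (simp add: add.commute)
      show "Q K \<omega> = ennreal (q K \<omega>)" unfolding Q_def q_def
        by (rule suminf_ennreal2[OF _ s]) (use W0 rp in \<open>auto simp: less_imp_le\<close>)
      show "0 \<le> q K \<omega>" unfolding q_def using W0 rp by (intro suminf_nonneg s) (auto simp: less_imp_le)
    qed
    have qle: "q K \<omega> \<le> q 0 \<omega>" if "Q 0 \<omega> \<noteq> \<infinity>" for K \<omega>
    proof -
      have "q 0 \<omega> = q K \<omega> + (\<Sum>k<K. W k \<omega> / r ^ k)"
        using suminf_split_initial_segment[OF summ[OF that], of K] by (simp add: q_def add.commute)
      moreover have "0 \<le> (\<Sum>k<K. W k \<omega> / r ^ k)" using W0 rp by (intro sum_nonneg) (auto simp: less_imp_le)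
      ultimately show ?thesis by simp
    qed
    have key: "(P x \<omega> n - P x \<omega> p)\<^sup>2 \<le> 4 * r ^ L p / (1 - r) * q (L p) \<omega>"
      if \<omega>: "Q 0 \<omega> \<noteq> \<infinity>" and x: "x \<in> ?B" and pn: "p \<le> n" for x \<omega> n p
    proof -
      have Y: "\<bar>P x \<omega> n - P x \<omega> (a k)\<bar> \<le> sqrt (W k \<omega>)" if "a k \<le> n" "n \<le> a (Suc k)" for k n
      proof -
        have "{1..n} = {1..a k} \<union> {a k<..n}" using that by auto
        then have "P x \<omega> n = P x \<omega> (a k) + (\<Sum>j\<in>{a k<..n}. u j x * Z j \<omega>)"
          unfolding P_def by (simp add: sum.union_disjoint disjoint_iff)
        then have "(P x \<omega> n - P x \<omega> (a k))\<^sup>2 \<le> W k \<omega>" using Wb[of n k x \<omega>] that x by simp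
        then show ?thesis by (rule real_le_rsqrt[of "\<bar>_\<bar>", simplified])
      qed
      have "\<bar>P x \<omega> n - P x \<omega> p\<bar> \<le> 2 * (\<Sum>k\<in>{L p..L n}. sqrt (W k \<omega>))"
        by (rule partial_sums_bound[where a = a and P = "P x \<omega>" and Y = "\<lambda>k. sqrt (W k \<omega>)", OF Y amono L(1) less_imp_le[OF L(2)] Lmono pn])
      then have "\<bar>P x \<omega> n - P x \<omega> p\<bar>\<^sup>2 \<le> (2 * (\<Sum>k\<in>{L p..L n}. sqrt (W k \<omega>)))\<^sup>2" by (intro power_mono) auto
      also have "\<dots> = 4 * (\<Sum>k\<in>{L p..L n}. sqrt (W k \<omega>))\<^sup>2" by (simp add: power_mult_distrib)
      also have "\<dots> \<le> 4 * (r ^ L p / (1 - r) * q (L p) \<omega>)"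
        unfolding q_def using W0 by (intro mult_left_mono weighted_tail_bound r summ \<omega>) auto
      finally show ?thesis by simp
    qed
    have conv: "uniformly_convergent_on ?B (\<lambda>n x. P x \<omega> n)" if \<omega>: "Q 0 \<omega> \<noteq> \<infinity>" for \<omega>
    proof (rule Cauchy_uniformly_convergent, unfold uniformly_Cauchy_on_def, intro allI impI)
      fix \<epsilon> :: real assume \<epsilon>: "\<epsilon> > 0"
      have "(\<lambda>k. 4 * r ^ k / (1 - r) * q 0 \<omega>) \<longlonglongrightarrow> 4 * 0 / (1 - r) * q 0 \<omega>"
        using r by (intro tendsto_intros LIMSEQ_power_zero) auto
      then have "\<forall>\<^sub>F k in sequentially. 4 * r ^ k / (1 - r) * q 0 \<omega> < (\<epsilon> / 2)\<^sup>2"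
        using \<epsilon> by (intro order_tendstoD(2)) auto
      then obtain k0 where k0: "\<And>k. k \<ge> k0 \<Longrightarrow> 4 * r ^ k / (1 - r) * q 0 \<omega> < (\<epsilon> / 2)\<^sup>2"
        unfolding eventually_sequentially by blast
      define p where "p = a k0"
      have "L p \<ge> k0"
      proof (rule ccontr)
        assume "\<not> k0 \<le> L p"
        then have "Suc (L p) \<le> k0" by simp
        then have "a (Suc (L p)) \<le> a k0" by (rule lift_Suc_mono_le[of a, OF amono])
        then show False using L(2)[of p] by (simp add: p_def)
      qed
      have *: "\<bar>P x \<omega> n - P x \<omega> p\<bar> < \<epsilon> / 2" if "x \<in> ?B" "n \<ge> p" for x n
      proof -
        have "(P x \<omega> n - P x \<omega> p)\<^sup>2 \<le> 4 * r ^ L p / (1 - r) * q (L p) \<omega>" by (rule key[OF \<omega> that])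
        also have "\<dots> \<le> 4 * r ^ L p / (1 - r) * q 0 \<omega>" using qle[OF \<omega>] r by (intro mult_left_mono) auto
        also have "\<dots> < (\<epsilon> / 2)\<^sup>2" by (rule k0[OF \<open>L p \<ge> k0\<close>])
        finally have "\<bar>P x \<omega> n - P x \<omega> p\<bar>\<^sup>2 < (\<epsilon> / 2)\<^sup>2" by simp
        then show ?thesis by (rule power2_less_imp_less) (use \<epsilon> in simp)
      qed
      show "\<exists>M. \<forall>x\<in>?B. \<forall>m\<ge>M. \<forall>n\<ge>M. dist (P x \<omega> m) (P x \<omega> n) < \<epsilon>"
      proof (intro exI[of _ p] ballI allI impI)
        fix x m n assume "x \<in> ?B" "p \<le> m" "p \<le> n"
        then show "dist (P x \<omega> m) (P x \<omega> n) < \<epsilon>"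
          using *[of x m] *[of x n] unfolding dist_real_def by linarith
      qed
    qed
    have "AE \<omega> in M. uniformly_convergent_on ?B (\<lambda>n x. \<Sum>j = 1..n. u j x * Z j \<omega>)"
      using fin conv unfolding P_def by (auto elim!: eventually_mono)
    moreover have "tail_error M u Z p \<le> ennreal (C * (real p powr (- H / real ?N) * sqrt (ln (real p))))" if p: "p \<ge> 2" for p
    proof -
      \<comment> \<open>The tail from p on is the limit minus the partial sum up to p - 1, and L (p
        - 1) is the level of the p-th term.\<close>
      let ?K = "L (p - 1)" and ?R = "real p powr (- H / real ?N) * sqrt (ln (real p))"
      let ?b = "4 * r ^ ?K / (1 - r)"
      have b0: "?b \<ge> 0" using r by simp
      have tail: "(ball_norm (\<lambda>x. \<Sum>j. u (p + j) x * Z (p + j) \<omega>))\<^sup>2 \<le> ennreal ?b * Q ?K \<omega>" if \<omega>: "Q 0 \<omega> \<noteq> \<infinity>" for \<omega>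
      proof -
        have le: "\<bar>\<Sum>j. u (p + j) x * Z (p + j) \<omega>\<bar> \<le> sqrt (?b * q ?K \<omega>)" if x: "x \<in> ?B" for x
        proof -
          have "convergent (\<lambda>n. P x \<omega> n)"
            using conv[OF \<omega>] x by (auto simp: uniformly_convergent_on_def convergent_def dest: tendsto_uniform_limitI)
          then obtain l where l: "(\<lambda>n. P x \<omega> n) \<longlonglongrightarrow> l" by (auto simp: convergent_def)
          have part: "(\<Sum>j<n. u (p + j) x * Z (p + j) \<omega>) = P x \<omega> (p - 1 + n) - P x \<omega> (p - 1)" for n
          proof (induction n)
            case (Suc n)
            have e: "p - 1 + Suc n = Suc (p - 1 + n)" "Suc (p - 1 + n) = p + n" using p by auto
            have "P x \<omega> (Suc (p - 1 + n)) = P x \<omega> (p - 1 + n) + u (Suc (p - 1 + n)) x * Z (Suc (p - 1 + n)) \<omega>"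
              by (simp add: P_def)
            then have "P x \<omega> (p - 1 + Suc n) = P x \<omega> (p - 1 + n) + u (p + n) x * Z (p + n) \<omega>"
              unfolding e(1) unfolding e(2) .
            then show ?case using Suc by simp
          qed simp
          have "(\<lambda>n. P x \<omega> (p - 1 + n)) \<longlonglongrightarrow> l" using LIMSEQ_ignore_initial_segment[OF l, of "p - 1"] by (simp add: add.commute)
          then have "(\<lambda>n. \<Sum>j<n. u (p + j) x * Z (p + j) \<omega>) \<longlonglongrightarrow> l - P x \<omega> (p - 1)"
            unfolding part by (intro tendsto_intros)
          then have s: "(\<Sum>j. u (p + j) x * Z (p + j) \<omega>) = l - P x \<omega> (p - 1)"
            by (simp add: sums_def sums_iff[symmetric] sums_unique[symmetric])
          have "(l - P x \<omega> (p - 1))\<^sup>2 \<le> ?b * q ?K \<omega>"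
          proof (rule tendsto_upperbound)
            show "(\<lambda>n. (P x \<omega> n - P x \<omega> (p - 1))\<^sup>2) \<longlonglongrightarrow> (l - P x \<omega> (p - 1))\<^sup>2" by (intro tendsto_intros l)
            show "\<forall>\<^sub>F n in sequentially. (P x \<omega> n - P x \<omega> (p - 1))\<^sup>2 \<le> ?b * q ?K \<omega>"
              using eventually_ge_at_top[of "p - 1"] by eventually_elim (rule key[OF \<omega> x])
          qed simp
          then show ?thesis unfolding s by (rule real_le_rsqrt[of "\<bar>_\<bar>", simplified])
        qed
        have "ball_norm (\<lambda>x. \<Sum>j. u (p + j) x * Z (p + j) \<omega>) \<le> ennreal (sqrt (?b * q ?K \<omega>))"
          unfolding ball_norm_def using le by (intro SUP_least ennreal_leI)
        then have "(ball_norm (\<lambda>x. \<Sum>j. u (p + j) x * Z (p + j) \<omega>))\<^sup>2 \<le> (ennreal (sqrt (?b * q ?K \<omega>)))\<^sup>2"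
          by (rule power_mono) simp
        also have "\<dots> = ennreal (?b * q ?K \<omega>)" using b0 q0[OF \<omega>, of ?K] by (simp add: ennreal_power del: times_divide_eq_left)
        also have "\<dots> = ennreal ?b * Q ?K \<omega>" unfolding Qq[OF \<omega>] using b0 q0[OF \<omega>, of ?K] by (rule ennreal_mult)
        finally show ?thesis .
      qed
      have "(\<integral>\<^sup>+\<omega>. (ball_norm (\<lambda>x. \<Sum>j. u (p + j) x * Z (p + j) \<omega>))\<^sup>2 \<partial>M) \<le> (\<integral>\<^sup>+\<omega>. ennreal ?b * Q ?K \<omega> \<partial>M)"
        using fin tail by (intro nn_integral_mono_AE) (auto elim!: eventually_mono)
      also have "\<dots> = ennreal ?b * (\<integral>\<^sup>+\<omega>. Q ?K \<omega> \<partial>M)" by (rule nn_integral_cmult) measurable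
      also have "\<dots> \<le> ennreal ?b * ennreal (c5 * real (?K + 1) * r ^ ?K / (1 - r)\<^sup>2)" by (intro mult_left_mono QE) simp
      also have "\<dots> = ennreal (c6 * (real (?K + 1) * (r ^ ?K)\<^sup>2))"
        using b0 c5 r by (subst ennreal_mult[symmetric]) (auto simp: c6_def power2_eq_square mult_ac)
      also have "\<dots> \<le> ennreal (c6 * (C0 * ?R\<^sup>2))"
      proof (intro ennreal_leI mult_left_mono C0(2) p)
        have "p \<le> a (Suc ?K)" using L(2)[of "p - 1"] by simp
        then have "real p \<le> real (a (Suc ?K))" by simp
        also have "\<dots> \<le> c3 * 2 ^ (?K * ?N)" by (rule acard)
        finally show "real p \<le> c3 * 2 ^ (?K * ?N)" .
      qed (use c6 in auto)
      also have "c6 * (C0 * ?R\<^sup>2) = (C * ?R)\<^sup>2" using c6 C0(1) by (simp add: C_def power_mult_distrib)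
      finally have "(\<integral>\<^sup>+\<omega>. (ball_norm (\<lambda>x. \<Sum>j. u (p + j) x * Z (p + j) \<omega>))\<^sup>2 \<partial>M) \<le> ennreal ((C * ?R)\<^sup>2)" .
      then show ?thesis unfolding tail_error_def
        using \<open>C > 0\<close> p by (intro ennreal_sqrt_le) auto
    qed
    ultimately show ?thesis by blast
  qed
  ultimately show ?thesis by blast
qed

theorem leveled_series_bound:
  fixes u :: "'i \<Rightarrow> real ^ 'n::finite \<Rightarrow> real" and lev :: "'i \<Rightarrow> nat"
  assumes H: "H > 0" and c2: "c2 > 0" and c3: "c3 \<ge> 1" and I: "infinite I"
    and lev: "\<And>k. finite {i \<in> I. lev i \<le> k}" "\<And>k. real (card {i \<in> I. lev i \<le> k}) \<le> c3 * 2 ^ (k * CARD('n))"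
    and var: "\<And>k F x. finite F \<Longrightarrow> F \<subseteq> I \<Longrightarrow> (\<And>i. i \<in> F \<Longrightarrow> lev i = k) \<Longrightarrow> x \<in> cball 0 1 \<Longrightarrow> (\<Sum>i\<in>F. (u i x)\<^sup>2) \<le> c2 * ((2 powr (- H)) ^ k)\<^sup>2"
    and hol: "\<And>F x y. finite F \<Longrightarrow> F \<subseteq> I \<Longrightarrow> x \<in> cball 0 1 \<Longrightarrow> y \<in> cball 0 1 \<Longrightarrow> (\<Sum>i\<in>F. (u i x - u i y)\<^sup>2) \<le> norm (x - y) powr (2 * H)"
  shows "\<exists>(\<sigma> :: nat \<Rightarrow> 'i) C. bij_betw \<sigma> {1..} I \<and> C > 0 \<and> (\<forall>M Z. prob_space (M :: 'a measure) \<longrightarrow> iid_std_normal M {1..} Z \<longrightarrow>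
    (AE \<omega> in M. uniformly_convergent_on (cball 0 1) (\<lambda>n x. \<Sum>j = 1..n. u (\<sigma> j) x * Z j \<omega>)) \<and>
    (\<forall>p\<ge>2. tail_error M (\<lambda>j. u (\<sigma> j)) Z p \<le> ennreal (C * (real p powr (- H / real CARD('n)) * sqrt (ln (real p))))))"
proof -
  obtain \<sigma> :: "nat \<Rightarrow> 'i" where \<sigma>: "bij_betw \<sigma> {1..} I" and mono: "\<And>p q. 1 \<le> p \<Longrightarrow> p \<le> q \<Longrightarrow> lev (\<sigma> p) \<le> lev (\<sigma> q)"
    using enumerate_by_level[OF lev(1) I] by blast
  have inj: "inj_on \<sigma> {1..}" using \<sigma> by (rule bij_betw_imp_inj_on)
  have \<sigma>I: "\<sigma> j \<in> I" if "j \<ge> 1" for j using bij_betwE[OF \<sigma>] that by auto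
  \<comment> \<open>The number of terms of level below k. As the level is monotone along \<sigma>,
    level k occupies exactly the positions \<open>{a k<..a (Suc k)}\<close>.\<close>
  define a where "a k = card {i \<in> I. lev i < k}" for k
  have fin': "finite {i \<in> I. lev i < k}" for k by (rule finite_subset[OF _ lev(1)[of k]]) auto
  have seg: "j \<le> a k \<longleftrightarrow> lev (\<sigma> j) < k" if j: "j \<ge> 1" for j k
  proof -
    define S where "S = {j \<in> {1..}. lev (\<sigma> j) < k}"
    have img: "\<sigma> ` S = {i \<in> I. lev i < k}"
    proof (intro set_eqI iffI)
      fix i assume "i \<in> \<sigma> ` S"
      then show "i \<in> {i \<in> I. lev i < k}" using \<sigma>I by (auto simp: S_def)
    next
      fix i assume i: "i \<in> {i \<in> I. lev i < k}"
      then have "i \<in> \<sigma> ` {1..}" using bij_betw_imp_surj_on[OF \<sigma>] by simp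
      then show "i \<in> \<sigma> ` S" using i by (auto simp: S_def)
    qed
    have injS: "inj_on \<sigma> S" using inj by (rule inj_on_subset) (auto simp: S_def)
    have "finite S" by (rule finite_imageD[OF _ injS]) (simp only: img fin')
    then have "S = {1..card S}"
    proof (rule initial_segment)
      show "S \<subseteq> {1..}" by (auto simp: S_def)
      show "i \<in> S" if "j \<in> S" "1 \<le> i" "i \<le> j" for i j
        using mono[OF that(2,3)] that by (simp add: S_def)
    qed
    moreover have "card S = a k" unfolding a_def img[symmetric] card_image[OF injS] ..
    ultimately have "S = {1..a k}" by simp
    moreover have "j \<in> S \<longleftrightarrow> lev (\<sigma> j) < k" using j by (simp add: S_def)
    ultimately show ?thesis using j by simp
  qed
  \<comment> \<open>The level of the next term, n + 1; this is what makes a (L n) \<le> n < a (L n +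
    1) true.\<close>
  define L where "L n = lev (\<sigma> (Suc n))" for n
  have aS: "a (Suc k) = card {i \<in> I. lev i \<le> k}" for k by (simp add: a_def less_Suc_eq_le)
  have blk: "lev (\<sigma> j) = k" if "j \<in> {a k<..a (Suc k)}" for j k
    using seg[of j k] seg[of j "Suc k"] that by auto
  have sumF: "(\<Sum>j\<in>{a k<..b}. f (\<sigma> j)) = (\<Sum>i\<in>\<sigma> ` {a k<..b}. f i)" for f :: "'i \<Rightarrow> real" and k b
  proof -
    have "{a k<..b} \<subseteq> {1..}" by auto
    from sum.reindex[OF inj_on_subset[OF inj this], of f] show ?thesis by (simp only: comp_def)
  qed
  have "\<exists>C>0. \<forall>M Z. prob_space (M :: 'a measure) \<longrightarrow> iid_std_normal M {1..} Z \<longrightarrow>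
    (AE \<omega> in M. uniformly_convergent_on (cball 0 1) (\<lambda>n x. \<Sum>j = 1..n. u (\<sigma> j) x * Z j \<omega>)) \<and>
    (\<forall>p\<ge>2. tail_error M (\<lambda>j. u (\<sigma> j)) Z p \<le> ennreal (C * (real p powr (- H / real CARD('n)) * sqrt (ln (real p)))))"
  proof (rule ordered_series_bound[OF H c2 c3, where a = a and L = L])
    show "a 0 = 0" by (simp add: a_def)
    show "a k \<le> a (Suc k)" for k unfolding a_def by (intro card_mono fin') auto
    show "real (a (Suc k)) \<le> c3 * 2 ^ (k * CARD('n))" for k unfolding aS by (rule lev(2))
    show "a (L n) \<le> n" for n using seg[of "Suc n" "L n"] by (simp add: L_def)
    show "n < a (Suc (L n))" for n using seg[of "Suc n" "Suc (L n)"] by (simp add: L_def)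
    show "mono L" unfolding L_def by (intro monoI mono) auto
    show "(\<Sum>j\<in>{a k<..a (Suc k)}. (u (\<sigma> j) x)\<^sup>2) \<le> c2 * ((2 powr (- H)) ^ k)\<^sup>2" if "x \<in> cball 0 1" for k x
      unfolding sumF[of "\<lambda>i. (u i x)\<^sup>2"] using that blk \<sigma>I by (intro var) auto
    show "(\<Sum>j\<in>{a k<..a (Suc k)}. (u (\<sigma> j) x - u (\<sigma> j) y)\<^sup>2) \<le> norm (x - y) powr (2 * H)" if "x \<in> cball 0 1" "y \<in> cball 0 1" for k x y
      unfolding sumF[of "\<lambda>i. (u i x - u i y)\<^sup>2"] using that \<sigma>I by (intro hol) auto
  qed
  then show ?thesis using \<sigma> by blast
qed

subsection \<open>Separated subfamilies\<close>

text \<open>Gaussian elimination: an equation with a nonzero pivot k0 eliminates that unknown from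
  the others and is solved last.\<close>

lemma nontrivial_solution:
  fixes c :: "'j \<Rightarrow> 'k \<Rightarrow> real"
  assumes "finite J" "finite G" "card J < card G"
  shows "\<exists>a. (\<exists>k\<in>G. a k \<noteq> 0) \<and> (\<forall>j\<in>J. (\<Sum>k\<in>G. c j k * a k) = 0)"
  using assms
proof (induction J arbitrary: G c rule: finite_induct)
  case empty
  then have "G \<noteq> {}" by auto
  then show ?case by (intro exI[of _ "\<lambda>_. 1"]) auto
next
  case (insert j0 J)
  show ?case
  proof (cases "\<forall>k\<in>G. c j0 k = 0")
    case True
    have "card J < card G" using insert by simp
    from insert.IH[OF insert.prems(1) this, of c] True show ?thesis by auto
  next
    case False
    then obtain k0 where k0: "k0 \<in> G" "c j0 k0 \<noteq> 0" by blast
    let ?G = "G - {k0}"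
    define c' where "c' j k = c j k - c j k0 / c j0 k0 * c j0 k" for j k
    have "card J < card ?G" using insert k0 by simp
    then obtain b where b: "\<exists>k\<in>?G. b k \<noteq> 0" "\<forall>j\<in>J. (\<Sum>k\<in>?G. c' j k * b k) = 0"
      using insert.IH[of ?G c'] insert.prems by blast
    define s where "s = (\<Sum>k\<in>?G. c j0 k * b k)"
    define a where "a = b(k0 := - s / c j0 k0)"
    have split: "(\<Sum>k\<in>G. c j k * a k) = c j k0 * (- s / c j0 k0) + (\<Sum>k\<in>?G. c j k * b k)" for j
      using insert.prems k0 by (subst sum.remove[of G k0]) (auto simp: a_def intro!: sum.cong)
    have "(\<Sum>k\<in>G. c j k * a k) = 0" if j: "j \<in> insert j0 J" for j
    proof (cases "j = j0")
      case True
      then show ?thesis unfolding split True using k0 by (simp add: s_def)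
    next
      case False
      then have "(\<Sum>k\<in>?G. c' j k * b k) = 0" using b j by simp
      also have "(\<Sum>k\<in>?G. c' j k * b k) = (\<Sum>k\<in>?G. c j k * b k) - c j k0 / c j0 k0 * s"
        unfolding c'_def s_def by (simp add: left_diff_distrib sum_subtractf sum_distrib_left mult.assoc)
      finally show ?thesis unfolding split by simp
    qed
    moreover have "\<exists>k\<in>G. a k \<noteq> 0" using b(1) by (auto simp: a_def)
    ultimately show ?thesis by blast
  qed
qed

text \<open>Orthogonality to the vectors already found is just r further linear equations, so no
  Gram-Schmidt process is needed; only the new vector is normalised.\<close>

lemma orthonormal_solutions:
  fixes c :: "'j \<Rightarrow> 'k \<Rightarrow> real"
  assumes "finite J" "finite G" "card J + r \<le> card G"
  shows "\<exists>v :: nat \<Rightarrow> 'k \<Rightarrow> real. (\<forall>s<r. \<forall>j\<in>J. (\<Sum>k\<in>G. c j k * v s k) = 0) \<and>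
    (\<forall>s<r. \<forall>t<r. (\<Sum>k\<in>G. v s k * v t k) = (if s = t then 1 else 0))"
  using assms(3)
proof (induction r)
  case (Suc r)
  then have "card J + r \<le> card G" by simp
  from Suc.IH[OF this] obtain v :: "nat \<Rightarrow> 'k \<Rightarrow> real" where
    "\<forall>s<r. \<forall>j\<in>J. (\<Sum>k\<in>G. c j k * v s k) = 0"
    "\<forall>s<r. \<forall>t<r. (\<Sum>k\<in>G. v s k * v t k) = (if s = t then 1 else 0)" by blast
  then have v: "\<And>s j. s < r \<Longrightarrow> j \<in> J \<Longrightarrow> (\<Sum>k\<in>G. c j k * v s k) = 0"
    "\<And>s t. s < r \<Longrightarrow> t < r \<Longrightarrow> (\<Sum>k\<in>G. v s k * v t k) = (if s = t then 1 else 0)" by blast+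
  define c' where "c' i k = (case i of Inl j \<Rightarrow> c j k | Inr s \<Rightarrow> v s k)" for i k
  have "card (J <+> {..<r}) < card G" using Suc.prems assms by (simp add: card_Plus)
  then obtain a where a: "\<exists>k\<in>G. a k \<noteq> 0" "\<forall>i\<in>J <+> {..<r}. (\<Sum>k\<in>G. c' i k * a k) = 0"
    using nontrivial_solution[of "J <+> {..<r}" G c'] assms by auto
  define q where "q = (\<Sum>k\<in>G. (a k)\<^sup>2)"
  have q: "q > 0" using a(1) assms(2) unfolding q_def by (auto intro!: sum_pos2)
  define b where "b k = a k / sqrt q" for k
  have lin: "(\<Sum>k\<in>G. f k * b k) = (\<Sum>k\<in>G. f k * a k) / sqrt q" for f
    by (simp add: b_def sum_divide_distrib)
  have bJ: "(\<Sum>k\<in>G. c j k * b k) = 0" if "j \<in> J" for j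
  proof -
    have "Inl j \<in> J <+> {..<r}" using that by auto
    from bspec[OF a(2) this] show ?thesis by (simp add: lin c'_def)
  qed
  have bv: "(\<Sum>k\<in>G. v s k * b k) = 0" if "s < r" for s
  proof -
    have "Inr s \<in> J <+> {..<r}" using that by auto
    from bspec[OF a(2) this] show ?thesis by (simp add: lin c'_def)
  qed
  have bb: "(\<Sum>k\<in>G. b k * b k) = 1"
    unfolding lin using q by (simp add: b_def power2_eq_square[symmetric] sum_divide_distrib[symmetric] q_def[symmetric])
  define v' where "v' = v(r := b)"
  have v'r: "v' r = b" and v's: "\<And>s. s < r \<Longrightarrow> v' s = v s" by (auto simp: v'_def)
  show ?case
  proof (intro exI[of _ v'] conjI allI impI ballI)
    fix s j assume "s < Suc r" "j \<in> J"
    then show "(\<Sum>k\<in>G. c j k * v' s k) = 0" using v(1) bJ v'r v's by (cases "s = r") auto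
  next
    fix s t assume "s < Suc r" "t < Suc r"
    then consider "s = r" "t = r" | "s = r" "t < r" | "s < r" "t = r" | "s < r" "t < r" by linarith
    then show "(\<Sum>k\<in>G. v' s k * v' t k) = (if s = t then 1 else 0)"
    proof cases
      case 1 then show ?thesis using bb v'r by simp
    next
      case 2 then show ?thesis using bv[of t] v'r v's by (simp add: mult.commute)
    next
      case 3 then show ?thesis using bv[of s] v'r v's by simp
    next
      case 4 then show ?thesis using v(2)[of s t] v's by simp
    qed
  qed
qed simp

lemma bessel_inequality_sum:
  fixes v :: "nat \<Rightarrow> 'k \<Rightarrow> real"
  assumes v: "\<And>s t. s < r \<Longrightarrow> t < r \<Longrightarrow> (\<Sum>k\<in>G. v s k * v t k) = (if s = t then 1 else 0)"
  shows "(\<Sum>s<r. (\<Sum>k\<in>G. v s k * d k)\<^sup>2) \<le> (\<Sum>k\<in>G. (d k)\<^sup>2)"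
proof -
  define \<alpha> where "\<alpha> s = (\<Sum>k\<in>G. v s k * d k)" for s
  define p where "p k = (\<Sum>s<r. \<alpha> s * v s k)" for k
  have dp: "(\<Sum>k\<in>G. d k * p k) = (\<Sum>s<r. (\<alpha> s)\<^sup>2)"
  proof -
    have "(\<Sum>k\<in>G. d k * p k) = (\<Sum>k\<in>G. \<Sum>s<r. \<alpha> s * (v s k * d k))"
      by (simp add: p_def sum_distrib_left mult_ac)
    also have "\<dots> = (\<Sum>s<r. \<Sum>k\<in>G. \<alpha> s * (v s k * d k))" by (rule sum.swap)
    also have "\<dots> = (\<Sum>s<r. (\<alpha> s)\<^sup>2)" by (simp add: sum_distrib_left[symmetric] \<alpha>_def power2_eq_square)
    finally show ?thesis .
  qed
  have pp: "(\<Sum>k\<in>G. p k * p k) = (\<Sum>s<r. (\<alpha> s)\<^sup>2)"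
  proof -
    have "(\<Sum>k\<in>G. p k * p k) = (\<Sum>k\<in>G. \<Sum>s<r. \<Sum>t<r. \<alpha> s * \<alpha> t * (v s k * v t k))"
      by (simp add: p_def sum_product mult_ac)
    also have "\<dots> = (\<Sum>s<r. \<Sum>k\<in>G. \<Sum>t<r. \<alpha> s * \<alpha> t * (v s k * v t k))" by (rule sum.swap)
    also have "\<dots> = (\<Sum>s<r. \<Sum>t<r. \<Sum>k\<in>G. \<alpha> s * \<alpha> t * (v s k * v t k))"
      by (intro sum.cong refl sum.swap)
    also have "\<dots> = (\<Sum>s<r. \<Sum>t<r. \<alpha> s * \<alpha> t * (if s = t then 1 else 0))"
      by (intro sum.cong refl) (simp add: sum_distrib_left[symmetric] v)
    also have "\<dots> = (\<Sum>s<r. \<Sum>t<r. if s = t then (\<alpha> s)\<^sup>2 else 0)"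
      by (intro sum.cong refl) (auto simp: power2_eq_square)
    finally show ?thesis by simp
  qed
  have "0 \<le> (\<Sum>k\<in>G. (d k - p k)\<^sup>2)" by (intro sum_nonneg) auto
  also have "\<dots> = (\<Sum>k\<in>G. (d k)\<^sup>2 - 2 * (d k * p k) + p k * p k)"
    by (intro sum.cong refl) (simp add: power2_eq_square algebra_simps)
  also have "\<dots> = (\<Sum>k\<in>G. (d k)\<^sup>2) - 2 * (\<Sum>k\<in>G. d k * p k) + (\<Sum>k\<in>G. p k * p k)"
    by (simp add: sum.distrib sum_subtractf sum_distrib_left)
  finally show ?thesis unfolding dp pp \<alpha>_def by simp
qed

lemma summable_square_sum:
  fixes y :: "'k \<Rightarrow> nat \<Rightarrow> real"
  assumes "\<And>k. k \<in> G \<Longrightarrow> summable (\<lambda>j. (y k j)\<^sup>2)"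
  shows "summable (\<lambda>j. (\<Sum>k\<in>G. a k * y k j)\<^sup>2)"
proof (rule summable_comparison_test)
  show "summable (\<lambda>j. (\<Sum>k\<in>G. (a k)\<^sup>2) * (\<Sum>k\<in>G. (y k j)\<^sup>2))"
    using assms by (intro summable_mult summable_sum)
  show "\<exists>n0. \<forall>j\<ge>n0. norm ((\<Sum>k\<in>G. a k * y k j)\<^sup>2) \<le> (\<Sum>k\<in>G. (a k)\<^sup>2) * (\<Sum>k\<in>G. (y k j)\<^sup>2)"
    using Cauchy_Schwarz_ineq_sum by (intro exI[of _ 0]) auto
qed

text \<open>If the tails were not separated, most of the \<open>y k\<close> would lie close to a common subspace of dimension
  \<open>p + card A\<close>; comparing the traces of the Gram matrix on its orthogonal complement rules this out.\<close>

lemma separated_subset: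
  fixes y :: "'k \<Rightarrow> nat \<Rightarrow> real"
  assumes G: "finite G" and p: "p \<ge> 1" and \<mu>: "\<mu> > 0"
    and s: "\<And>k. k \<in> G \<Longrightarrow> summable (\<lambda>j. (y k j)\<^sup>2)"
    and lower: "\<And>a. \<mu> * (\<Sum>k\<in>G. (a k)\<^sup>2) \<le> (\<Sum>j. (\<Sum>k\<in>G. a k * y k j)\<^sup>2)"
  shows "\<exists>A\<subseteq>G. (\<forall>k\<in>A. \<forall>l\<in>A. k \<noteq> l \<longrightarrow> \<mu> / 2 \<le> (\<Sum>j. (if j < p then 0 else y k j - y l j)\<^sup>2)) \<and> card G < 2 * (card A + p)"
proof -
  define d where "d k l = (\<Sum>j. (if j < p then 0 else y k j - y l j)\<^sup>2)" for k l
  define sep where "sep A \<longleftrightarrow> A \<subseteq> G \<and> (\<forall>k\<in>A. \<forall>l\<in>A. k \<noteq> l \<longrightarrow> \<mu> / 2 \<le> d k l)" for A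
  have dsym: "d k l = d l k" for k l
    unfolding d_def by (intro suminf_cong) (simp add: power2_commute)
  have "sep {}" by (simp add: sep_def)
  moreover have "\<And>A. sep A \<Longrightarrow> card A \<le> card G" using G by (auto simp: sep_def intro: card_mono)
  \<comment> \<open>A separated set of maximal cardinality: every k in G is then closer than \<mu> /
    2 to some member, which becomes its centre \<open>a k\<close>.\<close>
  ultimately obtain A where A: "sep A" "\<And>A'. sep A' \<Longrightarrow> card A' \<le> card A"
    using ex_has_greatest_nat[of sep "{}" card "card G + 1"] by (metis less_Suc_eq_le Suc_eq_plus1)
  have AG: "A \<subseteq> G" "finite A" using A(1) G by (auto simp: sep_def intro: finite_subset)
  have "\<exists>l\<in>A. d k l < \<mu> / 2" if k: "k \<in> G" for k
  proof (rule ccontr)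
    assume neg: "\<not> ?thesis"
    have "d k k = 0" unfolding d_def by (simp cong: if_cong)
    then have "k \<notin> A" using neg \<mu> by force
    have "sep (insert k A)" using A(1) k neg dsym unfolding sep_def by (auto simp: not_less)
    then have "card (insert k A) \<le> card A" by (rule A(2))
    then show False using \<open>k \<notin> A\<close> AG by simp
  qed
  then obtain a where a: "\<And>k. k \<in> G \<Longrightarrow> a k \<in> A" "\<And>k. k \<in> G \<Longrightarrow> d k (a k) < \<mu> / 2" by metis
  have "card G < 2 * (card A + p)"
  proof (rule ccontr)
    assume "\<not> ?thesis"
    then have big: "2 * (card A + p) \<le> card G" by simp
    \<comment> \<open>The dimension left after p + card A linear conditions; it is at least half of
      card G.\<close>
    define r where "r = card G - (card A + p)"
    have r: "card A + p + r = card G" "card G \<le> 2 * r" using big by (auto simp: r_def)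
    \<comment> \<open>The first p conditions annihilate the coordinates below p. The other card A
      make the coefficients of every cluster \<open>{k. a k = l}\<close> sum to 0, so that
      \<open>y k\<close> may be replaced by its deviation \<open>e k\<close> from the
      centre.\<close>
    define c where "c i k = (case i of Inl j \<Rightarrow> y k j | Inr l \<Rightarrow> if a k = l then 1 else 0)" for i :: "nat + 'k" and k
    have "card ({..<p} <+> A) + r \<le> card G" using AG r by (simp add: card_Plus)
    moreover have "finite ({..<p} <+> A)" using AG by simp
    ultimately have "\<exists>v :: nat \<Rightarrow> 'k \<Rightarrow> real. (\<forall>s<r. \<forall>i\<in>{..<p} <+> A. (\<Sum>k\<in>G. c i k * v s k) = 0) \<and>
      (\<forall>s<r. \<forall>t<r. (\<Sum>k\<in>G. v s k * v t k) = (if s = t then 1 else 0))"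
      by (intro orthonormal_solutions G)
    then obtain v :: "nat \<Rightarrow> 'k \<Rightarrow> real" where
      v0: "\<And>s i. s < r \<Longrightarrow> i \<in> {..<p} <+> A \<Longrightarrow> (\<Sum>k\<in>G. c i k * v s k) = 0" and
      von: "\<And>s t. s < r \<Longrightarrow> t < r \<Longrightarrow> (\<Sum>k\<in>G. v s k * v t k) = (if s = t then 1 else 0)" by blast
    define e where "e k j = (if j < p then 0 else y k j - y (a k) j)" for k j
    have es: "summable (\<lambda>j. (e k j)\<^sup>2)" if k: "k \<in> G" for k
    proof (rule summable_comparison_test)
      show "summable (\<lambda>j. 2 * ((y k j)\<^sup>2 + (y (a k) j)\<^sup>2))"
        using s k a(1)[OF k] AG by (intro summable_mult summable_add) auto
      show "\<exists>n0. \<forall>j\<ge>n0. norm ((e k j)\<^sup>2) \<le> 2 * ((y k j)\<^sup>2 + (y (a k) j)\<^sup>2)"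
      proof (intro exI allI impI)
        fix j
        have "0 \<le> (y k j + y (a k) j)\<^sup>2" by simp
        then show "norm ((e k j)\<^sup>2) \<le> 2 * ((y k j)\<^sup>2 + (y (a k) j)\<^sup>2)"
          by (simp add: e_def power2_eq_square algebra_simps)
      qed
    qed
    have eq: "(\<Sum>k\<in>G. v s k * y k j) = (\<Sum>k\<in>G. v s k * e k j)" if sr: "s < r" for s j
    proof (cases "j < p")
      case True
      then have "Inl j \<in> {..<p} <+> A" by auto
      from v0[OF sr this] show ?thesis using True by (simp add: c_def e_def mult.commute)
    next
      case False
      have "(\<Sum>k\<in>G. v s k * y (a k) j) = (\<Sum>k\<in>G. \<Sum>l\<in>A. y l j * (if a k = l then v s k else 0))"
        using a(1) AG by (intro sum.cong refl) (simp add: if_distrib[of "(*) _"] mult.commute cong: if_cong)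
      also have "\<dots> = (\<Sum>l\<in>A. \<Sum>k\<in>G. y l j * (if a k = l then v s k else 0))" by (rule sum.swap)
      also have "\<dots> = (\<Sum>l\<in>A. y l j * (\<Sum>k\<in>G. c (Inr l) k * v s k))"
        unfolding sum_distrib_left by (intro sum.cong refl) (simp add: c_def)
      also have "\<dots> = 0"
      proof (intro sum.neutral ballI)
        fix l assume "l \<in> A"
        then have "Inr l \<in> {..<p} <+> A" by auto
        from v0[OF sr this] show "y l j * (\<Sum>k\<in>G. c (Inr l) k * v s k) = 0" by simp
      qed
      finally show ?thesis using False by (simp add: e_def right_diff_distrib sum_subtractf)
    qed
    have one: "\<mu> \<le> (\<Sum>j. (\<Sum>k\<in>G. v s k * e k j)\<^sup>2)" if sr: "s < r" for s
    proof -
      have "(\<Sum>k\<in>G. (v s k)\<^sup>2) = 1" using von[OF sr sr] by (simp add: power2_eq_square)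
      then show ?thesis using lower[of "v s"] by (simp add: eq[OF sr])
    qed
    \<comment> \<open>Two bounds for the same trace: r orthonormal directions with at least \<mu>
      each, against less than \<mu> / 2 from each of the card G \<le> 2 r vectors.\<close>
    have "real r * \<mu> \<le> (\<Sum>s<r. \<Sum>j. (\<Sum>k\<in>G. v s k * e k j)\<^sup>2)"
      using sum_mono[of "{..<r}" "\<lambda>_. \<mu>" "\<lambda>s. \<Sum>j. (\<Sum>k\<in>G. v s k * e k j)\<^sup>2"] one by simp
    also have "\<dots> = (\<Sum>j. \<Sum>s<r. (\<Sum>k\<in>G. v s k * e k j)\<^sup>2)"
      by (rule suminf_sum[symmetric]) (rule summable_square_sum[OF es])
    also have "\<dots> \<le> (\<Sum>j. \<Sum>k\<in>G. (e k j)\<^sup>2)"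
      by (intro suminf_le summable_sum summable_square_sum es bessel_inequality_sum von)
    also have "\<dots> = (\<Sum>k\<in>G. \<Sum>j. (e k j)\<^sup>2)" by (rule suminf_sum) (rule es)
    also have "\<dots> = (\<Sum>k\<in>G. d k (a k))" unfolding e_def d_def ..
    also have "\<dots> < (\<Sum>k\<in>G. \<mu> / 2)"
    proof (rule sum_strict_mono[OF G])
      show "G \<noteq> {}" using big p by auto
    qed (use a in auto)
    also have "\<dots> = real (card G) * \<mu> / 2" by simp
    also have "\<dots> \<le> real (2 * r) * \<mu> / 2" using r(2) \<mu> by (intro divide_right_mono mult_right_mono of_nat_mono) auto
    finally show False by simp
  qed
  then show ?thesis using A(1) unfolding sep_def d_def by (intro exI[of _ A]) auto
qed

subsection \<open>The variogram on the integer lattice\<close>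

definition lat_sq :: "('n::finite \<Rightarrow> int) \<Rightarrow> ('n \<Rightarrow> int) \<Rightarrow> real" where
  "lat_sq z w = (\<Sum>i\<in>UNIV. (real_of_int (z i - w i))\<^sup>2)"

lemma sum_half_power_le:
  fixes a :: int
  assumes "finite T"
  shows "(\<Sum>k\<in>T. (1 / 2 :: real) ^ nat \<bar>a - k\<bar>) \<le> 3"
proof -
  have sym: "(\<Sum>k\<in>{a - int n..a + int n}. (1 / 2 :: real) ^ nat \<bar>a - k\<bar>) = 3 - 2 * (1 / 2) ^ n" for n
  proof (induction n)
    case (Suc n)
    have "{a - int (Suc n)..a + int (Suc n)} = insert (a - int (Suc n)) (insert (a + int (Suc n)) {a - int n..a + int n})"
      by auto
    then show ?case using Suc by (simp add: nat_add_distrib)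
  qed simp
  define n where "n = nat (Max (insert 0 ((\<lambda>k. \<bar>a - k\<bar>) ` T)))"
  have "T \<subseteq> {a - int n..a + int n}"
  proof
    fix k assume "k \<in> T"
    then have "\<bar>a - k\<bar> \<le> Max (insert 0 ((\<lambda>k. \<bar>a - k\<bar>) ` T))" using assms by (intro Max_ge) auto
    also have "\<dots> \<le> int n" by (simp add: n_def)
    finally show "k \<in> {a - int n..a + int n}" by auto
  qed
  then have "(\<Sum>k\<in>T. (1 / 2 :: real) ^ nat \<bar>a - k\<bar>) \<le> (\<Sum>k\<in>{a - int n..a + int n}. (1 / 2 :: real) ^ nat \<bar>a - k\<bar>)"
    by (intro sum_mono2) auto
  then show ?thesis unfolding sym by (smt (verit) zero_le_power divide_nonneg_nonneg)
qed

text \<open>Half of the exponent pays for the gap |z - w|^2 \<ge> 1 and supplies exp (- K / 2); the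
  other half still dominates the l1 distance, so the sum factorises into one-dimensional geometric
  series of value at most 3.\<close>

lemma lattice_row_sum:
  fixes S :: "('n::finite \<Rightarrow> int) set"
  assumes S: "finite S" and K: "K \<ge> 2"
  shows "(\<Sum>w\<in>S - {z}. exp (- K * lat_sq z w)) \<le> exp (- K / 2) * 3 ^ CARD('n)"
proof -
  define T where "T i = (\<lambda>w. w i) ` S" for i :: 'n
  have T: "finite (T i)" for i using S by (simp add: T_def)
  have pt: "exp (- K * lat_sq z w) \<le> exp (- K / 2) * (\<Prod>i\<in>UNIV. (1 / 2) ^ nat \<bar>z i - w i\<bar>)" if "w \<in> S - {z}" for w
  proof -
    have "z \<noteq> w" using that by auto
    then obtain i0 where i0: "z i0 \<noteq> w i0" by (auto simp: fun_eq_iff)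
    have sq: "(real_of_int \<bar>d\<bar>) \<le> (real_of_int d)\<^sup>2" for d :: int
    proof (cases "d = 0")
      case False
      then have "1 \<le> \<bar>real_of_int d\<bar>" by linarith
      then have "\<bar>real_of_int d\<bar> * 1 \<le> \<bar>real_of_int d\<bar> * \<bar>real_of_int d\<bar>" by (intro mult_left_mono) auto
      then show ?thesis by (simp add: power2_eq_square)
    qed simp
    have "1 \<le> (real_of_int (z i0 - w i0))\<^sup>2" using sq[of "z i0 - w i0"] i0 by linarith
    also have "\<dots> \<le> lat_sq z w" unfolding lat_sq_def by (rule member_le_sum) auto
    finally have q1: "1 \<le> lat_sq z w" .
    have "(\<Sum>i\<in>UNIV. real (nat \<bar>z i - w i\<bar>)) \<le> lat_sq z w"
      unfolding lat_sq_def
    proof (intro sum_mono)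
      fix i show "real (nat \<bar>z i - w i\<bar>) \<le> (real_of_int (z i - w i))\<^sup>2"
        using sq[of "z i - w i"] by (simp del: of_int_diff)
    qed
    moreover have "K / 2 * 1 \<le> K / 2 * lat_sq z w" using q1 K by (intro mult_left_mono) auto
    moreover have "1 * lat_sq z w \<le> K / 2 * lat_sq z w" using q1 K by (intro mult_right_mono) auto
    ultimately have "- K * lat_sq z w \<le> - K / 2 + - (\<Sum>i\<in>UNIV. real (nat \<bar>z i - w i\<bar>))" by simp
    then have "exp (- K * lat_sq z w) \<le> exp (- K / 2) * exp (- (\<Sum>i\<in>UNIV. real (nat \<bar>z i - w i\<bar>)))"
      unfolding exp_add[symmetric] exp_le_cancel_iff .
    also have "exp (- (\<Sum>i\<in>UNIV. real (nat \<bar>z i - w i\<bar>))) = (\<Prod>i\<in>UNIV. exp (- 1) ^ nat \<bar>z i - w i\<bar>)"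
      by (simp add: sum_negf[symmetric] exp_sum exp_of_nat_mult[symmetric])
    also have "\<dots> \<le> (\<Prod>i\<in>UNIV. (1 / 2) ^ nat \<bar>z i - w i\<bar>)"
    proof (intro prod_mono conjI power_mono)
      show "exp (- 1) \<le> (1 / 2 :: real)" using exp_ge_add_one_self[of 1] by (simp add: exp_minus field_simps)
    qed auto
    finally show ?thesis by simp
  qed
  have "(\<Sum>w\<in>S - {z}. exp (- K * lat_sq z w)) \<le> (\<Sum>w\<in>S - {z}. exp (- K / 2) * (\<Prod>i\<in>UNIV. (1 / 2) ^ nat \<bar>z i - w i\<bar>))"
    by (intro sum_mono pt)
  also have "\<dots> \<le> (\<Sum>w\<in>PiE UNIV T. exp (- K / 2) * (\<Prod>i\<in>UNIV. (1 / 2) ^ nat \<bar>z i - w i\<bar>))"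
    using T by (intro sum_mono2 finite_PiE) (auto simp: T_def intro!: mult_nonneg_nonneg prod_nonneg)
  also have "\<dots> = exp (- K / 2) * (\<Prod>i\<in>UNIV. \<Sum>k\<in>T i. (1 / 2) ^ nat \<bar>z i - k\<bar>)"
    unfolding sum_distrib_left[symmetric] using T by (subst prod_sum_PiE) auto
  also have "\<dots> \<le> exp (- K / 2) * (\<Prod>i\<in>(UNIV::'n set). 3)"
    using T by (intro mult_left_mono prod_mono conjI sum_nonneg sum_half_power_le) auto
  finally show ?thesis by simp
qed

text \<open>2 |b z b w| \<le> (b z)^2 + (b w)^2 moves the off-diagonal mass, at most half of each
  row, onto the diagonal.\<close>

lemma gauss_kernel_diag_dominant:
  fixes S :: "('n::finite \<Rightarrow> int) set"
  assumes S: "finite S" and row: "\<And>z. z \<in> S \<Longrightarrow> (\<Sum>w\<in>S - {z}. exp (- t * lat_sq z w)) \<le> 1 / 2"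
  shows "(\<Sum>z\<in>S. (b z)\<^sup>2) / 2 \<le> (\<Sum>z\<in>S. \<Sum>w\<in>S. b z * b w * exp (- t * lat_sq z w))"
proof -
  have sym: "lat_sq z w = lat_sq w z" for z w :: "'n \<Rightarrow> int"
    unfolding lat_sq_def by (intro sum.cong refl) (metis of_int_diff power2_commute)
  have self: "lat_sq z z = 0" for z :: "'n \<Rightarrow> int" by (simp add: lat_sq_def)
  let ?e = "\<lambda>z w. exp (- t * lat_sq z w)"
  have half: "(\<Sum>z\<in>S. \<Sum>w\<in>S - {z}. (b z)\<^sup>2 / 2 * ?e z w) \<le> (\<Sum>z\<in>S. (b z)\<^sup>2) / 4"
  proof -
    have "(\<Sum>z\<in>S. \<Sum>w\<in>S - {z}. (b z)\<^sup>2 / 2 * ?e z w) = (\<Sum>z\<in>S. (b z)\<^sup>2 / 2 * (\<Sum>w\<in>S - {z}. ?e z w))"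
      by (simp add: sum_distrib_left)
    also have "\<dots> \<le> (\<Sum>z\<in>S. (b z)\<^sup>2 / 2 * (1 / 2))" using row by (intro sum_mono mult_left_mono) auto
    finally show ?thesis by (simp add: sum_divide_distrib)
  qed
  have half': "(\<Sum>z\<in>S. \<Sum>w\<in>S - {z}. (b w)\<^sup>2 / 2 * ?e z w) = (\<Sum>z\<in>S. \<Sum>w\<in>S - {z}. (b z)\<^sup>2 / 2 * ?e z w)"
  proof -
    have a: "(\<Sum>z\<in>S. \<Sum>w\<in>S - {z}. f z w) = (\<Sum>z\<in>S. \<Sum>w\<in>S. if w = z then 0 else f z w)" for f :: "('n \<Rightarrow> int) \<Rightarrow> ('n \<Rightarrow> int) \<Rightarrow> real"
    proof (rule sum.cong[OF refl])
      fix z :: "'n \<Rightarrow> int" assume "z \<in> S"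
      have "(\<Sum>w\<in>S. if w = z then 0 else f z w) = (\<Sum>w\<in>S - {z}. if w = z then 0 else f z w)"
        using S by (intro sum.mono_neutral_right) auto
      also have "\<dots> = (\<Sum>w\<in>S - {z}. f z w)" by (intro sum.cong) auto
      finally show "(\<Sum>w\<in>S - {z}. f z w) = (\<Sum>w\<in>S. if w = z then 0 else f z w)" by simp
    qed
    show ?thesis unfolding a
      by (subst sum.swap) (auto intro!: sum.cong simp: sym)
  qed
  have "(\<Sum>z\<in>S. \<Sum>w\<in>S. b z * b w * ?e z w) = (\<Sum>z\<in>S. (b z)\<^sup>2 + (\<Sum>w\<in>S - {z}. b z * b w * ?e z w))"
    using S by (intro sum.cong refl) (simp add: sum.remove self power2_eq_square)
  also have "\<dots> = (\<Sum>z\<in>S. (b z)\<^sup>2) + (\<Sum>z\<in>S. \<Sum>w\<in>S - {z}. b z * b w * ?e z w)" by (rule sum.distrib)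
  finally have e1: "(\<Sum>z\<in>S. \<Sum>w\<in>S. b z * b w * ?e z w) = (\<Sum>z\<in>S. (b z)\<^sup>2) + (\<Sum>z\<in>S. \<Sum>w\<in>S - {z}. b z * b w * ?e z w)" .
  have e2: "(\<Sum>z\<in>S. \<Sum>w\<in>S - {z}. b z * b w * ?e z w) \<ge> (\<Sum>z\<in>S. \<Sum>w\<in>S - {z}. - ((b z)\<^sup>2 / 2 * ?e z w + (b w)\<^sup>2 / 2 * ?e z w))"
  proof (intro sum_mono)
    fix z w
    have "0 \<le> (b z + b w)\<^sup>2 * ?e z w" by simp
    then show "- ((b z)\<^sup>2 / 2 * ?e z w + (b w)\<^sup>2 / 2 * ?e z w) \<le> b z * b w * ?e z w"
      by (simp add: power2_eq_square algebra_simps)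
  qed
  have e3: "(\<Sum>z\<in>S. \<Sum>w\<in>S - {z}. - ((b z)\<^sup>2 / 2 * ?e z w + (b w)\<^sup>2 / 2 * ?e z w))
     = - (2 * (\<Sum>z\<in>S. \<Sum>w\<in>S - {z}. (b z)\<^sup>2 / 2 * ?e z w))"
    unfolding sum_negf sum.distrib half' by (simp only: mult_2)
  show ?thesis using half e1 e2 e3 by linarith
qed

text \<open>Expanding |z - w|^2 leaves, up to rescaled coefficients, the kernel exp (2 t <z, w>),
  whose power series has nonnegative coefficients. The powers of <z, w> are handled by induction,
  moving one factor z_i w_i at a time into the coefficients.\<close>

lemma gauss_kernel_psd:
  fixes S :: "('n::finite \<Rightarrow> int) set"
  assumes S: "finite S" and t: "t \<ge> 0"
  shows "0 \<le> (\<Sum>z\<in>S. \<Sum>w\<in>S. b z * b w * exp (- t * lat_sq z w))"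
proof -
  define ip where "ip z w = (\<Sum>i\<in>UNIV. real_of_int (z i) * real_of_int (w i))" for z w :: "'n \<Rightarrow> int"
  have pow: "0 \<le> (\<Sum>z\<in>S. \<Sum>w\<in>S. \<beta> z * \<beta> w * ip z w ^ n)" for \<beta> n
  proof (induction n arbitrary: \<beta>)
    case 0
    have "(\<Sum>z\<in>S. \<Sum>w\<in>S. \<beta> z * \<beta> w) = (\<Sum>z\<in>S. \<beta> z)\<^sup>2" by (simp add: power2_eq_square sum_product)
    then show ?case by simp
  next
    case (Suc n)
    have "(\<Sum>z\<in>S. \<Sum>w\<in>S. \<beta> z * \<beta> w * ip z w ^ Suc n)
      = (\<Sum>z\<in>S. \<Sum>w\<in>S. \<Sum>i\<in>UNIV. (\<beta> z * real_of_int (z i)) * (\<beta> w * real_of_int (w i)) * ip z w ^ n)"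
    proof (intro sum.cong refl)
      fix z w
      have "\<beta> z * \<beta> w * ip z w ^ Suc n = (\<beta> z * \<beta> w * ip z w ^ n) * ip z w" by simp
      also have "\<dots> = (\<Sum>i\<in>UNIV. (\<beta> z * \<beta> w * ip z w ^ n) * (real_of_int (z i) * real_of_int (w i)))"
        by (subst (2) ip_def) (rule sum_distrib_left)
      finally show "\<beta> z * \<beta> w * ip z w ^ Suc n = (\<Sum>i\<in>UNIV. (\<beta> z * real_of_int (z i)) * (\<beta> w * real_of_int (w i)) * ip z w ^ n)"
        by (simp only: ac_simps)
    qed
    also have "\<dots> = (\<Sum>z\<in>S. \<Sum>i\<in>UNIV. \<Sum>w\<in>S. (\<beta> z * real_of_int (z i)) * (\<beta> w * real_of_int (w i)) * ip z w ^ n)"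
      by (intro sum.cong refl sum.swap)
    also have "\<dots> = (\<Sum>i\<in>UNIV. \<Sum>z\<in>S. \<Sum>w\<in>S. (\<beta> z * real_of_int (z i)) * (\<beta> w * real_of_int (w i)) * ip z w ^ n)"
      by (rule sum.swap)
    finally show ?case using Suc by (simp add: sum_nonneg)
  qed
  define \<beta> where "\<beta> z = b z * exp (- t * ip z z)" for z
  have kernel: "b z * b w * exp (- t * lat_sq z w) = \<beta> z * \<beta> w * exp (2 * t * ip z w)" for z w
  proof -
    have "lat_sq z w = ip z z + ip w w - 2 * ip z w"
      by (simp add: lat_sq_def ip_def sum.distrib[symmetric] sum_subtractf[symmetric] sum_distrib_left power2_eq_square algebra_simps)
    then have "- t * lat_sq z w = - t * (ip z z + ip w w - 2 * ip z w)" by (rule arg_cong)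
    also have "\<dots> = - t * ip z z + - t * ip w w + 2 * t * ip z w" by (simp add: algebra_simps)
    finally have "- t * lat_sq z w = - t * ip z z + - t * ip w w + 2 * t * ip z w" .
    then show ?thesis by (simp only: \<beta>_def exp_add ac_simps)
  qed
  have s: "(\<lambda>n. \<Sum>z\<in>S. \<Sum>w\<in>S. \<beta> z * \<beta> w * ((2 * t * ip z w) ^ n /\<^sub>R fact n)) sums (\<Sum>z\<in>S. \<Sum>w\<in>S. \<beta> z * \<beta> w * exp (2 * t * ip z w))"
    by (intro sums_sum sums_mult exp_converges)
  have nn: "0 \<le> (\<Sum>z\<in>S. \<Sum>w\<in>S. \<beta> z * \<beta> w * ((2 * t * ip z w) ^ n /\<^sub>R fact n))" for n
  proof -
    have "(\<Sum>z\<in>S. \<Sum>w\<in>S. \<beta> z * \<beta> w * ((2 * t * ip z w) ^ n /\<^sub>R fact n))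
      = (2 * t) ^ n / fact n * (\<Sum>z\<in>S. \<Sum>w\<in>S. \<beta> z * \<beta> w * ip z w ^ n)"
      unfolding sum_distrib_left by (intro sum.cong refl) (simp add: power_mult_distrib field_simps)
    then show ?thesis using pow[of \<beta> n] t by simp
  qed
  show ?thesis unfolding kernel by (rule sums_le[OF nn sums_zero s])
qed

section \<open>The power q^H as a mixture of Gaussian kernels\<close>

text \<open>Up to a constant, q^H is the integral over t > 0 of (1 - exp (- t q)) t^(- H - 1), for 0
  < H < 1.\<close>

definition variogram_integrand :: "real \<Rightarrow> real \<Rightarrow> real \<Rightarrow> real" where
  "variogram_integrand H q t = indicator {0<..} t * ((1 - exp (- t * q)) * t powr (- H - 1))"

text \<open>H < 1 gives integrability at 0, where 1 - exp (- t) \<le> t; H > 0 gives it at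
  infinity.\<close>

lemma variogram_integrand_integrable_1:
  assumes H: "0 < H" "H < 1"
  shows "integrable lborel (variogram_integrand H 1)"
proof (rule integrableI_nonneg)
  show "variogram_integrand H 1 \<in> borel_measurable lborel"
    unfolding variogram_integrand_def[abs_def] by measurable
  show "AE t in lborel. 0 \<le> variogram_integrand H 1 t"
    by (rule AE_I2) (auto simp: variogram_integrand_def indicator_def)
  have b: "ennreal (variogram_integrand H 1 t) \<le> ennreal (indicator {0..1} t * t powr (- H)) + ennreal (indicator {1..} t * t powr (- H - 1))" for t
  proof -
    consider "t \<le> 0" | "0 < t" "t \<le> 1" | "t > 1" by linarith
    then show ?thesis
    proof cases
      case 1
      then show ?thesis by (simp add: variogram_integrand_def indicator_def)
    next
      case 2
      have "(1 - exp (- t)) * t powr (- H - 1) \<le> t * t powr (- H - 1)"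
        using exp_ge_add_one_self[of "- t"] by (intro mult_right_mono) auto
      also have "\<dots> = t powr (- H)" using 2 powr_add[of t 1 "- H - 1"] by simp
      finally have "variogram_integrand H 1 t \<le> indicator {0..1} t * t powr (- H)"
        using 2 by (simp add: variogram_integrand_def indicator_def)
      then have "ennreal (variogram_integrand H 1 t) \<le> ennreal (indicator {0..1} t * t powr (- H))" by (rule ennreal_leI)
      then show ?thesis by (rule order_trans) simp
    next
      case 3
      have "(1 - exp (- t)) * t powr (- H - 1) \<le> 1 * t powr (- H - 1)"
        by (intro mult_right_mono) auto
      then have "variogram_integrand H 1 t \<le> indicator {1..} t * t powr (- H - 1)"
        using 3 by (simp add: variogram_integrand_def indicator_def)
      then have "ennreal (variogram_integrand H 1 t) \<le> ennreal (indicator {1..} t * t powr (- H - 1))" by (rule ennreal_leI)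
      then show ?thesis by (rule order_trans) simp
    qed
  qed
  have 1: "(\<integral>\<^sup>+t. ennreal (indicator {0..1} t * t powr (- H)) \<partial>lborel) = ennreal (1 powr (- H + 1) / (- H + 1))"
  proof (rule nn_integral_has_integral_lebesgue)
    show "((\<lambda>t. t powr (- H)) has_integral 1 powr (- H + 1) / (- H + 1)) {0..1::real}"
      using H by (intro has_integral_powr_from_0) auto
  qed auto
  have 2: "(\<integral>\<^sup>+t. ennreal (indicator {1..} t * t powr (- H - 1)) \<partial>lborel) = ennreal (- (1 powr (- H - 1 + 1)) / (- H - 1 + 1))"
  proof (rule nn_integral_has_integral_lebesgue)
    show "((\<lambda>t. t powr (- H - 1)) has_integral - (1 powr (- H - 1 + 1)) / (- H - 1 + 1)) {1::real..}"
      using H by (intro has_integral_powr_to_inf) auto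
  qed auto
  have "(\<integral>\<^sup>+t. ennreal (variogram_integrand H 1 t) \<partial>lborel)
     \<le> (\<integral>\<^sup>+t. ennreal (indicator {0..1} t * t powr (- H)) + ennreal (indicator {1..} t * t powr (- H - 1)) \<partial>lborel)"
    by (intro nn_integral_mono b)
  also have "\<dots> = (\<integral>\<^sup>+t. ennreal (indicator {0..1} t * t powr (- H)) \<partial>lborel) + (\<integral>\<^sup>+t. ennreal (indicator {1..} t * t powr (- H - 1)) \<partial>lborel)"
    by (rule nn_integral_add) measurable
  also have "\<dots> < \<infinity>" unfolding 1 2 by simp
  finally show "(\<integral>\<^sup>+t. ennreal (variogram_integrand H 1 t) \<partial>lborel) < \<infinity>" .
qed

lemma variogram_integrand_scale:
  "q > 0 \<Longrightarrow> variogram_integrand H 1 (q * t) = q powr (- H - 1) * variogram_integrand H q t"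
  by (auto simp: variogram_integrand_def indicator_def powr_mult zero_less_mult_iff mult.commute)

text \<open>The substitution of q t for t produces the power of q.\<close>

lemma variogram_integral:
  assumes H: "0 < H" "H < 1" and q: "q \<ge> 0"
  shows "integrable lborel (variogram_integrand H q)"
    and "(\<integral>t. variogram_integrand H q t \<partial>lborel) = q powr H * (\<integral>t. variogram_integrand H 1 t \<partial>lborel)"
proof -
  have "integrable lborel (variogram_integrand H q) \<and>
    (\<integral>t. variogram_integrand H q t \<partial>lborel) = q powr H * (\<integral>t. variogram_integrand H 1 t \<partial>lborel)"
  proof (cases "q = 0")
    case True
    then show ?thesis by (simp add: variogram_integrand_def[abs_def])
  next
    case False
    then have q: "q > 0" using q by simp
    have "integrable lborel (\<lambda>t. variogram_integrand H 1 (0 + q * t))"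
      using variogram_integrand_integrable_1[OF H] q by (intro lborel_integrable_real_affine) auto
    then have "integrable lborel (\<lambda>t. q powr (- H - 1) * variogram_integrand H q t)"
      by (simp add: variogram_integrand_scale[OF q])
    then have i: "integrable lborel (variogram_integrand H q)" using q by simp
    have "(\<integral>t. variogram_integrand H 1 t \<partial>lborel) = \<bar>q\<bar> *\<^sub>R (\<integral>t. variogram_integrand H 1 (0 + q * t) \<partial>lborel)"
      using q by (intro lborel_integral_real_affine) auto
    also have "\<dots> = q * (q powr (- H - 1) * (\<integral>t. variogram_integrand H q t \<partial>lborel))"
      using q by (simp add: variogram_integrand_scale[OF q])
    also have "\<dots> = q powr (- H) * (\<integral>t. variogram_integrand H q t \<partial>lborel)"
      using q powr_add[of q 1 "- H - 1"] by simp
    finally show ?thesis using i q by (simp add: powr_minus field_simps)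
  qed
  then show "integrable lborel (variogram_integrand H q)"
    "(\<integral>t. variogram_integrand H q t \<partial>lborel) = q powr H * (\<integral>t. variogram_integrand H 1 t \<partial>lborel)" by auto
qed

text \<open>Coefficients with sum 0 cancel the 1 in 1 - exp (- t q) and leave the Gaussian form with
  positive sign. For small t it is merely nonnegative; the range t \<ge> K, where it dominates half
  the sum of squares, supplies the whole constant.\<close>

lemma lattice_variogram_lower:
  assumes H: "0 < H" "H < 1"
  shows "\<exists>c>0. \<forall>(S :: ('n::finite \<Rightarrow> int) set) b. finite S \<longrightarrow> (\<Sum>z\<in>S. b z) = 0 \<longrightarrow>
    c * (\<Sum>z\<in>S. (b z)\<^sup>2) \<le> - (\<Sum>z\<in>S. \<Sum>w\<in>S. b z * b w * lat_sq z w powr H)"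
proof -
  define \<kappa> where "\<kappa> = (\<integral>t. variogram_integrand H 1 t \<partial>lborel)"
  \<comment> \<open>From here on the row sums off the diagonal are at most exp (- K / 2) 3^N \<le>
    1/2.\<close>
  define K :: real where "K = max 2 (2 * ln (2 * 3 ^ CARD('n)))"
  have K: "K \<ge> 2" "K > 0" by (auto simp: K_def)
  have K2: "exp (- t / 2) * 3 ^ CARD('n) \<le> 1 / 2" if "t \<ge> K" for t
  proof -
    have "ln (2 * 3 ^ CARD('n)) \<le> t / 2" using that by (simp add: K_def)
    then have "exp (ln (2 * 3 ^ CARD('n))) \<le> exp (t / 2)" by (simp only: exp_le_cancel_iff)
    then have "2 * 3 ^ CARD('n) \<le> exp (t / 2)" by simp
    then show ?thesis by (simp add: exp_minus field_simps)
  qed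
  define J where "J = - (K powr (- H - 1 + 1)) / (- H - 1 + 1)"
  have J: "J > 0" unfolding J_def using H K by (simp add: divide_neg_neg)
  have \<kappa>: "\<kappa> > 0"
  proof (rule ccontr)
    assume "\<not> \<kappa> > 0"
    moreover have nn: "0 \<le> variogram_integrand H 1 t" for t by (auto simp: variogram_integrand_def indicator_def)
    then have "\<kappa> \<ge> 0" unfolding \<kappa>_def by (rule Bochner_Integration.integral_nonneg)
    ultimately have "\<kappa> = 0" by simp
    then have "AE t in lborel. variogram_integrand H 1 t = 0"
      using integral_nonneg_eq_0_iff_AE[OF variogram_integrand_integrable_1[OF H]] nn by (auto simp: \<kappa>_def)
    then have "AE t in lborel. t \<notin> {0<..<1::real}"
      by eventually_elim (auto simp: variogram_integrand_def indicator_def)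
    then have "emeasure lborel {0<..<1::real} = 0" by (subst (asm) AE_iff_measurable[where N = "{0<..<1}"]) auto
    then show False by simp
  qed
  define c where "c = J / (2 * \<kappa>)"
  have "c > 0" using J \<kappa> by (simp add: c_def)
  moreover have "c * (\<Sum>z\<in>S. (b z)\<^sup>2) \<le> - (\<Sum>z\<in>S. \<Sum>w\<in>S. b z * b w * lat_sq z w powr H)"
    if S: "finite S" and b: "(\<Sum>z\<in>S. b z) = 0" for S :: "('n \<Rightarrow> int) set" and b
  proof -
    define g where "g t = (\<Sum>z\<in>S. \<Sum>w\<in>S. b z * b w * exp (- t * lat_sq z w))" for t
    let ?B = "\<Sum>z\<in>S. (b z)\<^sup>2"
    have q0: "lat_sq z w \<ge> 0" for z w :: "'n \<Rightarrow> int" by (auto simp: lat_sq_def intro: sum_nonneg)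
    have pt: "- (\<Sum>z\<in>S. \<Sum>w\<in>S. b z * b w * variogram_integrand H (lat_sq z w) t) = indicator {0<..} t * t powr (- H - 1) * g t" for t
    proof -
      have "(\<Sum>z\<in>S. \<Sum>w\<in>S. b z * b w * variogram_integrand H (lat_sq z w) t)
        = indicator {0<..} t * t powr (- H - 1) * (\<Sum>z\<in>S. \<Sum>w\<in>S. b z * b w * (1 - exp (- t * lat_sq z w)))"
        unfolding sum_distrib_left variogram_integrand_def by (intro sum.cong refl) (simp only: ac_simps)
      also have "(\<Sum>z\<in>S. \<Sum>w\<in>S. b z * b w * (1 - exp (- t * lat_sq z w))) = (\<Sum>z\<in>S. \<Sum>w\<in>S. b z * b w) - g t"
        by (simp add: g_def right_diff_distrib sum_subtractf)
      also have "(\<Sum>z\<in>S. \<Sum>w\<in>S. b z * b w) = 0" using b by (simp add: sum_product[symmetric])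
      finally show ?thesis by simp
    qed
    have int: "integrable lborel (\<lambda>t. \<Sum>z\<in>S. \<Sum>w\<in>S. b z * b w * variogram_integrand H (lat_sq z w) t)"
      using variogram_integral(1)[OF H q0] by (intro Bochner_Integration.integrable_sum integrable_mult_right) auto
    have "(\<integral>t. (\<Sum>z\<in>S. \<Sum>w\<in>S. b z * b w * variogram_integrand H (lat_sq z w) t) \<partial>lborel)
       = (\<Sum>z\<in>S. \<Sum>w\<in>S. b z * b w * (lat_sq z w powr H * \<kappa>))"
      using variogram_integral[OF H q0] by (simp add: Bochner_Integration.integral_sum \<kappa>_def)
    also have "\<dots> = \<kappa> * (\<Sum>z\<in>S. \<Sum>w\<in>S. b z * b w * lat_sq z w powr H)"
      unfolding sum_distrib_left by (intro sum.cong refl) simp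
    finally have eq: "\<kappa> * - (\<Sum>z\<in>S. \<Sum>w\<in>S. b z * b w * lat_sq z w powr H)
        = (\<integral>t. indicator {0<..} t * t powr (- H - 1) * g t \<partial>lborel)"
      unfolding pt[symmetric] by simp
    have int': "integrable lborel (\<lambda>t. indicator {0<..} t * t powr (- H - 1) * g t)"
      unfolding pt[symmetric] using int by simp
    have low: "indicator {K..} t * t powr (- H - 1) * (?B / 2) \<le> indicator {0<..} t * t powr (- H - 1) * g t" for t
    proof (cases "t \<ge> K")
      case True
      then have "exp (- t / 2) * 3 ^ CARD('n) \<le> 1 / 2" by (rule K2)
      then have "?B / 2 \<le> g t" unfolding g_def
        using True K by (intro gauss_kernel_diag_dominant S order_trans[OF lattice_row_sum[OF S]]) linarith+
      then have "t powr (- H - 1) * (?B / 2) \<le> t powr (- H - 1) * g t" by (intro mult_left_mono) auto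
      then show ?thesis using True K by (simp add: indicator_def)
    next
      case False
      show ?thesis
      proof (cases "t > 0")
        case True
        then have "0 \<le> g t" unfolding g_def by (intro gauss_kernel_psd S) auto
        then show ?thesis using True False by (simp add: indicator_def)
      qed (use False in \<open>simp add: indicator_def\<close>)
    qed
    have hi: "((\<lambda>t. t powr (- H - 1)) has_integral J) {K..}"
      unfolding J_def using H K by (intro has_integral_powr_to_inf) auto
    have "J * (?B / 2) \<le> (\<integral>t. indicator {0<..} t * t powr (- H - 1) * g t \<partial>lborel)"
    proof -
      have n: "(\<integral>\<^sup>+t. ennreal (indicator {K..} t * t powr (- H - 1)) \<partial>lborel) = ennreal J"
        by (rule nn_integral_has_integral_lebesgue[OF _ hi]) auto
      have hb: "has_bochner_integral lborel (\<lambda>t. indicator {K..} t * t powr (- H - 1)) J"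
        using n J by (intro has_bochner_integral_nn_integral) auto
      then have "has_bochner_integral lborel (\<lambda>t. indicator {K..} t * t powr (- H - 1) * (?B / 2)) (J * (?B / 2))"
        by (intro has_bochner_integral_mult_left) auto
      then have "integrable lborel (\<lambda>t. indicator {K..} t * t powr (- H - 1) * (?B / 2))"
        and e: "(\<integral>t. indicator {K..} t * t powr (- H - 1) * (?B / 2) \<partial>lborel) = J * (?B / 2)"
        by (auto simp: has_bochner_integral_iff)
      then show ?thesis unfolding e[symmetric] by (intro integral_mono int' low)
    qed
    then have "J * (?B / 2) \<le> \<kappa> * - (\<Sum>z\<in>S. \<Sum>w\<in>S. b z * b w * lat_sq z w powr H)" unfolding eq .
    then show ?thesis using \<kappa> by (simp add: c_def field_simps)
  qed
  ultimately show ?thesis by blast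
qed

subsection \<open>Translates of Gaussian measures\<close>

lemma iid_std_normal_minus:
  assumes M: "prob_space M" and Z: "iid_std_normal M J Z"
  shows "iid_std_normal M J (\<lambda>j \<omega>. - Z j \<omega>)"
proof -
  interpret prob_space M by fact
  have "indep_vars (\<lambda>_. borel) (\<lambda>j \<omega>. - Z j \<omega>) J"
    using Z by (intro indep_vars_compose2[where X = Z and M' = "\<lambda>_. borel" and Y = "\<lambda>j z. - z"]) (auto simp: iid_std_normal_def)
  moreover have "distributed M lborel (\<lambda>\<omega>. - Z j \<omega>) std_normal_density" if "j \<in> J" for j
    using normal_density_affine[of "Z j" 0 1 "-1" 0] Z that by (auto simp: iid_std_normal_def)
  ultimately show ?thesis by (simp add: iid_std_normal_def)
qed

text \<open>The Cameron-Martin density: the law of Z - w relative to the standard Gaussian law of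
  Z.\<close>

definition shift_density :: "nat set \<Rightarrow> (nat \<Rightarrow> real) \<Rightarrow> (nat \<Rightarrow> real) \<Rightarrow> real" where
  "shift_density J w z = exp (- (\<Sum>j\<in>J. w j * z j) - (\<Sum>j\<in>J. (w j)\<^sup>2) / 2)"

lemma iid_std_normal_shift_law:
  assumes M: "prob_space M" and Z: "iid_std_normal M J Z" and J: "finite J" "J \<noteq> {}"
  shows "distr M (\<Pi>\<^sub>M j\<in>J. borel) (\<lambda>\<omega>. \<lambda>j\<in>J. Z j \<omega> - w j)
    = density (\<Pi>\<^sub>M j\<in>J. std_normal_distribution) (\<lambda>z. ennreal (shift_density J w z))"
proof -
  interpret prob_space M by fact
  define g where "g j x = exp (- (w j * x) - (w j)\<^sup>2 / 2)" for j x
  define N' where "N' j = density std_normal_distribution (\<lambda>x. ennreal (g j x))" for j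
  have gm: "(\<lambda>x. ennreal (g j x)) \<in> borel_measurable borel" for j unfolding g_def by measurable
  have single: "distr M borel (\<lambda>\<omega>. Z j \<omega> - w j) = N' j" if "j \<in> J" for j
  proof -
    have "distributed M lborel (Z j) (normal_density 0 1)" using Z that by (auto simp: iid_std_normal_def)
    then have "distributed M lborel (\<lambda>\<omega>. - w j + 1 * Z j \<omega>) (normal_density (- w j + 1 * 0) (\<bar>1\<bar> * 1))"
      by (rule normal_density_affine) auto
    then have "distributed M lborel (\<lambda>\<omega>. Z j \<omega> - w j) (normal_density (- w j) 1)" by (simp add: add.commute)
    then have "distr M lborel (\<lambda>\<omega>. Z j \<omega> - w j) = density lborel (normal_density (- w j) 1)"
      by (rule distributed_distr_eq_density)
    also have "\<dots> = density lborel (\<lambda>x. ennreal (std_normal_density x) * ennreal (g j x))"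
    proof (rule density_cong)
      show "AE x in lborel. ennreal (normal_density (- w j) 1 x) = ennreal (std_normal_density x) * ennreal (g j x)"
      proof (rule AE_I2)
        fix x
        have "normal_density (- w j) 1 x = std_normal_density x * g j x"
        proof -
          have "exp (- ((x + w j)\<^sup>2 / 2)) = exp (- (x\<^sup>2 / 2)) * exp (- (w j * x) - (w j)\<^sup>2 / 2)"
            unfolding exp_add[symmetric] by (rule arg_cong[where f = exp]) (simp add: power2_eq_square field_simps)
          then show ?thesis unfolding normal_density_def g_def by simp
        qed
        then show "ennreal (normal_density (- w j) 1 x) = ennreal (std_normal_density x) * ennreal (g j x)"
          by (simp add: ennreal_mult g_def)
      qed
    qed (use gm in measurable)
    also have "\<dots> = N' j" unfolding N'_def using gm by (intro density_density_eq[symmetric]) auto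
    finally have "distr M lborel (\<lambda>\<omega>. Z j \<omega> - w j) = N' j" .
    moreover have "distr M borel (\<lambda>\<omega>. Z j \<omega> - w j) = distr M lborel (\<lambda>\<omega>. Z j \<omega> - w j)" by (intro distr_cong) auto
    ultimately show ?thesis by simp
  qed
  have indep: "indep_vars (\<lambda>_. borel) (\<lambda>j \<omega>. Z j \<omega> - w j) J"
    using Z by (intro indep_vars_compose2[where X = Z and M' = "\<lambda>_. borel" and Y = "\<lambda>j z. z - w j"]) (auto simp: iid_std_normal_def)
  have "distr M (\<Pi>\<^sub>M j\<in>J. borel) (\<lambda>\<omega>. \<lambda>j\<in>J. Z j \<omega> - w j) = (\<Pi>\<^sub>M j\<in>J. distr M borel (\<lambda>\<omega>. Z j \<omega> - w j))"
    using indep J iid_std_normal_measurable[OF Z]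
    by (subst indep_vars_iff_distr_eq_PiM'[symmetric]) auto
  also have "\<dots> = (\<Pi>\<^sub>M j\<in>J. N' j)" by (intro PiM_cong refl single)
  also have "\<dots> = density (\<Pi>\<^sub>M j\<in>J. std_normal_distribution) (\<lambda>z. ennreal (shift_density J w z))"
  proof -
    have fin: "prob_space (N' j)" if "j \<in> J" for j
      unfolding single[OF that, symmetric] using iid_std_normal_measurable[OF Z that] by (intro prob_space_distr) simp
    \<comment> \<open>The product-measure rules want a sigma-finite factor at every index, not only
      in J; outside J the standard normal law is filled in.\<close>
    define N'' where "N'' j = (if j \<in> J then N' j else std_normal_distribution)" for j
    interpret N: product_sigma_finite "\<lambda>_ :: nat. std_normal_distribution"
      by (intro product_sigma_finite.intro prob_space_imp_sigma_finite prob_space_normal_density) simp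
    have sf: "sigma_finite_measure (N'' j)" for j
      unfolding N''_def using fin prob_space_normal_density[of 1 0] by (simp add: prob_space_imp_sigma_finite)
    interpret N'': product_sigma_finite N'' by (intro product_sigma_finite.intro sf)
    have sets: "sets (N'' j) = sets borel" for j by (simp add: N''_def N'_def)
    have "density (\<Pi>\<^sub>M j\<in>J. std_normal_distribution) (\<lambda>z. ennreal (shift_density J w z)) = PiM J N''"
    proof (rule N''.PiM_eqI[OF J(1)])
      show "sets (density (\<Pi>\<^sub>M j\<in>J. std_normal_distribution) (\<lambda>z. ennreal (shift_density J w z))) = sets (PiM J N'')"
        unfolding sets_density by (intro sets_PiM_cong refl) (simp add: sets)
      fix A assume A: "\<And>j. j \<in> J \<Longrightarrow> A j \<in> sets (N'' j)"
      then have A': "A j \<in> sets borel" if "j \<in> J" for j using that sets by auto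
      have box: "Pi\<^sub>E J A \<in> sets (\<Pi>\<^sub>M j\<in>J. std_normal_distribution)"
        using A' J by (intro sets_PiM_I_finite) auto
      have sd: "ennreal (shift_density J w z) * indicator (Pi\<^sub>E J A) z = (\<Prod>j\<in>J. ennreal (g j (z j)) * indicator (A j) (z j))"
        if z: "z \<in> space (\<Pi>\<^sub>M j\<in>J. std_normal_distribution)" for z
      proof -
        have "shift_density J w z = (\<Prod>j\<in>J. g j (z j))"
          unfolding shift_density_def g_def exp_sum[OF J(1), symmetric]
          by (simp add: sum_subtractf sum_negf sum_divide_distrib)
        moreover have "(indicator (Pi\<^sub>E J A) z :: ennreal) = (\<Prod>j\<in>J. indicator (A j) (z j))"
        proof (cases "z \<in> Pi\<^sub>E J A")
          case True
          then show ?thesis by (auto simp: PiE_iff indicator_def)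
        next
          case False
          then obtain j where "j \<in> J" "z j \<notin> A j" using z by (auto simp: space_PiM PiE_iff)
          then show ?thesis using J(1) False by (auto simp: indicator_def intro!: prod_zero[symmetric])
        qed
        ultimately show ?thesis by (simp add: prod_ennreal g_def prod.distrib)
      qed
      have "emeasure (density (\<Pi>\<^sub>M j\<in>J. std_normal_distribution) (\<lambda>z. ennreal (shift_density J w z))) (Pi\<^sub>E J A)
        = (\<integral>\<^sup>+z. ennreal (shift_density J w z) * indicator (Pi\<^sub>E J A) z \<partial>(\<Pi>\<^sub>M j\<in>J. std_normal_distribution))"
        using box J by (intro emeasure_density) (auto simp: shift_density_def[abs_def])
      also have "\<dots> = (\<integral>\<^sup>+z. (\<Prod>j\<in>J. ennreal (g j (z j)) * indicator (A j) (z j)) \<partial>(\<Pi>\<^sub>M j\<in>J. std_normal_distribution))"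
        by (intro nn_integral_cong sd)
      also have "\<dots> = (\<Prod>j\<in>J. \<integral>\<^sup>+x. ennreal (g j x) * indicator (A j) x \<partial>std_normal_distribution)"
        using A' gm by (intro N.product_nn_integral_prod J) (auto intro!: borel_measurable_times_ennreal borel_measurable_indicator)
      also have "\<dots> = (\<Prod>j\<in>J. emeasure (N'' j) (A j))"
        using A' gm by (intro prod.cong refl) (simp add: N''_def N'_def emeasure_density)
      finally show "emeasure (density (\<Pi>\<^sub>M j\<in>J. std_normal_distribution) (\<lambda>z. ennreal (shift_density J w z))) (Pi\<^sub>E J A)
        = (\<Prod>j\<in>J. emeasure (N'' j) (A j))" .
    qed
    also have "PiM J N'' = PiM J N'" by (intro PiM_cong refl) (simp add: N''_def)
    finally show ?thesis by simp
  qed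
  finally show ?thesis .
qed

text \<open>The set C is symmetric, so the shifts by w and - w have the same probability. Averaging
  their densities and using exp x + exp (- x) \<ge> 2 removes the linear term and leaves the factor
  exp (- |w|^2 / 2).\<close>

lemma gauss_shift_lower:
  fixes t :: "'k \<Rightarrow> nat \<Rightarrow> real"
  assumes M: "prob_space M" and Z: "iid_std_normal M J Z" and J: "finite J" "J \<noteq> {}" and A: "finite A"
  shows "ennreal (exp (- (\<Sum>j\<in>J. (w j)\<^sup>2) / 2)) * emeasure M {\<omega> \<in> space M. \<forall>l\<in>A. \<bar>\<Sum>j\<in>J. t l j * Z j \<omega>\<bar> \<le> s}
    \<le> emeasure M {\<omega> \<in> space M. \<forall>l\<in>A. \<bar>\<Sum>j\<in>J. t l j * (Z j \<omega> - w j)\<bar> \<le> s}"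
proof -
  interpret prob_space M by fact
  let ?P = "\<Pi>\<^sub>M j\<in>J. (borel :: real measure)" and ?N = "\<Pi>\<^sub>M j\<in>J. std_normal_distribution"
  define C where "C = {z \<in> space ?P. \<forall>l\<in>A. \<bar>\<Sum>j\<in>J. t l j * z j\<bar> \<le> s}"
  have CP: "C \<in> sets ?P"
  proof -
    have "{z \<in> space ?P. \<bar>\<Sum>j\<in>J. t l j * z j\<bar> \<le> s} \<in> sets ?P" for l by measurable
    then show ?thesis unfolding C_def using A by (intro sets.sets_Collect_finite_All) auto
  qed
  have setsN: "sets ?N = sets ?P" by (intro sets_PiM_cong) auto
  have CN: "C \<in> sets ?N" using CP setsN by simp
  have law: "emeasure M {\<omega> \<in> space M. \<forall>l\<in>A. \<bar>\<Sum>j\<in>J. t l j * (Z' j \<omega> - v j)\<bar> \<le> s} = (\<integral>\<^sup>+z. ennreal (shift_density J v z) * indicator C z \<partial>?N)"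
    if Z': "iid_std_normal M J Z'" for Z' v
  proof -
    have meas: "(\<lambda>\<omega>. \<lambda>j\<in>J. Z' j \<omega> - v j) \<in> measurable M ?P"
      using iid_std_normal_measurable[OF Z'] by (intro measurable_restrict) auto
    have "emeasure M {\<omega> \<in> space M. \<forall>l\<in>A. \<bar>\<Sum>j\<in>J. t l j * (Z' j \<omega> - v j)\<bar> \<le> s}
        = emeasure (distr M ?P (\<lambda>\<omega>. \<lambda>j\<in>J. Z' j \<omega> - v j)) C"
      using CP by (subst emeasure_distr[OF meas]) (auto simp: C_def space_PiM intro!: arg_cong[where f = "emeasure M"])
    also have "\<dots> = (\<integral>\<^sup>+z. ennreal (shift_density J v z) * indicator C z \<partial>?N)"
      unfolding iid_std_normal_shift_law[OF M Z' J]
      using CN by (intro emeasure_density) (auto simp: shift_density_def[abs_def])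
    finally show ?thesis .
  qed
  let ?p = "emeasure M {\<omega> \<in> space M. \<forall>l\<in>A. \<bar>\<Sum>j\<in>J. t l j * Z j \<omega>\<bar> \<le> s}"
  let ?pw = "emeasure M {\<omega> \<in> space M. \<forall>l\<in>A. \<bar>\<Sum>j\<in>J. t l j * (Z j \<omega> - w j)\<bar> \<le> s}"
  have 1: "?pw = (\<integral>\<^sup>+z. ennreal (shift_density J w z) * indicator C z \<partial>?N)" by (rule law[OF Z])
  \<comment> \<open>Replacing Z by - Z, which has the same law, turns the shift by w into the shift
    by - w without changing the absolute values.\<close>
  have 2: "?pw = (\<integral>\<^sup>+z. ennreal (shift_density J (\<lambda>j. - w j) z) * indicator C z \<partial>?N)"
  proof -
    have "(\<Sum>j\<in>J. t l j * (- Z j \<omega> - - w j)) = - (\<Sum>j\<in>J. t l j * (Z j \<omega> - w j))" for l \<omega>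
      by (simp add: sum_negf[symmetric] algebra_simps)
    then show ?thesis using law[OF iid_std_normal_minus[OF M Z], of "\<lambda>j. - w j"] by simp
  qed
  have 3: "?p = (\<integral>\<^sup>+z. indicator C z \<partial>?N)"
    using law[OF Z, of "\<lambda>_. 0"] by (simp add: shift_density_def)
  define E where "E = exp (- (\<Sum>j\<in>J. (w j)\<^sup>2) / 2)"
  have "ennreal 2 * (ennreal E * ?p) = (\<integral>\<^sup>+z. ennreal (2 * E) * indicator C z \<partial>?N)"
    unfolding 3 using CN by (simp add: nn_integral_cmult E_def ennreal_mult mult.assoc)
  also have "\<dots> \<le> (\<integral>\<^sup>+z. ennreal (shift_density J w z) * indicator C z + ennreal (shift_density J (\<lambda>j. - w j) z) * indicator C z \<partial>?N)"
  proof (intro nn_integral_mono)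
    fix z
    let ?x = "\<Sum>j\<in>J. w j * z j"
    have "2 \<le> exp (- ?x) + exp ?x"
      using exp_ge_add_one_self[of "?x"] exp_ge_add_one_self[of "- ?x"] by linarith
    then have "E * 2 \<le> E * (exp (- ?x) + exp ?x)" by (intro mult_left_mono) (auto simp: E_def)
    also have "\<dots> = shift_density J w z + shift_density J (\<lambda>j. - w j) z"
      by (simp add: shift_density_def E_def sum_negf distrib_left exp_add[symmetric] exp_diff exp_minus field_simps)
    finally have "ennreal (2 * E) \<le> ennreal (shift_density J w z) + ennreal (shift_density J (\<lambda>j. - w j) z)"
      by (simp add: ennreal_plus[symmetric] shift_density_def ennreal_leI mult.commute del: ennreal_plus)
    then show "ennreal (2 * E) * indicator C z \<le> ennreal (shift_density J w z) * indicator C z + ennreal (shift_density J (\<lambda>j. - w j) z) * indicator C z"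
      by (simp add: indicator_def)
  qed
  also have "\<dots> = ?pw + ?pw"
    by (subst (1) 1, subst 2, rule nn_integral_add) (use CN in \<open>auto simp: shift_density_def[abs_def]\<close>)
  also have "\<dots> = ennreal 2 * ?pw" by (simp add: mult_2)
  finally have "ennreal 2 * (ennreal E * ?p) \<le> ennreal 2 * ?pw" .
  then have "ennreal E * ?p \<le> ?pw"
    by (subst (asm) ennreal_mult_le_mult_iff) auto
  then show ?thesis by (simp add: E_def)
qed

text \<open>The slab |<t_l, .>| \<le> s (all l) is translated to \<theta> t_k for each k. A common
  point of the translates k and l would give \<theta> |t_k - t_l|^2 \<le> 4 s, so they are disjoint,
  and each keeps at least the fraction exp (- \<theta>^2 D / 2) of the original probability.\<close>

lemma dual_sudakov:
  fixes t :: "'k \<Rightarrow> nat \<Rightarrow> real"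
  assumes M: "prob_space M" and Z: "iid_std_normal M J Z" and J: "finite J" "J \<noteq> {}" and A: "finite A"
    and D: "\<And>k. k \<in> A \<Longrightarrow> (\<Sum>j\<in>J. (t k j)\<^sup>2) \<le> D"
    and sep: "\<And>k l. k \<in> A \<Longrightarrow> l \<in> A \<Longrightarrow> k \<noteq> l \<Longrightarrow> 4 * s < \<theta> * (\<Sum>j\<in>J. (t k j - t l j)\<^sup>2)" and \<theta>: "\<theta> \<ge> 0"
  shows "real (card A) * exp (- (\<theta>\<^sup>2 * D) / 2) * measure M {\<omega> \<in> space M. \<forall>l\<in>A. \<bar>\<Sum>j\<in>J. t l j * Z j \<omega>\<bar> \<le> s} \<le> 1"
proof -
  interpret prob_space M by fact
  define E where "E k = {\<omega> \<in> space M. \<forall>l\<in>A. \<bar>\<Sum>j\<in>J. t l j * (Z j \<omega> - \<theta> * t k j)\<bar> \<le> s}" for k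
  let ?p = "measure M {\<omega> \<in> space M. \<forall>l\<in>A. \<bar>\<Sum>j\<in>J. t l j * Z j \<omega>\<bar> \<le> s}"
  have EM: "E k \<in> sets M" for k
  proof -
    have "(\<lambda>\<omega>. \<bar>\<Sum>j\<in>J. t l j * (Z j \<omega> - \<theta> * t k j)\<bar>) \<in> borel_measurable M" for l
      using iid_std_normal_measurable[OF Z]
      by (intro borel_measurable_abs borel_measurable_sum borel_measurable_times borel_measurable_diff) auto
    from borel_measurable_le[OF this borel_measurable_const]
    have "{\<omega> \<in> space M. \<bar>\<Sum>j\<in>J. t l j * (Z j \<omega> - \<theta> * t k j)\<bar> \<le> s} \<in> sets M" for l .
    then show ?thesis unfolding E_def using A by (intro sets.sets_Collect_finite_All) auto
  qed
  have disj: "disjoint_family_on E A"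
    unfolding disjoint_family_on_def
  proof (intro ballI impI)
    fix k l assume kl: "k \<in> A" "l \<in> A" "k \<noteq> l"
    show "E k \<inter> E l = {}"
    proof (rule ccontr)
      assume "E k \<inter> E l \<noteq> {}"
      then obtain \<omega> where \<omega>: "\<omega> \<in> E k" "\<omega> \<in> E l" by auto
      define a where "a m n = (\<Sum>j\<in>J. t m j * (Z j \<omega> - \<theta> * t n j))" for m n
      have a: "\<bar>a k k\<bar> \<le> s" "\<bar>a l k\<bar> \<le> s" "\<bar>a k l\<bar> \<le> s" "\<bar>a l l\<bar> \<le> s"
        using \<omega> kl by (auto simp: E_def a_def)
      have "\<theta> * (\<Sum>j\<in>J. (t k j - t l j)\<^sup>2) = (a k l - a l l) - (a k k - a l k)"
        unfolding a_def sum_subtractf[symmetric] sum_distrib_left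
        by (intro sum.cong refl) (simp add: power2_eq_square algebra_simps)
      then show False using sep[OF kl] a by linarith
    qed
  qed
  have Ek: "exp (- (\<theta>\<^sup>2 * D) / 2) * ?p \<le> measure M (E k)" if "k \<in> A" for k
  proof -
    have "(\<Sum>j\<in>J. (\<theta> * t k j)\<^sup>2) = \<theta>\<^sup>2 * (\<Sum>j\<in>J. (t k j)\<^sup>2)" by (simp add: power_mult_distrib sum_distrib_left)
    also have "\<dots> \<le> \<theta>\<^sup>2 * D" using D[OF that] by (intro mult_left_mono) auto
    finally have "exp (- (\<theta>\<^sup>2 * D) / 2) \<le> exp (- (\<Sum>j\<in>J. (\<theta> * t k j)\<^sup>2) / 2)" by simp
    then have "exp (- (\<theta>\<^sup>2 * D) / 2) * ?p \<le> exp (- (\<Sum>j\<in>J. (\<theta> * t k j)\<^sup>2) / 2) * ?p" by (intro mult_right_mono) auto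
    also have "\<dots> \<le> measure M (E k)"
    proof -
      have "ennreal (exp (- (\<Sum>j\<in>J. (\<theta> * t k j)\<^sup>2) / 2) * ?p) \<le> ennreal (measure M (E k))"
        using gauss_shift_lower[OF M Z J A, of "\<lambda>j. \<theta> * t k j" t s]
        unfolding E_def emeasure_eq_measure by (simp add: ennreal_mult)
      then show ?thesis by (subst (asm) ennreal_le_iff) auto
    qed
    finally show ?thesis .
  qed
  have "real (card A) * (exp (- (\<theta>\<^sup>2 * D) / 2) * ?p) \<le> (\<Sum>k\<in>A. measure M (E k))"
    using sum_mono[of A "\<lambda>_. exp (- (\<theta>\<^sup>2 * D) / 2) * ?p" "\<lambda>k. measure M (E k)"] Ek by simp
  also have "\<dots> = measure M (\<Union>k\<in>A. E k)"
    by (rule finite_measure_finite_Union[OF A _ disj, symmetric]) (use EM in blast)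
  also have "\<dots> \<le> 1" by (rule prob_le_1)
  finally show ?thesis by (simp add: mult.assoc)
qed

subsection \<open>Lower bound for arbitrary representations\<close>

text \<open>Almost sure convergence alone says nothing about second moments. For Gaussian sums the
  characteristic function at 1 determines the variance, and its limit is positive, so logarithms can
  be taken.\<close>

lemma gauss_series_variance:
  assumes M: "prob_space M" and Z: "iid_std_normal M {1..} Z" and X: "centred_gaussian M X"
    and lim: "AE \<omega> in M. (\<lambda>q. \<Sum>j = 1..q. F j * Z j \<omega>) \<longlonglongrightarrow> X \<omega>"
  shows "(\<lambda>j. (if j = 0 then 0 else F j)\<^sup>2) sums (\<integral>\<omega>. (X \<omega>)\<^sup>2 \<partial>M)"
proof -
  let ?V = "\<integral>\<omega>. (X \<omega>)\<^sup>2 \<partial>M"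
  have Xm: "X \<in> borel_measurable M" using X by (simp add: centred_gaussian_def)
  have Sm: "(\<lambda>\<omega>. \<Sum>j = 1..q. F j * Z j \<omega>) \<in> borel_measurable M" for q
    using iid_std_normal_measurable[OF Z] by (intro borel_measurable_sum borel_measurable_times) auto
  define v where "v q = (\<Sum>j = 1..q. (F j)\<^sup>2)" for q
  have "(\<lambda>q. char_fun M (\<lambda>\<omega>. \<Sum>j = 1..q. F j * Z j \<omega>) 1) \<longlonglongrightarrow> char_fun M X 1"
    by (rule char_fun_tendsto[OF M Sm Xm lim])
  then have "(\<lambda>q. complex_of_real (exp (- v q / 2))) \<longlonglongrightarrow> complex_of_real (exp (- ?V / 2))"
    unfolding char_fun_centred_gaussian[OF M X] v_def by (subst (asm) char_fun_gauss_sum[OF M Z]) auto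
  then have "(\<lambda>q. exp (- v q / 2)) \<longlonglongrightarrow> exp (- ?V / 2)" by (simp only: tendsto_of_real_iff)
  then have "(\<lambda>q. ln (exp (- v q / 2))) \<longlonglongrightarrow> ln (exp (- ?V / 2))" by (rule tendsto_ln) simp
  then have "(\<lambda>q. - 2 * (- v q / 2)) \<longlonglongrightarrow> - 2 * (- ?V / 2)" unfolding ln_exp by (rule tendsto_mult_left)
  then have "v \<longlonglongrightarrow> ?V" by simp
  moreover have "(\<Sum>j\<le>q. (if j = 0 then 0 else F j)\<^sup>2) = v q" for q
  proof -
    have "(\<Sum>j\<le>q. (if j = 0 then 0 else F j)\<^sup>2) = (\<Sum>j = 1..q. (if j = 0 then 0 else F j)\<^sup>2)"
      by (rule sum.mono_neutral_right) (auto simp: not_less_eq_eq)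
    then show ?thesis by (simp add: v_def)
  qed
  ultimately show ?thesis unfolding sums_def_le by simp
qed

lemma series_rep_pointwise:
  assumes "series_rep M \<xi> f Z"
  shows "AE \<omega> in M. \<forall>x\<in>cball 0 1. (\<lambda>q. \<Sum>j = 1..q. f j x * Z j \<omega>) \<longlonglongrightarrow> \<xi> x \<omega>"
proof -
  have "AE \<omega> in M. uniform_limit (cball 0 1) (\<lambda>n x. \<Sum>j = 1..n. f j x * Z j \<omega>) (\<lambda>x. \<xi> x \<omega>) sequentially"
    using assms by (simp add: series_rep_def)
  then show ?thesis
  proof eventually_elim
    case (elim \<omega>)
    then show ?case by (intro ballI tendsto_uniform_limitI)
  qed
qed

definition lat_point :: "real \<Rightarrow> ('n::finite \<Rightarrow> int) \<Rightarrow> real ^ 'n" where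
  "lat_point \<epsilon> z = (\<chi> i. \<epsilon> * of_int (z i))"

lemma norm_lat_point_diff:
  assumes "\<epsilon> \<ge> 0"
  shows "norm (lat_point \<epsilon> z - lat_point \<epsilon> w) powr (2 * H) = \<epsilon> powr (2 * H) * lat_sq z w powr H"
proof -
  have q0: "lat_sq z w \<ge> 0" by (auto simp: lat_sq_def intro: sum_nonneg)
  have "norm (lat_point \<epsilon> z - lat_point \<epsilon> w) = sqrt (\<Sum>i\<in>UNIV. (\<epsilon> * of_int (z i) - \<epsilon> * of_int (w i))\<^sup>2)"
    by (simp add: norm_vec_def L2_set_def lat_point_def)
  also have "(\<Sum>i\<in>UNIV. (\<epsilon> * of_int (z i) - \<epsilon> * of_int (w i))\<^sup>2) = \<epsilon>\<^sup>2 * lat_sq z w"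
    unfolding lat_sq_def sum_distrib_left
    by (intro sum.cong refl) (simp add: power2_eq_square algebra_simps)
  also have "sqrt (\<epsilon>\<^sup>2 * lat_sq z w) = \<epsilon> * lat_sq z w powr (1 / 2)"
    using assms q0 by (simp add: real_sqrt_mult powr_half_sqrt)
  finally show ?thesis using assms q0 by (simp add: powr_mult powr_powr)
qed

lemma lattice_variance:
  fixes S :: "('n::finite \<Rightarrow> int) set"
  assumes mf: "is_mfbm M H \<xi>" and \<epsilon>: "\<epsilon> > 0" and S: "finite S" "\<And>z. z \<in> S \<Longrightarrow> lat_point \<epsilon> z \<in> cball 0 1"
    and b: "(\<Sum>z\<in>S. b z) = 0"
  shows "centred_gaussian M (\<lambda>\<omega>. \<Sum>z\<in>S. b z * \<xi> (lat_point \<epsilon> z) \<omega>)"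
    and "(\<integral>\<omega>. (\<Sum>z\<in>S. b z * \<xi> (lat_point \<epsilon> z) \<omega>)\<^sup>2 \<partial>M) =
      \<epsilon> powr (2 * H) / 2 * - (\<Sum>z\<in>S. \<Sum>w\<in>S. b z * b w * lat_sq z w powr H)"
proof -
  let ?pt = "lat_point \<epsilon> :: ('n \<Rightarrow> int) \<Rightarrow> real ^ 'n"
  have inj: "inj_on ?pt S"
  proof (rule inj_onI)
    fix z w assume "?pt z = ?pt w"
    then have "\<epsilon> * of_int (z i) = \<epsilon> * of_int (w i)" for i
      unfolding lat_point_def by (metis vec_lambda_beta)
    then have "z i = w i" for i using \<epsilon> by (metis less_irrefl mult_left_cancel of_int_eq_iff)
    then show "z = w" by (rule ext)
  qed
  define b' where "b' x = b (inv_into S ?pt x)" for x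
  have b': "b' (?pt z) = b z" if "z \<in> S" for z using inj that by (simp add: b'_def)
  have re: "(\<Sum>x\<in>?pt ` S. b' x * g x) = (\<Sum>z\<in>S. b z * g (?pt z))" for g
    using inj b' by (subst sum.reindex) (auto intro!: sum.cong)
  have P: "finite (?pt ` S)" "?pt ` S \<subseteq> cball 0 1" using S by auto
  show "centred_gaussian M (\<lambda>\<omega>. \<Sum>z\<in>S. b z * \<xi> (?pt z) \<omega>)"
    using is_mfbm_gaussian[OF mf P, of b'] unfolding re .
  let ?n = "\<lambda>x. norm x powr (2 * H)"
  have "(\<integral>\<omega>. (\<Sum>z\<in>S. b z * \<xi> (?pt z) \<omega>)\<^sup>2 \<partial>M) = (\<Sum>x\<in>?pt ` S. b' x * (\<Sum>y\<in>?pt ` S. b' y * ((?n x + ?n y - ?n (x - y)) / 2)))"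
  proof -
    have "(\<integral>\<omega>. (\<Sum>z\<in>S. b z * \<xi> (?pt z) \<omega>)\<^sup>2 \<partial>M) = (\<integral>\<omega>. (\<Sum>x\<in>?pt ` S. b' x * \<xi> x \<omega>)\<^sup>2 \<partial>M)" by (simp only: re)
    then show ?thesis unfolding is_mfbm_variance[OF mf P] by (simp only: sum_distrib_left mult.assoc)
  qed
  also have "\<dots> = (\<Sum>z\<in>S. b z * (\<Sum>w\<in>S. b w * ((?n (?pt z) + ?n (?pt w) - ?n (?pt z - ?pt w)) / 2)))"
    unfolding re ..
  also have "\<dots> = (\<Sum>z\<in>S. \<Sum>w\<in>S. (b z * ?n (?pt z) / 2) * b w) + (\<Sum>z\<in>S. \<Sum>w\<in>S. b z * (b w * ?n (?pt w) / 2))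
      - (\<Sum>z\<in>S. \<Sum>w\<in>S. b z * b w * ?n (?pt z - ?pt w) / 2)"
    unfolding sum_distrib_left sum.distrib[symmetric] sum_subtractf[symmetric]
    by (intro sum.cong refl) (simp add: field_simps)
  \<comment> \<open>As the coefficients sum to 0, terms that depend on only one of the two points
    drop out and the variogram remains.\<close>
  also have "\<dots> = - (\<Sum>z\<in>S. \<Sum>w\<in>S. b z * b w * ?n (?pt z - ?pt w) / 2)"
  proof -
    have "(\<Sum>z\<in>S. \<Sum>w\<in>S. (b z * ?n (?pt z) / 2) * b w) = 0"
      unfolding sum_distrib_left[symmetric] b by simp
    moreover have "(\<Sum>z\<in>S. \<Sum>w\<in>S. b z * (b w * ?n (?pt w) / 2)) = 0"
      unfolding sum_distrib_left[symmetric] sum_distrib_right[symmetric] b by simp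
    ultimately show ?thesis by simp
  qed
  also have "\<dots> = - (\<Sum>z\<in>S. \<Sum>w\<in>S. \<epsilon> powr (2 * H) / 2 * (b z * b w * lat_sq z w powr H))"
    unfolding norm_lat_point_diff[OF less_imp_le[OF \<epsilon>]] by (simp add: mult_ac)
  also have "\<dots> = \<epsilon> powr (2 * H) / 2 * - (\<Sum>z\<in>S. \<Sum>w\<in>S. b z * b w * lat_sq z w powr H)"
    by (simp add: sum_distrib_left)
  finally show "(\<integral>\<omega>. (\<Sum>z\<in>S. b z * \<xi> (?pt z) \<omega>)\<^sup>2 \<partial>M) =
      \<epsilon> powr (2 * H) / 2 * - (\<Sum>z\<in>S. \<Sum>w\<in>S. b z * b w * lat_sq z w powr H)" .
qed

text \<open>The \<open>k\<close>-th increment is taken between the lattice points \<open>2 k\<close> and \<open>2 k + (1, \<dots>, 1)\<close>, so that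
  different increments use different points.\<close>

definition grid_pt :: "('n \<Rightarrow> nat) \<Rightarrow> int \<Rightarrow> 'n \<Rightarrow> int" where
  "grid_pt k s i = 2 * int (k i) + s"

lemma increments_lower:
  fixes G :: "('n::finite \<Rightarrow> nat) set"
  assumes c: "\<And>(S :: ('n \<Rightarrow> int) set) b. finite S \<Longrightarrow> (\<Sum>z\<in>S. b z) = 0 \<Longrightarrow>
      c * (\<Sum>z\<in>S. (b z)\<^sup>2) \<le> - (\<Sum>z\<in>S. \<Sum>w\<in>S. b z * b w * lat_sq z w powr H)"
    and mf: "is_mfbm M H \<xi>" and \<epsilon>: "\<epsilon> > 0" and G: "finite G"
    and ball: "\<And>k s. k \<in> G \<Longrightarrow> s \<in> {0, 1} \<Longrightarrow> lat_point \<epsilon> (grid_pt k s) \<in> cball 0 1"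
  shows "centred_gaussian M (\<lambda>\<omega>. \<Sum>k\<in>G. a k * (\<xi> (lat_point \<epsilon> (grid_pt k 1)) \<omega> - \<xi> (lat_point \<epsilon> (grid_pt k 0)) \<omega>))"
    and "c * \<epsilon> powr (2 * H) * (\<Sum>k\<in>G. (a k)\<^sup>2) \<le>
      (\<integral>\<omega>. (\<Sum>k\<in>G. a k * (\<xi> (lat_point \<epsilon> (grid_pt k 1)) \<omega> - \<xi> (lat_point \<epsilon> (grid_pt k 0)) \<omega>))\<^sup>2 \<partial>M)"
proof -
  obtain i0 :: 'n where True by simp
  define S where "S = (\<lambda>k. grid_pt k 1) ` G \<union> (\<lambda>k. grid_pt k 0) ` G"
  \<comment> \<open>Decodes an edge from one of its endpoints: halving recovers k, the parity of a
    coordinate tells which end it is.\<close>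
  define b where "b z = (if odd (z i0) then 1 else - 1) * a (\<lambda>i. nat (z i div 2))" for z :: "'n \<Rightarrow> int"
  have b1: "b (grid_pt k 1) = a k" and b0: "b (grid_pt k 0) = - a k" for k
    by (auto simp: b_def grid_pt_def)
  have inj: "inj_on (\<lambda>k. grid_pt k s) G" for s by (auto simp: inj_on_def grid_pt_def fun_eq_iff)
  have disj: "(\<lambda>k. grid_pt k 1) ` G \<inter> (\<lambda>k. grid_pt k 0) ` G = {}"
  proof -
    have "grid_pt k 1 \<noteq> grid_pt l 0" for k l :: "'n \<Rightarrow> nat"
    proof
      assume "grid_pt k 1 = grid_pt l 0"
      then have "2 * int (k i0) + 1 = 2 * int (l i0)" by (metis grid_pt_def add_0_right)
      then show False by presburger
    qed
    then show ?thesis by auto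
  qed
  have split: "(\<Sum>z\<in>S. g z) = (\<Sum>k\<in>G. g (grid_pt k 1) + g (grid_pt k 0))" for g :: "_ \<Rightarrow> real"
    unfolding S_def using G disj
    by (subst sum.union_disjoint) (auto simp: sum.reindex[OF inj] sum.distrib)
  have S: "finite S" "\<And>z. z \<in> S \<Longrightarrow> lat_point \<epsilon> z \<in> cball 0 1" using G ball by (auto simp: S_def)
  have bsum: "(\<Sum>z\<in>S. b z) = 0" unfolding split b1 b0 by simp
  have comb: "(\<Sum>z\<in>S. b z * \<xi> (lat_point \<epsilon> z) \<omega>)
      = (\<Sum>k\<in>G. a k * (\<xi> (lat_point \<epsilon> (grid_pt k 1)) \<omega> - \<xi> (lat_point \<epsilon> (grid_pt k 0)) \<omega>))" for \<omega>
    unfolding split b1 b0 by (simp add: right_diff_distrib)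
  show "centred_gaussian M (\<lambda>\<omega>. \<Sum>k\<in>G. a k * (\<xi> (lat_point \<epsilon> (grid_pt k 1)) \<omega> - \<xi> (lat_point \<epsilon> (grid_pt k 0)) \<omega>))"
    using lattice_variance(1)[OF mf \<epsilon> S bsum] unfolding comb .
  have "(\<Sum>z\<in>S. (b z)\<^sup>2) = 2 * (\<Sum>k\<in>G. (a k)\<^sup>2)" unfolding split b1 b0 by (simp add: sum_distrib_left)
  then have "\<epsilon> powr (2 * H) / 2 * (c * (2 * (\<Sum>k\<in>G. (a k)\<^sup>2))) \<le>
      \<epsilon> powr (2 * H) / 2 * - (\<Sum>z\<in>S. \<Sum>w\<in>S. b z * b w * lat_sq z w powr H)"
    using c[OF S(1) bsum] by (intro mult_left_mono) auto
  then show "c * \<epsilon> powr (2 * H) * (\<Sum>k\<in>G. (a k)\<^sup>2) \<le>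
      (\<integral>\<omega>. (\<Sum>k\<in>G. a k * (\<xi> (lat_point \<epsilon> (grid_pt k 1)) \<omega> - \<xi> (lat_point \<epsilon> (grid_pt k 0)) \<omega>))\<^sup>2 \<partial>M)"
    using lattice_variance(2)[OF mf \<epsilon> S bsum] unfolding comb by (simp add: mult_ac)
qed

text \<open>Transfers a bound for finite truncations to the infinite tail. If every increment of the
  tail were below s, the truncated ones would eventually be below s as well; the reverse Fatou lemma
  keeps probability 1/2 for the contrary.\<close>

lemma tail_lower_of_increments:
  fixes x0 x1 :: "'k \<Rightarrow> real ^ 'n::finite"
  assumes mf: "is_mfbm M H \<xi>" and rep: "series_rep M \<xi> f Z" and p: "p \<ge> 1" and s: "s > 0"
    and A: "finite A" and x: "\<And>l. l \<in> A \<Longrightarrow> x0 l \<in> cball 0 1" "\<And>l. l \<in> A \<Longrightarrow> x1 l \<in> cball 0 1"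
    and ev: "\<forall>\<^sub>F q in sequentially. measure M {\<omega> \<in> space M. \<forall>l\<in>A. \<bar>\<Sum>j\<in>{p..q}. (f j (x1 l) - f j (x0 l)) * Z j \<omega>\<bar> \<le> s} \<le> 1 / 2"
  shows "ennreal (s / 3) \<le> tail_error M f Z p"
proof -
  interpret prob_space M using mf by (simp add: is_mfbm_def)
  have Z: "iid_std_normal M {1..} Z" using rep by (simp add: series_rep_def)
  define T where "T q l \<omega> = (\<Sum>j\<in>{p..q}. (f j (x1 l) - f j (x0 l)) * Z j \<omega>)" for q l \<omega>
  have Tm: "T q l \<in> borel_measurable M" for q l
    unfolding T_def[abs_def] using iid_std_normal_measurable[OF Z] p by (intro borel_measurable_sum borel_measurable_times) auto
  define E where "E q = {\<omega> \<in> space M. \<forall>l\<in>A. \<bar>T q l \<omega>\<bar> \<le> s}" for q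
  have EM: "E q \<in> sets M" for q
  proof -
    have "{\<omega> \<in> space M. \<bar>T q l \<omega>\<bar> \<le> s} \<in> sets M" for l
      by (rule borel_measurable_le[OF borel_measurable_abs[OF Tm] borel_measurable_const])
    then show ?thesis unfolding E_def using A by (intro sets.sets_Collect_finite_All) auto
  qed
  \<comment> \<open>Indicator that some truncated increment exceeds s. Where its upper limit is
    positive, some increment of the tail is at least s.\<close>
  define I where "I q \<omega> = (indicator (space M - E q) \<omega> :: ennreal)" for q \<omega>
  have Im[measurable]: "I q \<in> borel_measurable M" for q
    unfolding I_def[abs_def] using EM by (intro borel_measurable_indicator) auto
  let ?tail = "\<lambda>\<omega> x. \<Sum>j. f (p + j) x * Z (p + j) \<omega>"
  have pt: "AE \<omega> in M. ennreal (s\<^sup>2 / 4) * limsup (\<lambda>q. I q \<omega>) \<le> (ball_norm (?tail \<omega>))\<^sup>2"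
    using series_rep_pointwise[OF rep] AE_space
  proof eventually_elim
    case (elim \<omega>)
    have lim: "(\<lambda>q. \<Sum>j\<in>{p..q}. f j x * Z j \<omega>) \<longlonglongrightarrow> ?tail \<omega> x" if x: "x \<in> cball 0 1" for x
    proof -
      define P where "P q = (\<Sum>j = 1..q. f j x * Z j \<omega>)" for q
      have P: "P \<longlonglongrightarrow> \<xi> x \<omega>" using elim(1) x by (simp add: P_def[abs_def])
      have part: "(\<Sum>j<n. f (p + j) x * Z (p + j) \<omega>) = P (p - 1 + n) - P (p - 1)" for n
      proof (induction n)
        case (Suc n)
        have e: "p - 1 + Suc n = Suc (p - 1 + n)" "Suc (p - 1 + n) = p + n" using p by auto
        have "P (Suc (p - 1 + n)) = P (p - 1 + n) + f (Suc (p - 1 + n)) x * Z (Suc (p - 1 + n)) \<omega>" by (simp add: P_def)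
        then have "P (p - 1 + Suc n) = P (p - 1 + n) + f (p + n) x * Z (p + n) \<omega>" unfolding e(1) unfolding e(2) .
        then show ?case using Suc by simp
      qed simp
      have "(\<lambda>n. P (p - 1 + n)) \<longlonglongrightarrow> \<xi> x \<omega>" using LIMSEQ_ignore_initial_segment[OF P, of "p - 1"] by (simp add: add.commute)
      then have "(\<lambda>n. \<Sum>j<n. f (p + j) x * Z (p + j) \<omega>) \<longlonglongrightarrow> \<xi> x \<omega> - P (p - 1)"
        unfolding part by (intro tendsto_intros)
      then have t: "?tail \<omega> x = \<xi> x \<omega> - P (p - 1)" by (simp add: sums_def sums_iff[symmetric] sums_unique[symmetric])
      have "(\<lambda>q. P q - P (p - 1)) \<longlonglongrightarrow> \<xi> x \<omega> - P (p - 1)" by (intro tendsto_intros P)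
      moreover have "\<forall>\<^sub>F q in sequentially. P q - P (p - 1) = (\<Sum>j\<in>{p..q}. f j x * Z j \<omega>)"
        using eventually_ge_at_top[of p]
      proof eventually_elim
        case (elim q)
        have "{1..q} = {1..p - 1} \<union> {p..q}" using elim p by auto
        then show ?case unfolding P_def using p by (simp add: sum.union_disjoint disjoint_iff)
      qed
      ultimately show ?thesis unfolding t by (rule Lim_transform_eventually)
    qed
    have Tl: "(\<lambda>q. T q l \<omega>) \<longlonglongrightarrow> ?tail \<omega> (x1 l) - ?tail \<omega> (x0 l)" if "l \<in> A" for l
      using tendsto_diff[OF lim[OF x(2)[OF that]] lim[OF x(1)[OF that]]]
      by (simp add: T_def sum_subtractf left_diff_distrib)
    show ?case
    proof (cases "\<exists>l\<in>A. s \<le> \<bar>?tail \<omega> (x1 l) - ?tail \<omega> (x0 l)\<bar>")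
      case True
      then obtain l where l: "l \<in> A" "s \<le> \<bar>?tail \<omega> (x1 l) - ?tail \<omega> (x0 l)\<bar>" by blast
      then have "s / 2 \<le> \<bar>?tail \<omega> (x1 l)\<bar> \<or> s / 2 \<le> \<bar>?tail \<omega> (x0 l)\<bar>" by linarith
      then obtain y where y: "y \<in> cball 0 1" "s / 2 \<le> \<bar>?tail \<omega> y\<bar>" using x l(1) by blast
      have "ennreal (s / 2) \<le> ball_norm (?tail \<omega>)"
        unfolding ball_norm_def using y by (intro SUP_upper2[OF y(1)] ennreal_leI) auto
      then have "(ennreal (s / 2))\<^sup>2 \<le> (ball_norm (?tail \<omega>))\<^sup>2" by (rule power_mono) simp
      moreover have "(ennreal (s / 2))\<^sup>2 = ennreal (s\<^sup>2 / 4)" using s by (simp add: ennreal_power power_divide)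
      moreover have "limsup (\<lambda>q. I q \<omega>) \<le> 1"
        by (rule Limsup_bounded) (simp add: I_def indicator_def)
      ultimately show ?thesis
        using mult_left_mono[of "limsup (\<lambda>q. I q \<omega>)" 1 "ennreal (s\<^sup>2 / 4)"] by (auto intro: order_trans)
    next
      case False
      have "\<forall>\<^sub>F q in sequentially. \<forall>l\<in>A. \<bar>T q l \<omega>\<bar> \<le> s"
      proof (rule eventually_ball_finite[OF A], rule ballI)
        fix l assume l: "l \<in> A"
        have "\<forall>\<^sub>F q in sequentially. \<bar>T q l \<omega>\<bar> < s"
          using False l by (intro order_tendstoD(2)[OF tendsto_rabs[OF Tl[OF l]]]) auto
        then show "\<forall>\<^sub>F q in sequentially. \<bar>T q l \<omega>\<bar> \<le> s" by eventually_elim simp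
      qed
      then have "\<forall>\<^sub>F q in sequentially. I q \<omega> \<le> 0"
        by (rule eventually_mono) (use elim(2) in \<open>simp add: I_def E_def\<close>)
      then have "limsup (\<lambda>q. I q \<omega>) \<le> 0" by (rule Limsup_bounded)
      then show ?thesis by simp
    qed
  qed
  have half: "ennreal (1 / 2) \<le> limsup (\<lambda>q. \<integral>\<^sup>+\<omega>. I q \<omega> \<partial>M)"
  proof -
    have "\<forall>\<^sub>F q in sequentially. ennreal (1 / 2) \<le> (\<integral>\<^sup>+\<omega>. I q \<omega> \<partial>M)"
      using ev
    proof eventually_elim
      case (elim q)
      have "(\<integral>\<^sup>+\<omega>. I q \<omega> \<partial>M) = emeasure M (space M - E q)" unfolding I_def using EM by simp
      also have "\<dots> = ennreal (1 - measure M (E q))" using EM by (simp add: emeasure_eq_measure prob_compl)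
      also have "ennreal (1 / 2) \<le> \<dots>" using elim by (intro ennreal_leI) (simp add: E_def T_def)
      finally show ?case .
    qed
    then have "ennreal (1 / 2) \<le> liminf (\<lambda>q. \<integral>\<^sup>+\<omega>. I q \<omega> \<partial>M)" by (rule Liminf_bounded)
    also have "\<dots> \<le> limsup (\<lambda>q. \<integral>\<^sup>+\<omega>. I q \<omega> \<partial>M)" by (rule Liminf_le_Limsup) simp
    finally show ?thesis .
  qed
  also have "\<dots> \<le> (\<integral>\<^sup>+\<omega>. limsup (\<lambda>q. I q \<omega>) \<partial>M)"
    by (rule nn_integral_limsup[where w = "\<lambda>_. 1", OF Im]) (simp_all add: I_def[abs_def] indicator_def emeasure_space_1)
  finally have "ennreal (s\<^sup>2 / 4) * ennreal (1 / 2) \<le> ennreal (s\<^sup>2 / 4) * (\<integral>\<^sup>+\<omega>. limsup (\<lambda>q. I q \<omega>) \<partial>M)"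
    by (rule mult_left_mono) simp
  also have "\<dots> = (\<integral>\<^sup>+\<omega>. ennreal (s\<^sup>2 / 4) * limsup (\<lambda>q. I q \<omega>) \<partial>M)" by (rule nn_integral_cmult[symmetric]) measurable
  also have "\<dots> \<le> (\<integral>\<^sup>+\<omega>. (ball_norm (?tail \<omega>))\<^sup>2 \<partial>M)" by (rule nn_integral_mono_AE[OF pt])
  also have "ennreal (s\<^sup>2 / 4) * ennreal (1 / 2) = ennreal (s\<^sup>2 / 4 * (1 / 2))" by (rule ennreal_mult[symmetric]) auto
  finally have "ennreal (s\<^sup>2 / 8) \<le> (\<integral>\<^sup>+\<omega>. (ball_norm (?tail \<omega>))\<^sup>2 \<partial>M)"
    by simp
  \<comment> \<open>An increment of size s forces the norm to be at least s / 2 at one endpoint;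
    with probability at least 1/2 this gives s^2 / 8, rounded down to s^2 / 9.\<close>
  moreover have "ennreal ((s / 3)\<^sup>2) \<le> ennreal (s\<^sup>2 / 8)" by (intro ennreal_leI) (simp add: power_divide field_simps)
  ultimately have "ennreal ((s / 3)\<^sup>2) \<le> (\<integral>\<^sup>+\<omega>. (ball_norm (?tail \<omega>))\<^sup>2 \<partial>M)" by (rule order_trans[rotated])
  then show ?thesis unfolding tail_error_def using s by (intro ennreal_sqrt_ge) auto
qed

theorem series_rep_lower_bound:
  assumes H: "0 < H" "H < 1"
  shows "\<exists>c>0. \<forall>(M :: 'a measure) (\<xi> :: real ^ 'n::finite \<Rightarrow> 'a \<Rightarrow> real) f Z. is_mfbm M H \<xi> \<longrightarrow> series_rep M \<xi> f Z \<longrightarrow>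
    (\<forall>p\<ge>2. ennreal (c * (real p powr (- H / real CARD('n)) * sqrt (ln (real p)))) \<le> tail_error M f Z p)"
proof -
  let ?N = "real CARD('n)"
  obtain c0 where c0: "c0 > 0" and lat: "\<And>(S :: ('n \<Rightarrow> int) set) b. finite S \<Longrightarrow> (\<Sum>z\<in>S. b z) = 0 \<Longrightarrow>
    c0 * (\<Sum>z\<in>S. (b z)\<^sup>2) \<le> - (\<Sum>z\<in>S. \<Sum>w\<in>S. b z * b w * lat_sq z w powr H)"
    using lattice_variogram_lower[OF H, where 'n = 'n] by blast
  \<comment> \<open>Makes \<theta>^2 D / 2 equal to ln p for the s and \<theta> chosen below; 289 is
    17^2.\<close>
  define \<kappa> where "\<kappa> = 289 * ?N powr H / (2 * c0\<^sup>2)"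
  have \<kappa>: "\<kappa> > 0" unfolding \<kappa>_def using c0 by (intro divide_pos_pos mult_pos_pos) auto
  define c where "c = (4 * ?N) powr (- H) * 8 powr (- H / ?N) / (3 * sqrt \<kappa>)"
  have "c > 0" unfolding c_def using \<kappa> by (intro divide_pos_pos mult_pos_pos) auto
  moreover have "ennreal (c * (real p powr (- H / ?N) * sqrt (ln (real p)))) \<le> tail_error M f Z p"
    if mf: "is_mfbm M H \<xi>" and rep: "series_rep M \<xi> f Z" and p: "p \<ge> 2"
    for M :: "'a measure" and \<xi> :: "real ^ 'n \<Rightarrow> 'a \<Rightarrow> real" and f Z p
  proof -
    have M: "prob_space M" using mf by (simp add: is_mfbm_def)
    have Z: "iid_std_normal M {1..} Z" using rep by (simp add: series_rep_def)
    have N1: "?N \<ge> 1" using zero_less_card_finite[where 'a = 'n] by simp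
    \<comment> \<open>8 p edges are provided because \<open>separated_subset\<close> guarantees only
      card A > card G / 2 - p, while 2 p vectors are needed: with weight exp (- ln p) = 1 / p each,
      2 p disjoint events push the probability down to 1/2.\<close>
    define \<rho> where "\<rho> = (8 * real p) powr (1 / ?N)"
    have \<rho>: "\<rho> \<ge> 1" unfolding \<rho>_def using p N1 by (intro ge_one_powr_ge_zero) auto
    define m where "m = nat \<lceil>\<rho>\<rceil>"
    have m: "real m \<ge> \<rho>" "real m \<le> 2 * \<rho>" "m \<ge> 1" using \<rho> by (auto simp: m_def) linarith+
    have mN: "real m ^ CARD('n) \<ge> 8 * real p"
    proof -
      have "8 * real p = \<rho> ^ CARD('n)" using p by (simp add: \<rho>_def powr_power)
      also have "\<dots> \<le> real m ^ CARD('n)" using m \<rho> by (intro power_mono) auto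
      finally show ?thesis .
    qed
    \<comment> \<open>Lattice coordinates are at most 2 m, so each coordinate of a point is at most
      1/N and its l1 norm at most 1.\<close>
    define \<epsilon> where "\<epsilon> = 1 / (2 * real m * ?N)"
    have \<epsilon>: "\<epsilon> > 0" using m N1 by (simp add: \<epsilon>_def)
    define G where "G = PiE (UNIV :: 'n set) (\<lambda>_. {..<m})"
    have G: "finite G" unfolding G_def by (intro finite_PiE) auto
    have cardG: "card G = m ^ CARD('n)" by (simp add: G_def card_PiE)
    have ball: "lat_point \<epsilon> (grid_pt k s) \<in> cball 0 1" if k: "k \<in> G" and s: "s \<in> {0, 1}" for k s
    proof -
      have ki: "k i < m" for i using k by (auto simp: G_def PiE_iff)
      have "\<bar>lat_point \<epsilon> (grid_pt k s) $ i\<bar> \<le> 1 / ?N" for i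
      proof -
        have "0 \<le> grid_pt k s i" "grid_pt k s i \<le> 2 * int m" using ki[of i] s by (auto simp: grid_pt_def)
        then have "0 \<le> real_of_int (grid_pt k s i)" "real_of_int (grid_pt k s i) \<le> 2 * real m" by linarith+
        then have "\<bar>\<epsilon> * real_of_int (grid_pt k s i)\<bar> \<le> \<epsilon> * (2 * real m)" using \<epsilon> by (simp add: abs_mult)
        also have "\<dots> = 1 / ?N" using m N1 by (simp add: \<epsilon>_def)
        finally show ?thesis by (simp add: lat_point_def)
      qed
      then have "(\<Sum>i\<in>UNIV. \<bar>lat_point \<epsilon> (grid_pt k s) $ i\<bar>) \<le> (\<Sum>i\<in>(UNIV :: 'n set). 1 / ?N)" by (intro sum_mono)
      then have "norm (lat_point \<epsilon> (grid_pt k s)) \<le> 1" using norm_le_l1_cart[of "lat_point \<epsilon> (grid_pt k s)"] by simp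
      then show ?thesis by simp
    qed
    define x1 where "x1 k = lat_point \<epsilon> (grid_pt k 1)" for k :: "'n \<Rightarrow> nat"
    define x0 where "x0 k = lat_point \<epsilon> (grid_pt k 0)" for k :: "'n \<Rightarrow> nat"
    have x: "x0 k \<in> cball 0 1" "x1 k \<in> cball 0 1" if "k \<in> G" for k
      using ball[OF that] by (auto simp: x0_def x1_def)
    \<comment> \<open>The series starts at index 1; the entry at 0 is set to 0 so that sums over all
      j can be used.\<close>
    define y where "y k j = (if j = 0 then 0 else f j (x1 k) - f j (x0 k))" for k and j :: nat
    define \<mu> where "\<mu> = c0 * \<epsilon> powr (2 * H)"
    define D where "D = \<epsilon> powr (2 * H) * ?N powr H"
    have \<mu>: "\<mu> > 0" using c0 \<epsilon> by (simp add: \<mu>_def)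
    have single: "(\<lambda>j. (y k j)\<^sup>2) sums D" if k: "k \<in> G" for k
    proof -
      have "AE \<omega> in M. (\<lambda>q. \<Sum>j = 1..q. (f j (x1 k) - f j (x0 k)) * Z j \<omega>) \<longlonglongrightarrow> \<xi> (x1 k) \<omega> - \<xi> (x0 k) \<omega>"
        using series_rep_pointwise[OF rep]
      proof eventually_elim
        case (elim \<omega>)
        show ?case using tendsto_diff[OF bspec[OF elim x(2)[OF k]] bspec[OF elim x(1)[OF k]]]
          by (simp add: left_diff_distrib sum_subtractf)
      qed
      from gauss_series_variance[OF M Z is_mfbm_increment(2)[OF mf x(2)[OF k] x(1)[OF k]] this]
      have "(\<lambda>j. (y k j)\<^sup>2) sums (norm (x1 k - x0 k) powr (2 * H))"
        unfolding is_mfbm_increment(1)[OF mf x(2)[OF k] x(1)[OF k]] y_def .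
      moreover have "lat_sq (grid_pt k 1) (grid_pt k 0) = ?N" by (simp add: lat_sq_def grid_pt_def)
      ultimately show ?thesis unfolding x0_def x1_def using \<epsilon> by (simp add: norm_lat_point_diff D_def)
    qed
    have lower: "\<mu> * (\<Sum>k\<in>G. (a k)\<^sup>2) \<le> (\<Sum>j. (\<Sum>k\<in>G. a k * y k j)\<^sup>2)" for a
    proof -
      let ?X = "\<lambda>\<omega>. \<Sum>k\<in>G. a k * (\<xi> (x1 k) \<omega> - \<xi> (x0 k) \<omega>)"
      let ?F = "\<lambda>j. \<Sum>k\<in>G. a k * (f j (x1 k) - f j (x0 k))"
      have X: "centred_gaussian M ?X" and V: "\<mu> * (\<Sum>k\<in>G. (a k)\<^sup>2) \<le> (\<integral>\<omega>. (?X \<omega>)\<^sup>2 \<partial>M)"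
        using increments_lower[OF lat mf \<epsilon> G ball, of a] by (simp_all add: x0_def x1_def \<mu>_def)
      have "AE \<omega> in M. (\<lambda>q. \<Sum>j = 1..q. ?F j * Z j \<omega>) \<longlonglongrightarrow> ?X \<omega>"
        using series_rep_pointwise[OF rep]
      proof eventually_elim
        case (elim \<omega>)
        have "(\<lambda>q. \<Sum>k\<in>G. a k * ((\<Sum>j = 1..q. f j (x1 k) * Z j \<omega>) - (\<Sum>j = 1..q. f j (x0 k) * Z j \<omega>))) \<longlonglongrightarrow> ?X \<omega>"
          using elim x by (intro tendsto_sum tendsto_mult_left tendsto_diff) auto
        moreover have "(\<Sum>k\<in>G. a k * ((\<Sum>j = 1..q. f j (x1 k) * Z j \<omega>) - (\<Sum>j = 1..q. f j (x0 k) * Z j \<omega>))) = (\<Sum>j = 1..q. ?F j * Z j \<omega>)" for q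
        proof -
          have "(\<Sum>k\<in>G. a k * ((\<Sum>j = 1..q. f j (x1 k) * Z j \<omega>) - (\<Sum>j = 1..q. f j (x0 k) * Z j \<omega>)))
            = (\<Sum>k\<in>G. \<Sum>j = 1..q. a k * (f j (x1 k) - f j (x0 k)) * Z j \<omega>)"
            unfolding sum_subtractf[symmetric] sum_distrib_left by (intro sum.cong refl) (simp add: algebra_simps)
          also have "\<dots> = (\<Sum>j = 1..q. \<Sum>k\<in>G. a k * (f j (x1 k) - f j (x0 k)) * Z j \<omega>)" by (rule sum.swap)
          finally show ?thesis by (simp only: sum_distrib_right)
        qed
        ultimately show ?case by simp
      qed
      from gauss_series_variance[OF M Z X this]
      have "(\<lambda>j. (if j = 0 then 0 else ?F j)\<^sup>2) sums (\<integral>\<omega>. (?X \<omega>)\<^sup>2 \<partial>M)" .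
      moreover have "(if j = 0 then 0 else ?F j) = (\<Sum>k\<in>G. a k * y k j)" for j by (simp add: y_def)
      ultimately have "(\<Sum>j. (\<Sum>k\<in>G. a k * y k j)\<^sup>2) = (\<integral>\<omega>. (?X \<omega>)\<^sup>2 \<partial>M)" by (simp add: sums_iff)
      then show ?thesis using V by simp
    qed
    have p1: "p \<ge> 1" using p by simp
    obtain A where A: "A \<subseteq> G" and sep: "\<And>k l. k \<in> A \<Longrightarrow> l \<in> A \<Longrightarrow> k \<noteq> l \<Longrightarrow> \<mu> / 2 \<le> (\<Sum>j. (if j < p then 0 else y k j - y l j)\<^sup>2)"
      and cardA: "card G < 2 * (card A + p)"
      using separated_subset[OF G p1 \<mu> sums_summable[OF single] lower] by blast
    have finA: "finite A" using A G by (rule finite_subset)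
    have cA: "2 * real p \<le> real (card A)"
    proof -
      have "8 * real p \<le> real (card G)" using mN by (simp add: cardG)
      also have "\<dots> \<le> real (2 * (card A + p))" using cardA by simp
      finally show ?thesis by simp
    qed
    define s where "s = \<epsilon> powr H * sqrt (ln (real p) / \<kappa>)"
    have s: "s > 0" unfolding s_def using \<epsilon> p \<kappa> by simp
    \<comment> \<open>The truncated increments are separated by more than \<mu> / 4; 17 > 16 gives 4
      s < \<theta> \<mu> / 4.\<close>
    define \<theta> where "\<theta> = 17 * s / \<mu>"
    have \<theta>: "\<theta> \<ge> 0" using s \<mu> by (simp add: \<theta>_def)
    have \<theta>D: "\<theta>\<^sup>2 * D / 2 = ln (real p)"
    proof -
      have e2: "\<epsilon> powr (2 * H) = (\<epsilon> powr H)\<^sup>2" by (simp add: power2_eq_square powr_add[symmetric])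
      have s2: "s\<^sup>2 = (\<epsilon> powr H)\<^sup>2 * (ln (real p) / \<kappa>)" using p \<kappa> by (simp add: s_def power_mult_distrib)
      have e0: "\<epsilon> powr H \<noteq> 0" using \<epsilon> by simp
      have NH: "?N powr H > 0" by simp
      have "\<theta>\<^sup>2 * D / 2 = ln (real p) / \<kappa> * (289 * ?N powr H / (2 * c0\<^sup>2))"
        unfolding \<theta>_def D_def \<mu>_def power_divide power_mult_distrib s2 e2 using e0 c0
        by (simp add: field_simps power2_eq_square)
      then show ?thesis unfolding \<kappa>_def[symmetric] using \<kappa> by simp
    qed
    \<comment> \<open>The infinite tails are separated by \<mu> / 2, so the truncated ones are
      eventually by \<mu> / 4; finiteness of A makes this uniform over all pairs.\<close>
    have ev1: "\<forall>\<^sub>F q in sequentially. \<forall>k\<in>A. \<forall>l\<in>A. k \<noteq> l \<longrightarrow> \<mu> / 4 < (\<Sum>j\<in>{p..q}. (y k j - y l j)\<^sup>2)"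
    proof (intro eventually_ball_finite finA ballI)
      fix k l assume kl: "k \<in> A" "l \<in> A"
      show "\<forall>\<^sub>F q in sequentially. k \<noteq> l \<longrightarrow> \<mu> / 4 < (\<Sum>j\<in>{p..q}. (y k j - y l j)\<^sup>2)"
      proof (cases "k = l")
        case False
        let ?d = "\<lambda>j. (if j < p then 0 else y k j - y l j)\<^sup>2"
        have sk: "summable (\<lambda>j. (y k j)\<^sup>2)" "summable (\<lambda>j. (y l j)\<^sup>2)" using single kl A by (auto dest: sums_summable)
        have "summable ?d"
        proof (rule summable_comparison_test)
          show "summable (\<lambda>j. 2 * ((y k j)\<^sup>2 + (y l j)\<^sup>2))" using sk by (intro summable_mult summable_add)
          show "\<exists>n0. \<forall>j\<ge>n0. norm (?d j) \<le> 2 * ((y k j)\<^sup>2 + (y l j)\<^sup>2)"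
          proof (intro exI allI impI)
            fix j
            have "0 \<le> (y k j + y l j)\<^sup>2" by simp
            then show "norm (?d j) \<le> 2 * ((y k j)\<^sup>2 + (y l j)\<^sup>2)" by (simp add: power2_eq_square algebra_simps)
          qed
        qed
        then have "(\<lambda>q. \<Sum>j\<le>q. ?d j) \<longlonglongrightarrow> suminf ?d" by (rule summable_LIMSEQ')
        moreover have "\<mu> / 4 < suminf ?d" using sep[OF kl False] \<mu> by linarith
        ultimately have "\<forall>\<^sub>F q in sequentially. \<mu> / 4 < (\<Sum>j\<le>q. ?d j)" by (rule order_tendstoD(1))
        moreover have "(\<Sum>j\<le>q. ?d j) = (\<Sum>j\<in>{p..q}. (y k j - y l j)\<^sup>2)" for q
        proof -
          have "(\<Sum>j\<le>q. ?d j) = (\<Sum>j\<in>{p..q}. ?d j)" by (rule sum.mono_neutral_right) auto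
          then show ?thesis by simp
        qed
        ultimately show ?thesis by simp
      qed simp
    qed
    have "ennreal (s / 3) \<le> tail_error M f Z p"
    proof (rule tail_lower_of_increments[OF mf rep p1 s finA])
      show "x0 l \<in> cball 0 1" "x1 l \<in> cball 0 1" if "l \<in> A" for l using x that A by auto
      show "\<forall>\<^sub>F q in sequentially. measure M {\<omega> \<in> space M. \<forall>l\<in>A. \<bar>\<Sum>j\<in>{p..q}. (f j (x1 l) - f j (x0 l)) * Z j \<omega>\<bar> \<le> s} \<le> 1 / 2"
        using ev1 eventually_ge_at_top[of p]
      proof eventually_elim
        case (elim q)
        let ?P = "measure M {\<omega> \<in> space M. \<forall>l\<in>A. \<bar>\<Sum>j\<in>{p..q}. (f j (x1 l) - f j (x0 l)) * Z j \<omega>\<bar> \<le> s}"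
        have yf: "(\<Sum>j\<in>{p..q}. (f j (x1 l) - f j (x0 l)) * Z j \<omega>) = (\<Sum>j\<in>{p..q}. y l j * Z j \<omega>)" for l \<omega>
          using p by (intro sum.cong refl) (auto simp: y_def)
        have Zq: "iid_std_normal M {p..q} Z" using p by (intro iid_std_normal_subset[OF M Z]) auto
        have "real (card A) * exp (- (\<theta>\<^sup>2 * D) / 2) * ?P \<le> 1"
          unfolding yf
        proof (rule dual_sudakov[OF M Zq _ _ finA _ _ \<theta>])
          show "(\<Sum>j\<in>{p..q}. (y k j)\<^sup>2) \<le> D" if "k \<in> A" for k
          proof -
            have "(\<lambda>j. (y k j)\<^sup>2) sums D" using single that A by auto
            then show ?thesis using sum_le_suminf[of "\<lambda>j. (y k j)\<^sup>2" "{p..q}"] by (simp add: sums_iff)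
          qed
          show "4 * s < \<theta> * (\<Sum>j\<in>{p..q}. (y k j - y l j)\<^sup>2)" if "k \<in> A" "l \<in> A" "k \<noteq> l" for k l
          proof -
            have "4 * s < \<theta> * (\<mu> / 4)" using s \<mu> by (simp add: \<theta>_def)
            also have "\<dots> \<le> \<theta> * (\<Sum>j\<in>{p..q}. (y k j - y l j)\<^sup>2)"
              using elim(1) that \<theta> by (intro mult_left_mono) (auto simp: less_imp_le)
            finally show ?thesis .
          qed
        qed (use elim(2) in auto)
        moreover have "exp (- (\<theta>\<^sup>2 * D) / 2) = 1 / real p"
        proof -
          have "- (\<theta>\<^sup>2 * D) / 2 = - ln (real p)" using \<theta>D by linarith
          then have "exp (- (\<theta>\<^sup>2 * D) / 2) = inverse (exp (ln (real p)))" by (simp only: exp_minus)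
          also have "exp (ln (real p)) = real p" using p by (intro exp_ln) simp
          finally show ?thesis by (simp add: inverse_eq_divide)
        qed
        ultimately have "real (card A) / real p * ?P \<le> 1" by simp
        moreover have "2 * ?P \<le> real (card A) / real p * ?P"
        proof (rule mult_right_mono)
          show "2 \<le> real (card A) / real p" using cA p by (simp add: le_divide_eq)
        qed simp
        ultimately show ?case by linarith
      qed
    qed
    moreover have "c * (real p powr (- H / ?N) * sqrt (ln (real p))) \<le> s / 3"
    proof -
      have "(4 * ?N) powr (- H) * (8 * real p) powr (- H / ?N) \<le> \<epsilon> powr H"
      proof -
        have "\<epsilon> \<ge> 1 / (4 * ?N * \<rho>)"
          unfolding \<epsilon>_def using m \<rho> N1 by (intro divide_left_mono) (auto simp: mult_ac intro!: mult_pos_pos)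
        then have "(1 / (4 * ?N * \<rho>)) powr H \<le> \<epsilon> powr H" using H \<rho> N1 by (intro powr_mono2) auto
        moreover have "(1 / (4 * ?N * \<rho>)) powr H = (4 * ?N) powr (- H) * \<rho> powr (- H)"
        proof -
          have "(1 / (4 * ?N * \<rho>)) powr H = 1 / (4 * ?N * \<rho>) powr H" using N1 \<rho> by (subst powr_divide) auto
          also have "\<dots> = (4 * ?N * \<rho>) powr (- H)" by (simp add: powr_minus_divide)
          also have "\<dots> = (4 * ?N) powr (- H) * \<rho> powr (- H)" by (rule powr_mult)
          finally show ?thesis .
        qed
        moreover have "\<rho> powr (- H) = (8 * real p) powr (- H / ?N)" by (simp add: \<rho>_def powr_powr)
        ultimately show ?thesis by simp
      qed
      moreover have "(8 * real p) powr (- H / ?N) = 8 powr (- H / ?N) * real p powr (- H / ?N)" by (rule powr_mult)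
      ultimately have "(4 * ?N) powr (- H) * 8 powr (- H / ?N) * real p powr (- H / ?N) \<le> \<epsilon> powr H" by (simp add: mult.assoc)
      then have "(4 * ?N) powr (- H) * 8 powr (- H / ?N) * real p powr (- H / ?N) * (sqrt (ln (real p)) / (3 * sqrt \<kappa>))
          \<le> \<epsilon> powr H * (sqrt (ln (real p)) / (3 * sqrt \<kappa>))"
        using \<kappa> p by (intro mult_right_mono) auto
      then show ?thesis by (simp add: c_def s_def real_sqrt_divide)
    qed
    ultimately show ?thesis by (meson ennreal_leI order_trans)
  qed
  ultimately show ?thesis by blast
qed

subsection \<open>Rearranging the series\<close>

text \<open>Independence is transported on the level of the generated events; injectivity of
  \<sigma> is what matches the products over K and over its image.\<close>

lemma iid_std_normal_reindex:
  assumes M: "prob_space M" and Z: "iid_std_normal M I Z" and inj: "inj_on \<sigma> J" and sub: "\<sigma> ` J \<subseteq> I"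
  shows "iid_std_normal M J (\<lambda>j. Z (\<sigma> j))"
proof -
  interpret prob_space M by fact
  define E where "E i = {Z i -` A \<inter> space M | A. A \<in> sets borel}" for i
  have Z': "\<And>i. i \<in> I \<Longrightarrow> Z i \<in> borel_measurable M" "indep_sets E I"
    using Z unfolding iid_std_normal_def indep_vars_def2 E_def[abs_def] by auto
  have "indep_sets (\<lambda>j. E (\<sigma> j)) J"
    unfolding indep_sets_def
  proof (intro conjI ballI allI impI)
    show "E (\<sigma> j) \<subseteq> events" if "j \<in> J" for j using that sub Z'(2) by (auto simp: indep_sets_def)
    show "prob (\<Inter>j\<in>K. A j) = (\<Prod>j\<in>K. prob (A j))"
      if K: "K \<subseteq> J" "K \<noteq> {}" "finite K" and A: "A \<in> Pi K (\<lambda>j. E (\<sigma> j))" for K A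
    proof -
      define B where "B i = A (inv_into K \<sigma> i)" for i
      have injK: "inj_on \<sigma> K" using inj K(1) by (rule inj_on_subset)
      have B: "B (\<sigma> j) = A j" if "j \<in> K" for j using injK that by (simp add: B_def)
      have "B \<in> Pi (\<sigma> ` K) E" using A B by (auto simp: Pi_iff)
      then have "prob (\<Inter>i\<in>\<sigma> ` K. B i) = (\<Prod>i\<in>\<sigma> ` K. prob (B i))"
        using Z'(2) K sub unfolding indep_sets_def by (metis finite_imageI image_is_empty image_mono order_trans)
      moreover have "(\<Inter>i\<in>\<sigma> ` K. B i) = (\<Inter>j\<in>K. A j)" using B by auto
      moreover have "(\<Prod>i\<in>\<sigma> ` K. prob (B i)) = (\<Prod>j\<in>K. prob (A j))"
        using B by (simp add: prod.reindex[OF injK])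
      ultimately show ?thesis by simp
    qed
  qed
  then show ?thesis
    using Z Z'(1) sub unfolding iid_std_normal_def indep_vars_def2 E_def by auto
qed

text \<open>At p = 1 the rate is 0 and compares nothing; instead the error is seen to be the same
  for all representations.\<close>

lemma tail_error_1:
  assumes "series_rep M \<xi> f Z"
  shows "tail_error M f Z 1 = ennreal_sqrt (\<integral>\<^sup>+\<omega>. (ball_norm (\<lambda>x. \<xi> x \<omega>))\<^sup>2 \<partial>M)"
proof -
  have "AE \<omega> in M. (ball_norm (\<lambda>x. \<Sum>j. f (1 + j) x * Z (1 + j) \<omega>))\<^sup>2 = (ball_norm (\<lambda>x. \<xi> x \<omega>))\<^sup>2"
    using series_rep_pointwise[OF assms]
  proof eventually_elim
    case (elim \<omega>)
    have "(\<Sum>j. f (1 + j) x * Z (1 + j) \<omega>) = \<xi> x \<omega>" if "x \<in> cball 0 1" for x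
    proof -
      have "(\<lambda>n. \<Sum>j = 1..n. f j x * Z j \<omega>) \<longlonglongrightarrow> \<xi> x \<omega>" using elim that by blast
      moreover have "(\<Sum>j = 1..n. f j x * Z j \<omega>) = (\<Sum>j<n. f (1 + j) x * Z (1 + j) \<omega>)" for n
        by (simp add: sum.atLeast1_atMost_eq)
      ultimately have "(\<lambda>j. f (1 + j) x * Z (1 + j) \<omega>) sums \<xi> x \<omega>" by (simp add: sums_def)
      then show ?thesis by (rule sums_unique[symmetric])
    qed
    then show ?case by (simp add: ball_norm_def)
  qed
  then show ?thesis unfolding tail_error_def by (subst nn_integral_cong_AE) auto
qed

lemma mfbm_term_zero: "mfbm_term H e i 0 = 0"
  by (cases i) (simp add: mfbm_term_def)

lemma mfbm_term_sum_squares: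
  fixes e :: "nat \<Rightarrow> 'n::finite"
  assumes mf: "is_mfbm M H \<xi>" and rep: "mfbm_series_rep M H e \<xi> Z" and H: "H > 0"
    and F: "finite F" "F \<subseteq> term_index CARD('n)" and x: "x \<in> cball 0 1"
  shows "(\<Sum>i\<in>F. (mfbm_term H e i x)\<^sup>2) \<le> 1"
proof -
  have "(\<Sum>i\<in>F. (mfbm_term H e i x)\<^sup>2) \<le> norm x powr (2 * H)"
    using mfbm_series_increments[OF mf rep F x, of 0] by (simp add: mfbm_term_zero)
  also have "\<dots> \<le> 1 powr (2 * H)" using x H by (intro powr_mono2) auto
  finally show ?thesis by simp
qed

lemma mfbm_term_continuous:
  fixes e :: "nat \<Rightarrow> 'n::finite"
  assumes mf: "is_mfbm M H \<xi>" and rep: "mfbm_series_rep M H e \<xi> Z" and H: "H > 0"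
    and i: "i \<in> term_index CARD('n)"
  shows "continuous_on (cball 0 1) (mfbm_term H e i)"
proof (rule continuous_on_of_holder[OF H])
  fix x y :: "real ^ 'n" assume xy: "x \<in> cball 0 1" "y \<in> cball 0 1"
  have "(norm (x - y) powr H)\<^sup>2 = norm (x - y) powr (2 * H)" by (simp add: power2_eq_square powr_add[symmetric])
  then have "\<bar>mfbm_term H e i x - mfbm_term H e i y\<bar>\<^sup>2 \<le> (norm (x - y) powr H)\<^sup>2"
    using mfbm_series_increments[OF mf rep _ _ xy, of "{i}"] i by simp
  then have "\<bar>mfbm_term H e i x - mfbm_term H e i y\<bar> \<le> norm (x - y) powr H" by (rule power2_le_imp_le) simp
  then show "\<bar>mfbm_term H e i x - mfbm_term H e i y\<bar> \<le> 1 * norm (x - y) powr H" by simp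
qed

text \<open>Once the partial sum in the new order contains a finite set F that carries almost all
  the variance, its mean square distance to the iterated limit is small. Fatou's lemma then
  identifies the two limits almost surely.\<close>

lemma mfbm_rearranged_pointwise:
  fixes e :: "nat \<Rightarrow> 'n::finite" and \<sigma> :: "nat \<Rightarrow> nat \<times> nat \<times> nat"
  assumes mf: "is_mfbm M H \<xi>" and rep: "mfbm_series_rep M H e \<xi> Z" and H: "H > 0"
    and \<sigma>: "bij_betw \<sigma> {1..} (term_index CARD('n))" and x: "x \<in> cball 0 1"
    and conv: "AE \<omega> in M. convergent (\<lambda>n. \<Sum>j = 1..n. mfbm_term H e (\<sigma> j) x * Z (\<sigma> j) \<omega>)"
  shows "AE \<omega> in M. (\<lambda>n. \<Sum>j = 1..n. mfbm_term H e (\<sigma> j) x * Z (\<sigma> j) \<omega>) \<longlonglongrightarrow> \<xi> x \<omega>"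
proof -
  let ?I = "term_index CARD('n)"
  have M: "prob_space M" using mf by (simp add: is_mfbm_def)
  have Z: "iid_std_normal M ?I Z" using rep by (simp add: mfbm_series_rep_def)
  define a where "a i = mfbm_term H e i x" for i
  define P where "P n \<omega> = (\<Sum>j = 1..n. a (\<sigma> j) * Z (\<sigma> j) \<omega>)" for n \<omega>
  have \<sigma>I: "\<sigma> j \<in> ?I" if "j \<ge> 1" for j using bij_betwE[OF \<sigma>] that by auto
  have inj: "inj_on \<sigma> {1..n}" for n using bij_betw_imp_inj_on[OF \<sigma>] by (rule inj_on_subset) auto
  have Pm[measurable]: "P n \<in> borel_measurable M" for n
    unfolding P_def[abs_def] using iid_std_normal_measurable[OF Z \<sigma>I]
    by (intro borel_measurable_sum borel_measurable_times) auto
  have \<xi>m[measurable]: "\<xi> x \<in> borel_measurable M" using is_mfbm_measurable(1)[OF mf] x by auto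
  have Xl: "AE \<omega> in M. \<exists>V. (\<forall>m. (\<lambda>k. \<Sum>n=1..k. \<Sum>l=1..harm_dim m CARD('n). a (m, n, l) * Z (m, n, l) \<omega>) \<longlonglongrightarrow> V m)
       \<and> (\<lambda>K. \<Sum>m\<le>K. V m) \<longlonglongrightarrow> \<xi> x \<omega>"
    using conjunct2[OF rep[unfolded mfbm_series_rep_def]]
  proof eventually_elim
    case (elim \<omega>)
    then obtain V where V: "\<And>m. uniform_limit (cball 0 1)
           (\<lambda>k x. \<Sum>n = 1..k. \<Sum>l = 1..harm_dim m CARD('n). mfbm_term H e (m, n, l) x * Z (m, n, l) \<omega>) (V m) sequentially"
      "uniform_limit (cball 0 1) (\<lambda>k x. \<Sum>m\<le>k. V m x) (\<lambda>x. \<xi> x \<omega>) sequentially" by blast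
    show ?case unfolding a_def
      using tendsto_uniform_limitI[OF V(1) x] tendsto_uniform_limitI[OF V(2) x]
      by (intro exI[of _ "\<lambda>m. V m x"]) blast
  qed
  \<comment> \<open>The total variance at x. A finite F that exhausts it up to \<epsilon> leaves at
    most \<epsilon> for any finite set of indices outside F.\<close>
  define S where "S = (SUP F\<in>{F. finite F \<and> F \<subseteq> ?I}. \<Sum>i\<in>F. (a i)\<^sup>2)"
  have bdd: "bdd_above ((\<lambda>F. \<Sum>i\<in>F. (a i)\<^sup>2) ` {F. finite F \<and> F \<subseteq> ?I})"
    using mfbm_term_sum_squares[OF mf rep H _ _ x] by (auto simp: a_def intro!: bdd_aboveI2[where M = 1])
  have le: "(\<integral>\<^sup>+\<omega>. ennreal ((\<xi> x \<omega> - lim (\<lambda>n. P n \<omega>))\<^sup>2) \<partial>M) \<le> ennreal \<epsilon>" if \<epsilon>: "\<epsilon> > 0" for \<epsilon>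
  proof -
    have "\<exists>F\<in>{F. finite F \<and> F \<subseteq> ?I}. S - \<epsilon> < (\<Sum>i\<in>F. (a i)\<^sup>2)"
      unfolding S_def using \<epsilon> bdd by (subst less_cSUP_iff[symmetric]) (auto simp: S_def[symmetric])
    then obtain F where F: "finite F" "F \<subseteq> ?I" "S - \<epsilon> < (\<Sum>i\<in>F. (a i)\<^sup>2)" by blast
    have "\<exists>n0. F \<subseteq> \<sigma> ` {1..n0}"
    proof -
      have "F \<subseteq> \<sigma> ` {1..}" using F(2) bij_betw_imp_surj_on[OF \<sigma>] by simp
      then obtain J where J: "J \<subseteq> {1..}" "finite J" "F = \<sigma> ` J" using finite_subset_image[OF F(1)] by metis
      have "J \<subseteq> {1..Max (insert 0 J)}" using J by auto
      then show ?thesis using J(3) by blast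
    qed
    then obtain n0 where n0: "F \<subseteq> \<sigma> ` {1..n0}" by blast
    have "(\<integral>\<^sup>+\<omega>. ennreal ((\<xi> x \<omega> - P n \<omega>)\<^sup>2) \<partial>M) \<le> ennreal \<epsilon>" if n: "n \<ge> n0" for n
    proof -
      let ?F = "\<sigma> ` {1..n}"
      have Fn: "finite ?F" "?F \<subseteq> ?I" using \<sigma>I by auto
      have "{1..n0} \<subseteq> {1..n}" using n by auto
      then have sub: "F \<subseteq> ?F" using n0 by blast
      have "(\<Sum>i\<in>G. (a i)\<^sup>2) \<le> \<epsilon>" if G: "finite G" "G \<subseteq> ?I - ?F" for G
      proof -
        have "(\<Sum>i\<in>F. (a i)\<^sup>2) \<le> (\<Sum>i\<in>?F. (a i)\<^sup>2)" using sub Fn by (intro sum_mono2) auto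
        moreover have "(\<Sum>i\<in>?F. (a i)\<^sup>2) + (\<Sum>i\<in>G. (a i)\<^sup>2) = (\<Sum>i\<in>?F \<union> G. (a i)\<^sup>2)"
          using G Fn by (intro sum.union_disjoint[symmetric]) auto
        moreover have "\<dots> \<le> S" unfolding S_def using G Fn by (intro cSUP_upper[OF _ bdd]) auto
        ultimately show ?thesis using F(3) by linarith
      qed
      from iterated_series(2)[OF M Z \<xi>m Xl Fn this]
      have "(\<integral>\<^sup>+\<omega>. ennreal ((\<xi> x \<omega> - (\<Sum>i\<in>?F. a i * Z i \<omega>))\<^sup>2) \<partial>M) \<le> ennreal \<epsilon>" by blast
      then show ?thesis unfolding P_def sum.reindex[OF inj] comp_def .
    qed
    then have ev: "\<forall>\<^sub>F n in sequentially. (\<integral>\<^sup>+\<omega>. ennreal ((\<xi> x \<omega> - P n \<omega>)\<^sup>2) \<partial>M) \<le> ennreal \<epsilon>"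
      by (rule eventually_sequentiallyI)
    show ?thesis
    proof (rule nn_integral_le_lim[OF _ _ _ ev])
      show "AE \<omega> in M. (\<lambda>n. \<xi> x \<omega> - P n \<omega>) \<longlonglongrightarrow> \<xi> x \<omega> - lim (\<lambda>n. P n \<omega>)"
        using conv
      proof eventually_elim
        case (elim \<omega>)
        then have "convergent (\<lambda>n. P n \<omega>)" by (simp add: P_def a_def)
        then have "(\<lambda>n. P n \<omega>) \<longlonglongrightarrow> lim (\<lambda>n. P n \<omega>)" by (simp add: convergent_LIMSEQ_iff)
        then show ?case by (intro tendsto_intros)
      qed
    qed measurable
  qed
  have "(\<integral>\<^sup>+\<omega>. ennreal ((\<xi> x \<omega> - lim (\<lambda>n. P n \<omega>))\<^sup>2) \<partial>M) = 0"
  proof (rule antisym[OF ennreal_le_epsilon])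
    show "(\<integral>\<^sup>+\<omega>. ennreal ((\<xi> x \<omega> - lim (\<lambda>n. P n \<omega>))\<^sup>2) \<partial>M) \<le> 0 + ennreal \<epsilon>" if "0 < \<epsilon>" for \<epsilon> using le that by simp
  qed simp
  then have "AE \<omega> in M. ennreal ((\<xi> x \<omega> - lim (\<lambda>n. P n \<omega>))\<^sup>2) = 0"
    by (subst (asm) nn_integral_0_iff_AE) measurable
  then show ?thesis
    using conv
  proof eventually_elim
    case (elim \<omega>)
    have "\<xi> x \<omega> = lim (\<lambda>n. P n \<omega>)" using elim(1) by (simp add: ennreal_eq_0_iff power2_le_iff_abs_le)
    moreover have "convergent (\<lambda>n. P n \<omega>)" using elim(2) by (simp add: P_def a_def)
    ultimately show ?case unfolding a_def[symmetric] P_def[symmetric]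
      by (simp add: convergent_LIMSEQ_iff)
  qed
qed

text \<open>The exceptional null set of the pointwise identification depends on x, so it is used
  only on a countable dense set; continuity of the uniform limit and of the sample path extends the
  equality to the ball.\<close>

lemma mfbm_rearranged_series_rep:
  fixes e :: "nat \<Rightarrow> 'n::finite" and \<sigma> :: "nat \<Rightarrow> nat \<times> nat \<times> nat"
  assumes mf: "is_mfbm M H \<xi>" and rep: "mfbm_series_rep M H e \<xi> Z" and H: "H > 0"
    and \<sigma>: "bij_betw \<sigma> {1..} (term_index CARD('n))"
    and conv: "AE \<omega> in M. uniformly_convergent_on (cball 0 1) (\<lambda>n x. \<Sum>j = 1..n. mfbm_term H e (\<sigma> j) x * Z (\<sigma> j) \<omega>)"
  shows "series_rep M \<xi> (\<lambda>j. mfbm_term H e (\<sigma> j)) (\<lambda>j. Z (\<sigma> j))"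
proof -
  let ?I = "term_index CARD('n)" and ?P = "\<lambda>\<omega> n x. \<Sum>j = 1..n. mfbm_term H e (\<sigma> j) x * Z (\<sigma> j) \<omega>"
  have M: "prob_space M" using mf by (simp add: is_mfbm_def)
  have Z: "iid_std_normal M ?I Z" using rep by (simp add: mfbm_series_rep_def)
  have \<sigma>I: "\<sigma> j \<in> ?I" if "j \<ge> 1" for j using bij_betwE[OF \<sigma>] that by auto
  have cont: "continuous_on (cball 0 1) (mfbm_term H e (\<sigma> j))" if "j \<ge> 1" for j
    using mfbm_term_continuous[OF mf rep H \<sigma>I[OF that]] .
  obtain T :: "(real ^ 'n) set" where T: "countable T" "T \<subseteq> cball 0 1" "cball 0 1 \<subseteq> closure T"
    using separable by blast
  have clT: "closure T = cball 0 1" using T(2,3) closure_minimal[OF T(2)] by auto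
  have "AE \<omega> in M. \<forall>x\<in>T. (\<lambda>n. ?P \<omega> n x) \<longlonglongrightarrow> \<xi> x \<omega>"
  proof (rule AE_ball_countable'[OF _ T(1)])
    fix x assume "x \<in> T"
    then have x: "x \<in> cball 0 1" using T by auto
    show "AE \<omega> in M. (\<lambda>n. ?P \<omega> n x) \<longlonglongrightarrow> \<xi> x \<omega>"
    proof (rule mfbm_rearranged_pointwise[OF mf rep H \<sigma> x])
      show "AE \<omega> in M. convergent (\<lambda>n. ?P \<omega> n x)"
        using conv
      proof eventually_elim
        case (elim \<omega>)
        then show ?case using x by (auto simp: uniformly_convergent_on_def convergent_def dest!: tendsto_uniform_limitI)
      qed
    qed
  qed
  then have "AE \<omega> in M. uniform_limit (cball 0 1) (?P \<omega>) (\<lambda>x. \<xi> x \<omega>) sequentially"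
    using conv AE_space
  proof eventually_elim
    case (elim \<omega>)
    obtain \<zeta> where \<zeta>: "uniform_limit (cball 0 1) (?P \<omega>) \<zeta> sequentially"
      using elim(2) by (auto simp: uniformly_convergent_on_def)
    have "continuous_on (cball 0 1) (?P \<omega> n)" for n using cont by (intro continuous_intros) auto
    then have "continuous_on (cball 0 1) \<zeta>" using \<zeta> by (intro uniform_limit_theorem[OF _ \<zeta>]) auto
    moreover have "continuous_on (cball 0 1) (\<lambda>x. \<xi> x \<omega>)" using mf elim(3) by (simp add: is_mfbm_def)
    ultimately have c: "continuous_on (closure T) (\<lambda>x. \<zeta> x - \<xi> x \<omega>)" unfolding clT by (rule continuous_on_diff)
    have z: "\<zeta> x - \<xi> x \<omega> = 0" if "x \<in> T" for x
    proof -
      have "(\<lambda>n. ?P \<omega> n x) \<longlonglongrightarrow> \<zeta> x" using tendsto_uniform_limitI[OF \<zeta>] that T(2) by blast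
      then show ?thesis using elim(1) that LIMSEQ_unique by fastforce
    qed
    have "\<zeta> x = \<xi> x \<omega>" if "x \<in> cball 0 1" for x
      using continuous_constant_on_closure[OF c z, of x] that T(3) by auto
    then show ?case using \<zeta> uniform_limit_cong'[of "cball 0 1" "?P \<omega>" "?P \<omega>" \<zeta> "\<lambda>x. \<xi> x \<omega>" sequentially] by auto
  qed
  moreover have "iid_std_normal M {1..} (\<lambda>j. Z (\<sigma> j))"
    using \<sigma>I by (intro iid_std_normal_reindex[OF M Z bij_betw_imp_inj_on[OF \<sigma>]]) auto
  ultimately show ?thesis using cont by (simp add: series_rep_def)
qed

text \<open>The given representation enters only through its deterministic consequences for the
  functions, so the enumeration and C serve every other space and every other family of normal
  variables.\<close>

lemma mfbm_series_levels:
  fixes e :: "nat \<Rightarrow> 'n::finite"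
  assumes H: "0 < H" "H < 1" and e: "bij_betw e {1..CARD('n)} UNIV"
    and mf: "is_mfbm M0 H \<xi>0" and rep: "mfbm_series_rep M0 H e \<xi>0 Z0"
  shows "\<exists>(\<sigma> :: nat \<Rightarrow> nat \<times> nat \<times> nat) C. bij_betw \<sigma> {1..} (term_index CARD('n)) \<and> C > 0 \<and>
    (\<forall>M Z. prob_space (M :: 'a measure) \<longrightarrow> iid_std_normal M {1..} Z \<longrightarrow>
      (AE \<omega> in M. uniformly_convergent_on (cball 0 1) (\<lambda>n x. \<Sum>j = 1..n. mfbm_term H e (\<sigma> j) x * Z j \<omega>)) \<and>
      (\<forall>p\<ge>2. tail_error M (\<lambda>j. mfbm_term H e (\<sigma> j)) Z p \<le> ennreal (C * (real p powr (- H / real CARD('n)) * sqrt (ln (real p))))))"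
proof -
  let ?N = "CARD('n)"
  have N: "?N \<ge> 1" using zero_less_card_finite[where 'a = 'n] by linarith
  obtain c where c: "c > 0" and zero: "\<And>m n. n \<ge> 1 \<Longrightarrow> bessel_zero (\<bar>real m - 1\<bar> - H) n \<ge> c * (real m + real n)"
    using bessel_zero_lower[OF H] by blast
  define J where "J = (\<lambda>(m :: nat, n :: nat, l :: nat). bessel_zero (\<bar>real m - 1\<bar> - H) n :: real)"
  \<comment> \<open>Level 0 collects all zeros below 2, however small; a lower bound 2^k on the
    zeros is available only for levels k \<ge> 1.\<close>
  define lev where "lev i = (LEAST k. J i < 2 ^ (k + 1))" for i :: "nat \<times> nat \<times> nat"
  have ex: "\<exists>k. J i < 2 ^ (k + 1)" for i
  proof -
    obtain k where "J i < 2 ^ k" using real_arch_pow[of 2 "J i"] by auto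
    also have "(2 :: real) ^ k \<le> 2 ^ (k + 1)" by simp
    finally show ?thesis ..
  qed
  have lev_upper: "J i < 2 ^ (lev i + 1)" for i unfolding lev_def by (rule LeastI_ex[OF ex])
  have lev_lower: "2 ^ k \<le> J i" if "lev i = k" "k \<ge> 1" for i k
    using not_less_Least[of "k - 1" "\<lambda>k. J i < 2 ^ (k + 1)"] that by (simp add: lev_def)
  have sub: "{i \<in> term_index ?N. lev i \<le> k} \<subseteq> {(m, n, l) \<in> term_index ?N. bessel_zero (\<bar>real m - 1\<bar> - H) n < 2 ^ (k + 1)}" for k
  proof
    fix i assume i: "i \<in> {i \<in> term_index ?N. lev i \<le> k}"
    have "J i < 2 ^ (lev i + 1)" by (rule lev_upper)
    also have "\<dots> \<le> (2 :: real) ^ (k + 1)" using i by (intro power_increasing) auto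
    finally show "i \<in> {(m, n, l) \<in> term_index ?N. bessel_zero (\<bar>real m - 1\<bar> - H) n < 2 ^ (k + 1)}"
      using i by (cases i) (simp add: J_def)
  qed
  have T: "(1 :: real) \<le> 2 ^ (k + 1)" for k by (rule one_le_power) simp
  note count = term_index_count[OF N c zero T]
  define c3 where "c3 = max 1 (2 * (1 / c + real ?N) ^ ?N * 2 ^ ?N)"
  define c2 where "c2 = max 1 ((3 + 4 * real ?N)\<^sup>2)"
  show ?thesis
  proof (rule leveled_series_bound[where lev = lev and I = "term_index ?N" and u = "mfbm_term H e" and ?c2.0 = c2 and ?c3.0 = c3])
    show "H > 0" "c2 > 0" "c3 \<ge> 1" using H by (auto simp: c2_def c3_def)
    show "infinite (term_index ?N)" by (rule infinite_term_index[OF N])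
    show "finite {i \<in> term_index ?N. lev i \<le> k}" for k by (rule finite_subset[OF sub count(1)])
    show "real (card {i \<in> term_index ?N. lev i \<le> k}) \<le> c3 * 2 ^ (k * ?N)" for k
    proof -
      have "real (card {i \<in> term_index ?N. lev i \<le> k}) \<le> 2 * (1 / c + real ?N) ^ ?N * (2 ^ (k + 1)) ^ ?N"
        using card_mono[OF count(1) sub] count(2)[of k] by (meson of_nat_mono order_trans)
      also have "(2 ^ (k + 1)) ^ ?N = (2 :: real) ^ ?N * 2 ^ (k * ?N)"
        by (simp add: power_mult_distrib power_mult)
      also have "2 * (1 / c + real ?N) ^ ?N * (2 ^ ?N * 2 ^ (k * ?N)) \<le> c3 * 2 ^ (k * ?N)"
        unfolding mult.assoc[symmetric] by (intro mult_right_mono) (auto simp: c3_def)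
      finally show ?thesis .
    qed
    show "(\<Sum>i\<in>F. (mfbm_term H e i x - mfbm_term H e i y)\<^sup>2) \<le> norm (x - y) powr (2 * H)"
      if "finite F" "F \<subseteq> term_index ?N" "x \<in> cball 0 1" "y \<in> cball 0 1" for F x y
      using mfbm_series_increments[OF mf rep that] .
    show "(\<Sum>i\<in>F. (mfbm_term H e i x)\<^sup>2) \<le> c2 * ((2 powr (- H)) ^ k)\<^sup>2"
      if F: "finite F" "F \<subseteq> term_index ?N" and k: "\<And>i. i \<in> F \<Longrightarrow> lev i = k" and x: "x \<in> cball 0 1" for k F x
    \<comment> \<open>On level 0 the Helmholtz estimate is replaced by the bound 1 for the total
      variance at a point of the ball.\<close>
    proof (cases "k = 0")
      case True
      have "(\<Sum>i\<in>F. (mfbm_term H e i x)\<^sup>2) \<le> 1" by (rule mfbm_term_sum_squares[OF mf rep H(1) F x])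
      also have "1 \<le> c2" by (simp add: c2_def)
      finally show ?thesis using True by (simp add: c2_def)
    next
      case False
      have "(\<Sum>i\<in>F. (mfbm_term H e i x)\<^sup>2) \<le> (3 + 4 * real ?N)\<^sup>2 * (2 ^ k) powr (- 2 * H)"
      proof (rule helmholtz_tail_bound[where j = J, OF e H(1) F(1) _ _ _ _ x])
        show Jk: "2 ^ k \<le> J i" if "i \<in> F" for i using lev_lower[OF k[OF that]] False by simp
        show "(2 :: real) \<le> 2 ^ k" using False self_le_power[of "2 :: real" k] by simp
        show "\<exists>v D D2. has_partials {1..?N} v D D2 \<and>
            (\<forall>X. (\<Sum>k\<in>{1..?N}. D2 k X) = - ((J i)\<^sup>2 * v X)) \<and> (\<forall>x. mfbm_term H e i x = v (coords e x) - v (coords e 0))"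
          if i: "i \<in> F" for i
        proof -
          obtain m n l where mnl: "i = (m, n, l)" by (cases i)
          have "0 < J i" using Jk[OF i] by (rule less_le_trans[rotated]) simp
          then show ?thesis using mfbm_term_helmholtz[OF e, of m n l "J i" H] F(2) i by (auto simp: mnl J_def)
        qed
      qed (use mfbm_series_increments[OF mf rep F] in blast)
      also have "((2 :: real) ^ k) powr (- 2 * H) = ((2 powr (- H)) ^ k)\<^sup>2"
        by (simp add: powr_realpow[symmetric] powr_powr powr_power mult_ac)
      also have "(3 + 4 * real ?N)\<^sup>2 * ((2 powr (- H)) ^ k)\<^sup>2 \<le> c2 * ((2 powr (- H)) ^ k)\<^sup>2"
        by (intro mult_right_mono) (auto simp: c2_def)
      finally show ?thesis .
    qed
  qed
qed

theorem theorem2: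
  fixes H :: real and e :: "nat \<Rightarrow> 'n::finite"
  assumes "0 < H" and "H < 1"
    and "bij_betw e {1..CARD('n)} UNIV"
  shows "\<exists>(\<sigma> :: nat \<Rightarrow> nat \<times> nat \<times> nat) (c :: real) (C :: real).
    bij_betw \<sigma> {1..} (term_index CARD('n)) \<and> 0 < c \<and> 0 < C \<and>
    (\<forall>(M :: 'a measure) (\<xi> :: real ^ 'n \<Rightarrow> 'a \<Rightarrow> real) (Z :: nat \<times> nat \<times> nat \<Rightarrow> 'a \<Rightarrow> real).
      is_mfbm M H \<xi> \<and> mfbm_series_rep M H e \<xi> Z \<longrightarrow>
      (let f = (\<lambda>j. mfbm_term H e (\<sigma> j)); X = (\<lambda>j. Z (\<sigma> j)) in
        series_rep M \<xi> f X \<and>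
        (\<forall>p\<ge>1. ennreal c * l_approx M \<xi> p \<le> tail_error M f X p \<and>
                tail_error M f X p \<le> ennreal C * l_approx M \<xi> p) \<and>
        (\<forall>p\<ge>2. ennreal (c * (real p powr (- H / real CARD('n)) * sqrt (ln (real p)))) \<le> tail_error M f X p \<and>
                tail_error M f X p \<le> ennreal (C * (real p powr (- H / real CARD('n)) * sqrt (ln (real p)))))))"
proof (cases "\<exists>(M :: 'a measure) (\<xi> :: real ^ 'n \<Rightarrow> 'a \<Rightarrow> real) Z. is_mfbm M H \<xi> \<and> mfbm_series_rep M H e \<xi> Z")
  case False
  have "infinite (term_index CARD('n))"
    using zero_less_card_finite[where 'a = 'n] by (intro infinite_term_index) linarith
  \<comment> \<open>The numbering \<open>to_nat\<close> of triples serves as a level function; the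
    estimates are vacuous here and only an enumeration is wanted.\<close>
  moreover have "finite {i \<in> term_index CARD('n). to_nat i \<le> k}" for k
    by (rule finite_subset[OF _ finite_vimageI[OF finite_atMost[of k] inj_to_nat]]) auto
  ultimately obtain \<sigma> :: "nat \<Rightarrow> nat \<times> nat \<times> nat" where "bij_betw \<sigma> {1..} (term_index CARD('n))"
    using enumerate_by_level[of "term_index CARD('n)" to_nat] by blast
  then show ?thesis using False by (intro exI[of _ \<sigma>] exI[of _ 1]) (simp only: simp_thms Let_def zero_less_one, blast)
next
  case True
  let ?r = "\<lambda>p. real p powr (- H / real CARD('n)) * sqrt (ln (real p))"
  obtain M0 :: "'a measure" and \<xi>0 :: "real ^ 'n \<Rightarrow> 'a \<Rightarrow> real" and Z0 where M0: "is_mfbm M0 H \<xi>0" "mfbm_series_rep M0 H e \<xi>0 Z0"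
    using True by blast
  obtain \<sigma> :: "nat \<Rightarrow> nat \<times> nat \<times> nat" and C where \<sigma>: "bij_betw \<sigma> {1..} (term_index CARD('n))" and C: "C > 0"
    and up: "\<forall>M Z. prob_space (M :: 'a measure) \<longrightarrow> iid_std_normal M {1..} Z \<longrightarrow>
      (AE \<omega> in M. uniformly_convergent_on (cball 0 1) (\<lambda>n x. \<Sum>j = 1..n. mfbm_term H e (\<sigma> j) x * Z j \<omega>)) \<and>
      (\<forall>p\<ge>2. tail_error M (\<lambda>j. mfbm_term H e (\<sigma> j)) Z p \<le> ennreal (C * ?r p))"
    using mfbm_series_levels[OF assms M0] by (elim exE conjE) rule
  obtain c where c: "c > 0" and low: "\<forall>(M :: 'a measure) (\<xi> :: real ^ 'n \<Rightarrow> 'a \<Rightarrow> real) f Z.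
      is_mfbm M H \<xi> \<longrightarrow> series_rep M \<xi> f Z \<longrightarrow> (\<forall>p\<ge>2. ennreal (c * ?r p) \<le> tail_error M f Z p)"
    using series_rep_lower_bound[OF assms(1,2), where 'n = 'n and 'a = 'a] by (elim exE conjE) rule
  \<comment> \<open>The value 1 covers the comparison with the infimum, of which this representation
    is a competitor, and c the comparison with the rate.\<close>
  define c' where "c' = min c 1"
  \<comment> \<open>C compares with the rate, C / c with the infimum for p \<ge> 2 through the rate,
    and 1 with the infimum at p = 1.\<close>
  define C' where "C' = max (max C (C / c)) 1"
  have c': "c' > 0" "c' \<le> c" "c' \<le> 1" using c by (auto simp: c'_def)
  have C': "C' > 0" "C \<le> C'" "C / c \<le> C'" "1 \<le> C'" by (auto simp: C'_def)
  have r0: "?r p \<ge> 0" if "p \<ge> 2" for p using that by (intro mult_nonneg_nonneg) auto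
  have main: "series_rep M \<xi> (\<lambda>j. mfbm_term H e (\<sigma> j)) (\<lambda>j. Z (\<sigma> j)) \<and>
      (\<forall>p\<ge>1. ennreal c' * l_approx M \<xi> p \<le> tail_error M (\<lambda>j. mfbm_term H e (\<sigma> j)) (\<lambda>j. Z (\<sigma> j)) p \<and>
        tail_error M (\<lambda>j. mfbm_term H e (\<sigma> j)) (\<lambda>j. Z (\<sigma> j)) p \<le> ennreal C' * l_approx M \<xi> p) \<and>
      (\<forall>p\<ge>2. ennreal (c' * ?r p) \<le> tail_error M (\<lambda>j. mfbm_term H e (\<sigma> j)) (\<lambda>j. Z (\<sigma> j)) p \<and>
        tail_error M (\<lambda>j. mfbm_term H e (\<sigma> j)) (\<lambda>j. Z (\<sigma> j)) p \<le> ennreal (C' * ?r p))"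
    if mf: "is_mfbm M H \<xi>" and rep: "mfbm_series_rep M H e \<xi> Z"
    for M :: "'a measure" and \<xi> :: "real ^ 'n \<Rightarrow> 'a \<Rightarrow> real" and Z
  proof -
    have M: "prob_space M" using mf by (simp add: is_mfbm_def)
    have "iid_std_normal M (term_index CARD('n)) Z" using rep by (simp add: mfbm_series_rep_def)
    then have X: "iid_std_normal M {1..} (\<lambda>j. Z (\<sigma> j))"
      by (rule iid_std_normal_reindex[OF M _ bij_betw_imp_inj_on[OF \<sigma>]]) (use bij_betw_imp_surj_on[OF \<sigma>] in simp)
    note up' = up[rule_format, OF M X]
    let ?te = "tail_error M (\<lambda>j. mfbm_term H e (\<sigma> j)) (\<lambda>j. Z (\<sigma> j))"
    have sr: "series_rep M \<xi> (\<lambda>j. mfbm_term H e (\<sigma> j)) (\<lambda>j. Z (\<sigma> j))"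
      by (rule mfbm_rearranged_series_rep[OF mf rep assms(1) \<sigma> conjunct1[OF up']])
    have le_te: "l_approx M \<xi> p \<le> ?te p" for p unfolding l_approx_def 
      using sr by (intro INF_lower2[of "(\<lambda>j. mfbm_term H e (\<sigma> j), \<lambda>j. Z (\<sigma> j))"]) auto
    have te_up: "?te p \<le> ennreal (C * ?r p)" if "p \<ge> 2" for p using conjunct2[OF up'] that by blast
    have la_low: "ennreal (c * ?r p) \<le> l_approx M \<xi> p" if "p \<ge> 2" for p
      unfolding l_approx_def by (rule INF_greatest) (use low[rule_format, OF mf _ that] in auto)
    have 1: "ennreal c' * l_approx M \<xi> p \<le> ?te p" for p
    proof -
      have "ennreal c' * l_approx M \<xi> p \<le> 1 * l_approx M \<xi> p" using c' by (intro mult_right_mono) auto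
      then show ?thesis using le_te[of p] by simp
    qed
    have 2: "?te p \<le> ennreal C' * l_approx M \<xi> p" if p: "p \<ge> 1" for p
    proof (cases "p = 1")
      case True
      have "?te 1 \<le> l_approx M \<xi> 1" unfolding l_approx_def
        by (rule INF_greatest) (auto simp: tail_error_1[OF sr] tail_error_1 simp del: One_nat_def)
      also have "1 * l_approx M \<xi> 1 \<le> ennreal C' * l_approx M \<xi> 1" using C' by (intro mult_right_mono) auto
      finally show ?thesis using True by simp
    next
      case False
      then have p2: "p \<ge> 2" using p by simp
      have "?te p \<le> ennreal (C * ?r p)" by (rule te_up[OF p2])
      also have "C * ?r p = C / c * (c * ?r p)" using c by simp
      also have "ennreal (C / c * (c * ?r p)) = ennreal (C / c) * ennreal (c * ?r p)"
        using C c r0[OF p2] by (intro ennreal_mult) auto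
      also have "\<dots> \<le> ennreal C' * l_approx M \<xi> p" using C' la_low[OF p2] by (intro mult_mono ennreal_leI) auto
      finally show ?thesis .
    qed
    have 3: "ennreal (c' * ?r p) \<le> ?te p" if p: "p \<ge> 2" for p
      using c' r0[OF p] by (intro order_trans[OF ennreal_leI low[rule_format, OF mf sr p]] mult_right_mono) auto
    have 4: "?te p \<le> ennreal (C' * ?r p)" if p: "p \<ge> 2" for p
      using C' r0[OF p] by (intro order_trans[OF te_up[OF p] ennreal_leI] mult_right_mono) auto
    show ?thesis using sr 1 2 3 4 by blast
  qed
  show ?thesis
    by (intro exI[of _ \<sigma>] exI[of _ c'] exI[of _ C'] conjI \<sigma> c'(1) C'(1) allI impI)
      (unfold Let_def, use main in blast)
qed

end
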